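(* Let $c\ge2$ and $g\ge1$ be integers, and let $\mathcal{F}=\mathcal{F}_{c,g}$ be the free nilpotent Lie algebra over $\mathbb{Z}$ of class $c$ on $g$ generators. Let $m_i$ be the rank of $\gamma_i(\mathcal{F})/\gamma_{i+1}(\mathcal{F})$ for $1\le i\le c$, and put $\alpha=\frac1g\sum_{i=1}^c i\,m_i$ and $\beta=\sum_{i=2}^c i\,m_i$. Then $$\zeta^i_{\mathcal{F}}(s)=\zeta^\wedge_{\mathcal{F}}(s)=\prod_{j=0}^{g-1}\zeta(\alpha s-\beta-j),$$ where $\zeta(s)$ is the Riemann zeta function.
   Context: $\gamma_i(\mathcal{F})$ is the $i$-th term of the lower central series of $\mathcal{F}$ ($\gamma_1(\mathcal{F})=\mathcal{F}$). For a Lie algebra $L$ over $\mathbb{Z}$ that is free of finite rank as an abelian group, and $n\ge1$, let $a^i_n(L)$ be the number of subalgebras $M\subset L$ of index $n$ with $M\cong L$ as algebras, and $a^\wedge_n(L)$ the number of subalgebras $M\subset L$ of index $n$ with $M\otimes\widehat{\mathbb{Z}}\cong L\otimes\widehat{\mathbb{Z}}$ as algebras over $\widehat{\mathbb{Z}}$ (the profinite completion of $\mathbb{Z}$). The isomorphic and pro-isomorphic zeta functions of $L$ are the Dirichlet series $\zeta^i_L(s)=\sum_{n>0}a^i_n(L)n^{-s}$ and $\zeta^\wedge_L(s)=\sum_{n>0}a^\wedge_n(L)n^{-s}$. *)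

theory Defs
  imports
    "HOL-Analysis.Complex_Transcendental"
    "HOL-Analysis.Infinite_Sum"
    "HOL-Algebra.Free_Abelian_Groups"
    "HOL-Algebra.IntRing"
    "HOL-Algebra.QuotRing"
    "HOL-Algebra.Module"
begin

hide_const (open) Multiset.mult

section \<open>Lie algebras\<close>

text \<open>
  A not necessarily associative algebra is carried by the record type of modules, whose
  multiplication field holds the product; for a Lie algebra this is the bracket.  There is no
  unit: the field \<open>one\<close> of the record is never used.
\<close>

locale nonassoc_algebra = Module.module R L
  for R :: "('r, 'x) ring_scheme" (structure) and L :: "('r, 'a) module" (structure) +
  assumes prod_closed:
      "\<lbrakk>x \<in> carrier L; y \<in> carrier L\<rbrakk> \<Longrightarrow> x \<otimes>\<^bsub>L\<^esub> y \<in> carrier L"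
    and prod_add_left:
      "\<lbrakk>x \<in> carrier L; y \<in> carrier L; z \<in> carrier L\<rbrakk>
        \<Longrightarrow> (x \<oplus>\<^bsub>L\<^esub> y) \<otimes>\<^bsub>L\<^esub> z = x \<otimes>\<^bsub>L\<^esub> z \<oplus>\<^bsub>L\<^esub> y \<otimes>\<^bsub>L\<^esub> z"
    and prod_add_right:
      "\<lbrakk>x \<in> carrier L; y \<in> carrier L; z \<in> carrier L\<rbrakk>
        \<Longrightarrow> x \<otimes>\<^bsub>L\<^esub> (y \<oplus>\<^bsub>L\<^esub> z) = x \<otimes>\<^bsub>L\<^esub> y \<oplus>\<^bsub>L\<^esub> x \<otimes>\<^bsub>L\<^esub> z"
    and prod_smult_left:
      "\<lbrakk>r \<in> carrier R; x \<in> carrier L; y \<in> carrier L\<rbrakk>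
        \<Longrightarrow> (r \<odot>\<^bsub>L\<^esub> x) \<otimes>\<^bsub>L\<^esub> y = r \<odot>\<^bsub>L\<^esub> (x \<otimes>\<^bsub>L\<^esub> y)"
    and prod_smult_right:
      "\<lbrakk>r \<in> carrier R; x \<in> carrier L; y \<in> carrier L\<rbrakk>
        \<Longrightarrow> x \<otimes>\<^bsub>L\<^esub> (r \<odot>\<^bsub>L\<^esub> y) = r \<odot>\<^bsub>L\<^esub> (x \<otimes>\<^bsub>L\<^esub> y)"

locale lie_algebra = nonassoc_algebra +
  assumes bracket_self: "x \<in> carrier L \<Longrightarrow> x \<otimes>\<^bsub>L\<^esub> x = \<zero>\<^bsub>L\<^esub>"
    and jacobi:
      "\<lbrakk>x \<in> carrier L; y \<in> carrier L; z \<in> carrier L\<rbrakk>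
        \<Longrightarrow> x \<otimes>\<^bsub>L\<^esub> (y \<otimes>\<^bsub>L\<^esub> z) \<oplus>\<^bsub>L\<^esub> y \<otimes>\<^bsub>L\<^esub> (z \<otimes>\<^bsub>L\<^esub> x) \<oplus>\<^bsub>L\<^esub> z \<otimes>\<^bsub>L\<^esub> (x \<otimes>\<^bsub>L\<^esub> y)
          = \<zero>\<^bsub>L\<^esub>"

definition subalgebra_of :: "('r, 'x) ring_scheme \<Rightarrow> ('r, 'a) module \<Rightarrow> 'a set \<Rightarrow> bool" where
  "subalgebra_of R L M \<longleftrightarrow> submodule M R L \<and> (\<forall>x\<in>M. \<forall>y\<in>M. x \<otimes>\<^bsub>L\<^esub> y \<in> M)"

text \<open>The value is \<open>0\<close> if the index is infinite.\<close>

definition add_index :: "('r, 'a) module \<Rightarrow> 'a set \<Rightarrow> nat" where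
  "add_index L M = card (a_rcosets\<^bsub>L\<^esub> M)"

definition alg_iso ::
  "('r, 'x) ring_scheme \<Rightarrow> ('r, 'a) module \<Rightarrow> ('r, 'b) module \<Rightarrow> bool" where
  "alg_iso R L M \<longleftrightarrow> (\<exists>h. bij_betw h (carrier L) (carrier M)
     \<and> (\<forall>x\<in>carrier L. \<forall>y\<in>carrier L. h (x \<oplus>\<^bsub>L\<^esub> y) = h x \<oplus>\<^bsub>M\<^esub> h y)
     \<and> (\<forall>r\<in>carrier R. \<forall>x\<in>carrier L. h (r \<odot>\<^bsub>L\<^esub> x) = r \<odot>\<^bsub>M\<^esub> h x)
     \<and> (\<forall>x\<in>carrier L. \<forall>y\<in>carrier L. h (x \<otimes>\<^bsub>L\<^esub> y) = h x \<otimes>\<^bsub>M\<^esub> h y))"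

text \<open>
  Quotient by a two-sided ideal: the operations of \<^const>\<open>FactRing\<close>, which do not depend on
  associativity, together with the scalar multiplication.
\<close>

definition quot_alg :: "('r, 'a) module \<Rightarrow> 'a set \<Rightarrow> ('r, 'a set) module" where
  "quot_alg L I = \<lparr>carrier = a_rcosets\<^bsub>L\<^esub> I, mult = rcoset_mult L I, one = I +>\<^bsub>L\<^esub> \<one>\<^bsub>L\<^esub>,
     zero = I, add = set_add L, smult = (\<lambda>r A. \<Union>a\<in>A. I +>\<^bsub>L\<^esub> (r \<odot>\<^bsub>L\<^esub> a))\<rparr>"

text \<open>
  \<open>lower_central L i\<close> is \<open>\<gamma>\<^sub>i(L)\<close> for \<open>i \<ge> 1\<close>.  The additive span of the brackets is closed under
  scalars because \<open>\<gamma>\<^sub>i(L)\<close> is.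
\<close>

fun lower_central :: "('r, 'a) module \<Rightarrow> nat \<Rightarrow> 'a set" where
  "lower_central L 0 = carrier L"
| "lower_central L (Suc 0) = carrier L"
| "lower_central L (Suc (Suc i)) =
     generate (add_monoid L) {x \<otimes>\<^bsub>L\<^esub> y | x y. x \<in> carrier L \<and> y \<in> lower_central L (Suc i)}"

text \<open>The group \<open>\<gamma>\<^sub>i(L)/\<gamma>\<^sub>i\<^sub>+\<^sub>1(L)\<close>, written multiplicatively as all groups of HOL-Algebra.\<close>

definition lower_central_factor :: "('r, 'a) module \<Rightarrow> nat \<Rightarrow> 'a set monoid" where
  "lower_central_factor L i =
     ((add_monoid L)\<lparr>carrier := lower_central L i\<rparr>) Mod (lower_central L (Suc i))"

text \<open>
  The rank of an abelian group is the largest number of \<open>\<int>\<close>-linearly independent elements; for a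
  free abelian group it is the size of a basis.  Meaningful for groups of finite rank only.
\<close>

definition int_independent :: "('a, 'x) monoid_scheme \<Rightarrow> 'a set \<Rightarrow> bool" where
  "int_independent G S \<longleftrightarrow> finite S \<and> S \<subseteq> carrier G
     \<and> (\<forall>k :: 'a \<Rightarrow> int. finprod G (\<lambda>x. x [^]\<^bsub>G\<^esub> k x) S = \<one>\<^bsub>G\<^esub> \<longrightarrow> (\<forall>x\<in>S. k x = 0))"

definition ab_rank :: "('a, 'x) monoid_scheme \<Rightarrow> nat" where
  "ab_rank G = Sup {card S | S. int_independent G S}"


section \<open>Free nilpotent Lie algebras over the integers\<close>

text \<open>
  The free Lie algebra is constructed as in Bourbaki: the free nonassociative algebra, with the
  free magma as a basis, modulo the two-sided ideal generated by the squares and the Jacobi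
  expressions.  An element of the free nonassociative algebra is its finitely supported
  coefficient function.  As every word of length at least two is a product in exactly one way, the
  coefficient of \<open>uv\<close> in \<open>p q\<close> is \<open>p(u) q(v)\<close>.
\<close>

datatype free_magma = Gen nat | Prod free_magma free_magma

primrec gens :: "free_magma \<Rightarrow> nat set" where
  "gens (Gen i) = {i}"
| "gens (Prod u v) = gens u \<union> gens v"

definition free_nonassoc :: "nat \<Rightarrow> (int, free_magma \<Rightarrow> int) module" where
  "free_nonassoc g =
     \<lparr>carrier = {p. finite {w. p w \<noteq> 0} \<and> (\<forall>w. p w \<noteq> 0 \<longrightarrow> gens w \<subseteq> {..<g})},
      mult = (\<lambda>p q w. case w of Gen i \<Rightarrow> 0 | Prod u v \<Rightarrow> p u * q v),
      one = (\<lambda>w. 0), zero = (\<lambda>w. 0), add = (\<lambda>p q w. p w + q w), smult = (\<lambda>k p w. k * p w)\<rparr>"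

definition two_sided_ideal ::
  "('r, 'x) ring_scheme \<Rightarrow> ('r, 'a) module \<Rightarrow> 'a set \<Rightarrow> bool" where
  "two_sided_ideal R A I \<longleftrightarrow> submodule I R A
     \<and> (\<forall>a\<in>carrier A. \<forall>x\<in>I. a \<otimes>\<^bsub>A\<^esub> x \<in> I \<and> x \<otimes>\<^bsub>A\<^esub> a \<in> I)"

definition gen_two_sided_ideal ::
  "('r, 'x) ring_scheme \<Rightarrow> ('r, 'a) module \<Rightarrow> 'a set \<Rightarrow> 'a set" where
  "gen_two_sided_ideal R A S = \<Inter>{I. two_sided_ideal R A I \<and> S \<subseteq> I}"

definition lie_relations :: "('r, 'a) module \<Rightarrow> 'a set" where
  "lie_relations A =
     {x \<otimes>\<^bsub>A\<^esub> x | x. x \<in> carrier A} \<union>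
     {x \<otimes>\<^bsub>A\<^esub> (y \<otimes>\<^bsub>A\<^esub> z) \<oplus>\<^bsub>A\<^esub> y \<otimes>\<^bsub>A\<^esub> (z \<otimes>\<^bsub>A\<^esub> x) \<oplus>\<^bsub>A\<^esub> z \<otimes>\<^bsub>A\<^esub> (x \<otimes>\<^bsub>A\<^esub> y) | x y z.
        x \<in> carrier A \<and> y \<in> carrier A \<and> z \<in> carrier A}"

definition free_lie :: "nat \<Rightarrow> (int, (free_magma \<Rightarrow> int) set) module" where
  "free_lie g =
     quot_alg (free_nonassoc g)
       (gen_two_sided_ideal \<Z> (free_nonassoc g) (lie_relations (free_nonassoc g)))"

definition free_nilpotent :: "nat \<Rightarrow> nat \<Rightarrow> (int, (free_magma \<Rightarrow> int) set set) module" where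
  "free_nilpotent c g = quot_alg (free_lie g) (lower_central (free_lie g) (Suc c))"


subsection \<open>The Lie algebra axioms for the free nilpotent Lie algebra\<close>

context nonassoc_algebra begin

lemma prod_zero_left: "x \<in> carrier L \<Longrightarrow> \<zero>\<^bsub>L\<^esub> \<otimes>\<^bsub>L\<^esub> x = \<zero>\<^bsub>L\<^esub>"
  using prod_add_left[of "\<zero>\<^bsub>L\<^esub>" "\<zero>\<^bsub>L\<^esub>" x] prod_closed[of "\<zero>\<^bsub>L\<^esub>" x] by simp

context
  fixes I assumes I: "two_sided_ideal R L I"
begin

lemma two_sided_ideal_abelian_subgroup: "abelian_subgroup I L"
  using I abelian_subgroupI3 M.abelian_group_axioms
  by (auto simp: two_sided_ideal_def submodule_def additive_subgroup_def)

interpretation I: abelian_subgroup I L by (rule two_sided_ideal_abelian_subgroup)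

lemma mem_ideal_coset: "y \<in> I +>\<^bsub>L\<^esub> x \<longleftrightarrow> (\<exists>h\<in>I. y = h \<oplus>\<^bsub>L\<^esub> x)"
  by (auto simp: a_r_coset_def')

lemma ideal_coset_eq: "\<lbrakk>x \<in> carrier L; h \<in> I\<rbrakk> \<Longrightarrow> I +>\<^bsub>L\<^esub> (h \<oplus>\<^bsub>L\<^esub> x) = I +>\<^bsub>L\<^esub> x"
  using M.a_repr_independence[of "h \<oplus>\<^bsub>L\<^esub> x" I x] I.a_subgroup mem_ideal_coset by auto

lemma quot_mult:
  assumes "x \<in> carrier L" "y \<in> carrier L"
  shows "(I +>\<^bsub>L\<^esub> x) \<otimes>\<^bsub>quot_alg L I\<^esub> (I +>\<^bsub>L\<^esub> y) = I +>\<^bsub>L\<^esub> (x \<otimes>\<^bsub>L\<^esub> y)"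
proof -
  have "I +>\<^bsub>L\<^esub> (a \<otimes>\<^bsub>L\<^esub> b) = I +>\<^bsub>L\<^esub> (x \<otimes>\<^bsub>L\<^esub> y)"
    if ab: "a \<in> I +>\<^bsub>L\<^esub> x" "b \<in> I +>\<^bsub>L\<^esub> y" for a b
  proof -
    obtain h k where hk: "h \<in> I" "k \<in> I" "a = h \<oplus>\<^bsub>L\<^esub> x" "b = k \<oplus>\<^bsub>L\<^esub> y"
      using ab mem_ideal_coset by auto
    have c: "h \<in> carrier L" "k \<in> carrier L" using hk I.a_subset by auto
    have "a \<otimes>\<^bsub>L\<^esub> b = (h \<otimes>\<^bsub>L\<^esub> (k \<oplus>\<^bsub>L\<^esub> y) \<oplus>\<^bsub>L\<^esub> x \<otimes>\<^bsub>L\<^esub> k) \<oplus>\<^bsub>L\<^esub> x \<otimes>\<^bsub>L\<^esub> y"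
      using hk c assms by (simp add: prod_add_left prod_add_right prod_closed M.a_ac)
    moreover have "h \<otimes>\<^bsub>L\<^esub> (k \<oplus>\<^bsub>L\<^esub> y) \<oplus>\<^bsub>L\<^esub> x \<otimes>\<^bsub>L\<^esub> k \<in> I"
      using I hk c assms by (intro I.a_closed) (auto simp: two_sided_ideal_def)
    ultimately show ?thesis using ideal_coset_eq assms prod_closed by simp
  qed
  hence "(\<Union>a\<in>I +>\<^bsub>L\<^esub> x. \<Union>b\<in>I +>\<^bsub>L\<^esub> y. I +>\<^bsub>L\<^esub> (a \<otimes>\<^bsub>L\<^esub> b))
      = (\<Union>a\<in>I +>\<^bsub>L\<^esub> x. \<Union>b\<in>I +>\<^bsub>L\<^esub> y. I +>\<^bsub>L\<^esub> (x \<otimes>\<^bsub>L\<^esub> y))" by (intro SUP_cong refl)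
  moreover have "x \<in> I +>\<^bsub>L\<^esub> x" "y \<in> I +>\<^bsub>L\<^esub> y" using assms I.a_rcos_self by auto
  ultimately show ?thesis by (auto simp: quot_alg_def rcoset_mult_def)
qed

lemma quot_smult:
  assumes "r \<in> carrier R" "x \<in> carrier L"
  shows "r \<odot>\<^bsub>quot_alg L I\<^esub> (I +>\<^bsub>L\<^esub> x) = I +>\<^bsub>L\<^esub> (r \<odot>\<^bsub>L\<^esub> x)"
proof -
  have "I +>\<^bsub>L\<^esub> (r \<odot>\<^bsub>L\<^esub> a) = I +>\<^bsub>L\<^esub> (r \<odot>\<^bsub>L\<^esub> x)" if ab: "a \<in> I +>\<^bsub>L\<^esub> x" for a
  proof -
    obtain h where hk: "h \<in> I" "a = h \<oplus>\<^bsub>L\<^esub> x" using ab mem_ideal_coset by auto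
    have c: "h \<in> carrier L" using hk I.a_subset by auto
    have "r \<odot>\<^bsub>L\<^esub> h \<in> I" using I hk assms by (auto simp: two_sided_ideal_def submodule.smult_closed)
    thus ?thesis using hk c assms ideal_coset_eq by (simp add: smult_r_distr)
  qed
  hence "(\<Union>a\<in>I +>\<^bsub>L\<^esub> x. I +>\<^bsub>L\<^esub> (r \<odot>\<^bsub>L\<^esub> a)) = (\<Union>a\<in>I +>\<^bsub>L\<^esub> x. I +>\<^bsub>L\<^esub> (r \<odot>\<^bsub>L\<^esub> x))"
    by (intro SUP_cong refl)
  moreover have "x \<in> I +>\<^bsub>L\<^esub> x" using assms I.a_rcos_self by auto
  ultimately show ?thesis by (auto simp: quot_alg_def)
qed

lemma quot_add:
  assumes "x \<in> carrier L" "y \<in> carrier L"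
  shows "(I +>\<^bsub>L\<^esub> x) \<oplus>\<^bsub>quot_alg L I\<^esub> (I +>\<^bsub>L\<^esub> y) = I +>\<^bsub>L\<^esub> (x \<oplus>\<^bsub>L\<^esub> y)"
  using assms I.a_rcos_sum by (simp add: quot_alg_def)

lemma quot_zero: "\<zero>\<^bsub>quot_alg L I\<^esub> = I +>\<^bsub>L\<^esub> \<zero>\<^bsub>L\<^esub>"
  using I.a_subset by (simp add: quot_alg_def)

lemma quot_carrier: "A \<in> carrier (quot_alg L I) \<longleftrightarrow> (\<exists>x\<in>carrier L. A = I +>\<^bsub>L\<^esub> x)"
  by (auto simp: quot_alg_def A_RCOSETS_def')

lemmas quot_ops = quot_mult quot_smult quot_add quot_zero

lemma quot_nonassoc_algebra: "nonassoc_algebra R (quot_alg L I)"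
proof -
  have ag: "abelian_group (quot_alg L I)"
  proof (rule abelian_groupI)
    fix A assume "A \<in> carrier (quot_alg L I)"
    then obtain x where x: "x \<in> carrier L" "A = I +>\<^bsub>L\<^esub> x" by (auto simp: quot_carrier)
    show "\<exists>B\<in>carrier (quot_alg L I). B \<oplus>\<^bsub>quot_alg L I\<^esub> A = \<zero>\<^bsub>quot_alg L I\<^esub>"
      by (rule bexI[of _ "I +>\<^bsub>L\<^esub> (\<ominus>\<^bsub>L\<^esub> x)"]) (use x in \<open>auto simp: quot_ops quot_carrier M.l_neg\<close>)
  qed (auto simp: quot_carrier quot_ops M.a_ac)
  have m: "Module.module R (quot_alg L I)"
    by (rule moduleI[OF R.is_cring ag])
      (auto simp: quot_carrier quot_ops smult_l_distr smult_r_distr smult_assoc1)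
  show ?thesis
    by (intro nonassoc_algebra.intro nonassoc_algebra_axioms.intro m)
      (auto simp: quot_carrier quot_ops prod_closed prod_add_left prod_add_right prod_smult_left
        prod_smult_right)
qed

end
end

lemma gen_two_sided_ideal:
  assumes "nonassoc_algebra R A" "S \<subseteq> carrier A"
  shows "two_sided_ideal R A (gen_two_sided_ideal R A S)" "S \<subseteq> gen_two_sided_ideal R A S"
proof -
  interpret nonassoc_algebra R A by fact
  have c: "two_sided_ideal R A (carrier A)"
    unfolding two_sided_ideal_def using carrier_is_submodule prod_closed by auto
  have sub: "submodule (gen_two_sided_ideal R A S) R A"
    unfolding gen_two_sided_ideal_def
  proof (rule submoduleI)
    show "\<Inter>{I. two_sided_ideal R A I \<and> S \<subseteq> I} \<subseteq> carrier A" using c assms by auto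
    show "\<zero>\<^bsub>A\<^esub> \<in> \<Inter>{I. two_sided_ideal R A I \<and> S \<subseteq> I}"
      using subgroup.one_closed[of _ "add_monoid A"] by (auto simp: two_sided_ideal_def submodule_def)
  qed (auto simp: two_sided_ideal_def dest: submoduleE)
  thus "two_sided_ideal R A (gen_two_sided_ideal R A S)"
    by (auto simp: two_sided_ideal_def gen_two_sided_ideal_def)
qed (auto simp: gen_two_sided_ideal_def)

lemma nonassoc_algebra_free_nonassoc: "nonassoc_algebra \<Z> (free_nonassoc g)"
proof -
  have fina: "finite {w. p w + q w \<noteq> (0::int)}" if "finite {w. p w \<noteq> 0}" "finite {w. q w \<noteq> 0}" for p q :: "free_magma \<Rightarrow> int"
    by (rule finite_subset[OF _ finite_UnI[OF that]]) auto
  have ag: "abelian_group (free_nonassoc g)"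
  proof (rule abelian_groupI)
    fix p assume "p \<in> carrier (free_nonassoc g)"
    thus "\<exists>q\<in>carrier (free_nonassoc g). q \<oplus>\<^bsub>free_nonassoc g\<^esub> p = \<zero>\<^bsub>free_nonassoc g\<^esub>"
      by (intro bexI[of _ "\<lambda>w. - p w"]) (auto simp: free_nonassoc_def)
  qed (auto simp: free_nonassoc_def fina add_ac, (metis add.right_neutral subsetD lessThan_iff)+)
  have m: "Module.module \<Z> (free_nonassoc g)"
    apply (rule moduleI[OF int_is_cring ag])
    by (auto simp: free_nonassoc_def algebra_simps intro: finite_subset[rotated])
  have f2: "finite {w. (case w of Gen i \<Rightarrow> 0 | Prod u v \<Rightarrow> p u * q v) \<noteq> (0::int)}"
    if "finite {w. p w \<noteq> 0}" "finite {w. q w \<noteq> 0}" for p q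
  proof (rule finite_subset)
    show "{w. (case w of Gen i \<Rightarrow> 0 | Prod u v \<Rightarrow> p u * q v) \<noteq> (0::int)} \<subseteq> (\<lambda>(u,v). Prod u v) ` ({w. p w \<noteq> 0} \<times> {w. q w \<noteq> 0})"
      by (auto split: free_magma.splits simp: image_iff) (metis free_magma.exhaust)
  qed (use that in auto)
  show ?thesis
    apply (intro nonassoc_algebra.intro nonassoc_algebra_axioms.intro m)
    by (auto simp: free_nonassoc_def f2 algebra_simps fun_eq_iff split: free_magma.splits)
qed

lemma lie_algebra_free_lie: "lie_algebra \<Z> (free_lie g)"
proof -
  interpret A: nonassoc_algebra \<Z> "free_nonassoc g" by (rule nonassoc_algebra_free_nonassoc)
  let ?A = "free_nonassoc g" let ?I = "gen_two_sided_ideal \<Z> ?A (lie_relations ?A)"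
  have rel: "lie_relations ?A \<subseteq> carrier ?A"
    by (auto simp: lie_relations_def A.prod_closed)
  note I = gen_two_sided_ideal[OF nonassoc_algebra_free_nonassoc rel]
  interpret I: abelian_subgroup ?I ?A by (rule A.two_sided_ideal_abelian_subgroup[OF I(1)])
  have z: "?I +>\<^bsub>?A\<^esub> x = ?I" if "x \<in> lie_relations ?A" for x
    using that I(2) rel A.M.a_coset_join2[of x ?I] I.a_subgroup by auto
  show ?thesis
    unfolding free_lie_def
  proof (intro lie_algebra.intro lie_algebra_axioms.intro A.quot_nonassoc_algebra I)
    fix A assume "A \<in> carrier (quot_alg ?A ?I)"
    then obtain x where x: "x \<in> carrier ?A" "A = ?I +>\<^bsub>?A\<^esub> x" by (auto simp: A.quot_carrier[OF I(1)])
    have "x \<otimes>\<^bsub>?A\<^esub> x \<in> lie_relations ?A" using x(1) unfolding lie_relations_def by blast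
    note e = z[OF this]
    have q: "\<zero>\<^bsub>quot_alg ?A ?I\<^esub> = ?I" by (simp add: quot_alg_def)
    show "A \<otimes>\<^bsub>quot_alg ?A ?I\<^esub> A = \<zero>\<^bsub>quot_alg ?A ?I\<^esub>"
      unfolding q using x A.quot_mult[OF I(1) x(1) x(1)] e by simp
  next
    fix A B C assume "A \<in> carrier (quot_alg ?A ?I)" "B \<in> carrier (quot_alg ?A ?I)" "C \<in> carrier (quot_alg ?A ?I)"
    then obtain x y w where x: "x \<in> carrier ?A" "A = ?I +>\<^bsub>?A\<^esub> x"  "y \<in> carrier ?A" "B = ?I +>\<^bsub>?A\<^esub> y"
      "w \<in> carrier ?A" "C = ?I +>\<^bsub>?A\<^esub> w" by (auto simp: A.quot_carrier[OF I(1)])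
    have "x \<otimes>\<^bsub>?A\<^esub> (y \<otimes>\<^bsub>?A\<^esub> w) \<oplus>\<^bsub>?A\<^esub> y \<otimes>\<^bsub>?A\<^esub> (w \<otimes>\<^bsub>?A\<^esub> x) \<oplus>\<^bsub>?A\<^esub> w \<otimes>\<^bsub>?A\<^esub> (x \<otimes>\<^bsub>?A\<^esub> y) \<in> lie_relations ?A"
      using x(1,3,5) unfolding lie_relations_def by blast
    note e = z[OF this]
    have q: "\<zero>\<^bsub>quot_alg ?A ?I\<^esub> = ?I" by (simp add: quot_alg_def)
    show "A \<otimes>\<^bsub>quot_alg ?A ?I\<^esub> (B \<otimes>\<^bsub>quot_alg ?A ?I\<^esub> C) \<oplus>\<^bsub>quot_alg ?A ?I\<^esub>
       B \<otimes>\<^bsub>quot_alg ?A ?I\<^esub> (C \<otimes>\<^bsub>quot_alg ?A ?I\<^esub> A) \<oplus>\<^bsub>quot_alg ?A ?I\<^esub>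
       C \<otimes>\<^bsub>quot_alg ?A ?I\<^esub> (A \<otimes>\<^bsub>quot_alg ?A ?I\<^esub> B) = \<zero>\<^bsub>quot_alg ?A ?I\<^esub>"
      unfolding q x(2,4,6) apply (rule trans[OF _ e]) using x(1,3,5)
      by (simp only: A.quot_mult[OF I(1)] A.quot_add[OF I(1)] A.prod_closed A.M.a_closed)
  qed
qed

context lie_algebra begin

lemma quot_lie_algebra: assumes I: "two_sided_ideal R L I" shows "lie_algebra R (quot_alg L I)"
proof (intro lie_algebra.intro lie_algebra_axioms.intro quot_nonassoc_algebra I)
qed (auto simp: quot_carrier[OF I] quot_ops[OF I] prod_closed bracket_self jacobi simp del: a_coset_add_zero)

lemma bracket_anti: assumes "x \<in> carrier L" "y \<in> carrier L" shows "x \<otimes>\<^bsub>L\<^esub> y = \<ominus>\<^bsub>L\<^esub> (y \<otimes>\<^bsub>L\<^esub> x)"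
proof -
  have "(x \<oplus>\<^bsub>L\<^esub> y) \<otimes>\<^bsub>L\<^esub> (x \<oplus>\<^bsub>L\<^esub> y) = x \<otimes>\<^bsub>L\<^esub> y \<oplus>\<^bsub>L\<^esub> y \<otimes>\<^bsub>L\<^esub> x"
    using assms bracket_self[of x] bracket_self[of y] by (simp add: prod_add_left prod_add_right prod_closed M.a_comm)
  hence "x \<otimes>\<^bsub>L\<^esub> y \<oplus>\<^bsub>L\<^esub> y \<otimes>\<^bsub>L\<^esub> x = \<zero>\<^bsub>L\<^esub>" using bracket_self[of "x \<oplus>\<^bsub>L\<^esub> y"] assms by simp
  from M.minus_equality[OF this] show ?thesis using assms prod_closed by auto
qed

lemma lower_central_ideal: "two_sided_ideal R L (lower_central L i)"
proof (induction i)
    case 0 show ?case using carrier_is_submodule prod_closed by (auto simp: two_sided_ideal_def)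
  next
    case (Suc i)
    show ?case
    proof (cases i)
      case 0 thus ?thesis using carrier_is_submodule prod_closed by (auto simp: two_sided_ideal_def)
    next
      case [simp]: (Suc k)
      let ?G = "{x \<otimes>\<^bsub>L\<^esub> y | x y. x \<in> carrier L \<and> y \<in> lower_central L i}"
      have sub: "lower_central L i \<subseteq> carrier L"
        using Suc.IH submoduleE(1) by (auto simp: two_sided_ideal_def)
      have G: "?G \<subseteq> lower_central L i" using Suc.IH by (auto simp: two_sided_ideal_def)
      hence Gc: "?G \<subseteq> carrier L" using sub by auto
      have sg: "subgroup (lower_central L i) (add_monoid L)" using Suc.IH by (auto simp: two_sided_ideal_def submodule_def)
      have eq: "lower_central L (Suc i) = generate (add_monoid L) ?G" by simp
      have desc: "lower_central L (Suc i) \<subseteq> lower_central L i"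
        unfolding eq by (rule add.generate_subgroup_incl[OF G sg])
      have sm: "r \<odot>\<^bsub>L\<^esub> h \<in> generate (add_monoid L) ?G" if "r \<in> carrier R" "h \<in> generate (add_monoid L) ?G" for r h
        using that(2)
      proof (induction h rule: generate.induct)
        case one then show ?case using that generate.one[of "add_monoid L"] by simp
      next
        case (incl h)
        then obtain x y where "x \<in> carrier L" "y \<in> lower_central L i" "h = x \<otimes>\<^bsub>L\<^esub> y" by auto
        hence "r \<odot>\<^bsub>L\<^esub> h = (r \<odot>\<^bsub>L\<^esub> x) \<otimes>\<^bsub>L\<^esub> y" "r \<odot>\<^bsub>L\<^esub> x \<in> carrier L" "y \<in> lower_central L i"
          using that sub by (auto simp: prod_smult_left)
        then show ?case by (intro generate.incl) blast
      next
        case (inv h)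
        then obtain x y where h: "x \<in> carrier L" "y \<in> lower_central L i" "h = x \<otimes>\<^bsub>L\<^esub> y" by auto
        hence "r \<odot>\<^bsub>L\<^esub> h = (r \<odot>\<^bsub>L\<^esub> x) \<otimes>\<^bsub>L\<^esub> y" "r \<odot>\<^bsub>L\<^esub> x \<in> carrier L" "y \<in> lower_central L i"
          using that sub by (auto simp: prod_smult_left)
        hence "r \<odot>\<^bsub>L\<^esub> h \<in> ?G" by blast
        from generate.inv[OF this, of "add_monoid L"]
        show ?case using that h sub prod_closed[of x y] by (auto simp: smult_r_minus a_inv_def[symmetric])
      next
        case (eng a b)
        have "a \<in> carrier L" "b \<in> carrier L" using eng add.generate_in_carrier[OF Gc] by auto
        then show ?case using that generate.eng[OF eng.IH] by (simp add: smult_r_distr)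
      qed
      have sgG: "subgroup (generate (add_monoid L) ?G) (add_monoid L)" using add.generate_is_subgroup[of ?G] Gc by simp
      have left: "a \<otimes>\<^bsub>L\<^esub> h \<in> lower_central L (Suc i)" if "a \<in> carrier L" "h \<in> lower_central L (Suc i)" for a h
      proof -
        have "a \<otimes>\<^bsub>L\<^esub> h \<in> ?G" using that desc by blast
        thus ?thesis unfolding eq by (rule generate.incl)
      qed
      have right: "h \<otimes>\<^bsub>L\<^esub> a \<in> lower_central L (Suc i)" if "a \<in> carrier L" "h \<in> lower_central L (Suc i)" for a h
      proof -
        have "h \<otimes>\<^bsub>L\<^esub> a = \<ominus>\<^bsub>L\<^esub> (a \<otimes>\<^bsub>L\<^esub> h)" using that desc sub by (intro bracket_anti) auto
        thus ?thesis using left[OF that] subgroup.m_inv_closed[OF sgG] unfolding eq by (simp add: a_inv_def)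
      qed
      show ?thesis unfolding two_sided_ideal_def
        using left right sgG[folded eq] sm[folded eq] by (auto simp: submodule_def submodule_axioms_def simp del: lower_central.simps)
    qed
  qed
end

lemma lie_algebra_free_nilpotent: "lie_algebra \<Z> (free_nilpotent c g)"
proof -
  interpret A: lie_algebra \<Z> "free_lie g" by (rule lie_algebra_free_lie)
  show ?thesis unfolding free_nilpotent_def by (intro A.quot_lie_algebra A.lower_central_ideal)
qed


section \<open>Profinite integers and extension of scalars\<close>

text \<open>
  The inverse limit of the rings \<open>\<int>/n\<int>\<close> over \<open>n \<ge> 1\<close> ordered by divisibility, with residues
  represented by \<open>0, \<dots>, n - 1\<close> (the case \<open>m = n\<close> of the compatibility condition).  The index \<open>0\<close>
  does not belong to the system, and the entry there is fixed to be \<open>0\<close>.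
\<close>

definition profinite_int :: "(nat \<Rightarrow> int) ring" where
  "profinite_int =
     \<lparr>carrier = {x. x 0 = 0 \<and> (\<forall>n>0. \<forall>m. m dvd n \<longrightarrow> x n mod int m = x m)},
      mult = (\<lambda>x y n. (x n * y n) mod int n),
      one = (\<lambda>n. if n = 0 then 0 else 1 mod int n),
      zero = (\<lambda>n. 0),
      add = (\<lambda>x y n. (x n + y n) mod int n)\<rparr>"

text \<open>
  \<open>L \<otimes>\<^sub>\<int> A\<close> for an algebra \<open>L\<close> over \<open>\<int>\<close> and a commutative ring \<open>A\<close>: the free abelian group on the
  pairs \<open>(x, a)\<close>, with product \<open>(x, a)(y, b) = ([x, y], ab)\<close> and scalars \<open>b(x, a) = (x, ba)\<close>, modulo
  the biadditivity relations.  Over \<open>\<int>\<close>, biadditivity implies \<open>kx \<otimes> a = x \<otimes> ka\<close>.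
\<close>

definition tensor_free ::
  "(int, 'a) module \<Rightarrow> ('b, 'x) ring_scheme \<Rightarrow> ('b, 'a \<times> 'b \<Rightarrow>\<^sub>0 int) module" where
  "tensor_free L A =
     \<lparr>carrier = {p. Poly_Mapping.keys p \<subseteq> carrier L \<times> carrier A},
      mult = (\<lambda>p q. frag_extend (\<lambda>(x, a). frag_extend (\<lambda>(y, b).
                frag_of (x \<otimes>\<^bsub>L\<^esub> y, a \<otimes>\<^bsub>A\<^esub> b)) q) p),
      one = 0, zero = 0, add = (+),
      smult = (\<lambda>b. frag_extend (\<lambda>(x, a). frag_of (x, b \<otimes>\<^bsub>A\<^esub> a)))\<rparr>"

definition tensor_relations ::
  "(int, 'a) module \<Rightarrow> ('b, 'x) ring_scheme \<Rightarrow> ('a \<times> 'b \<Rightarrow>\<^sub>0 int) set" where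
  "tensor_relations L A =
     {frag_of (x \<oplus>\<^bsub>L\<^esub> y, a) - frag_of (x, a) - frag_of (y, a) | x y a.
        x \<in> carrier L \<and> y \<in> carrier L \<and> a \<in> carrier A} \<union>
     {frag_of (x, a \<oplus>\<^bsub>A\<^esub> b) - frag_of (x, a) - frag_of (x, b) | x a b.
        x \<in> carrier L \<and> a \<in> carrier A \<and> b \<in> carrier A}"

definition tensor ::
  "(int, 'a) module \<Rightarrow> ('b, 'x) ring_scheme \<Rightarrow> ('b, ('a \<times> 'b \<Rightarrow>\<^sub>0 int) set) module" where
  "tensor L A =
     quot_alg (tensor_free L A) (generate (add_monoid (tensor_free L A)) (tensor_relations L A))"


section \<open>Zeta functions\<close>

text \<open>
  A Lie algebra that is free of finite rank as an abelian group has only finitely many subalgebras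
  of a given finite index, so that \<^const>\<open>card\<close> is the true number for \<open>n \<ge> 1\<close>.
\<close>

definition iso_count :: "(int, 'a) module \<Rightarrow> nat \<Rightarrow> nat" where
  "iso_count L n = card {M. subalgebra_of \<Z> L M \<and> add_index L M = n
     \<and> alg_iso \<Z> (L\<lparr>carrier := M\<rparr>) L}"

definition proiso_count :: "(int, 'a) module \<Rightarrow> nat \<Rightarrow> nat" where
  "proiso_count L n = card {M. subalgebra_of \<Z> L M \<and> add_index L M = n
     \<and> alg_iso profinite_int (tensor (L\<lparr>carrier := M\<rparr>) profinite_int) (tensor L profinite_int)}"

definition dirichlet_term :: "(nat \<Rightarrow> nat) \<Rightarrow> complex \<Rightarrow> nat \<Rightarrow> complex" where
  "dirichlet_term a s n = of_nat (a n) * of_nat n powr (- s)"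

definition dirichlet_converges :: "(nat \<Rightarrow> nat) \<Rightarrow> complex \<Rightarrow> bool" where
  "dirichlet_converges a s \<longleftrightarrow> dirichlet_term a s abs_summable_on {1..}"

definition dirichlet_series :: "(nat \<Rightarrow> nat) \<Rightarrow> complex \<Rightarrow> complex" where
  "dirichlet_series a s = (\<Sum>\<^sub>\<infinity>n\<in>{1..}. dirichlet_term a s n)"

definition iso_zeta :: "(int, 'a) module \<Rightarrow> complex \<Rightarrow> complex" where
  "iso_zeta L = dirichlet_series (iso_count L)"

definition proiso_zeta :: "(int, 'a) module \<Rightarrow> complex \<Rightarrow> complex" where
  "proiso_zeta L = dirichlet_series (proiso_count L)"

text \<open>The Riemann zeta function on the half-plane \<open>Re s > 1\<close>.\<close>

definition riemann_zeta :: "complex \<Rightarrow> complex" where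
  "riemann_zeta = dirichlet_series (\<lambda>n. 1)"

end

theory Submission
  imports Defs "HOL-Library.List_Lexorder" "HOL-Library.Function_Algebras"
begin

text \<open>
  Write \<open>F\<close> for the free nilpotent Lie ring of class \<open>c\<close> on \<open>g\<close> generators. The theorem holds because
  the subalgebras of finite index that are pro-isomorphic to \<open>F\<close> are exactly those generated by \<open>g\<close>
  elements in a triangular normal form; all of these are isomorphic to \<open>F\<close>, and counting them is
  elementary.

  \<^emph>\<open>A concrete model.\<close> Let \<open>P\<close> be the Lie ring generated by the letters \<open>0, \<dots>, g - 1\<close> inside the
  noncommutative integer polynomials, with all words longer than \<open>c\<close> discarded. The bracketed Lyndon
  words span every Lie ring with \<open>g\<close> generators (\<open>bracket_lyndon_span\<close>). In \<open>P\<close> they are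
  independent, since the bracket of a Lyndon word \<open>w\<close> has the leading word \<open>w\<close> with coefficient \<open>1\<close>
  (\<open>lyn_leading\<close>). Hence \<open>F\<close> is isomorphic to \<open>P\<close> (\<open>free_nilpotent_iso\<close>), the Lyndon words of length at
  most \<open>c\<close> index a basis of \<open>P\<close>, and those of length \<open>i\<close> index a basis of the \<open>i\<close>-th factor of the
  lower central series (\<open>rank_lower_central_factor\<close>).

  \<^emph>\<open>Pro-isomorphic subalgebras.\<close> Let \<open>M\<close> be a subalgebra of finite index whose profinite extension
  is isomorphic to that of \<open>P\<close>. The abelianisation of the extension of \<open>P\<close> is a free module over the
  profinite integers, so it is torsion free, and so is that of the extension of \<open>M\<close>. A multiple of every
  element of \<open>M \<inter> [P, P]\<close> lies in \<open>[M, M]\<close>, and reduction modulo a suitable integer turns torsion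
  freeness into the equality \<open>M \<inter> [P, P] = [M, M]\<close> (\<open>proiso_pure\<close>). By nilpotency, \<open>M\<close> is then
  generated by any elements that generate its image in \<open>P / [P, P]\<close> (\<open>gen_sub_eq\<close>).

  \<^emph>\<open>Normal forms.\<close> Order the basis by a weight in which the letters come first, in their order. As in
  the Hermite normal form, \<open>M\<close> has exactly one tuple of generators \<open>y\<^sub>j = d\<^sub>j x\<^sub>j + higher terms\<close> whose
  coefficient at each higher word \<open>w\<close> is reduced modulo \<open>d\<^sup>w\<close>, the product of the \<open>d\<^sub>l\<close> over the letters
  \<open>l\<close> of \<open>w\<close> (\<open>normal_form_exists\<close>, \<open>normal_form_unique\<close>). The Lyndon brackets of every such tuple are
  triangular with diagonal entries \<open>d\<^sup>w\<close> with respect to the basis of \<open>P\<close>, so that they span a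
  subalgebra isomorphic to \<open>P\<close> (\<open>gen_sub_iso\<close>) of index \<open>\<Prod>\<^sub>w d\<^sup>w\<close> (\<open>add_index_gen_sub\<close>).

  \<^emph>\<open>The count.\<close> Every letter occurs equally often in the list of all Lyndon words of length at most
  \<open>c\<close> (\<open>letter_count_eq\<close>), namely \<open>\<alpha>\<close> times; hence the index is \<open>(\<Prod>\<^sub>j d\<^sub>j)\<^sup>\<alpha>\<close>. Given \<open>d\<close>, the words of
  length at least two admit \<open>\<Prod>\<^sub>j d\<^sub>j\<^sup>\<beta>\<close> choices of coefficients, where \<open>\<beta> = g (\<alpha> - 1)\<close>, and the letters
  above the diagonal admit \<open>\<Prod>\<^sub>j d\<^sub>j\<^sup>j\<close> choices (\<open>card_reduced_data\<close>). Both zeta functions are therefore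
  the sum of \<open>\<Prod>\<^sub>j d\<^sub>j\<^bsup>j + \<beta> - \<alpha> s\<^esup>\<close> over all tuples \<open>d\<close> of positive integers, which is the product of
  the \<open>\<zeta>(\<alpha> s - \<beta> - j)\<close> (\<open>zeta_product\<close>).
\<close>

section \<open>Lyndon words\<close>

lemma append_less_append_iff [simp]: "u @ v < u @ w \<longleftrightarrow> v < (w :: nat list)"
  by (induction u) auto

lemma append_le_append_iff [simp]: "u @ v \<le> u @ w \<longleftrightarrow> v \<le> (w :: nat list)"
  by (induction u) auto

lemma less_append_self [simp]: "(u :: nat list) < u @ v \<longleftrightarrow> v \<noteq> []"
  by (induction u) (cases v; auto)+

lemma le_append_self [simp]: "(u :: nat list) \<le> u @ v"
  by (induction u) auto

lemma less_append_mono: "length u = length u' \<Longrightarrow> u < u' \<Longrightarrow> u @ v < u' @ (v' :: nat list)"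
  by (induction u u' rule: list_induct2) auto

text \<open>
  Unless \<open>u\<close> is a prefix of \<open>v\<close>, the two words differ at some position, and what is appended to them
  does not influence the comparison any more.
\<close>

lemma less_cases_prefix:
  assumes "u < (v :: nat list)"
  shows "(\<exists>z. z \<noteq> [] \<and> v = u @ z) \<or> (\<forall>x y. u @ x < v @ y)"
  using assms
proof (induction u arbitrary: v)
  case (Cons a u)
  then obtain b v' where v: "v = b # v'" by (cases v) auto
  show ?case using Cons.IH[of v'] Cons.prems v by auto
qed auto

definition lyndon :: "nat list \<Rightarrow> bool" where
  "lyndon w \<longleftrightarrow> w \<noteq> [] \<and> (\<forall>u v. w = u @ v \<longrightarrow> u \<noteq> [] \<longrightarrow> v \<noteq> [] \<longrightarrow> w < v)"

lemma lyndonD: "lyndon (u @ v) \<Longrightarrow> u \<noteq> [] \<Longrightarrow> v \<noteq> [] \<Longrightarrow> u @ v < v"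
  by (auto simp: lyndon_def)

lemma lyndon_not_Nil [simp]: "lyndon w \<Longrightarrow> w \<noteq> []"
  by (auto simp: lyndon_def)

lemma lyndon_single [simp]: "lyndon [a]"
  unfolding lyndon_def by (metis append_eq_Cons_conv append_is_Nil_conv not_Cons_self2)

lemma append_less_right:
  assumes "lyndon v" "u < v" "u \<noteq> []"
  shows "u @ v < v"
  using less_cases_prefix[OF assms(2)]
proof
  assume "\<exists>z. z \<noteq> [] \<and> v = u @ z"
  then obtain z where z: "z \<noteq> []" "v = u @ z" by auto
  with lyndonD[of u z] assms have "v < z" by auto
  thus ?thesis using z by auto
next
  assume "\<forall>x y. u @ x < v @ y"
  hence "u @ v < v @ []" by blast
  thus ?thesis by simp
qed

lemma lyndon_append:
  assumes "lyndon u" "lyndon v" "u < v"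
  shows "lyndon (u @ v)"
  unfolding lyndon_def
proof (intro conjI allI impI)
  show "u @ v \<noteq> []" using assms by auto
  fix x y assume xy: "u @ v = x @ y" "x \<noteq> []" "y \<noteq> []"
  have uv: "u @ v < v" using append_less_right[of v u] assms by auto
  from xy(1) consider z where "u = x @ z" "y = z @ v" | z where "x = u @ z" "v = z @ y"
    by (auto simp: append_eq_append_conv2)
  thus "u @ v < y"
  proof cases
    case 1
    show ?thesis
    proof (cases "z = []")
      case True thus ?thesis using 1 uv by simp
    next
      case False
      hence "u < z" using lyndonD[of x z] assms 1 xy by auto
      hence "\<forall>a b. u @ a < z @ b"
      proof -
        assume "u < z"
        moreover have "length z < length u" using 1 xy by simp
        ultimately show ?thesis using less_cases_prefix[of u z] by auto
      qed
      thus ?thesis using 1 by blast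
    qed
  next
    case 2
    show ?thesis
    proof (cases "z = []")
      case True thus ?thesis using 2 uv by simp
    next
      case False
      hence "v < y" using lyndonD[of z y] assms 2 xy by auto
      thus ?thesis using uv by order
    qed
  qed
qed

text \<open>
  The least proper suffix of a word. For a Lyndon word it is also the longest proper suffix that is
  a Lyndon word, so that \<open>minpre w\<close> and \<open>minsuf w\<close> form the standard factorisation of \<open>w\<close>.
\<close>

definition minsuf :: "nat list \<Rightarrow> nat list" where
  "minsuf w = Min ((\<lambda>k. drop k w) ` {0<..<length w})"

lemma minsuf_ex:
  assumes "2 \<le> length w"
  obtains k where "0 < k" "k < length w" "minsuf w = drop k w"
proof -
  have "1 \<in> {0<..<length w}" using assms by auto
  hence "(\<lambda>k. drop k w) ` {0<..<length w} \<noteq> {}" by blast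
  hence "minsuf w \<in> (\<lambda>k. drop k w) ` {0<..<length w}"
    unfolding minsuf_def by (intro Min_in) auto
  thus thesis using that by auto
qed

lemma minsuf_le:
  assumes "w = u @ v" "u \<noteq> []" "v \<noteq> []"
  shows "minsuf w \<le> v"
proof -
  have "v = drop (length u) w" "length u \<in> {0<..<length w}" using assms by auto
  thus ?thesis unfolding minsuf_def by (intro Min_le) auto
qed

lemma minsuf_eqI:
  assumes "w = u @ v" "u \<noteq> []" "v \<noteq> []"
    and "\<And>x y. w = x @ y \<Longrightarrow> x \<noteq> [] \<Longrightarrow> y \<noteq> [] \<Longrightarrow> v \<le> y"
  shows "minsuf w = v"
proof -
  have l: "2 \<le> length w" using assms(1-3) by (cases u; cases v) auto
  obtain k where k: "0 < k" "k < length w" "minsuf w = drop k w" using minsuf_ex[OF l] .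
  have "v \<le> drop k w" by (rule assms(4)[of "take k w"]) (use k in auto)
  with minsuf_le[OF assms(1-3)] k show ?thesis by auto
qed

definition minpre :: "nat list \<Rightarrow> nat list" where
  "minpre w = take (length w - length (minsuf w)) w"

lemma minpre_append_minsuf:
  assumes "2 \<le> length w"
  shows "minpre w @ minsuf w = w" "minpre w \<noteq> []" "minsuf w \<noteq> []"
proof -
  obtain k where k: "0 < k" "k < length w" "minsuf w = drop k w" using minsuf_ex[OF assms] .
  hence "minpre w = take k w" by (simp add: minpre_def)
  with k show "minpre w @ minsuf w = w" "minpre w \<noteq> []" "minsuf w \<noteq> []" by auto
qed

lemma minpre_minsuf_length:
  assumes "2 \<le> length w"
  shows "length (minpre w) < length w" "length (minsuf w) < length w"
proof -
  have "length (minpre w @ minsuf w) = length w" using minpre_append_minsuf(1)[OF assms] by simp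
  thus "length (minpre w) < length w" "length (minsuf w) < length w"
    using minpre_append_minsuf(2,3)[OF assms] by (simp_all add: add_strict_increasing length_greater_0_conv[symmetric] del: length_greater_0_conv)
qed

lemma lyndon_minsuf:
  assumes "2 \<le> length w"
  shows "lyndon (minsuf w)"
  unfolding lyndon_def
proof (intro conjI allI impI)
  show "minsuf w \<noteq> []" using minpre_append_minsuf[OF assms] by blast
  fix x y assume xy: "minsuf w = x @ y" "x \<noteq> []" "y \<noteq> []"
  hence "minsuf w \<le> y"
    using minsuf_le[of w "minpre w @ x" y] minpre_append_minsuf[OF assms] by simp
  moreover have "minsuf w \<noteq> y" using xy by auto
  ultimately show "minsuf w < y" by order
qed

text \<open>
  A proper suffix \<open>y\<close> of the first factor that is smaller than it would either be a prefix of it, and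
  cancelling \<open>y\<close> contradicts the minimality of the second factor, or differ from it at some
  position, and then \<open>w\<close> would have a smaller suffix.
\<close>

lemma lyndon_minpre:
  assumes "2 \<le> length w" "lyndon w"
  shows "lyndon (minpre w)"
  unfolding lyndon_def
proof (intro conjI allI impI)
  note m = minpre_append_minsuf[OF assms(1)]
  show "minpre w \<noteq> []" using m by blast
  fix x y assume xy: "minpre w = x @ y" "x \<noteq> []" "y \<noteq> []"
  have w: "w = x @ y @ minsuf w" using m xy by simp
  have less: "w < y @ minsuf w" using lyndonD[of x "y @ minsuf w"] w assms xy by simp
  show "minpre w < y"
  proof (rule ccontr)
    assume "\<not> minpre w < y"
    moreover have "y \<noteq> minpre w" using xy by auto
    ultimately have "y < minpre w" by order
    from less_cases_prefix[OF this] show False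
    proof
      assume "\<exists>z. z \<noteq> [] \<and> minpre w = y @ z"
      then obtain z where z: "z \<noteq> []" "minpre w = y @ z" by blast
      have "w = y @ (z @ minsuf w)" using m z by simp
      moreover have "z @ minsuf w < minsuf w" using less calculation
        by (metis append_less_append_iff)
      moreover have "minsuf w \<le> z @ minsuf w"
        by (rule minsuf_le[of w y]) (use calculation m xy in auto)
      ultimately show False by order
    next
      assume "\<forall>a b. y @ a < minpre w @ b"
      hence "y @ minsuf w < minpre w @ minsuf w" by blast
      with less m show False by (metis order.asym)
    qed
  qed
qed

lemma minpre_less_minsuf:
  assumes "2 \<le> length w" "lyndon w"
  shows "minpre w < minsuf w"
proof -
  note m = minpre_append_minsuf[OF assms(1)]
  have "minpre w \<le> w" using m by (metis le_append_self)
  also have "w < minsuf w" using assms m lyndonD[of "minpre w" "minsuf w"] by simp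
  finally show ?thesis .
qed

text \<open>
  For a word \<open>u\<close> of length at least two the hypothesis says that \<open>v\<close> is at most every proper suffix of
  \<open>u\<close>. Hence no cut inside \<open>u\<close> gives a smaller suffix of \<open>u @ v\<close> than \<open>v\<close>.
\<close>

lemma minsuf_append:
  assumes "lyndon u" "lyndon v" and "length u = 1 \<or> v \<le> minsuf u"
  shows "minsuf (u @ v) = v" "minpre (u @ v) = u"
proof -
  show *: "minsuf (u @ v) = v"
  proof (rule minsuf_eqI[of _ u])
    fix x y assume xy: "u @ v = x @ y" "x \<noteq> []" "y \<noteq> []"
    from xy(1) consider z where "u = x @ z" "y = z @ v" | z where "x = u @ z" "v = z @ y"
      by (auto simp: append_eq_append_conv2)
    thus "v \<le> y"
    proof cases
      case 1
      show ?thesis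
      proof (cases "z = []")
        case True thus ?thesis using 1 by simp
      next
        case False
        hence "length u \<noteq> 1" using 1 xy by (cases x; cases z) auto
        hence "v \<le> minsuf u" using assms by blast
        also have "minsuf u \<le> z" using minsuf_le[of u x z] 1 xy False by blast
        also have "z \<le> y" using 1 by simp
        finally show ?thesis .
      qed
    next
      case 2
      show ?thesis
      proof (cases "z = []")
        case True thus ?thesis using 2 by simp
      next
        case False
        thus ?thesis using lyndonD[of z y] assms 2 xy by auto
      qed
    qed
  qed (use assms in auto)
  show "minpre (u @ v) = u" by (simp add: minpre_def *)
qed

text \<open>The bracketing of a Lyndon word along its iterated standard factorisation.\<close>

function lyndon_bracket :: "nat list \<Rightarrow> free_magma" where
  "lyndon_bracket w = (if length w < 2 then Gen (hd w)
     else Prod (lyndon_bracket (minpre w)) (lyndon_bracket (minsuf w)))"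
  by auto
termination
  by (relation "measure length") (auto simp: minpre_minsuf_length)

declare lyndon_bracket.simps [simp del]

text \<open>The word that remains of a bracketing when the brackets are erased.\<close>

primrec foliage :: "free_magma \<Rightarrow> nat list" where
  "foliage (Gen i) = [i]"
| "foliage (Prod s t) = foliage s @ foliage t"

lemma foliage_not_Nil [simp]: "foliage t \<noteq> []" by (induction t) auto

lemma set_foliage [simp]: "set (foliage t) = gens t" by (induction t) auto

lemma lyndon_bracket_single [simp]: "lyndon_bracket [a] = Gen a"
  by (simp add: lyndon_bracket.simps)

lemma lyndon_bracket_step:
  "2 \<le> length w \<Longrightarrow> lyndon_bracket w = Prod (lyndon_bracket (minpre w)) (lyndon_bracket (minsuf w))"
  by (subst lyndon_bracket.simps) auto

lemma lyndon_bracket_append: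
  assumes "lyndon u" "lyndon v" and "length u = 1 \<or> v \<le> minsuf u"
  shows "lyndon_bracket (u @ v) = Prod (lyndon_bracket u) (lyndon_bracket v)"
proof -
  have "2 \<le> length (u @ v)" 
    using lyndon_not_Nil[OF assms(1)] lyndon_not_Nil[OF assms(2)] by (cases u; cases v) auto
  from lyndon_bracket_step[OF this] show ?thesis using minsuf_append[OF assms] by simp
qed

lemma lyndon_length_cases:
  assumes "lyndon w"
  obtains a where "w = [a]" | "2 \<le> length w"
proof -
  have "length w \<noteq> 0" using assms by auto
  thus thesis using that by (cases w; cases "tl w") auto
qed

text \<open>Induction along the standard factorisation, which also determines the bracketing.\<close>

lemma lyndon_induct [consumes 1, case_names single append]:
  assumes "lyndon w" and "\<And>a. P [a]"
    and "\<And>u v. lyndon u \<Longrightarrow> lyndon v \<Longrightarrow> u < v \<Longrightarrow> lyndon (u @ v) \<Longrightarrow>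
       lyndon_bracket (u @ v) = Prod (lyndon_bracket u) (lyndon_bracket v) \<Longrightarrow> P u \<Longrightarrow> P v \<Longrightarrow> P (u @ v)"
  shows "P w"
  using assms(1)
proof (induction "length w" arbitrary: w rule: less_induct)
  case less
  show ?case using less.prems
  proof (cases rule: lyndon_length_cases)
    case 1 thus ?thesis using assms(2) by simp
  next
    case 2
    note f = minpre_append_minsuf[OF 2] lyndon_minsuf[OF 2] lyndon_minpre[OF 2 less.prems]
      minpre_less_minsuf[OF 2 less.prems] minpre_minsuf_length[OF 2]
    have "P (minpre w @ minsuf w)"
      using f lyndon_bracket_step[OF 2] less by (intro assms(3) less) auto
    thus ?thesis using f by simp
  qed
qed

lemma foliage_lyndon_bracket: "lyndon w \<Longrightarrow> foliage (lyndon_bracket w) = w"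
  by (induction rule: lyndon_induct) auto

lemma gens_lyndon_bracket: "lyndon w \<Longrightarrow> gens (lyndon_bracket w) = set w"
  using foliage_lyndon_bracket[of w] set_foliage[of "lyndon_bracket w"] by simp

section \<open>Lyndon brackets span a Lie ring\<close>

primrec magma_eval :: "('r, 'a) module \<Rightarrow> (nat \<Rightarrow> 'a) \<Rightarrow> free_magma \<Rightarrow> 'a" where
  "magma_eval L f (Gen i) = f i"
| "magma_eval L f (Prod s t) = magma_eval L f s \<otimes>\<^bsub>L\<^esub> magma_eval L f t"

context nonassoc_algebra
begin

lemma magma_eval_closed:
  "(\<And>i. i \<in> gens t \<Longrightarrow> f i \<in> carrier L) \<Longrightarrow> magma_eval L f t \<in> carrier L"
  by (induction t) (auto simp: prod_closed)

lemma prod_zero_right: "x \<in> carrier L \<Longrightarrow> x \<otimes>\<^bsub>L\<^esub> \<zero>\<^bsub>L\<^esub> = \<zero>\<^bsub>L\<^esub>"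
  using prod_add_right[of x "\<zero>\<^bsub>L\<^esub>" "\<zero>\<^bsub>L\<^esub>"] prod_closed[of x "\<zero>\<^bsub>L\<^esub>"] by simp

lemma prod_minus_right:
  assumes "x \<in> carrier L" "y \<in> carrier L"
  shows "x \<otimes>\<^bsub>L\<^esub> (\<ominus>\<^bsub>L\<^esub> y) = \<ominus>\<^bsub>L\<^esub> (x \<otimes>\<^bsub>L\<^esub> y)"
proof -
  have "x \<otimes>\<^bsub>L\<^esub> (\<ominus>\<^bsub>L\<^esub> y) \<oplus>\<^bsub>L\<^esub> x \<otimes>\<^bsub>L\<^esub> y = \<zero>\<^bsub>L\<^esub>"
    using prod_add_right[of x "\<ominus>\<^bsub>L\<^esub> y" y] assms prod_zero_right by (simp add: M.l_neg)
  from M.minus_equality[OF this] show ?thesis using assms prod_closed by simp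
qed

lemma prod_minus_left:
  assumes "x \<in> carrier L" "y \<in> carrier L"
  shows "(\<ominus>\<^bsub>L\<^esub> x) \<otimes>\<^bsub>L\<^esub> y = \<ominus>\<^bsub>L\<^esub> (x \<otimes>\<^bsub>L\<^esub> y)"
proof -
  have "(\<ominus>\<^bsub>L\<^esub> x) \<otimes>\<^bsub>L\<^esub> y \<oplus>\<^bsub>L\<^esub> x \<otimes>\<^bsub>L\<^esub> y = \<zero>\<^bsub>L\<^esub>"
    using prod_add_left[of "\<ominus>\<^bsub>L\<^esub> x" x y] assms prod_zero_left by (simp add: M.l_neg)
  from M.minus_equality[OF this] show ?thesis using assms prod_closed by simp
qed

lemma generate_add_minus:
  assumes "x \<in> generate (add_monoid L) S" "S \<subseteq> carrier L"
  shows "\<ominus>\<^bsub>L\<^esub> x \<in> generate (add_monoid L) S"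
  using add.generate_m_inv_closed[of S x] assms by (simp add: a_inv_def)

lemma generate_add_in_carrier:
  "S \<subseteq> carrier L \<Longrightarrow> x \<in> generate (add_monoid L) S \<Longrightarrow> x \<in> carrier L"
  using add.generate_in_carrier[of S x] by simp

lemma prod_generate_right:
  assumes T: "subgroup T (add_monoid L)" and S: "S \<subseteq> carrier L" and x: "x \<in> carrier L"
    and xs: "\<And>s. s \<in> S \<Longrightarrow> x \<otimes>\<^bsub>L\<^esub> s \<in> T" and z: "z \<in> generate (add_monoid L) S"
  shows "x \<otimes>\<^bsub>L\<^esub> z \<in> T"
  using z
proof (induction rule: generate.induct)
  case one
  show ?case using subgroup.one_closed[OF T] x by (simp add: prod_zero_right)
next
  case (incl h)
  thus ?case by (rule xs)
next
  case (inv h)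
  hence "h \<in> carrier L" using S by auto
  thus ?case using subgroup.m_inv_closed[OF T xs[OF inv]] x
    by (simp add: a_inv_def[symmetric] prod_minus_right)
next
  case (eng a b)
  hence "a \<in> carrier L" "b \<in> carrier L" using generate_add_in_carrier[OF S] by auto
  thus ?case using subgroup.m_closed[OF T eng.IH] x by (simp add: prod_add_right)
qed

lemma prod_generate_left:
  assumes T: "subgroup T (add_monoid L)" and S: "S \<subseteq> carrier L" and x: "x \<in> carrier L"
    and xs: "\<And>s. s \<in> S \<Longrightarrow> s \<otimes>\<^bsub>L\<^esub> x \<in> T" and z: "z \<in> generate (add_monoid L) S"
  shows "z \<otimes>\<^bsub>L\<^esub> x \<in> T"
  using z
proof (induction rule: generate.induct)
  case one
  show ?case using subgroup.one_closed[OF T] x by (simp add: prod_zero_left)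
next
  case (incl h)
  thus ?case by (rule xs)
next
  case (inv h)
  hence "h \<in> carrier L" using S by auto
  thus ?case using subgroup.m_inv_closed[OF T xs[OF inv]] x
    by (simp add: a_inv_def[symmetric] prod_minus_left)
next
  case (eng a b)
  hence "a \<in> carrier L" "b \<in> carrier L" using generate_add_in_carrier[OF S] by auto
  thus ?case using subgroup.m_closed[OF T eng.IH] x by (simp add: prod_add_left)
qed

end

context lie_algebra
begin

lemma jacobi_left:
  assumes "x \<in> carrier L" "y \<in> carrier L" "z \<in> carrier L"
  shows "(x \<otimes>\<^bsub>L\<^esub> y) \<otimes>\<^bsub>L\<^esub> z = x \<otimes>\<^bsub>L\<^esub> (y \<otimes>\<^bsub>L\<^esub> z) \<oplus>\<^bsub>L\<^esub> y \<otimes>\<^bsub>L\<^esub> (z \<otimes>\<^bsub>L\<^esub> x)"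
proof -
  have "(x \<otimes>\<^bsub>L\<^esub> y) \<otimes>\<^bsub>L\<^esub> z = \<ominus>\<^bsub>L\<^esub> (z \<otimes>\<^bsub>L\<^esub> (x \<otimes>\<^bsub>L\<^esub> y))"
    using assms by (intro bracket_anti prod_closed)
  also have "\<dots> = x \<otimes>\<^bsub>L\<^esub> (y \<otimes>\<^bsub>L\<^esub> z) \<oplus>\<^bsub>L\<^esub> y \<otimes>\<^bsub>L\<^esub> (z \<otimes>\<^bsub>L\<^esub> x)"
    using jacobi[OF assms] assms by (intro M.minus_equality) (auto simp: prod_closed)
  finally show ?thesis .
qed

text \<open>
  The condition \<open>Q\<close> on the words serves to bound them in the induction of \<open>bracket_lyndon_span\<close>.
\<close>

definition lyndon_elems :: "(nat \<Rightarrow> 'c) \<Rightarrow> nat set \<Rightarrow> nat \<Rightarrow> (nat list \<Rightarrow> bool) \<Rightarrow> 'c set" where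
  "lyndon_elems f X n Q =
     {magma_eval L f (lyndon_bracket w) | w. lyndon w \<and> length w = n \<and> set w \<subseteq> X \<and> Q w}"

lemma lyndon_elems_subset:
  assumes "\<And>i. i \<in> X \<Longrightarrow> f i \<in> carrier L"
  shows "lyndon_elems f X n Q \<subseteq> carrier L"
  unfolding lyndon_elems_def using assms
  by (auto intro!: magma_eval_closed simp: gens_lyndon_bracket)

lemma lyndon_elems_generate_mono:
  "(\<And>w. Q w \<Longrightarrow> Q' w) \<Longrightarrow>
    generate (add_monoid L) (lyndon_elems f X n Q) \<subseteq> generate (add_monoid L) (lyndon_elems f X n Q')"
  by (intro add.mono_generate) (auto simp: lyndon_elems_def)

text \<open>
  The rewriting procedure of Shirshov and Lyndon. If \<open>u\<close> and \<open>v\<close> are the standard factors of \<open>u @ v\<close>, then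
  the bracket is the Lyndon bracket of \<open>u @ v\<close>, which is less than \<open>v\<close>. Otherwise \<open>u = u1 @ u2\<close> with
  \<open>u1 < u2 < v\<close>, and the Jacobi identity gives
  \<open>[[u1, u2], v] = [u1, [u2, v]] + [u2, [v, u1]]\<close>. The inner brackets have smaller total length, hence
  are combinations of Lyndon words less than \<open>v\<close>. The outer brackets then have the same total length
  as before, but both of their arguments are less than \<open>v\<close>. So the induction is on the total length and,
  for fixed length, on the larger argument; this is why the conclusion has to include the bound by \<open>v\<close>.
\<close>

lemma bracket_lyndon_span:
  assumes f: "\<And>i. i \<in> X \<Longrightarrow> f i \<in> carrier L" and X: "finite X"
    and "lyndon u" "lyndon v" "u < v" "set u \<subseteq> X" "set v \<subseteq> X"
  shows "magma_eval L f (lyndon_bracket u) \<otimes>\<^bsub>L\<^esub> magma_eval L f (lyndon_bracket v)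
    \<in> generate (add_monoid L) (lyndon_elems f X (length u + length v) (\<lambda>w. w < v))"
  using assms(3-)
proof (induction "length u + length v" arbitrary: u v rule: less_induct)
  case (less u0 v0)
  note IH = less.hyps
  define n where "n = length u0 + length v0"
  let ?b = "\<lambda>w. magma_eval L f (lyndon_bracket w)"
  let ?G = "\<lambda>n v. generate (add_monoid L) (lyndon_elems f X n (\<lambda>w. w < v))"
  let ?ok = "\<lambda>w. lyndon w \<and> set w \<subseteq> X"
  \<comment> \<open>Only words of length at most \<open>n\<close> over the finite alphabet occur, so that descending in the
    larger argument terminates; \<open>?m\<close> counts the words that are still available below it.\<close>
  let ?m = "\<lambda>v. card {w. set w \<subseteq> X \<and> length w \<le> n \<and> w < v}"
  have bc: "?b w \<in> carrier L" if "?ok w" for w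
    using that f by (intro magma_eval_closed) (auto simp: gens_lyndon_bracket)
  have sub: "lyndon_elems f X k Q \<subseteq> carrier L" for k Q by (rule lyndon_elems_subset[OF f])
  have sg: "subgroup (?G k v) (add_monoid L)" for k v
    using add.generate_is_subgroup sub by simp
  have "?b u \<otimes>\<^bsub>L\<^esub> ?b v \<in> ?G n v" if "?ok u" "?ok v" "u < v" "length u + length v = n" for u v
    using that
  proof (induction "?m v" arbitrary: u v rule: less_induct)
    case (less v u)
    \<comment> \<open>The brackets of the given total length with both arguments less than \<open>v\<close>.\<close>
    have cross: "?b a \<otimes>\<^bsub>L\<^esub> ?b w \<in> ?G n v"
      if a: "?ok a" "a < v" and w: "?ok w" "w < v" and l: "length a + length w = n" for a w
    proof -
      have m: "?m x < ?m v" if "?ok x" "x < v" "length x \<le> n" for x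
      proof (rule psubset_card_mono)
        show "finite {w. set w \<subseteq> X \<and> length w \<le> n \<and> w < v}"
          by (rule finite_subset[OF _ finite_lists_length_le[OF X, of n]]) auto
        show "{w. set w \<subseteq> X \<and> length w \<le> n \<and> w < x} \<subset> {w. set w \<subseteq> X \<and> length w \<le> n \<and> w < v}"
        proof
          show "{w. set w \<subseteq> X \<and> length w \<le> n \<and> w < x} \<subseteq> {w. set w \<subseteq> X \<and> length w \<le> n \<and> w < v}"
            using that by auto
          have "x \<in> {w. set w \<subseteq> X \<and> length w \<le> n \<and> w < v}" using that by simp
          thus "{w. set w \<subseteq> X \<and> length w \<le> n \<and> w < x} \<noteq> {w. set w \<subseteq> X \<and> length w \<le> n \<and> w < v}"
            by blast
        qed
      qed
      consider "a = w" | "a < w" | "w < a" by (rule linorder_cases)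
      thus ?thesis
      proof cases
        case 1
        thus ?thesis using bracket_self bc a generate.one[of "add_monoid L"] by simp
      next
        case 2
        have "?b a \<otimes>\<^bsub>L\<^esub> ?b w \<in> ?G n w" using less.hyps[of w a] m[of w] a w l 2 by simp
        also have "\<dots> \<subseteq> ?G n v" using w by (intro lyndon_elems_generate_mono) auto
        finally show ?thesis .
      next
        case 3
        have "?b w \<otimes>\<^bsub>L\<^esub> ?b a \<in> ?G n a" using less.hyps[of a w] m[of a] a w l 3 by simp
        also have "\<dots> \<subseteq> ?G n v" using a by (intro lyndon_elems_generate_mono) auto
        finally show ?thesis
          using bracket_anti[of "?b a" "?b w"] bc a w generate_add_minus[OF _ sub] by simp
      qed
    qed
    show ?case
    proof (cases "length u = 1 \<or> v \<le> minsuf u")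
      case True
      hence "?b (u @ v) = ?b u \<otimes>\<^bsub>L\<^esub> ?b v" using lyndon_bracket_append less.prems by simp
      moreover have "?b (u @ v) \<in> lyndon_elems f X n (\<lambda>w. w < v)"
        unfolding lyndon_elems_def
      proof (intro CollectI exI[of _ "u @ v"] conjI refl)
        show "lyndon (u @ v)" using less.prems by (intro lyndon_append) auto
        show "u @ v < v" using less.prems by (intro append_less_right) auto
      qed (use less.prems in auto)
      ultimately show ?thesis using generate.incl by fastforce
    next
      case False
      have "u \<noteq> []" using less.prems by auto
      hence l2: "2 \<le> length u" using False by (cases u; cases "tl u") auto
      define u1 u2 where "u1 = minpre u" and "u2 = minsuf u"
      have u: "u1 @ u2 = u" "lyndon u1" "lyndon u2" "u1 < u2" "length u1 < length u" "length u2 < length u"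
        using minpre_append_minsuf[OF l2] lyndon_minsuf[OF l2] lyndon_minpre[OF l2]
          minpre_less_minsuf[OF l2] minpre_minsuf_length[OF l2] less.prems by (auto simp: u1_def u2_def)
      have ok: "?ok u1" "?ok u2" "?ok v" using u less.prems by auto
      have lt: "u2 < v" "u1 < v" using False u by (auto simp: u2_def)
      have lu: "length u = length u1 + length u2" using u(1) by auto
      have bu: "?b u = ?b u1 \<otimes>\<^bsub>L\<^esub> ?b u2" using lyndon_bracket_step[OF l2] by (simp add: u1_def u2_def)
      have smaller: "?b x \<otimes>\<^bsub>L\<^esub> ?b v \<in> ?G (length x + length v) v"
        if "?ok x" "x < v" "length x < length u" for x
        using IH[of x v] that less.prems n_def by simp
      have "?b u1 \<otimes>\<^bsub>L\<^esub> (?b u2 \<otimes>\<^bsub>L\<^esub> ?b v) \<in> ?G n v"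
      proof (rule prod_generate_right[OF sg sub])
        show "?b u2 \<otimes>\<^bsub>L\<^esub> ?b v \<in> ?G (length u2 + length v) v"
          using smaller[of u2] ok lt u by blast
        fix s assume "s \<in> lyndon_elems f X (length u2 + length v) (\<lambda>w. w < v)"
        then obtain w where w: "s = ?b w" "?ok w" "length w = length u2 + length v" "w < v"
          unfolding lyndon_elems_def by blast
        show "?b u1 \<otimes>\<^bsub>L\<^esub> s \<in> ?G n v"
          unfolding w(1) by (rule cross) (use ok lt lu less.prems(4) w in auto)
      qed (use bc ok in auto)
      moreover have "?b u2 \<otimes>\<^bsub>L\<^esub> (?b v \<otimes>\<^bsub>L\<^esub> ?b u1) \<in> ?G n v"
      proof (rule prod_generate_right[OF sg sub])
        show "?b v \<otimes>\<^bsub>L\<^esub> ?b u1 \<in> ?G (length u1 + length v) v"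
          using generate_add_minus[OF smaller[of u1] sub] ok lt u bracket_anti[of "?b v" "?b u1"] bc by simp
        fix s assume "s \<in> lyndon_elems f X (length u1 + length v) (\<lambda>w. w < v)"
        then obtain w where w: "s = ?b w" "?ok w" "length w = length u1 + length v" "w < v"
          unfolding lyndon_elems_def by blast
        show "?b u2 \<otimes>\<^bsub>L\<^esub> s \<in> ?G n v"
          unfolding w(1) by (rule cross) (use ok lt lu less.prems(4) w in auto)
      qed (use bc ok in auto)
      ultimately have "?b u1 \<otimes>\<^bsub>L\<^esub> (?b u2 \<otimes>\<^bsub>L\<^esub> ?b v) \<oplus>\<^bsub>L\<^esub> ?b u2 \<otimes>\<^bsub>L\<^esub> (?b v \<otimes>\<^bsub>L\<^esub> ?b u1) \<in> ?G n v"
        using subgroup.m_closed[OF sg] by simp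
      thus ?thesis unfolding bu using jacobi_left[of "?b u1" "?b u2" "?b v"] bc ok by simp
    qed
  qed
  from this[of u0 v0] show ?case using less.prems n_def by simp
qed

text \<open>
  Expand both factors of a product by bilinearity, and rewrite each bracket of two Lyndon brackets with
  \<open>bracket_lyndon_span\<close> after putting its arguments in increasing order.
\<close>

lemma magma_eval_lyndon_span:
  assumes f: "\<And>i. i \<in> X \<Longrightarrow> f i \<in> carrier L" and X: "finite X" and "gens t \<subseteq> X"
  shows "magma_eval L f t
    \<in> generate (add_monoid L) (lyndon_elems f X (length (foliage t)) (\<lambda>w. True))"
  using assms(3)
proof (induction t)
  case (Gen i)
  hence "magma_eval L f (Gen i) \<in> lyndon_elems f X 1 (\<lambda>w. True)"
    unfolding lyndon_elems_def by (intro CollectI exI[of _ "[i]"]) auto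
  thus ?case using generate.incl by fastforce
next
  case (Prod s t)
  let ?E = "\<lambda>n. lyndon_elems f X n (\<lambda>w. True)"
  let ?n = "length (foliage s) + length (foliage t)"
  let ?b = "\<lambda>w. magma_eval L f (lyndon_bracket w)"
  have sub: "lyndon_elems f X k Q \<subseteq> carrier L" for k Q by (rule lyndon_elems_subset[OF f])
  have sg: "subgroup (generate (add_monoid L) (?E n)) (add_monoid L)" for n
    using add.generate_is_subgroup sub by simp
  have bc: "?b w \<in> carrier L" if "lyndon w" "set w \<subseteq> X" for w
    using that f by (intro magma_eval_closed) (auto simp: gens_lyndon_bracket)
  have mon: "generate (add_monoid L) (lyndon_elems f X n Q) \<subseteq> generate (add_monoid L) (?E n)" for n Q
    by (rule lyndon_elems_generate_mono) simp
  have key: "?b u \<otimes>\<^bsub>L\<^esub> ?b v \<in> generate (add_monoid L) (?E (length u + length v))"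
    if "lyndon u" "set u \<subseteq> X" "lyndon v" "set v \<subseteq> X" for u v
  proof (cases u v rule: linorder_cases)
    case less
    show ?thesis by (rule subsetD[OF mon bracket_lyndon_span]) (use less that X f in auto)
  next
    case equal
    thus ?thesis using bracket_self bc that generate.one[of "add_monoid L"] by simp
  next
    case greater
    have "?b v \<otimes>\<^bsub>L\<^esub> ?b u \<in> generate (add_monoid L) (?E (length v + length u))"
      by (rule subsetD[OF mon bracket_lyndon_span]) (use greater that X f in auto)
    thus ?thesis
      using bracket_anti[of "?b u" "?b v"] bc that generate_add_minus[OF _ sub] by (simp add: add.commute)
  qed
  have ec: "magma_eval L f s \<in> carrier L" "magma_eval L f t \<in> carrier L"
    using Prod.prems f by (auto intro!: magma_eval_closed)
  have "magma_eval L f s \<otimes>\<^bsub>L\<^esub> magma_eval L f t \<in> generate (add_monoid L) (?E ?n)"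
  proof (rule prod_generate_left[OF sg sub ec(2)])
    show "magma_eval L f s \<in> generate (add_monoid L) (?E (length (foliage s)))"
      using Prod by simp
    fix a assume "a \<in> ?E (length (foliage s))"
    then obtain u where u: "a = ?b u" "lyndon u" "length u = length (foliage s)" "set u \<subseteq> X"
      unfolding lyndon_elems_def by blast
    show "a \<otimes>\<^bsub>L\<^esub> magma_eval L f t \<in> generate (add_monoid L) (?E ?n)"
    proof (rule prod_generate_right[OF sg sub])
      show "magma_eval L f t \<in> generate (add_monoid L) (?E (length (foliage t)))"
        using Prod by simp
      fix b assume "b \<in> ?E (length (foliage t))"
      then obtain v where v: "b = ?b v" "lyndon v" "length v = length (foliage t)" "set v \<subseteq> X"
        unfolding lyndon_elems_def by blast
      show "a \<otimes>\<^bsub>L\<^esub> b \<in> generate (add_monoid L) (?E ?n)" using key[of u v] u v by simp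
    qed (use u bc in auto)
  qed
  thus ?case by simp
qed

lemma lower_central_subset: "lower_central L i \<subseteq> carrier L"
  using lower_central_ideal[of i] submoduleE(1) by (auto simp: two_sided_ideal_def)

lemma lower_central_subgroup: "subgroup (lower_central L i) (add_monoid L)"
  using lower_central_ideal[of i] by (auto simp: two_sided_ideal_def submodule_def)

lemma lower_central_step:
  "x \<in> carrier L \<Longrightarrow> y \<in> lower_central L (Suc i) \<Longrightarrow> x \<otimes>\<^bsub>L\<^esub> y \<in> lower_central L (Suc (Suc i))"
  by (auto intro: generate.incl)

text \<open>
  By the Jacobi identity, \<open>[[a, b], y] = [a, [b, y]] + [b, [y, a]]\<close>, and in both terms the left factor
  has a smaller depth than \<open>[a, b]\<close>.
\<close>

lemma lower_central_bracket:
  assumes "x \<in> lower_central L (Suc i)" "y \<in> lower_central L (Suc j)"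
  shows "x \<otimes>\<^bsub>L\<^esub> y \<in> lower_central L (Suc (Suc (i + j)))"
  using assms
proof (induction i arbitrary: j x y)
  case 0
  thus ?case using lower_central_step by simp
next
  case (Suc i)
  let ?G = "{a \<otimes>\<^bsub>L\<^esub> b | a b. a \<in> carrier L \<and> b \<in> lower_central L (Suc i)}"
  have y: "y \<in> carrier L" using Suc.prems lower_central_subset by blast
  have G: "?G \<subseteq> carrier L" using lower_central_subset prod_closed by blast
  show ?case
  proof (rule prod_generate_left[OF lower_central_subgroup G y])
    show "x \<in> generate (add_monoid L) ?G" using Suc.prems by simp
    fix s assume "s \<in> ?G"
    then obtain a b where ab: "s = a \<otimes>\<^bsub>L\<^esub> b" "a \<in> carrier L" "b \<in> lower_central L (Suc i)" by auto
    have b: "b \<in> carrier L" using ab lower_central_subset by blast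
    have 1: "a \<otimes>\<^bsub>L\<^esub> (b \<otimes>\<^bsub>L\<^esub> y) \<in> lower_central L (Suc (Suc (Suc i + j)))"
      using lower_central_step[OF ab(2) Suc.IH[OF ab(3) Suc.prems(2)]] by simp
    have "y \<otimes>\<^bsub>L\<^esub> a = \<ominus>\<^bsub>L\<^esub> (a \<otimes>\<^bsub>L\<^esub> y)" using ab y by (intro bracket_anti)
    hence "y \<otimes>\<^bsub>L\<^esub> a \<in> lower_central L (Suc (Suc j))"
      using subgroup.m_inv_closed[OF lower_central_subgroup lower_central_step[OF ab(2) Suc.prems(2)]]
      by (simp add: a_inv_def del: lower_central.simps)
    hence 2: "b \<otimes>\<^bsub>L\<^esub> (y \<otimes>\<^bsub>L\<^esub> a) \<in> lower_central L (Suc (Suc (Suc i + j)))"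
      using Suc.IH[OF ab(3)] by fastforce
    show "s \<otimes>\<^bsub>L\<^esub> y \<in> lower_central L (Suc (Suc (Suc i + j)))"
      using subgroup.m_closed[OF lower_central_subgroup 1 2] jacobi_left[OF ab(2) b y] ab(1)
      by (simp del: lower_central.simps)
  qed
qed

lemma magma_eval_lower_central:
  assumes "\<And>i. i \<in> gens t \<Longrightarrow> f i \<in> carrier L"
  shows "magma_eval L f t \<in> lower_central L (length (foliage t))"
  using assms
proof (induction t)
  case (Prod s t)
  obtain i j where ij: "length (foliage s) = Suc i" "length (foliage t) = Suc j"
    by (metis foliage_not_Nil length_0_conv not0_implies_Suc)
  show ?case using lower_central_bracket[of _ i _ j] Prod ij by (simp del: lower_central.simps)
qed auto

end

section \<open>Truncated noncommutative polynomials\<close>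

text \<open>
  Noncommutative polynomials are given by their coefficient functions on words. This is their product
  in the quotient by the words of length greater than \<open>c\<close>.
\<close>

definition conv :: "nat \<Rightarrow> (nat list \<Rightarrow> int) \<Rightarrow> (nat list \<Rightarrow> int) \<Rightarrow> nat list \<Rightarrow> int" where
  "conv c p q w = (if length w \<le> c then \<Sum>k\<le>length w. p (take k w) * q (drop k w) else 0)"

definition comm :: "nat \<Rightarrow> (nat list \<Rightarrow> int) \<Rightarrow> (nat list \<Rightarrow> int) \<Rightarrow> nat list \<Rightarrow> int" where
  "comm c p q = conv c p q - conv c q p"

definition iscale :: "int \<Rightarrow> ('b \<Rightarrow> int) \<Rightarrow> 'b \<Rightarrow> int" where
  "iscale k p = (\<lambda>w. k * p w)"

text \<open>
  Without constant terms the product raises the degree, so that this Lie ring is nilpotent of class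
  \<open>c\<close> at most.
\<close>

definition trunc_lie :: "nat \<Rightarrow> (int, nat list \<Rightarrow> int) module" where
  "trunc_lie c = \<lparr>carrier = {p. \<forall>w. p w \<noteq> 0 \<longrightarrow> w \<noteq> [] \<and> length w \<le> c},
     mult = comm c, one = 0, zero = 0, add = (+), smult = iscale\<rparr>"

lemma trunc_lie_simps [simp]:
  "carrier (trunc_lie c) = {p. \<forall>w. p w \<noteq> 0 \<longrightarrow> w \<noteq> [] \<and> length w \<le> c}"
  "x \<otimes>\<^bsub>trunc_lie c\<^esub> y = comm c x y" "\<zero>\<^bsub>trunc_lie c\<^esub> = 0"
  "x \<oplus>\<^bsub>trunc_lie c\<^esub> y = x + y" "k \<odot>\<^bsub>trunc_lie c\<^esub> x = iscale k x"
  by (simp_all add: trunc_lie_def)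

lemma iscale_apply [simp]: "iscale k p w = k * p w"
  by (simp add: iscale_def)

lemma sum_fun_apply: "sum f A x = (\<Sum>a\<in>A. f a x)" for f :: "'a \<Rightarrow> 'b \<Rightarrow> int"
  by (induction A rule: infinite_finite_induct) auto

lemma conv_add_left: "conv c (p + q) r = conv c p r + conv c q r"
  by (auto simp: conv_def fun_eq_iff distrib_right sum.distrib)

lemma conv_add_right: "conv c r (p + q) = conv c r p + conv c r q"
  by (auto simp: conv_def fun_eq_iff distrib_left sum.distrib)

lemma conv_diff_left: "conv c (p - q) r = conv c p r - conv c q r"
  by (auto simp: conv_def fun_eq_iff left_diff_distrib sum_subtractf)

lemma conv_diff_right: "conv c r (p - q) = conv c r p - conv c r q"
  by (auto simp: conv_def fun_eq_iff right_diff_distrib sum_subtractf)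

lemma conv_scale_left: "conv c (iscale k p) q = iscale k (conv c p q)"
  by (auto simp: conv_def fun_eq_iff sum_distrib_left mult_ac)

lemma conv_scale_right: "conv c p (iscale k q) = iscale k (conv c p q)"
  by (auto simp: conv_def fun_eq_iff sum_distrib_left mult_ac)

lemma conv_assoc: "conv c (conv c p q) r = conv c p (conv c q r)"
proof
  fix w :: "nat list"
  let ?n = "length w"
  show "conv c (conv c p q) r w = conv c p (conv c q r) w"
  proof (cases "?n \<le> c")
    case True
    \<comment> \<open>Both sides run over the factorisations of \<open>w\<close> into three words, cut after \<open>j\<close> and after \<open>k = j + i\<close>
      letters.\<close>
    have "conv c (conv c p q) r w
        = (\<Sum>k\<le>?n. \<Sum>j\<le>k. p (take j w) * q (drop j (take k w)) * r (drop k w))"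
      using True unfolding conv_def by (auto simp: sum_distrib_right min_def intro!: sum.cong)
    also have "\<dots> = (\<Sum>(k, j)\<in>Sigma {..?n} (\<lambda>k. {..k}). p (take j w) * q (drop j (take k w)) * r (drop k w))"
      by (simp add: sum.Sigma)
    also have "\<dots> = (\<Sum>(j, i)\<in>Sigma {..?n} (\<lambda>j. {..?n - j}).
        p (take j w) * (q (take i (drop j w)) * r (drop i (drop j w))))"
      by (rule sum.reindex_bij_witness[of _ "\<lambda>(j, i). (j + i, j)" "\<lambda>(k, j). (j, k - j)"])
        (auto simp: drop_take mult.assoc)
    also have "\<dots> = (\<Sum>j\<le>?n. \<Sum>i\<le>?n - j. p (take j w) * (q (take i (drop j w)) * r (drop i (drop j w))))"
      by (simp add: sum.Sigma)
    also have "\<dots> = conv c p (conv c q r) w"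
      using True unfolding conv_def by (auto simp: sum_distrib_left intro!: sum.cong)
    finally show ?thesis .
  qed (simp add: conv_def)
qed

lemma comm_add_left: "comm c (p + q) r = comm c p r + comm c q r"
  by (simp add: comm_def conv_add_left conv_add_right)

lemma comm_add_right: "comm c r (p + q) = comm c r p + comm c r q"
  by (simp add: comm_def conv_add_left conv_add_right)

lemma comm_scale_left: "comm c (iscale k p) q = iscale k (comm c p q)"
  by (simp add: comm_def conv_scale_left conv_scale_right fun_eq_iff algebra_simps)

lemma comm_scale_right: "comm c p (iscale k q) = iscale k (comm c p q)"
  by (simp add: comm_def conv_scale_left conv_scale_right fun_eq_iff algebra_simps)

lemma comm_zero_left [simp]: "comm c 0 q = 0"
  using comm_add_left[of c 0 0 q] by simp

lemma comm_zero_right [simp]: "comm c q 0 = 0"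
  using comm_add_right[of c q 0 0] by simp

lemma comm_minus_left: "comm c (- p) q = - comm c p q"
  using comm_add_left[of c "- p" p q] by (simp add: eq_neg_iff_add_eq_0)

lemma comm_minus_right: "comm c p (- q) = - comm c p q"
  using comm_add_right[of c p "- q" q] by (simp add: eq_neg_iff_add_eq_0)

lemma comm_diff_left: "comm c (p - q) r = comm c p r - comm c q r"
  using comm_add_left[of c p "- q" r] by (simp add: comm_minus_left)

lemma comm_diff_right: "comm c r (p - q) = comm c r p - comm c r q"
  using comm_add_right[of c r p "- q"] by (simp add: comm_minus_right)

lemma comm_sum_left: "comm c (sum f A) q = (\<Sum>a\<in>A. comm c (f a) q)"
proof (induction A rule: infinite_finite_induct)
  case (infinite A)
  show ?case by (simp only: sum.infinite[OF infinite] comm_zero_left)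
next
  case empty
  show ?case by (simp only: sum.empty comm_zero_left)
next
  case (insert x F)
  show ?case by (simp only: sum.insert[OF insert.hyps] comm_add_left insert.IH)
qed

lemma comm_sum_right: "comm c q (sum f A) = (\<Sum>a\<in>A. comm c q (f a))"
proof (induction A rule: infinite_finite_induct)
  case (infinite A)
  show ?case by (simp only: sum.infinite[OF infinite] comm_zero_right)
next
  case empty
  show ?case by (simp only: sum.empty comm_zero_right)
next
  case (insert x F)
  show ?case by (simp only: sum.insert[OF insert.hyps] comm_add_right insert.IH)
qed

lemma conv_nonzero:
  assumes "conv c p q w \<noteq> 0"
  obtains u v where "w = u @ v" "p u \<noteq> 0" "q v \<noteq> 0" "length w \<le> c"
proof -
  have l: "length w \<le> c" using assms by (auto simp: conv_def split: if_splits)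
  hence "(\<Sum>k\<le>length w. p (take k w) * q (drop k w)) \<noteq> 0" using assms by (simp add: conv_def)
  then obtain k where "p (take k w) * q (drop k w) \<noteq> 0" by (rule sum.not_neutral_contains_not_neutral)
  thus thesis using that[of "take k w" "drop k w"] l by auto
qed

lemma comm_nonzero:
  assumes "comm c p q w \<noteq> 0"
  obtains u v where "w = u @ v \<or> w = v @ u" "p u \<noteq> 0" "q v \<noteq> 0" "length w \<le> c"
proof -
  have "conv c p q w \<noteq> 0 \<or> conv c q p w \<noteq> 0" using assms by (auto simp: comm_def)
  thus thesis by (elim disjE conv_nonzero) (use that in blast)+
qed

lemma lie_algebra_trunc_lie: "lie_algebra \<Z> (trunc_lie c)"
proof -
  have ag: "abelian_group (trunc_lie c)"
  proof (rule abelian_groupI)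
    fix p assume "p \<in> carrier (trunc_lie c)"
    thus "\<exists>q\<in>carrier (trunc_lie c). q \<oplus>\<^bsub>trunc_lie c\<^esub> p = \<zero>\<^bsub>trunc_lie c\<^esub>"
      by (intro bexI[of _ "- p"]) auto
  qed (auto simp: add_ac, (metis add.right_neutral)+)
  have m: "Module.module \<Z> (trunc_lie c)"
    by (rule moduleI[OF int_is_cring ag]) (auto simp: fun_eq_iff algebra_simps)
  show ?thesis
  proof (intro lie_algebra.intro lie_algebra_axioms.intro nonassoc_algebra.intro
      nonassoc_algebra_axioms.intro m)
    fix x y assume "x \<in> carrier (trunc_lie c)" "y \<in> carrier (trunc_lie c)"
    thus "x \<otimes>\<^bsub>trunc_lie c\<^esub> y \<in> carrier (trunc_lie c)"
      by (auto elim!: comm_nonzero)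
  next
    fix x assume "x \<in> carrier (trunc_lie c)"
    show "x \<otimes>\<^bsub>trunc_lie c\<^esub> x = \<zero>\<^bsub>trunc_lie c\<^esub>" by (simp add: comm_def)
  next
    fix x y z
    have "comm c x (comm c y z) + comm c y (comm c z x) + comm c z (comm c x y) = 0"
      by (simp add: comm_def conv_diff_left conv_diff_right conv_assoc)
    thus "x \<otimes>\<^bsub>trunc_lie c\<^esub> (y \<otimes>\<^bsub>trunc_lie c\<^esub> z) \<oplus>\<^bsub>trunc_lie c\<^esub>
      y \<otimes>\<^bsub>trunc_lie c\<^esub> (z \<otimes>\<^bsub>trunc_lie c\<^esub> x) \<oplus>\<^bsub>trunc_lie c\<^esub>
      z \<otimes>\<^bsub>trunc_lie c\<^esub> (x \<otimes>\<^bsub>trunc_lie c\<^esub> y) = \<zero>\<^bsub>trunc_lie c\<^esub>" by simp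
  qed (auto simp: comm_add_left comm_add_right comm_scale_left comm_scale_right)
qed

abbreviation meval :: "nat \<Rightarrow> (nat \<Rightarrow> nat list \<Rightarrow> int) \<Rightarrow> free_magma \<Rightarrow> nat list \<Rightarrow> int" where
  "meval c \<equiv> magma_eval (trunc_lie c)"

lemma meval_carrier:
  "(\<And>j. j \<in> gens t \<Longrightarrow> y j \<in> carrier (trunc_lie c)) \<Longrightarrow> meval c y t \<in> carrier (trunc_lie c)"
  using nonassoc_algebra.magma_eval_closed[OF lie_algebra.axioms(1)[OF lie_algebra_trunc_lie]] by blast

section \<open>Evaluation homomorphisms on the free nonassociative algebra\<close>

definition single :: "free_magma \<Rightarrow> free_magma \<Rightarrow> int" where
  "single t = (\<lambda>s. if s = t then 1 else 0)"

lemma free_nonassoc_simps: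
  "carrier (free_nonassoc g) = {p. finite {w. p w \<noteq> 0} \<and> (\<forall>w. p w \<noteq> 0 \<longrightarrow> gens w \<subseteq> {..<g})}"
  "x \<oplus>\<^bsub>free_nonassoc g\<^esub> y = x + y" "\<zero>\<^bsub>free_nonassoc g\<^esub> = 0" "k \<odot>\<^bsub>free_nonassoc g\<^esub> x = iscale k x"
  by (auto simp: free_nonassoc_def fun_eq_iff)

lemma free_nonassoc_mult_Gen [simp]: "(p \<otimes>\<^bsub>free_nonassoc g\<^esub> q) (Gen i) = 0"
  and free_nonassoc_mult_Prod [simp]: "(p \<otimes>\<^bsub>free_nonassoc g\<^esub> q) (Prod u v) = p u * q v"
  by (simp_all add: free_nonassoc_def)

lemma single_carrier: "gens t \<subseteq> {..<g} \<Longrightarrow> single t \<in> carrier (free_nonassoc g)"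
  by (auto simp: free_nonassoc_simps single_def)

lemma single_Prod: "single s \<otimes>\<^bsub>free_nonassoc g\<^esub> single t = single (Prod s t)"
proof
  fix w show "(single s \<otimes>\<^bsub>free_nonassoc g\<^esub> single t) w = single (Prod s t) w"
    by (cases w) (auto simp: single_def)
qed

lemma free_nonassoc_induct [consumes 1, case_names zero add]:
  assumes "a \<in> carrier (free_nonassoc g)" and "P 0"
    and add: "\<And>a t k. a \<in> carrier (free_nonassoc g) \<Longrightarrow> gens t \<subseteq> {..<g} \<Longrightarrow> P a \<Longrightarrow> P (a + iscale k (single t))"
  shows "P a"
proof -
  have "finite S \<Longrightarrow> \<forall>a. a \<in> carrier (free_nonassoc g) \<longrightarrow> {t. a t \<noteq> 0} = S \<longrightarrow> P a" for S
  proof (induction S rule: finite_induct)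
    case empty
    have "P a" if "{t. a t \<noteq> 0} = {}" for a
    proof -
      have "a = 0" using that by (auto simp: fun_eq_iff)
      thus ?thesis using assms by simp
    qed
    thus ?case by blast
  next
    case (insert t S)
    show ?case
    proof (intro allI impI)
      fix a assume a: "a \<in> carrier (free_nonassoc g)" "{t. a t \<noteq> 0} = insert t S"
      have "a t \<noteq> 0" using a(2) by blast
      hence t: "gens t \<subseteq> {..<g}" using a by (simp add: free_nonassoc_simps)
      define b where "b = a(t := 0)"
      have s: "{t. b t \<noteq> 0} = S" using a(2) insert.hyps by (auto simp: b_def)
      hence b: "b \<in> carrier (free_nonassoc g)" using a insert.hyps
        by (auto simp: free_nonassoc_simps b_def)
      have e: "a = b + iscale (a t) (single t)" by (auto simp: b_def single_def fun_eq_iff)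
      have "P b" using insert.IH b s by blast
      from add[OF b t this, of "a t"] e show "P a" by simp
    qed
  qed
  moreover have "finite {t. a t \<noteq> 0}" using assms(1) by (simp add: free_nonassoc_simps)
  ultimately show ?thesis using assms(1) by blast
qed

text \<open>
  The homomorphism from the free nonassociative algebra that sends the generator \<open>j\<close> to \<open>y j\<close>.
\<close>

definition evalp :: "nat \<Rightarrow> (nat \<Rightarrow> nat list \<Rightarrow> int) \<Rightarrow> (free_magma \<Rightarrow> int) \<Rightarrow> nat list \<Rightarrow> int" where
  "evalp c y a = (\<Sum>t\<in>{t. a t \<noteq> 0}. iscale (a t) (meval c y t))"

lemma iscale_0 [simp]: "iscale 0 p = 0" "iscale k 0 = 0"
  and iscale_1 [simp]: "iscale 1 p = p"
  by (auto simp: fun_eq_iff)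

lemma iscale_add_left: "iscale (k + l) p = iscale k p + iscale l p"
  and iscale_add_right: "iscale k (p + q) = iscale k p + iscale k q"
  and iscale_diff_right: "iscale k (p - q) = iscale k p - iscale k q"
  and iscale_iscale: "iscale k (iscale l p) = iscale (k * l) p"
  by (auto simp: fun_eq_iff algebra_simps)

lemma iscale_sum: "iscale k (sum f A) = (\<Sum>a\<in>A. iscale k (f a))"
proof (induction A rule: infinite_finite_induct)
  case (infinite A)
  show ?case by (simp only: sum.infinite[OF infinite] iscale_0)
next
  case empty
  show ?case by (simp only: sum.empty iscale_0)
next
  case (insert x F)
  show ?case by (simp only: sum.insert[OF insert.hyps] iscale_add_right insert.IH)
qed

lemma evalp_superset:
  assumes "finite S" "{t. a t \<noteq> 0} \<subseteq> S"
  shows "evalp c y a = (\<Sum>t\<in>S. iscale (a t) (meval c y t))"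
  unfolding evalp_def using assms by (intro sum.mono_neutral_left) auto

lemma evalp_add:
  assumes "a \<in> carrier (free_nonassoc g)" "b \<in> carrier (free_nonassoc g)"
  shows "evalp c y (a + b) = evalp c y a + evalp c y b"
proof -
  let ?S = "{t. a t \<noteq> 0} \<union> {t. b t \<noteq> 0}"
  have "finite ?S" using assms by (simp add: free_nonassoc_simps)
  moreover have "{t. (a + b) t \<noteq> 0} \<subseteq> ?S" by auto
  ultimately show ?thesis
    using evalp_superset[of ?S "a + b"] evalp_superset[of ?S a] evalp_superset[of ?S b]
    by (simp add: sum.distrib[symmetric] iscale_add_left)
qed

lemma evalp_scale:
  assumes "a \<in> carrier (free_nonassoc g)"
  shows "evalp c y (iscale k a) = iscale k (evalp c y a)"
  using assms evalp_superset[of "{t. a t \<noteq> 0}" "iscale k a"] evalp_superset[of "{t. a t \<noteq> 0}" a]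
  by (auto simp: free_nonassoc_simps iscale_sum iscale_iscale)

lemma evalp_zero [simp]: "evalp c y 0 = 0"
  by (simp add: evalp_def)

lemma evalp_single [simp]: "evalp c y (single t) = meval c y t"
  using evalp_superset[of "{t}" "single t"] by (auto simp: single_def)

lemma free_nonassoc_closed:
  assumes "a \<in> carrier (free_nonassoc g)" "b \<in> carrier (free_nonassoc g)"
  shows "a + b \<in> carrier (free_nonassoc g)" "a - b \<in> carrier (free_nonassoc g)"
    "iscale k a \<in> carrier (free_nonassoc g)" "a \<otimes>\<^bsub>free_nonassoc g\<^esub> b \<in> carrier (free_nonassoc g)"
proof -
  interpret nonassoc_algebra \<Z> "free_nonassoc g" by (rule nonassoc_algebra_free_nonassoc)
  show "a + b \<in> carrier (free_nonassoc g)" using M.a_closed[OF assms] by (simp add: free_nonassoc_simps(2))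
  have k: "iscale k a \<in> carrier (free_nonassoc g)"
    if "a \<in> carrier (free_nonassoc g)" for k a
    using smult_closed[of k a] that by (simp add: free_nonassoc_simps(4))
  thus "iscale k a \<in> carrier (free_nonassoc g)" using assms by blast
  show "a \<otimes>\<^bsub>free_nonassoc g\<^esub> b \<in> carrier (free_nonassoc g)" using prod_closed[OF assms] .
  have e: "a - b = a + iscale (- 1) b" by (auto simp: fun_eq_iff)
  show "a - b \<in> carrier (free_nonassoc g)"
    unfolding e using M.a_closed[OF assms(1) k[OF assms(2), of "- 1"]]
    by (simp only: free_nonassoc_simps(2))
qed

lemma evalp_diff:
  assumes "a \<in> carrier (free_nonassoc g)" "b \<in> carrier (free_nonassoc g)"
  shows "evalp c y (a - b) = evalp c y a - evalp c y b"
  using evalp_add[OF free_nonassoc_closed(2)[OF assms] assms(2), of c y] by (simp add: algebra_simps)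

lemma evalp_mult:
  assumes "a \<in> carrier (free_nonassoc g)" "b \<in> carrier (free_nonassoc g)"
  shows "evalp c y (a \<otimes>\<^bsub>free_nonassoc g\<^esub> b) = comm c (evalp c y a) (evalp c y b)"
proof -
  let ?A = "{t. a t \<noteq> 0}" and ?B = "{t. b t \<noteq> 0}"
  let ?p = "\<lambda>(u, v). Prod u v"
  have f: "finite ?A" "finite ?B" using assms by (auto simp: free_nonassoc_simps)
  have "{t. (a \<otimes>\<^bsub>free_nonassoc g\<^esub> b) t \<noteq> 0} \<subseteq> ?p ` (?A \<times> ?B)"
  proof
    fix t assume "t \<in> {t. (a \<otimes>\<^bsub>free_nonassoc g\<^esub> b) t \<noteq> 0}"
    thus "t \<in> ?p ` (?A \<times> ?B)" by (cases t) (auto simp: image_iff)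
  qed
  hence "evalp c y (a \<otimes>\<^bsub>free_nonassoc g\<^esub> b)
      = (\<Sum>t\<in>?p ` (?A \<times> ?B). iscale ((a \<otimes>\<^bsub>free_nonassoc g\<^esub> b) t) (meval c y t))"
    using f by (intro evalp_superset) auto
  also have "\<dots> = (\<Sum>(u, v)\<in>?A \<times> ?B. iscale (a u * b v) (comm c (meval c y u) (meval c y v)))"
    by (subst sum.reindex) (auto simp: inj_on_def case_prod_unfold intro!: sum.cong)
  also have "\<dots> = (\<Sum>u\<in>?A. \<Sum>v\<in>?B. iscale (a u * b v) (comm c (meval c y u) (meval c y v)))"
    by (simp add: sum.cartesian_product)
  also have "\<dots> = comm c (evalp c y a) (evalp c y b)"
    unfolding evalp_def comm_sum_left comm_scale_left iscale_sum[symmetric]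
    unfolding comm_sum_right comm_scale_right iscale_sum iscale_iscale ..
  finally show ?thesis .
qed

section \<open>Free nilpotent Lie rings inside truncated polynomials\<close>

lemma quot_eq_iff:
  assumes "nonassoc_algebra R L" "two_sided_ideal R L I" "x \<in> carrier L" "y \<in> carrier L"
  shows "I +>\<^bsub>L\<^esub> x = I +>\<^bsub>L\<^esub> y \<longleftrightarrow> x \<ominus>\<^bsub>L\<^esub> y \<in> I"
proof -
  interpret nonassoc_algebra R L by fact
  interpret I: abelian_subgroup I L by (rule two_sided_ideal_abelian_subgroup[OF assms(2)])
  show ?thesis
  proof
    assume "I +>\<^bsub>L\<^esub> x = I +>\<^bsub>L\<^esub> y"
    hence "x \<in> I +>\<^bsub>L\<^esub> y" using I.a_rcos_self[OF assms(3)] by simp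
    then obtain h where "h \<in> I" "x = h \<oplus>\<^bsub>L\<^esub> y" using mem_ideal_coset[OF assms(2)] by blast
    moreover have "h \<in> carrier L" using calculation I.a_subset by blast
    ultimately show "x \<ominus>\<^bsub>L\<^esub> y \<in> I" using assms(4) by (simp add: M.minus_eq M.a_assoc M.r_neg)
  next
    assume a: "x \<ominus>\<^bsub>L\<^esub> y \<in> I"
    have "x = (x \<ominus>\<^bsub>L\<^esub> y) \<oplus>\<^bsub>L\<^esub> y" using assms(3,4) by (simp add: M.minus_eq M.a_assoc M.l_neg)
    thus "I +>\<^bsub>L\<^esub> x = I +>\<^bsub>L\<^esub> y" using ideal_coset_eq[OF assms(2) assms(4) a] by metis
  qed
qed

lemma (in lie_algebra) lower_central_Suc_subset: "lower_central L (Suc i) \<subseteq> lower_central L i"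
proof (cases i)
  case (Suc k)
  have "lower_central L (Suc (Suc k)) \<subseteq> lower_central L (Suc k)"
    unfolding lower_central.simps(3)
    by (rule add.generate_subgroup_incl[OF _ lower_central_subgroup])
      (use lower_central_ideal[of "Suc k"] in \<open>auto simp: two_sided_ideal_def\<close>)
  thus ?thesis using Suc by simp
qed (use lower_central_subset in auto)

lemma (in lie_algebra) lower_central_antimono: "i \<le> j \<Longrightarrow> lower_central L j \<subseteq> lower_central L i"
  by (induction j rule: dec_induct) (use lower_central_Suc_subset in blast)+

text \<open>
  The filtration by a weight of words. It is used for the length of a word and for a finer weight
  that separates the letters; \<open>comm_filt\<close> holds for both because they are additive.
\<close>

definition filt :: "(nat list \<Rightarrow> nat) \<Rightarrow> nat \<Rightarrow> (nat list \<Rightarrow> int) set" where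
  "filt \<omega> i = {p. \<forall>w. \<omega> w < i \<longrightarrow> p w = 0}"

lemma filt_closed:
  "0 \<in> filt \<omega> i" "p \<in> filt \<omega> i \<Longrightarrow> q \<in> filt \<omega> i \<Longrightarrow> p + q \<in> filt \<omega> i"
  "p \<in> filt \<omega> i \<Longrightarrow> q \<in> filt \<omega> i \<Longrightarrow> p - q \<in> filt \<omega> i"
  "p \<in> filt \<omega> i \<Longrightarrow> iscale k p \<in> filt \<omega> i"
  by (auto simp: filt_def)

lemma filt_mono: "i \<le> j \<Longrightarrow> filt \<omega> j \<subseteq> filt \<omega> i"
  by (auto simp: filt_def)

lemma comm_filt:
  assumes "\<And>u v. \<omega> (u @ v) = \<omega> u + \<omega> v" "p \<in> filt \<omega> i" "q \<in> filt \<omega> j"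
  shows "comm c p q \<in> filt \<omega> (i + j)"
  unfolding filt_def
proof (intro CollectI allI impI)
  fix w assume w: "\<omega> w < i + j"
  show "comm c p q w = 0"
  proof (rule ccontr)
    assume "comm c p q w \<noteq> 0"
    then obtain u v where uv: "w = u @ v \<or> w = v @ u" "p u \<noteq> 0" "q v \<noteq> 0" by (rule comm_nonzero)
    hence "i \<le> \<omega> u" "j \<le> \<omega> v" using assms by (force simp: filt_def not_less[symmetric])+
    thus False using uv(1) w assms(1) by auto
  qed
qed

definition lie_ideal :: "nat \<Rightarrow> (free_magma \<Rightarrow> int) set" where
  "lie_ideal g = gen_two_sided_ideal \<Z> (free_nonassoc g) (lie_relations (free_nonassoc g))"

lemma lie_relations_subset: "lie_relations (free_nonassoc g) \<subseteq> carrier (free_nonassoc g)"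
proof -
  interpret nonassoc_algebra \<Z> "free_nonassoc g" by (rule nonassoc_algebra_free_nonassoc)
  show ?thesis by (auto simp: lie_relations_def prod_closed)
qed

lemma lie_ideal: "two_sided_ideal \<Z> (free_nonassoc g) (lie_ideal g)"
  unfolding lie_ideal_def
  by (rule gen_two_sided_ideal[OF nonassoc_algebra_free_nonassoc lie_relations_subset])

lemma free_lie_eq: "free_lie g = quot_alg (free_nonassoc g) (lie_ideal g)"
  by (simp add: free_lie_def lie_ideal_def)

definition to_lie :: "nat \<Rightarrow> (free_magma \<Rightarrow> int) \<Rightarrow> (free_magma \<Rightarrow> int) set" where
  "to_lie g a = lie_ideal g +>\<^bsub>free_nonassoc g\<^esub> a"

definition to_nil :: "nat \<Rightarrow> nat \<Rightarrow> (free_magma \<Rightarrow> int) \<Rightarrow> (free_magma \<Rightarrow> int) set set" where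
  "to_nil c g a = lower_central (free_lie g) (Suc c) +>\<^bsub>free_lie g\<^esub> to_lie g a"

lemma free_nonassoc_minus:
  assumes "a \<in> carrier (free_nonassoc g)" "b \<in> carrier (free_nonassoc g)"
  shows "a \<ominus>\<^bsub>free_nonassoc g\<^esub> b = a - b"
proof -
  interpret nonassoc_algebra \<Z> "free_nonassoc g" by (rule nonassoc_algebra_free_nonassoc)
  have "a - b \<oplus>\<^bsub>free_nonassoc g\<^esub> b = a" by (simp add: free_nonassoc_simps)
  thus ?thesis using M.add.inv_solve_right'[of "a - b" a b] free_nonassoc_closed(2)[OF assms] assms
    by (metis M.minus_eq M.add.m_assoc M.add.inv_closed M.r_neg M.r_zero)
qed

lemma to_lie_hom:
  assumes "a \<in> carrier (free_nonassoc g)" "b \<in> carrier (free_nonassoc g)"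
  shows "to_lie g (a + b) = to_lie g a \<oplus>\<^bsub>free_lie g\<^esub> to_lie g b"
    "to_lie g (iscale k a) = k \<odot>\<^bsub>free_lie g\<^esub> to_lie g a"
    "to_lie g (a \<otimes>\<^bsub>free_nonassoc g\<^esub> b) = to_lie g a \<otimes>\<^bsub>free_lie g\<^esub> to_lie g b"
    "to_lie g a \<in> carrier (free_lie g)"
    "to_lie g a = to_lie g b \<longleftrightarrow> a - b \<in> lie_ideal g"
proof -
  interpret nonassoc_algebra \<Z> "free_nonassoc g" by (rule nonassoc_algebra_free_nonassoc)
  note I = lie_ideal[of g]
  show "to_lie g (a + b) = to_lie g a \<oplus>\<^bsub>free_lie g\<^esub> to_lie g b"
    using quot_add[OF I assms] by (simp add: to_lie_def free_lie_eq free_nonassoc_simps(2))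
  show "to_lie g (iscale k a) = k \<odot>\<^bsub>free_lie g\<^esub> to_lie g a"
    using quot_smult[OF I, of k a] assms(1) by (simp add: to_lie_def free_lie_eq free_nonassoc_simps(4))
  show "to_lie g (a \<otimes>\<^bsub>free_nonassoc g\<^esub> b) = to_lie g a \<otimes>\<^bsub>free_lie g\<^esub> to_lie g b"
    using quot_mult[OF I assms] by (simp add: to_lie_def free_lie_eq)
  show "to_lie g a \<in> carrier (free_lie g)"
    using quot_carrier[OF I] assms by (auto simp: to_lie_def free_lie_eq)
  show "to_lie g a = to_lie g b \<longleftrightarrow> a - b \<in> lie_ideal g"
    using quot_eq_iff[OF nonassoc_algebra_free_nonassoc I assms] free_nonassoc_minus[OF assms]
    by (simp add: to_lie_def)
qed

lemma to_lie_surj: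
  assumes "x \<in> carrier (free_lie g)"
  obtains a where "a \<in> carrier (free_nonassoc g)" "x = to_lie g a"
  using assms nonassoc_algebra.quot_carrier[OF nonassoc_algebra_free_nonassoc lie_ideal[of g]]
  by (auto simp: to_lie_def free_lie_eq)

lemma to_nil_hom:
  assumes "a \<in> carrier (free_nonassoc g)" "b \<in> carrier (free_nonassoc g)"
  shows "to_nil c g (a + b) = to_nil c g a \<oplus>\<^bsub>free_nilpotent c g\<^esub> to_nil c g b"
    "to_nil c g (iscale k a) = k \<odot>\<^bsub>free_nilpotent c g\<^esub> to_nil c g a"
    "to_nil c g (a \<otimes>\<^bsub>free_nonassoc g\<^esub> b) = to_nil c g a \<otimes>\<^bsub>free_nilpotent c g\<^esub> to_nil c g b"
    "to_nil c g a \<in> carrier (free_nilpotent c g)"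
    "to_nil c g a = to_nil c g b \<longleftrightarrow> to_lie g (a - b) \<in> lower_central (free_lie g) (Suc c)"
proof -
  interpret lie_algebra \<Z> "free_lie g" by (rule lie_algebra_free_lie)
  note I = lower_central_ideal[of "Suc c"]
  note cl = to_lie_hom(4)[OF assms(1) assms(1)] to_lie_hom(4)[OF assms(2) assms(2)]
  show "to_nil c g (a + b) = to_nil c g a \<oplus>\<^bsub>free_nilpotent c g\<^esub> to_nil c g b"
    using quot_add[OF I cl] by (simp only: to_nil_def free_nilpotent_def to_lie_hom(1)[OF assms])
  show "to_nil c g (iscale k a) = k \<odot>\<^bsub>free_nilpotent c g\<^esub> to_nil c g a"
    using quot_smult[OF I _ cl(1), of k] by (simp add: to_nil_def free_nilpotent_def to_lie_hom(2)[OF assms])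
  show "to_nil c g (a \<otimes>\<^bsub>free_nonassoc g\<^esub> b) = to_nil c g a \<otimes>\<^bsub>free_nilpotent c g\<^esub> to_nil c g b"
    using quot_mult[OF I cl] by (simp only: to_nil_def free_nilpotent_def to_lie_hom(3)[OF assms])
  show "to_nil c g a \<in> carrier (free_nilpotent c g)"
    using quot_carrier[OF I] cl(1) by (auto simp: to_nil_def free_nilpotent_def)
  have "to_lie g (a - b) \<oplus>\<^bsub>free_lie g\<^esub> to_lie g b = to_lie g a"
    using to_lie_hom(1)[OF free_nonassoc_closed(2)[OF assms] assms(2)] by simp
  hence "to_lie g a \<ominus>\<^bsub>free_lie g\<^esub> to_lie g b = to_lie g (a - b)"
    using cl to_lie_hom(4)[OF free_nonassoc_closed(2)[OF assms] assms(1)]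
    by (metis M.minus_eq M.add.m_assoc M.add.inv_closed M.r_neg M.r_zero)
  thus "to_nil c g a = to_nil c g b \<longleftrightarrow> to_lie g (a - b) \<in> lower_central (free_lie g) (Suc c)"
    using quot_eq_iff[OF nonassoc_algebra_axioms I cl] by (simp add: to_nil_def)
qed

lemma to_nil_surj:
  assumes "x \<in> carrier (free_nilpotent c g)"
  obtains a where "a \<in> carrier (free_nonassoc g)" "x = to_nil c g a"
proof -
  interpret lie_algebra \<Z> "free_lie g" by (rule lie_algebra_free_lie)
  obtain b where b: "b \<in> carrier (free_lie g)" "x = lower_central (free_lie g) (Suc c) +>\<^bsub>free_lie g\<^esub> b"
    using assms quot_carrier[OF lower_central_ideal[of "Suc c"]] by (auto simp: free_nilpotent_def)
  from b(1) show thesis by (rule to_lie_surj) (use that b in \<open>auto simp: to_nil_def\<close>)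
qed

lemma evalp_carrier:
  assumes y: "\<And>j. j < g \<Longrightarrow> y j \<in> carrier (trunc_lie c)" and a: "a \<in> carrier (free_nonassoc g)"
  shows "evalp c y a \<in> carrier (trunc_lie c)"
proof -
  interpret T: lie_algebra \<Z> "trunc_lie c" by (rule lie_algebra_trunc_lie)
  from a show ?thesis
  proof (induction rule: free_nonassoc_induct)
    case zero
    have "evalp c y 0 \<in> carrier (trunc_lie c)" by simp
    thus ?case .
  next
    case (add a t k)
    have t: "meval c y t \<in> carrier (trunc_lie c)" using add y by (intro meval_carrier) auto
    have "evalp c y (a + iscale k (single t)) = evalp c y a + iscale k (meval c y t)"
      using add.hyps single_carrier free_nonassoc_closed
      by (simp add: evalp_add[where g = g] evalp_scale[where g = g])
    thus ?case using T.M.a_closed[OF add.IH T.smult_closed[OF _ t, of k]] by (simp only: trunc_lie_simps) auto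
  qed
qed

text \<open>
  The kernel of an evaluation is a two-sided ideal, and it contains the Lie relations because the
  target is a Lie ring.
\<close>

lemma evalp_lie_ideal:
  assumes a: "a \<in> lie_ideal g"
  shows "evalp c y a = 0"
proof -
  let ?A = "free_nonassoc g"
  interpret A: nonassoc_algebra \<Z> ?A by (rule nonassoc_algebra_free_nonassoc)
  interpret T: lie_algebra \<Z> "trunc_lie c" by (rule lie_algebra_trunc_lie)
  let ?K = "{a \<in> carrier ?A. evalp c y a = 0}"
  have neg: "\<ominus>\<^bsub>?A\<^esub> a = iscale (- 1) a" if "a \<in> carrier ?A" for a
  proof (rule A.M.minus_equality)
    show "iscale (- 1) a \<oplus>\<^bsub>?A\<^esub> a = \<zero>\<^bsub>?A\<^esub>" by (auto simp: free_nonassoc_simps fun_eq_iff)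
  qed (use that free_nonassoc_closed in auto)
  have "submodule ?K \<Z> ?A"
  proof (rule A.submoduleI)
    show "\<zero>\<^bsub>?A\<^esub> \<in> ?K" using A.M.zero_closed by (simp add: free_nonassoc_simps(3))
    fix a assume a: "a \<in> ?K"
    show "\<ominus>\<^bsub>?A\<^esub> a \<in> ?K" using a neg[of a] free_nonassoc_closed(3)[of a g a "- 1"] evalp_scale[of a g c y "-1"] by simp
    fix b assume b: "b \<in> ?K"
    show "a \<oplus>\<^bsub>?A\<^esub> b \<in> ?K" using a b free_nonassoc_closed(1)[of a g b] evalp_add[of a g b c y]
      by (simp add: free_nonassoc_simps(2))
  next
    fix k a assume "a \<in> ?K"
    thus "k \<odot>\<^bsub>?A\<^esub> a \<in> ?K" using free_nonassoc_closed(3)[of a g a k] evalp_scale[of a g c y k]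
      by (simp add: free_nonassoc_simps(4))
  qed auto
  hence "two_sided_ideal \<Z> ?A ?K"
    unfolding two_sided_ideal_def using free_nonassoc_closed(4) by (auto simp: evalp_mult)
  moreover have "lie_relations ?A \<subseteq> ?K"
  proof
    fix r assume r: "r \<in> lie_relations ?A"
    hence "r \<in> carrier ?A" using lie_relations_subset by blast
    moreover from r have "evalp c y r = 0" unfolding lie_relations_def
    proof (elim UnE CollectE exE conjE)
      fix x assume x: "r = x \<otimes>\<^bsub>?A\<^esub> x" "x \<in> carrier ?A"
      thus ?thesis by (simp add: evalp_mult comm_def)
    next
      fix x y' z assume x: "x \<in> carrier ?A" "y' \<in> carrier ?A" "z \<in> carrier ?A"
        "r = x \<otimes>\<^bsub>?A\<^esub> (y' \<otimes>\<^bsub>?A\<^esub> z) \<oplus>\<^bsub>?A\<^esub> y' \<otimes>\<^bsub>?A\<^esub> (z \<otimes>\<^bsub>?A\<^esub> x) \<oplus>\<^bsub>?A\<^esub> z \<otimes>\<^bsub>?A\<^esub> (x \<otimes>\<^bsub>?A\<^esub> y')"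
      have j: "comm c p (comm c q s) + comm c q (comm c s p) + comm c s (comm c p q) = 0" for p q s
        by (simp add: comm_def conv_diff_left conv_diff_right conv_assoc)
      show ?thesis using x j
        by (simp add: evalp_add[where g = g] evalp_mult free_nonassoc_closed(1,4) free_nonassoc_simps(2))
    qed
    ultimately show "r \<in> ?K" by simp
  qed
  ultimately have "lie_ideal g \<subseteq> ?K" unfolding lie_ideal_def gen_two_sided_ideal_def by blast
  thus ?thesis using a by blast
qed

lemma to_lie_eq_evalp:
  assumes "a \<in> carrier (free_nonassoc g)" "b \<in> carrier (free_nonassoc g)" "to_lie g a = to_lie g b"
  shows "evalp c y a = evalp c y b"
  using to_lie_hom(5)[OF assms(1,2)] evalp_lie_ideal[of "a - b" g c y] assms evalp_diff[OF assms(1,2), of c y]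
  by simp

text \<open>
  Each bracket with an element of the free Lie ring raises the degree of the value, so that an element of
  the \<open>i\<close>-th term of the lower central series is mapped to polynomials of degree at least \<open>i\<close>.
\<close>

lemma evalp_lower_central:
  assumes y: "\<And>j. j < g \<Longrightarrow> y j \<in> carrier (trunc_lie c)"
    and "x \<in> lower_central (free_lie g) (Suc i)" "x = to_lie g a" "a \<in> carrier (free_nonassoc g)"
  shows "evalp c y a \<in> filt length (Suc i)"
  using assms(2-)
proof (induction i arbitrary: x a)
  case 0
  have "evalp c y a \<in> carrier (trunc_lie c)" using evalp_carrier[where g = g and y = y] y 0 by blast
  thus ?case by (auto simp: filt_def)
next
  case (Suc i)
  interpret L: lie_algebra \<Z> "free_lie g" by (rule lie_algebra_free_lie)
  let ?A = "free_nonassoc g"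
  let ?G = "{u \<otimes>\<^bsub>free_lie g\<^esub> v | u v. u \<in> carrier (free_lie g) \<and> v \<in> lower_central (free_lie g) (Suc i)}"
  define T where "T = {to_lie g a | a. a \<in> carrier ?A \<and> evalp c y a \<in> filt length (Suc (Suc i))}"
  have "x \<in> generate (add_monoid (free_lie g)) ?G" using Suc.prems by simp
  hence "x \<in> T"
  proof (induction rule: generate.induct)
    case one
    have "0 \<in> carrier ?A" by (simp add: free_nonassoc_simps)
    moreover have "to_lie g 0 = \<zero>\<^bsub>free_lie g\<^esub>"
      using L.smult_l_null[OF to_lie_hom(4)[OF calculation calculation]] to_lie_hom(2)[OF calculation calculation, of 0]
      by simp
    moreover have "evalp c y 0 \<in> filt length (Suc (Suc i))" using filt_closed(1) by simp
    ultimately have "\<zero>\<^bsub>free_lie g\<^esub> \<in> T" unfolding T_def by force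
    thus ?case by simp
  next
    case (incl h)
    then obtain u v where uv: "h = u \<otimes>\<^bsub>free_lie g\<^esub> v" "u \<in> carrier (free_lie g)" "v \<in> lower_central (free_lie g) (Suc i)" by blast
    obtain a where a: "a \<in> carrier ?A" "u = to_lie g a" by (rule to_lie_surj[OF uv(2)])
    have "v \<in> carrier (free_lie g)" using uv(3) L.lower_central_subset by blast
    then obtain b where b: "b \<in> carrier ?A" "v = to_lie g b" by (rule to_lie_surj)
    have "evalp c y b \<in> filt length (Suc i)" using Suc.IH[OF uv(3) b(2,1)] .
    moreover have "evalp c y a \<in> carrier (trunc_lie c)" using evalp_carrier[where g = g and y = y] y a by blast
    hence "evalp c y a \<in> filt length 1" by (auto simp: filt_def)
    ultimately have "comm c (evalp c y a) (evalp c y b) \<in> filt length (1 + Suc i)" by (intro comm_filt) auto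
    hence "evalp c y (a \<otimes>\<^bsub>?A\<^esub> b) \<in> filt length (Suc (Suc i))" using evalp_mult[OF a(1) b(1)] by simp
    moreover have "h = to_lie g (a \<otimes>\<^bsub>?A\<^esub> b)" using a b uv(1) to_lie_hom(3)[OF a(1) b(1)] by simp
    ultimately show ?case unfolding T_def using free_nonassoc_closed(4)[OF a(1) b(1)] by blast
  next
    case (inv h)
    then obtain u v where uv: "h = u \<otimes>\<^bsub>free_lie g\<^esub> v" "u \<in> carrier (free_lie g)" "v \<in> lower_central (free_lie g) (Suc i)" by blast
    obtain a where a: "a \<in> carrier ?A" "u = to_lie g a" by (rule to_lie_surj[OF uv(2)])
    have vc: "v \<in> carrier (free_lie g)" using uv(3) L.lower_central_subset by blast
    then obtain b where b: "b \<in> carrier ?A" "v = to_lie g b" by (rule to_lie_surj)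
    have "evalp c y b \<in> filt length (Suc i)" using Suc.IH[OF uv(3) b(2,1)] .
    moreover have "evalp c y a \<in> carrier (trunc_lie c)" using evalp_carrier[where g = g and y = y] y a by blast
    hence "evalp c y a \<in> filt length 1" by (auto simp: filt_def)
    ultimately have "comm c (evalp c y b) (evalp c y a) \<in> filt length (Suc i + 1)" by (intro comm_filt) auto
    hence "evalp c y (b \<otimes>\<^bsub>?A\<^esub> a) \<in> filt length (Suc (Suc i))" using evalp_mult[OF b(1) a(1)] by simp
    moreover have "inv\<^bsub>add_monoid (free_lie g)\<^esub> h = v \<otimes>\<^bsub>free_lie g\<^esub> u"
      using L.bracket_anti[OF vc uv(2)] uv(1) by (simp add: a_inv_def)
    hence "inv\<^bsub>add_monoid (free_lie g)\<^esub> h = to_lie g (b \<otimes>\<^bsub>?A\<^esub> a)"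
      using a b to_lie_hom(3)[OF b(1) a(1)] by simp
    ultimately show ?case unfolding T_def using free_nonassoc_closed(4)[OF b(1) a(1)] by blast
  next
    case (eng h1 h2)
    then obtain a b where "h1 = to_lie g a" "a \<in> carrier ?A" "evalp c y a \<in> filt length (Suc (Suc i))"
      "h2 = to_lie g b" "b \<in> carrier ?A" "evalp c y b \<in> filt length (Suc (Suc i))" unfolding T_def by blast
    hence "evalp c y (a + b) \<in> filt length (Suc (Suc i))" "h1 \<otimes>\<^bsub>add_monoid (free_lie g)\<^esub> h2 = to_lie g (a + b)"
      "a + b \<in> carrier ?A"
      using free_nonassoc_closed(1)[of a g b] to_lie_hom(1)[of a g b] evalp_add[of a g b c y]
        filt_closed(2)[of "evalp c y a" length _ "evalp c y b"] by auto
    thus ?case unfolding T_def by blast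
  qed
  then obtain b where "b \<in> carrier ?A" "x = to_lie g b" "evalp c y b \<in> filt length (Suc (Suc i))"
    unfolding T_def by blast
  thus ?case using to_lie_eq_evalp[of a g b c y] Suc.prems by simp
qed

text \<open>
  Evaluations factor through the free nilpotent Lie ring, because there are no words of length
  \<open>c + 1\<close> in the target.
\<close>

lemma to_nil_eq_evalp:
  assumes y: "\<And>j. j < g \<Longrightarrow> y j \<in> carrier (trunc_lie c)"
    and "a \<in> carrier (free_nonassoc g)" "b \<in> carrier (free_nonassoc g)" "to_nil c g a = to_nil c g b"
  shows "evalp c y a = evalp c y b"
proof -
  have d: "a - b \<in> carrier (free_nonassoc g)" using assms free_nonassoc_closed(2) by blast
  have "evalp c y (a - b) \<in> filt length (Suc c)"
    using evalp_lower_central[OF y _ refl d] to_nil_hom(5)[OF assms(2,3)] assms(4) by simp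
  moreover have "evalp c y (a - b) \<in> carrier (trunc_lie c)" using evalp_carrier[where g = g and y = y] y d by blast
  ultimately have "evalp c y (a - b) w = 0" for w by (cases "length w \<le> c") (auto simp: filt_def)
  hence "evalp c y (a - b) = 0" by (auto simp: fun_eq_iff)
  thus ?thesis using evalp_diff[OF assms(2,3), of c y] by simp
qed

definition letter :: "nat \<Rightarrow> nat list \<Rightarrow> int" where
  "letter j = (\<lambda>w. if w = [j] then 1 else 0)"

abbreviation lyn :: "nat \<Rightarrow> (nat \<Rightarrow> nat list \<Rightarrow> int) \<Rightarrow> nat list \<Rightarrow> nat list \<Rightarrow> int" where
  "lyn c y w \<equiv> meval c y (lyndon_bracket w)"

lemma letter_carrier: "1 \<le> c \<Longrightarrow> letter j \<in> carrier (trunc_lie c)"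
  by (auto simp: letter_def)

lemma meval_letter_support: "meval c letter t u \<noteq> 0 \<Longrightarrow> mset u = mset (foliage t)"
proof (induction t arbitrary: u)
  case (Gen i)
  thus ?case by (auto simp: letter_def split: if_splits)
next
  case (Prod s t)
  from Prod.prems have "comm c (meval c letter s) (meval c letter t) u \<noteq> 0" by simp
  thus ?case by (rule comm_nonzero) (use Prod.IH in auto)
qed

lemma meval_letter_support_length: "meval c letter t u \<noteq> 0 \<Longrightarrow> length u = length (foliage t)"
  by (metis meval_letter_support size_mset)

lemma lyn_support:
  assumes "lyndon w" "lyn c letter w u \<noteq> 0"
  shows "mset u = mset w" "length u = length w"
  using meval_letter_support[OF assms(2)] meval_letter_support_length[OF assms(2)]
  by (simp_all add: foliage_lyndon_bracket assms(1))

text \<open>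
  Let \<open>P\<close> and \<open>Q\<close> be the values of the standard factors \<open>u\<close> and \<open>v\<close>. They are homogeneous, so that a word of
  \<open>P Q\<close> is at least \<open>u @ v\<close>, with equality for one factorisation only, while a word of \<open>Q P\<close> is at least
  \<open>v @ u\<close>, which is greater than \<open>u @ v\<close>.
\<close>

lemma lyn_leading_aux:
  assumes "lyndon w" "length w \<le> c"
  shows "lyn c letter w w = 1 \<and> (\<forall>u. lyn c letter w u \<noteq> 0 \<longrightarrow> w \<le> u)"
  using assms
proof (induction rule: lyndon_induct)
  case (single a)
  thus ?case by (auto simp: letter_def)
next
  case (append u v)
  let ?P = "lyn c letter u" and ?Q = "lyn c letter v"
  have IH: "?P u = 1" "\<And>x. ?P x \<noteq> 0 \<Longrightarrow> u \<le> x" "?Q v = 1" "\<And>x. ?Q x \<noteq> 0 \<Longrightarrow> v \<le> x"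
    using append by auto
  have len: "?P x \<noteq> 0 \<Longrightarrow> length x = length u" "?Q x \<noteq> 0 \<Longrightarrow> length x = length v" for x
    using lyn_support append by auto
  have e: "lyn c letter (u @ v) = comm c ?P ?Q" using append by simp
  have vu: "u @ v < v @ u"
  proof -
    have "u @ v < v" using append by (intro append_less_right) auto
    also have "v \<le> v @ u" by simp
    finally show ?thesis .
  qed
  have ge1: "u @ v \<le> a @ b" if "?P a \<noteq> 0" "?Q b \<noteq> 0" for a b
  proof (cases "a = u")
    case True
    thus ?thesis using IH(4) that by simp
  next
    case False
    hence "u < a" using IH(2)[of a] that by auto
    thus ?thesis using less_append_mono[of u a v b] len that by auto
  qed
  have ge2: "u @ v < b @ a" if "?P a \<noteq> 0" "?Q b \<noteq> 0" for a b
  proof -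
    have "v @ u \<le> b @ a"
    proof (cases "b = v")
      case True
      thus ?thesis using IH(2) that by simp
    next
      case False
      hence "v < b" using IH(4)[of b] that by auto
      thus ?thesis using less_append_mono[of v b u a] len that by auto
    qed
    thus ?thesis using vu by order
  qed
  have "u @ v \<le> x" if "comm c ?P ?Q x \<noteq> 0" for x
    using that by (rule comm_nonzero) (use ge1 ge2 in force)
  moreover have "conv c ?Q ?P (u @ v) = 0"
  proof (rule ccontr)
    assume "conv c ?Q ?P (u @ v) \<noteq> 0"
    thus False by (rule conv_nonzero) (metis ge2 order.irrefl)
  qed
  moreover have "conv c ?P ?Q (u @ v) = 1"
  proof -
    have "conv c ?P ?Q (u @ v) = (\<Sum>k\<le>length (u @ v). ?P (take k (u @ v)) * ?Q (drop k (u @ v)))"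
      using append.prems by (simp only: conv_def) simp
    also have "\<dots> = (\<Sum>k\<in>{length u}. ?P (take k (u @ v)) * ?Q (drop k (u @ v)))"
    proof (rule sum.mono_neutral_right)
      show "\<forall>k\<in>{..length (u @ v)} - {length u}. ?P (take k (u @ v)) * ?Q (drop k (u @ v)) = 0"
      proof
        fix k assume "k \<in> {..length (u @ v)} - {length u}"
        hence "length (take k (u @ v)) \<noteq> length u" by auto
        hence "?P (take k (u @ v)) = 0" using len(1) by blast
        thus "?P (take k (u @ v)) * ?Q (drop k (u @ v)) = 0" by simp
      qed
    qed auto
    also have "\<dots> = 1" using IH by simp
    finally show ?thesis .
  qed
  ultimately show ?case unfolding e by (simp add: comm_def)
qed

lemma lyn_leading:
  assumes "lyndon w" "length w \<le> c"
  shows "lyn c letter w w = 1" "lyn c letter w u \<noteq> 0 \<Longrightarrow> w \<le> u"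
  using lyn_leading_aux[OF assms] by auto

locale free_nilp =
  fixes c g :: nat
  assumes c_pos: "1 \<le> c" and g_pos: "1 \<le> g"
begin

text \<open>
  The index set of the Lyndon basis of the free nilpotent Lie ring of class \<open>c\<close> on \<open>g\<close> generators.
\<close>

definition W :: "nat list set" where
  "W = {w. lyndon w \<and> set w \<subseteq> {..<g} \<and> length w \<le> c}"

lemma finite_W: "finite W"
  unfolding W_def by (rule finite_subset[OF _ finite_lists_length_le[of "{..<g}" c]]) auto

lemma W_D: "w \<in> W \<Longrightarrow> lyndon w" "w \<in> W \<Longrightarrow> set w \<subseteq> {..<g}" "w \<in> W \<Longrightarrow> length w \<le> c" "w \<in> W \<Longrightarrow> w \<noteq> []"
  by (auto simp: W_def)

lemma single_W: "[j] \<in> W \<longleftrightarrow> j < g"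
  using c_pos by (auto simp: W_def)

definition lynpoly :: "(nat list \<Rightarrow> int) \<Rightarrow> free_magma \<Rightarrow> int" where
  "lynpoly n = (\<Sum>w\<in>W. iscale (n w) (single (lyndon_bracket w)))"

text \<open>
  The value of \<open>lynpoly n\<close> at a tuple \<open>y\<close>. For the tuple of letters these are the elements of the model,
  and for other tuples the elements of the subalgebra that the tuple generates.
\<close>

definition comb :: "(nat \<Rightarrow> nat list \<Rightarrow> int) \<Rightarrow> (nat list \<Rightarrow> int) \<Rightarrow> nat list \<Rightarrow> int" where
  "comb y n = (\<Sum>w\<in>W. iscale (n w) (lyn c y w))"

definition ok :: "(nat \<Rightarrow> nat list \<Rightarrow> int) \<Rightarrow> bool" where
  "ok y \<longleftrightarrow> (\<forall>j<g. y j \<in> carrier (trunc_lie c))"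

lemma ok_letter: "ok letter"
  using letter_carrier[OF c_pos] by (auto simp: ok_def)

lemma single_lyn_carrier: "w \<in> W \<Longrightarrow> single (lyndon_bracket w) \<in> carrier (free_nonassoc g)"
  by (intro single_carrier) (auto simp: gens_lyndon_bracket W_D)

lemma zero_free_nonassoc [simp]: "0 \<in> carrier (free_nonassoc g)"
  by (simp add: free_nonassoc_simps)

lemma lynpoly_aux:
  assumes "S \<subseteq> W"
  shows "(\<Sum>w\<in>S. iscale (n w) (single (lyndon_bracket w))) \<in> carrier (free_nonassoc g)
    \<and> evalp c y (\<Sum>w\<in>S. iscale (n w) (single (lyndon_bracket w))) = (\<Sum>w\<in>S. iscale (n w) (lyn c y w))"
proof -
  have "finite S" using assms finite_W finite_subset by blast
  thus ?thesis using assms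
  proof (induction S rule: finite_induct)
    case empty
    show ?case by (simp only: sum.empty zero_free_nonassoc evalp_zero simp_thms)
  next
    case (insert w S)
    let ?a = "single (lyndon_bracket w)"
    let ?b = "\<Sum>w\<in>S. iscale (n w) (single (lyndon_bracket w))"
    have w: "?a \<in> carrier (free_nonassoc g)" using insert.prems single_lyn_carrier by auto
    have b: "?b \<in> carrier (free_nonassoc g)" "evalp c y ?b = (\<Sum>w\<in>S. iscale (n w) (lyn c y w))"
      using insert.IH insert.prems by blast+
    have "iscale (n w) ?a + ?b \<in> carrier (free_nonassoc g)"
      using free_nonassoc_closed(1)[OF free_nonassoc_closed(3)[OF w w] b(1)] .
    moreover have "evalp c y (iscale (n w) ?a + ?b) = iscale (n w) (lyn c y w) + (\<Sum>w\<in>S. iscale (n w) (lyn c y w))"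
      using evalp_add[OF free_nonassoc_closed(3)[OF w w] b(1)] evalp_scale[OF w] b(2) by simp
    ultimately show ?case unfolding sum.insert[OF insert.hyps] by blast
  qed
qed

lemma lynpoly_carrier: "lynpoly n \<in> carrier (free_nonassoc g)"
  and evalp_lynpoly: "evalp c y (lynpoly n) = comb y n"
  using lynpoly_aux[of W] by (auto simp: lynpoly_def comb_def)

lemma lynpoly_add: "lynpoly (\<lambda>w. m w + n w) = lynpoly m + lynpoly n"
  unfolding lynpoly_def by (simp only: iscale_add_left sum.distrib)

lemma lynpoly_scale: "lynpoly (\<lambda>w. k * n w) = iscale k (lynpoly n)"
  unfolding lynpoly_def by (simp only: iscale_sum iscale_iscale)

lemma lynpoly_delta:
  assumes "w \<in> W"
  shows "lynpoly (\<lambda>v. if v = w then 1 else 0) = single (lyndon_bracket w)"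
proof -
  have "lynpoly (\<lambda>v. if v = w then 1 else 0) = (\<Sum>v\<in>W. if v = w then single (lyndon_bracket w) else 0)"
    unfolding lynpoly_def by (rule sum.cong) auto
  also have "\<dots> = single (lyndon_bracket w)" using assms finite_W by (simp only: sum.delta if_True)
  finally show ?thesis .
qed

lemma comb_add: "comb y (\<lambda>w. m w + n w) = comb y m + comb y n"
  unfolding comb_def by (simp only: iscale_add_left sum.distrib)

lemma comb_scale: "comb y (\<lambda>w. k * n w) = iscale k (comb y n)"
  unfolding comb_def by (simp only: iscale_sum iscale_iscale)

lemma comb_diff: "comb y (\<lambda>w. m w - n w) = comb y m - comb y n"
  using comb_add[of y "\<lambda>w. m w - n w" n] by simp

lemma comb_zero: "comb y (\<lambda>w. 0) = 0"
  using comb_scale[of y 0 "\<lambda>w. 0"] by simp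

lemma comb_cong: "(\<And>w. w \<in> W \<Longrightarrow> m w = n w) \<Longrightarrow> comb y m = comb y n"
  unfolding comb_def by (rule sum.cong) auto

lemma comb_apply: "comb y n u = (\<Sum>w\<in>W. n w * lyn c y w u)"
  unfolding comb_def sum_fun_apply by simp

lemma to_nil_single:
  "gens t \<subseteq> {..<g} \<Longrightarrow> to_nil c g (single t) = magma_eval (free_nilpotent c g) (\<lambda>j. to_nil c g (single (Gen j))) t"
proof (induction t)
  case (Prod s t)
  hence "to_nil c g (single (Prod s t)) = to_nil c g (single s) \<otimes>\<^bsub>free_nilpotent c g\<^esub> to_nil c g (single t)"
    using to_nil_hom(3)[of "single s" g "single t" c] single_Prod[of g s t] by (simp add: single_carrier)
  thus ?case using Prod by simp
qed simp

lemma to_lie_single: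
  "gens t \<subseteq> {..<g} \<Longrightarrow> to_lie g (single t) = magma_eval (free_lie g) (\<lambda>j. to_lie g (single (Gen j))) t"
proof (induction t)
  case (Prod s t)
  hence "to_lie g (single (Prod s t)) = to_lie g (single s) \<otimes>\<^bsub>free_lie g\<^esub> to_lie g (single t)"
    using to_lie_hom(3)[of "single s" g "single t"] single_Prod[of g s t] by (simp add: single_carrier)
  thus ?case using Prod by simp
qed simp

lemma to_nil_long:
  assumes t: "gens t \<subseteq> {..<g}" "c < length (foliage t)"
  shows "to_nil c g (single t) = to_nil c g 0"
proof -
  interpret lie_algebra \<Z> "free_lie g" by (rule lie_algebra_free_lie)
  have "to_lie g (single t) \<in> lower_central (free_lie g) (length (foliage t))"
    unfolding to_lie_single[OF t(1)]
    by (rule magma_eval_lower_central) (intro to_lie_hom(4)[OF single_carrier zero_free_nonassoc], use t(1) in auto)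
  also have "\<dots> \<subseteq> lower_central (free_lie g) (Suc c)" using t by (intro lower_central_antimono) simp
  finally show ?thesis using to_nil_hom(5)[OF single_carrier[OF t(1)] zero_free_nonassoc, of c] by simp
qed

text \<open>
  The Lyndon brackets span the free nilpotent Lie ring, and those of length greater than \<open>c\<close> vanish in
  it because they lie in the term \<open>c + 1\<close> of the lower central series.
\<close>

lemma to_nil_lynpoly:
  assumes "a \<in> carrier (free_nonassoc g)"
  shows "\<exists>n. to_nil c g a = to_nil c g (lynpoly n)"
proof -
  interpret F: lie_algebra \<Z> "free_nilpotent c g" by (rule lie_algebra_free_nilpotent)
  let ?F = "free_nilpotent c g" and ?f = "\<lambda>j. to_nil c g (single (Gen j))"
  define T where "T = range (\<lambda>n. to_nil c g (lynpoly n))"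
  have addT: "x \<oplus>\<^bsub>?F\<^esub> y \<in> T" if "x \<in> T" "y \<in> T" for x y
    using that unfolding T_def
    by (auto simp: to_nil_hom(1)[OF lynpoly_carrier lynpoly_carrier, symmetric] lynpoly_add[symmetric])
  have scaleT: "k \<odot>\<^bsub>?F\<^esub> x \<in> T" if "x \<in> T" for k x
    using that unfolding T_def
    by (auto simp: to_nil_hom(2)[OF lynpoly_carrier lynpoly_carrier, symmetric] lynpoly_scale[symmetric])
  have Tc: "T \<subseteq> carrier ?F" unfolding T_def using to_nil_hom(4)[OF lynpoly_carrier lynpoly_carrier] by blast
  have negT: "\<ominus>\<^bsub>?F\<^esub> x \<in> T" if "x \<in> T" for x
  proof -
    have "(- 1) \<odot>\<^bsub>?F\<^esub> x = \<ominus>\<^bsub>?F\<^esub> x"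
    proof (rule F.M.minus_equality[symmetric])
      have xc: "x \<in> carrier ?F" using that Tc by blast
      show "(- 1) \<odot>\<^bsub>?F\<^esub> x \<oplus>\<^bsub>?F\<^esub> x = \<zero>\<^bsub>?F\<^esub>"
        using F.smult_l_distr[of "-1" 1 x] F.smult_one[OF xc] F.smult_l_null[OF xc] xc by simp
    qed (use that Tc F.smult_closed in auto)
    thus ?thesis using scaleT[OF that, of "-1"] by simp
  qed
  have l0: "lynpoly (\<lambda>w. 0) = 0" using lynpoly_scale[of 0 "\<lambda>w. 0"] by simp
  have zero: "to_nil c g 0 \<in> T" unfolding T_def using l0 by (metis rangeI)
  have z0: "to_nil c g 0 = \<zero>\<^bsub>?F\<^esub>"
    using to_nil_hom(2)[OF zero_free_nonassoc zero_free_nonassoc, of c 0]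
      F.smult_l_null[OF to_nil_hom(4)[OF zero_free_nonassoc zero_free_nonassoc]] by simp
  have sgT: "subgroup T (add_monoid ?F)"
    by (intro subgroup.intro) (use Tc addT negT zero z0 in \<open>auto simp: a_inv_def[symmetric]\<close>)
  have single: "to_nil c g (single t) \<in> T" if t: "gens t \<subseteq> {..<g}" for t
  proof -
    have f: "?f j \<in> carrier ?F" if "j \<in> {..<g}" for j
      using that by (intro to_nil_hom(4)[OF single_carrier zero_free_nonassoc]) auto
    have "F.lyndon_elems ?f {..<g} (length (foliage t)) (\<lambda>w. True) \<subseteq> T"
    proof
      fix x assume "x \<in> F.lyndon_elems ?f {..<g} (length (foliage t)) (\<lambda>w. True)"
      then obtain w where w: "x = magma_eval ?F ?f (lyndon_bracket w)" "lyndon w" "set w \<subseteq> {..<g}"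
        unfolding F.lyndon_elems_def by blast
      have gw: "gens (lyndon_bracket w) \<subseteq> {..<g}" using w by (simp add: gens_lyndon_bracket)
      have x: "x = to_nil c g (single (lyndon_bracket w))" using w(1) to_nil_single[OF gw] by simp
      show "x \<in> T"
      proof (cases "length w \<le> c")
        case True
        hence "w \<in> W" using w by (simp add: W_def)
        from lynpoly_delta[OF this] show ?thesis unfolding x T_def by (metis rangeI)
      next
        case False
        thus ?thesis using to_nil_long[OF gw] zero w(2) x by (simp add: foliage_lyndon_bracket)
      qed
    qed
    hence "generate (add_monoid ?F) (F.lyndon_elems ?f {..<g} (length (foliage t)) (\<lambda>w. True)) \<subseteq> T"
      by (rule F.add.generate_subgroup_incl[OF _ sgT])
    moreover have "magma_eval ?F ?f t \<in> generate (add_monoid ?F) (F.lyndon_elems ?f {..<g} (length (foliage t)) (\<lambda>w. True))"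
      by (rule F.magma_eval_lyndon_span) (use f t in auto)
    ultimately show ?thesis using to_nil_single[OF t] by auto
  qed
  from assms have "to_nil c g a \<in> T"
  proof (induction rule: free_nonassoc_induct)
    case zero
    show ?case by (rule \<open>to_nil c g 0 \<in> T\<close>)
  next
    case (add a t k)
    note s = single_carrier[OF add.hyps(2)]
    have "to_nil c g a \<oplus>\<^bsub>?F\<^esub> k \<odot>\<^bsub>?F\<^esub> to_nil c g (single t) \<in> T"
      using addT[OF add.IH scaleT[OF single[OF add.hyps(2)]]] .
    thus ?case
      using to_nil_hom(1)[OF add.hyps(1) free_nonassoc_closed(3)[OF s s]] to_nil_hom(2)[OF s s] by metis
  qed
  thus ?thesis unfolding T_def by blast
qed

text \<open>
  The coefficients are found in the free nilpotent Lie ring, through which every evaluation factors.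
  Hence they do not depend on the tuple \<open>y\<close>.
\<close>

lemma evalp_comb:
  assumes "a \<in> carrier (free_nonassoc g)"
  obtains n where "to_nil c g a = to_nil c g (lynpoly n)" "\<And>y. ok y \<Longrightarrow> evalp c y a = comb y n"
proof -
  obtain n where n: "to_nil c g a = to_nil c g (lynpoly n)" using to_nil_lynpoly[OF assms] by blast
  have "evalp c y a = comb y n" if "ok y" for y
  proof -
    have "evalp c y a = evalp c y (lynpoly n)"
      by (rule to_nil_eq_evalp[where g = g]) (use that n assms lynpoly_carrier in \<open>auto simp: ok_def\<close>)
    thus ?thesis by (simp add: evalp_lynpoly)
  qed
  thus thesis using that n by blast
qed

text \<open>
  All tuples share the structure constants of the Lyndon basis. This makes the subalgebra generated by
  a tuple isomorphic to the model as soon as its Lyndon brackets are independent.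
\<close>

lemma comb_comm:
  obtains n where "\<And>y. ok y \<Longrightarrow> comm c (comb y m) (comb y m') = comb y n"
proof -
  obtain n where "\<And>y. ok y \<Longrightarrow> evalp c y (lynpoly m \<otimes>\<^bsub>free_nonassoc g\<^esub> lynpoly m') = comb y n"
    using evalp_comb[OF free_nonassoc_closed(4)[OF lynpoly_carrier lynpoly_carrier]] by metis
  thus thesis using that evalp_mult[OF lynpoly_carrier lynpoly_carrier] by (simp add: evalp_lynpoly)
qed

text \<open>
  At the least Lyndon word where the coefficients differ, no other Lyndon bracket contributes, by
  \<open>lyn_leading\<close>.
\<close>

lemma comb_letter_inj:
  assumes "comb letter m = comb letter n" "w \<in> W"
  shows "m w = n w"
proof (rule ccontr)
  assume "m w \<noteq> n w"
  let ?S = "{w \<in> W. m w \<noteq> n w}"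
  have S: "finite ?S" "?S \<noteq> {}" using finite_W assms(2) \<open>m w \<noteq> n w\<close> by auto
  define v where "v = Min ?S"
  have v: "v \<in> W" "m v \<noteq> n v" using Min_in[OF S] by (auto simp: v_def)
  have "(\<Sum>w\<in>W. (m w - n w) * lyn c letter w v) = (\<Sum>w\<in>{v}. (m w - n w) * lyn c letter w v)"
  proof (rule sum.mono_neutral_right)
    show "\<forall>w\<in>W - {v}. (m w - n w) * lyn c letter w v = 0"
    proof
      fix w assume w: "w \<in> W - {v}"
      show "(m w - n w) * lyn c letter w v = 0"
      proof (rule ccontr)
        assume nz: "(m w - n w) * lyn c letter w v \<noteq> 0"
        hence "w \<le> v" using lyn_leading(2)[of w c v] w W_D by auto
        moreover have "v \<le> w" unfolding v_def using S(1) w nz by (intro Min_le) auto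
        ultimately show False using w by auto
      qed
    qed
  qed (use finite_W v in auto)
  moreover have "(\<Sum>w\<in>W. (m w - n w) * lyn c letter w v) = comb letter (\<lambda>w. m w - n w) v"
    by (simp add: comb_apply)
  ultimately show False using v lyn_leading(1)[of v c] W_D assms(1) by (simp add: comb_diff)
qed

text \<open>
  The Lie ring generated by the letters, which is closed under brackets by \<open>comb_comm\<close>.
\<close>

definition P :: "(nat list \<Rightarrow> int) set" where
  "P = range (comb letter)"

text \<open>The coordinate of an element of \<open>P\<close> at a member of the Lyndon basis.\<close>

definition coef :: "(nat list \<Rightarrow> int) \<Rightarrow> nat list \<Rightarrow> int" where
  "coef p w = (if w \<in> W then (SOME n. p = comb letter n) w else 0)"

lemma coef_comb: "w \<in> W \<Longrightarrow> coef (comb letter n) w = n w"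
  unfolding coef_def using comb_letter_inj[of _ n w]
  by (metis (mono_tags, lifting) someI_ex)

lemma comb_coef: "p \<in> P \<Longrightarrow> comb letter (coef p) = p"
  unfolding P_def using coef_comb comb_cong by (metis imageE)

lemma comb_P [simp]: "comb letter n \<in> P" by (simp add: P_def)

lemma evalp_P: "a \<in> carrier (free_nonassoc g) \<Longrightarrow> evalp c letter a \<in> P"
  by (rule evalp_comb[of a]) (use ok_letter in auto)

lemma P_closed:
  assumes "p \<in> P" "q \<in> P"
  shows "p + q \<in> P" "p - q \<in> P" "iscale k p \<in> P" "comm c p q \<in> P"
proof -
  obtain m n where p: "p = comb letter m" and q: "q = comb letter n" using assms by (auto simp: P_def)
  show "p + q \<in> P" "p - q \<in> P" "iscale k p \<in> P"
    unfolding p q comb_add[symmetric] comb_diff[symmetric] comb_scale[symmetric] by simp_all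
  show "comm c p q \<in> P" unfolding p q by (rule comb_comm[of m n]) (use ok_letter in auto)
qed

lemma P_zero [simp]: "0 \<in> P" using comb_zero comb_P by metis

lemma P_uminus: "p \<in> P \<Longrightarrow> - p \<in> P" using P_closed(2)[OF P_zero] by simp

lemma coef_add: "p \<in> P \<Longrightarrow> q \<in> P \<Longrightarrow> w \<in> W \<Longrightarrow> coef (p + q) w = coef p w + coef q w"
  and coef_diff: "p \<in> P \<Longrightarrow> q \<in> P \<Longrightarrow> w \<in> W \<Longrightarrow> coef (p - q) w = coef p w - coef q w"
  and coef_scale: "p \<in> P \<Longrightarrow> w \<in> W \<Longrightarrow> coef (iscale k p) w = k * coef p w"
  unfolding P_def
  by (auto simp: comb_add[symmetric] comb_diff[symmetric] comb_scale[symmetric] coef_comb)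

lemma P_carrier: "P \<subseteq> carrier (trunc_lie c)"
proof
  fix p assume "p \<in> P"
  then obtain n where n: "p = comb letter n" by (auto simp: P_def)
  show "p \<in> carrier (trunc_lie c)"
    using evalp_carrier[where g = g and y = letter and c = c, OF letter_carrier[OF c_pos] lynpoly_carrier[of n]]
    by (simp only: n evalp_lynpoly)
qed

lemma ok_P: "(\<And>j. j < g \<Longrightarrow> y j \<in> P) \<Longrightarrow> ok y"
  using P_carrier by (auto simp: ok_def simp del: trunc_lie_simps)

definition Palg :: "(int, nat list \<Rightarrow> int) module" where
  "Palg = (trunc_lie c)\<lparr>carrier := P\<rparr>"

lemma Palg_simps [simp]:
  "carrier Palg = P" "x \<otimes>\<^bsub>Palg\<^esub> y = comm c x y" "\<zero>\<^bsub>Palg\<^esub> = 0" "x \<oplus>\<^bsub>Palg\<^esub> y = x + y"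
  "k \<odot>\<^bsub>Palg\<^esub> x = iscale k x"
  by (simp_all add: Palg_def trunc_lie_def)

lemma to_nil_eq_iff:
  assumes "a \<in> carrier (free_nonassoc g)" "b \<in> carrier (free_nonassoc g)"
  shows "to_nil c g a = to_nil c g b \<longleftrightarrow> evalp c letter a = evalp c letter b"
proof
  assume "to_nil c g a = to_nil c g b"
  thus "evalp c letter a = evalp c letter b"
    using to_nil_eq_evalp[OF _ assms] letter_carrier[OF c_pos] by blast
next
  assume e: "evalp c letter a = evalp c letter b"
  obtain m where m: "to_nil c g a = to_nil c g (lynpoly m)" "evalp c letter a = comb letter m"
    using evalp_comb[OF assms(1)] ok_letter by metis
  obtain n where n: "to_nil c g b = to_nil c g (lynpoly n)" "evalp c letter b = comb letter n"
    using evalp_comb[OF assms(2)] ok_letter by metis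
  have "m w = n w" if "w \<in> W" for w using comb_letter_inj[of m n w] that e m n by simp
  hence "lynpoly m = lynpoly n" unfolding lynpoly_def by (intro sum.cong) auto
  thus "to_nil c g a = to_nil c g b" using m n by simp
qed

text \<open>
  The isomorphism is the evaluation at the letters. It is injective since Lyndon brackets span the free
  nilpotent Lie ring and have independent values, see \<open>to_nil_eq_iff\<close>.
\<close>

lemma free_nilpotent_iso: "alg_iso \<Z> (free_nilpotent c g) Palg"
proof -
  let ?A = "free_nonassoc g" and ?F = "free_nilpotent c g" and ?e = "evalp c letter"
  define r where "r x = (SOME a. a \<in> carrier ?A \<and> to_nil c g a = x)" for x
  have r: "r x \<in> carrier ?A" "to_nil c g (r x) = x" if "x \<in> carrier ?F" for x
    using someI_ex[of "\<lambda>a. a \<in> carrier ?A \<and> to_nil c g a = x"] to_nil_surj[OF that] unfolding r_def by metis+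
  have er: "?e (r (to_nil c g a)) = ?e a" if "a \<in> carrier ?A" for a
    using to_nil_eq_iff[of "r (to_nil c g a)" a] r[OF to_nil_hom(4)[OF that that]] that by simp
  show ?thesis unfolding alg_iso_def
  proof (intro exI[of _ "\<lambda>x. ?e (r x)"] conjI ballI)
    show "bij_betw (\<lambda>x. ?e (r x)) (carrier ?F) (carrier Palg)"
    proof (rule bij_betw_imageI)
      show "inj_on (\<lambda>x. ?e (r x)) (carrier ?F)"
      proof (rule inj_onI)
        fix x y assume "x \<in> carrier ?F" "y \<in> carrier ?F" "?e (r x) = ?e (r y)"
        thus "x = y" using to_nil_eq_iff[of "r x" "r y"] r[of x] r[of y] by simp
      qed
      show "(\<lambda>x. ?e (r x)) ` carrier ?F = carrier Palg"
      proof (rule subset_antisym)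
        show "(\<lambda>x. ?e (r x)) ` carrier ?F \<subseteq> carrier Palg" using evalp_P r by auto
        show "carrier Palg \<subseteq> (\<lambda>x. ?e (r x)) ` carrier ?F"
        proof
          fix p assume "p \<in> carrier Palg"
          then obtain n where n: "p = comb letter n" by (auto simp: P_def)
          have "p = ?e (r (to_nil c g (lynpoly n)))" unfolding er[OF lynpoly_carrier] evalp_lynpoly n ..
          thus "p \<in> (\<lambda>x. ?e (r x)) ` carrier ?F" using to_nil_hom(4)[OF lynpoly_carrier lynpoly_carrier] by blast
        qed
      qed
    qed
    fix x assume x: "x \<in> carrier ?F"
    show "?e (r (k \<odot>\<^bsub>?F\<^esub> x)) = k \<odot>\<^bsub>Palg\<^esub> ?e (r x)" for k
      using er[OF free_nonassoc_closed(3)[OF r(1)[OF x] r(1)[OF x], of k]] to_nil_hom(2)[OF r(1)[OF x] r(1)[OF x], of c k]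
        evalp_scale[OF r(1)[OF x]] r[OF x] by simp
    fix y assume y: "y \<in> carrier ?F"
    show "?e (r (x \<oplus>\<^bsub>?F\<^esub> y)) = ?e (r x) \<oplus>\<^bsub>Palg\<^esub> ?e (r y)"
      using er[OF free_nonassoc_closed(1)[OF r(1)[OF x] r(1)[OF y]]] to_nil_hom(1)[OF r(1)[OF x] r(1)[OF y], of c]
        evalp_add[OF r(1)[OF x] r(1)[OF y]] r[OF x] r[OF y] by simp
    show "?e (r (x \<otimes>\<^bsub>?F\<^esub> y)) = ?e (r x) \<otimes>\<^bsub>Palg\<^esub> ?e (r y)"
      using er[OF free_nonassoc_closed(4)[OF r(1)[OF x] r(1)[OF y]]] to_nil_hom(3)[OF r(1)[OF x] r(1)[OF y], of c]
        evalp_mult[OF r(1)[OF x] r(1)[OF y]] r[OF x] r[OF y] by simp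
  qed
qed

end

section \<open>Triangular lattices\<close>

text \<open>
  The vectors \<open>v u\<close> form a triangular system with respect to the weight \<open>\<kappa>\<close>, with diagonal entries \<open>D\<close>. At an
  index \<open>x\<close> of least weight with \<open>m x \<noteq> 0\<close>, the combination has the coordinate \<open>m x * D x\<close>, which is not
  small.
\<close>

lemma triangular_low:
  fixes v :: "'a \<Rightarrow> 'a \<Rightarrow> int" and \<kappa> :: "'a \<Rightarrow> nat"
  assumes W: "finite W" and D: "\<And>w. w \<in> W \<Longrightarrow> 0 < D w" "\<And>w. w \<in> W \<Longrightarrow> v w w = D w"
    and tri: "\<And>u w. u \<in> W \<Longrightarrow> w \<in> W \<Longrightarrow> w \<noteq> u \<Longrightarrow> \<kappa> w \<le> \<kappa> u \<Longrightarrow> v u w = 0"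
    and small: "\<And>w. w \<in> W \<Longrightarrow> \<kappa> w \<le> k \<Longrightarrow> \<bar>\<Sum>u\<in>W. m u * v u w\<bar> < D w"
    and w: "w \<in> W" "\<kappa> w \<le> k"
  shows "m w = 0"
proof (rule ccontr)
  assume "m w \<noteq> 0"
  then obtain x where x: "x \<in> W \<and> \<kappa> x \<le> k \<and> m x \<noteq> 0"
    and min: "\<And>u. u \<in> W \<and> \<kappa> u \<le> k \<and> m u \<noteq> 0 \<Longrightarrow> \<kappa> x \<le> \<kappa> u"
    using ex_has_least_nat[of "\<lambda>u. u \<in> W \<and> \<kappa> u \<le> k \<and> m u \<noteq> 0" w \<kappa>] w by blast
  have "(\<Sum>u\<in>W. m u * v u x) = (\<Sum>u\<in>{x}. m u * v u x)"
  proof (rule sum.mono_neutral_right)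
    show "\<forall>u\<in>W - {x}. m u * v u x = 0"
    proof
      fix u assume u: "u \<in> W - {x}"
      show "m u * v u x = 0"
      proof (cases "m u = 0")
        case False
        hence "\<kappa> x \<le> \<kappa> u" using min[of u] x u by (cases "\<kappa> u \<le> k") auto
        thus ?thesis using tri[of u x] u x by auto
      qed simp
    qed
  qed (use W x in auto)
  hence "\<bar>m x * D x\<bar> < D x" using small[of x] x D(2) by simp
  moreover have "1 \<le> \<bar>m x\<bar>" using x by linarith
  hence "D x \<le> \<bar>m x\<bar> * D x" using D(1)[of x] x mult_right_mono[of 1 "\<bar>m x\<bar>" "D x"] by simp
  ultimately show False using D(1)[of x] x by (simp add: abs_mult)
qed

text \<open>
  Division with remainder, starting from the lowest weight. Subtracting a multiple of a vector of
  weight \<open>k + 1\<close> changes its own coordinate and coordinates of greater weight, but no others.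
\<close>

lemma triangular_reduce:
  fixes v :: "'a \<Rightarrow> 'a \<Rightarrow> int" and \<kappa> :: "'a \<Rightarrow> nat" and x :: "'a \<Rightarrow> int"
  assumes W: "finite W" and D: "\<And>w. w \<in> W \<Longrightarrow> 0 < D w" "\<And>w. w \<in> W \<Longrightarrow> v w w = D w"
    and tri: "\<And>u w. u \<in> W \<Longrightarrow> w \<in> W \<Longrightarrow> w \<noteq> u \<Longrightarrow> \<kappa> w \<le> \<kappa> u \<Longrightarrow> v u w = 0"
  shows "\<exists>m. (\<forall>w\<in>W. \<kappa> w \<le> k \<longrightarrow> m w = 0) \<and>
    (\<forall>w\<in>W. k < \<kappa> w \<longrightarrow> 0 \<le> x w - (\<Sum>u\<in>W. m u * v u w) \<and> x w - (\<Sum>u\<in>W. m u * v u w) < D w)"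
proof -
  define N where "N = Max (insert 0 (\<kappa> ` W))"
  have N: "\<kappa> w \<le> N" if "w \<in> W" for w unfolding N_def using W that by (intro Max_ge) auto
  show ?thesis
  proof (induction "N - k" arbitrary: k x)
    case 0
    show ?case by (rule exI[of _ "\<lambda>w. 0"]) (use N 0 in fastforce)
  next
    case (Suc l)
    define m1 where "m1 w = (if \<kappa> w = Suc k then x w div D w else 0)" for w
    define x' where "x' w = x w - (\<Sum>u\<in>W. m1 u * v u w)" for w
    obtain m2 where m2: "\<And>w. w \<in> W \<Longrightarrow> \<kappa> w \<le> Suc k \<Longrightarrow> m2 w = 0"
      "\<And>w. w \<in> W \<Longrightarrow> Suc k < \<kappa> w \<Longrightarrow> 0 \<le> x' w - (\<Sum>u\<in>W. m2 u * v u w) \<and> x' w - (\<Sum>u\<in>W. m2 u * v u w) < D w"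
    proof -
      have "l = N - Suc k" using Suc.hyps(2) by simp
      from Suc.hyps(1)[OF this, of x'] show thesis using that by blast
    qed
    have eq: "x w - (\<Sum>u\<in>W. (m1 u + m2 u) * v u w) = x' w - (\<Sum>u\<in>W. m2 u * v u w)" for w
      by (simp add: x'_def distrib_right sum.distrib)
    have at: "x' w - (\<Sum>u\<in>W. m2 u * v u w) = x w mod D w" if w: "w \<in> W" "\<kappa> w = Suc k" for w
    proof -
      have "m2 u * v u w = 0" if "u \<in> W" for u
        using m2(1)[of u] tri[of u w] w that by (cases "\<kappa> u \<le> Suc k"; cases "u = w") auto
      hence "(\<Sum>u\<in>W. m2 u * v u w) = 0" by (intro sum.neutral) blast
      moreover have "(\<Sum>u\<in>W. m1 u * v u w) = (\<Sum>u\<in>{w}. m1 u * v u w)"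
        by (rule sum.mono_neutral_right) (use W w tri[of _ w] in \<open>auto simp: m1_def\<close>)
      ultimately show ?thesis using w D(2)[of w]
        by (simp add: x'_def m1_def minus_div_mult_eq_mod)
    qed
    show ?case
    proof (intro exI[of _ "\<lambda>w. m1 w + m2 w"] conjI ballI impI)
      fix w assume w: "w \<in> W" "\<kappa> w \<le> k"
      thus "m1 w + m2 w = 0" using m2(1)[of w] by (simp add: m1_def)
    next
      fix w assume w: "w \<in> W" "k < \<kappa> w"
      hence "0 \<le> x' w - (\<Sum>u\<in>W. m2 u * v u w) \<and> x' w - (\<Sum>u\<in>W. m2 u * v u w) < D w"
        using m2(2)[of w] at[of w] D(1)[of w] by (cases "\<kappa> w = Suc k") auto
      thus "0 \<le> x w - (\<Sum>u\<in>W. (m1 u + m2 u) * v u w)" "x w - (\<Sum>u\<in>W. (m1 u + m2 u) * v u w) < D w"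
        unfolding eq by auto
    qed
  qed
qed

context free_nilp
begin

text \<open>
  The letter \<open>j\<close> has the weight \<open>g + j\<close>. So the weight separates the letters, and every letter, having
  weight less than \<open>2 * g\<close>, is lighter than every word of length at least two. In addition, the weight
  depends only on the letters of a word with their multiplicities, for which Lyndon brackets are
  homogeneous.
\<close>

definition weight :: "nat list \<Rightarrow> nat" where
  "weight w = sum_list (map (\<lambda>j. g + j) w)"

lemma weight_append: "weight (u @ v) = weight u + weight v" by (simp add: weight_def)

lemma weight_single [simp]: "weight [j] = g + j" by (simp add: weight_def)

lemma weight_mset: "mset u = mset w \<Longrightarrow> weight u = weight w"
  unfolding weight_def by (metis mset_map sum_mset_sum_list)

lemma weight_length: "length w * g \<le> weight w"
  by (induction w) (auto simp: weight_def)

lemma weight_pos: "w \<in> W \<Longrightarrow> 0 < weight w"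
  using weight_length[of w] W_D(4)[of w] g_pos by (cases w) auto

lemma W_weight_small:
  assumes "w \<in> W" "weight w < 2 * g"
  obtains j where "j < g" "w = [j]"
proof -
  have "length w < 2"
  proof (rule ccontr)
    assume "\<not> length w < 2"
    hence "2 * g \<le> length w * g" by (intro mult_right_mono) auto
    thus False using weight_length[of w] assms by linarith
  qed
  then obtain j where "w = [j]" using W_D(4)[OF assms(1)] by (cases w) auto
  thus thesis using that assms single_W by auto
qed

lemma W_length_cases:
  assumes "w \<in> W" "\<And>j. j < g \<Longrightarrow> w = [j] \<Longrightarrow> thesis" "2 \<le> length w \<Longrightarrow> thesis"
  shows thesis
  using lyndon_length_cases[OF W_D(1)[OF assms(1)]] assms single_W by metis

lemma lyn_delta: "w \<in> W \<Longrightarrow> comb y (\<lambda>v. if v = w then 1 else 0) = lyn c y w"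
proof -
  assume w: "w \<in> W"
  have "comb y (\<lambda>v. if v = w then 1 else 0) = (\<Sum>v\<in>W. if v = w then lyn c y w else 0)"
    unfolding comb_def by (rule sum.cong) auto
  thus ?thesis using w finite_W by (simp only: sum.delta if_True)
qed

lemma coef_lyn: "w \<in> W \<Longrightarrow> v \<in> W \<Longrightarrow> coef (lyn c letter w) v = (if v = w then 1 else 0)"
  by (subst lyn_delta[symmetric]) (auto simp: coef_comb)

text \<open>
  Lyndon brackets are homogeneous for the weight. For the converse direction, look at the least Lyndon word
  of small weight in the expansion: the other brackets have greater leading words, so that the
  polynomial does not vanish at it.
\<close>

lemma coef_filt_weight:
  assumes "p \<in> P"
  shows "p \<in> filt weight k \<longleftrightarrow> (\<forall>w\<in>W. weight w < k \<longrightarrow> coef p w = 0)"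
proof -
  obtain n where n: "p = comb letter n" using assms by (auto simp: P_def)
  show ?thesis
  proof
    assume l: "\<forall>w\<in>W. weight w < k \<longrightarrow> coef p w = 0"
    show "p \<in> filt weight k" unfolding filt_def
    proof (intro CollectI allI impI)
      fix u assume u: "weight u < k"
      have "n w * lyn c letter w u = 0" if "w \<in> W" for w
        using lyn_support(1)[OF W_D(1)[OF that], of c u] weight_mset[of u w] u l that coef_comb[OF that, of n] n by auto
      thus "p u = 0" unfolding n comb_apply by (intro sum.neutral) blast
    qed
  next
    assume f: "p \<in> filt weight k"
    show "\<forall>w\<in>W. weight w < k \<longrightarrow> coef p w = 0"
    proof (rule ccontr)
      assume neg: "\<not> ?thesis"
      let ?S = "{w \<in> W. weight w < k \<and> n w \<noteq> 0}"
      have S: "finite ?S" "?S \<noteq> {}" using finite_W neg coef_comb n by auto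
      define v where "v = Min ?S"
      have v: "v \<in> W" "weight v < k" "n v \<noteq> 0" using Min_in[OF S] by (auto simp: v_def)
      have "p v = (\<Sum>w\<in>{v}. n w * lyn c letter w v)"
        unfolding n comb_apply
      proof (rule sum.mono_neutral_right)
        show "\<forall>w\<in>W - {v}. n w * lyn c letter w v = 0"
        proof (rule ballI, rule ccontr)
          fix w assume w: "w \<in> W - {v}" and nz: "n w * lyn c letter w v \<noteq> 0"
          hence "w \<le> v" "weight w < k" using lyn_leading(2)[of w c v] W_D lyn_support(1)[of w c v] weight_mset[of v w] v by auto
          moreover have "v \<le> w" unfolding v_def using S(1) w nz calculation by (intro Min_le) auto
          ultimately show False using w by auto
        qed
      qed (use finite_W v in auto)
      hence "p v \<noteq> 0" using v lyn_leading(1)[of v c] W_D by simp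
      thus False using f v by (auto simp: filt_def)
    qed
  qed
qed

text \<open>
  This and the next lemma correspond to \<open>coef_filt_weight\<close>, with the length in place of the weight.
\<close>

lemma P_filt_length:
  assumes "p \<in> P" "\<And>w. w \<in> W \<Longrightarrow> length w < k \<Longrightarrow> coef p w = 0"
  shows "p \<in> filt length k"
  unfolding filt_def
proof (intro CollectI allI impI)
  fix u :: "nat list" assume u: "length u < k"
  have "coef p w * lyn c letter w u = 0" if "w \<in> W" for w
    using lyn_support(2)[OF W_D(1)[OF that], of c u] u assms(2)[OF that] by auto
  hence "comb letter (coef p) u = 0" unfolding comb_apply by (intro sum.neutral) blast
  thus "p u = 0" using comb_coef[OF assms(1)] by simp
qed

lemma coef_filt_length:
  assumes "p \<in> P" "p \<in> filt length k" "w \<in> W" "length w < k"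
  shows "coef p w = 0"
proof (rule ccontr)
  assume nz: "coef p w \<noteq> 0"
  let ?n = "coef p"
  let ?S = "{w \<in> W. length w < k \<and> ?n w \<noteq> 0}"
  have S: "finite ?S" "?S \<noteq> {}" using finite_W nz assms by auto
  define v where "v = Min ?S"
  have v: "v \<in> W" "length v < k" "?n v \<noteq> 0" using Min_in[OF S] by (auto simp: v_def)
  have "p v = comb letter ?n v" using comb_coef[OF assms(1)] by simp
  also have "\<dots> = (\<Sum>w\<in>{v}. ?n w * lyn c letter w v)"
    unfolding comb_apply
  proof (rule sum.mono_neutral_right)
    show "\<forall>w\<in>W - {v}. ?n w * lyn c letter w v = 0"
    proof (rule ballI, rule ccontr)
      fix w assume w: "w \<in> W - {v}" and nz: "?n w * lyn c letter w v \<noteq> 0"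
      hence "w \<le> v" "length w < k" using lyn_leading(2)[of w c v] W_D lyn_support(2)[of w c v] v by auto
      moreover have "v \<le> w" unfolding v_def using S(1) w nz calculation by (intro Min_le) auto
      ultimately show False using w by auto
    qed
  qed (use finite_W v in auto)
  finally have "p v \<noteq> 0" using v lyn_leading(1)[of v c] W_D by simp
  thus False using assms(2) v by (auto simp: filt_def)
qed

text \<open>
  The product \<open>d\<^sup>w\<close> of the numbers \<open>d\<^sub>j\<close> over the letters \<open>j\<close> of \<open>w\<close>.
\<close>

definition diagw :: "(nat \<Rightarrow> nat) \<Rightarrow> nat list \<Rightarrow> int" where
  "diagw d w = prod_list (map (\<lambda>j. int (d j)) w)"

lemma diagw_append: "diagw d (u @ v) = diagw d u * diagw d v" by (simp add: diagw_def)

lemma diagw_single [simp]: "diagw d [j] = int (d j)" by (simp add: diagw_def)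

text \<open>
  The shape \<open>y\<^sub>j = d\<^sub>j x\<^sub>j + higher terms\<close> with positive \<open>d\<^sub>j\<close>, where \<open>x\<^sub>j\<close> is the letter \<open>j\<close> and the order is
  that of the weight.
\<close>

definition tri :: "(nat \<Rightarrow> nat) \<Rightarrow> (nat \<Rightarrow> nat list \<Rightarrow> int) \<Rightarrow> bool" where
  "tri d y \<longleftrightarrow> (\<forall>j<g. 0 < d j \<and> y j \<in> P \<and> (\<forall>w\<in>W. weight w < g + j \<longrightarrow> coef (y j) w = 0)
     \<and> coef (y j) [j] = int (d j))"

lemma tri_D:
  assumes "tri d y" "j < g"
  shows "0 < d j" "y j \<in> P" "w \<in> W \<Longrightarrow> weight w < g + j \<Longrightarrow> coef (y j) w = 0" "coef (y j) [j] = int (d j)"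
  using assms by (auto simp: tri_def)

lemma tri_ok: "tri d y \<Longrightarrow> ok y" by (rule ok_P) (auto simp: tri_def)

lemma letter_P: "j < g \<Longrightarrow> letter j \<in> P"
  using lyn_delta[of "[j]" letter] comb_P[of "\<lambda>v. if v = [j] then 1 else 0"] by (simp add: single_W)

lemma coef_letter: "j < g \<Longrightarrow> w \<in> W \<Longrightarrow> coef (letter j) w = (if w = [j] then 1 else 0)"
  using coef_lyn[of "[j]" w] by (simp add: single_W)

lemma tri_letter_diff:
  assumes "tri d y" "j < g"
  shows "y j - iscale (int (d j)) (letter j) \<in> filt weight (Suc (g + j))"
proof -
  note P = tri_D(2)[OF assms] P_closed(3)[OF letter_P[OF assms(2)] letter_P[OF assms(2)], of "int (d j)"]
  have "coef (y j - iscale (int (d j)) (letter j)) w = 0" if w: "w \<in> W" "weight w < Suc (g + j)" for w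
  proof (cases "w = [j]")
    case True
    thus ?thesis using tri_D(4)[OF assms] w assms
      by (simp add: coef_diff[OF P] coef_scale[OF letter_P] coef_letter)
  next
    case False
    have "weight w < 2 * g" using w assms by simp
    then obtain i where i: "w = [i]" "i < g" using W_weight_small[OF w(1)] by metis
    hence "weight w < g + j" using False w by simp
    thus ?thesis using tri_D(3)[OF assms w(1)] w False assms
      by (simp add: coef_diff[OF P] coef_scale[OF letter_P] coef_letter)
  qed
  thus ?thesis using coef_filt_weight[OF P_closed(2)[OF P]] by blast
qed

lemma meval_letter_filt: "meval c letter t \<in> filt weight (weight (foliage t))"
proof -
  have "meval c letter t w = 0" if "weight w < weight (foliage t)" for w
  proof (rule ccontr)
    assume "meval c letter t w \<noteq> 0"
    from weight_mset[OF meval_letter_support[OF this]] that show False by simp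
  qed
  thus ?thesis by (simp add: filt_def)
qed

text \<open>
  In lowest weight each \<open>y\<^sub>j\<close> may be replaced by \<open>d\<^sub>j x\<^sub>j\<close>, because brackets add weights.
\<close>

lemma meval_tri:
  assumes "tri d y" "gens t \<subseteq> {..<g}"
  shows "meval c y t - iscale (diagw d (foliage t)) (meval c letter t) \<in> filt weight (Suc (weight (foliage t)))"
  using assms(2)
proof (induction t)
  case (Gen j)
  hence "y j - iscale (int (d j)) (letter j) \<in> filt weight (Suc (g + j))"
    by (intro tri_letter_diff[OF assms(1)]) simp
  thus ?case by (simp only: magma_eval.simps foliage.simps weight_single diagw_single)
next
  case (Prod s t)
  let ?a = "meval c letter s" and ?b = "meval c letter t"
  let ?a' = "meval c y s" and ?b' = "meval c y t"
  let ?\<alpha> = "diagw d (foliage s)" and ?\<beta> = "diagw d (foliage t)"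
  let ?r = "?a' - iscale ?\<alpha> ?a" and ?s = "?b' - iscale ?\<beta> ?b"
  have gs: "gens s \<subseteq> {..<g}" "gens t \<subseteq> {..<g}" using Prod.prems by auto
  have r: "?r \<in> filt weight (Suc (weight (foliage s)))" and s: "?s \<in> filt weight (Suc (weight (foliage t)))"
    by (rule Prod.IH(1)[OF gs(1)], rule Prod.IH(2)[OF gs(2)])
  have "?s \<in> filt weight (weight (foliage t))" by (rule subsetD[OF filt_mono s]) simp
  hence "?s + iscale ?\<beta> ?b \<in> filt weight (weight (foliage t))"
    by (rule filt_closed(2)[OF _ filt_closed(4)[OF meval_letter_filt]])
  hence b: "?b' \<in> filt weight (weight (foliage t))" by simp
  have a: "iscale ?\<alpha> ?a \<in> filt weight (weight (foliage s))" by (rule filt_closed(4)[OF meval_letter_filt])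
  have "comm c ?a' ?b' - iscale (?\<alpha> * ?\<beta>) (comm c ?a ?b) = comm c ?r ?b' + comm c (iscale ?\<alpha> ?a) ?s"
    by (simp add: comm_diff_left comm_diff_right comm_scale_left comm_scale_right iscale_iscale mult.commute)
  also have "\<dots> \<in> filt weight (Suc (weight (foliage (Prod s t))))"
  proof (rule filt_closed(2))
    show "comm c ?r ?b' \<in> filt weight (Suc (weight (foliage (Prod s t))))"
      using comm_filt[OF weight_append r b, of c] by (simp only: foliage.simps weight_append add_Suc)
    show "comm c (iscale ?\<alpha> ?a) ?s \<in> filt weight (Suc (weight (foliage (Prod s t))))"
      using comm_filt[OF weight_append a s, of c] by (simp only: foliage.simps weight_append add_Suc_right)
  qed
  finally show ?case by (simp only: magma_eval.simps foliage.simps diagw_append trunc_lie_simps)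
qed

lemma meval_P: "(\<And>j. j \<in> gens t \<Longrightarrow> y j \<in> P) \<Longrightarrow> meval c y t \<in> P"
  by (induction t) (auto intro: P_closed)

lemma lyn_P: "tri d y \<Longrightarrow> w \<in> W \<Longrightarrow> lyn c y w \<in> P"
  by (rule meval_P) (use W_D in \<open>auto simp: gens_lyndon_bracket tri_def\<close>)

text \<open>
  The Lyndon brackets of a triangular tuple form a triangular system with diagonal entries \<open>d\<^sup>w\<close> with
  respect to the Lyndon basis; this is where \<open>triangular_low\<close> and \<open>triangular_reduce\<close> apply.
\<close>

lemma lyn_tri:
  assumes "tri d y" "u \<in> W" "w \<in> W" "weight w \<le> weight u"
  shows "coef (lyn c y u) w = (if w = u then diagw d u else 0)"
proof -
  note fu = foliage_lyndon_bracket[OF W_D(1)[OF assms(2)]]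
  have bP: "lyn c letter u \<in> P" using lyn_delta[OF assms(2), of letter] comb_P by metis
  note P = lyn_P[OF assms(1,2)] P_closed(3)[OF bP bP, of "diagw d u"]
  have "lyn c y u - iscale (diagw d u) (lyn c letter u) \<in> filt weight (Suc (weight u))"
    using meval_tri[OF assms(1), of "lyndon_bracket u"] W_D[OF assms(2)] by (simp add: fu gens_lyndon_bracket)
  hence "coef (lyn c y u - iscale (diagw d u) (lyn c letter u)) w = 0"
    using coef_filt_weight[OF P_closed(2)[OF P]] assms by auto
  thus ?thesis using assms by (simp add: coef_diff[OF P] coef_scale[OF bP] coef_lyn)
qed

lemma diagw_pos: "tri d y \<Longrightarrow> w \<in> W \<Longrightarrow> 0 < diagw d w"
proof -
  assume t: "tri d y" and w: "w \<in> W"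
  have "set w \<subseteq> {..<g} \<Longrightarrow> 0 < diagw d w" for w
    by (induction w) (use tri_D(1)[OF t] in \<open>auto simp: diagw_def\<close>)
  thus ?thesis using W_D(2)[OF w] by blast
qed

lemma coef_sum:
  assumes "finite S" "\<And>u. u \<in> S \<Longrightarrow> f u \<in> P" "w \<in> W"
  shows "sum f S \<in> P \<and> coef (sum f S) w = (\<Sum>u\<in>S. coef (f u) w)"
  using assms
proof (induction S rule: finite_induct)
  case empty
  have "coef 0 w = 0" using coef_diff[OF P_zero P_zero assms(3)] by simp
  thus ?case by (simp only: sum.empty P_zero simp_thms)
next
  case (insert x F)
  hence IH: "sum f F \<in> P" "coef (sum f F) w = (\<Sum>u\<in>F. coef (f u) w)" "f x \<in> P" by auto
  have "f x + sum f F \<in> P \<and> coef (f x + sum f F) w = coef (f x) w + (\<Sum>u\<in>F. coef (f u) w)"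
    using P_closed(1)[OF IH(3,1)] coef_add[OF IH(3,1) assms(3)] IH(2) by simp
  thus ?case unfolding sum.insert[OF insert.hyps] .
qed

lemma coef_comb_gen:
  assumes "tri d y" "w \<in> W"
  shows "coef (comb y m) w = (\<Sum>u\<in>W. m u * coef (lyn c y u) w)"
proof -
  have P: "iscale (m u) (lyn c y u) \<in> P" if "u \<in> W" for u
    using P_closed(3)[OF lyn_P[OF assms(1) that] P_zero] .
  have "coef (comb y m) w = (\<Sum>u\<in>W. coef (iscale (m u) (lyn c y u)) w)"
    unfolding comb_def by (rule conjunct2[OF coef_sum[OF finite_W P assms(2)]])
  thus ?thesis using coef_scale[OF lyn_P[OF assms(1)] assms(2)] by simp
qed

lemma comb_gen_P:
  assumes "tri d y"
  shows "comb y m \<in> P"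
proof -
  have P: "iscale (m u) (lyn c y u) \<in> P" if "u \<in> W" for u
    using P_closed(3)[OF lyn_P[OF assms that] P_zero] .
  have w: "[0] \<in> W" using single_W g_pos by simp
  show ?thesis unfolding comb_def by (rule conjunct1[OF coef_sum[OF finite_W P w]])
qed

lemmas tri_low = triangular_low[OF finite_W, where \<kappa> = weight]
lemmas tri_reduce = triangular_reduce[OF finite_W, where \<kappa> = weight]

lemma comb_gen_low:
  assumes t: "tri d y" and small: "\<And>w. w \<in> W \<Longrightarrow> weight w \<le> k \<Longrightarrow> \<bar>coef (comb y m) w\<bar> < diagw d w"
    and w: "w \<in> W" "weight w \<le> k"
  shows "m w = 0"
  by (rule tri_low[where v = "\<lambda>u. coef (lyn c y u)" and D = "diagw d" and k = k and m = m])
    (use w diagw_pos[OF t] lyn_tri[OF t] small coef_comb_gen[OF t] in auto)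

lemma comb_gen_zero:
  assumes t: "tri d y" and small: "\<And>w. w \<in> W \<Longrightarrow> \<bar>coef (comb y m) w\<bar> < diagw d w"
  shows "comb y m = 0"
proof -
  have "m w = 0" if "w \<in> W" for w
    by (rule comb_gen_low[OF t small that order.refl])
  hence "comb y m = comb y (\<lambda>w. 0)" by (rule comb_cong)
  thus ?thesis using comb_zero by simp
qed

lemma comb_gen_reduce:
  assumes t: "tri d y" and p: "p \<in> P"
  obtains m where "\<And>w. w \<in> W \<Longrightarrow> weight w \<le> k \<Longrightarrow> coef (p - comb y m) w = coef p w"
    "\<And>w. w \<in> W \<Longrightarrow> k < weight w \<Longrightarrow> coef (p - comb y m) w \<in> {0..<diagw d w}"
proof -
  obtain m where m: "\<And>w. w \<in> W \<Longrightarrow> weight w \<le> k \<Longrightarrow> m w = 0"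
    "\<And>w. w \<in> W \<Longrightarrow> k < weight w \<Longrightarrow> 0 \<le> coef p w - (\<Sum>u\<in>W. m u * coef (lyn c y u) w) \<and>
      coef p w - (\<Sum>u\<in>W. m u * coef (lyn c y u) w) < diagw d w"
  proof -
    have "\<exists>m. (\<forall>w\<in>W. weight w \<le> k \<longrightarrow> m w = 0) \<and>
      (\<forall>w\<in>W. k < weight w \<longrightarrow> 0 \<le> coef p w - (\<Sum>u\<in>W. m u * coef (lyn c y u) w) \<and>
        coef p w - (\<Sum>u\<in>W. m u * coef (lyn c y u) w) < diagw d w)"
      by (rule tri_reduce[where v = "\<lambda>u. coef (lyn c y u)" and D = "diagw d"])
        (use diagw_pos[OF t] lyn_tri[OF t] in auto)
    thus thesis using that by blast
  qed
  have e: "coef (p - comb y m) w = coef p w - (\<Sum>u\<in>W. m u * coef (lyn c y u) w)" if "w \<in> W" for w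
    using coef_diff[OF p comb_gen_P[OF t] that] coef_comb_gen[OF t that] by simp
  show thesis
  proof (rule that[of m])
    fix w assume w: "w \<in> W" "weight w \<le> k"
    have "m u * coef (lyn c y u) w = 0" if "u \<in> W" for u
      using m(1)[OF that] lyn_tri[OF t that w(1)] w by (cases "weight u \<le> k") auto
    hence "(\<Sum>u\<in>W. m u * coef (lyn c y u) w) = 0" by (intro sum.neutral) blast
    thus "coef (p - comb y m) w = coef p w" using e[OF w(1)] by simp
  next
    fix w assume "w \<in> W" "k < weight w"
    thus "coef (p - comb y m) w \<in> {0..<diagw d w}" using m(2) e by simp
  qed
qed

text \<open>
  The subalgebra generated by the tuple \<open>y\<close>, see \<open>gen_sub_is_sub\<close> and \<open>gen_sub_least\<close>.
\<close>

definition gen_sub :: "(nat \<Rightarrow> nat list \<Rightarrow> int) \<Rightarrow> (nat list \<Rightarrow> int) set" where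
  "gen_sub y = range (comb y)"

text \<open>
  The subalgebras of the model, in terms of functions only, see \<open>subalgebra_Palg\<close>.
\<close>

definition is_sub :: "(nat list \<Rightarrow> int) set \<Rightarrow> bool" where
  "is_sub M \<longleftrightarrow> M \<subseteq> P \<and> 0 \<in> M \<and> (\<forall>p\<in>M. \<forall>q\<in>M. p - q \<in> M) \<and> (\<forall>p\<in>M. \<forall>q\<in>M. comm c p q \<in> M)"

lemma is_subD:
  assumes "is_sub M"
  shows "M \<subseteq> P" "0 \<in> M" "p \<in> M \<Longrightarrow> q \<in> M \<Longrightarrow> p - q \<in> M" "p \<in> M \<Longrightarrow> q \<in> M \<Longrightarrow> comm c p q \<in> M"
    "p \<in> M \<Longrightarrow> - p \<in> M" "p \<in> M \<Longrightarrow> q \<in> M \<Longrightarrow> p + q \<in> M" "p \<in> M \<Longrightarrow> iscale k p \<in> M"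
proof -
  show "M \<subseteq> P" "0 \<in> M" "p \<in> M \<Longrightarrow> q \<in> M \<Longrightarrow> p - q \<in> M" "p \<in> M \<Longrightarrow> q \<in> M \<Longrightarrow> comm c p q \<in> M" for p q
    using assms by (auto simp: is_sub_def)
  note d = this(2,3)
  show m: "p \<in> M \<Longrightarrow> - p \<in> M" for p using d(2)[OF d(1), of p] by simp
  show a: "p \<in> M \<Longrightarrow> q \<in> M \<Longrightarrow> p + q \<in> M" for p q using d(2)[of p "- q"] m by simp
  assume p: "p \<in> M"
  have n: "iscale (int n) p \<in> M" for n
  proof (induction n)
    case 0
    have "iscale (int 0) p \<in> M" using d(1) by simp
    thus ?case .
  next
    case (Suc n)
    have "iscale (int (Suc n)) p = iscale (int n) p + p" by (simp add: iscale_def fun_eq_iff algebra_simps)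
    moreover have "iscale (int n) p + p \<in> M" by (rule a[OF Suc p])
    ultimately show ?case by (simp only:)
  qed
  show "iscale k p \<in> M"
  proof (cases k)
    case (nonneg n) thus ?thesis using n by simp
  next
    case (neg n)
    have "iscale k p = - iscale (int (Suc n)) p"
    proof
      fix x
      have "k = - int (Suc n)" using neg by simp
      thus "iscale k p x = (- iscale (int (Suc n)) p) x" by (simp only: iscale_apply uminus_apply mult_minus_left)
    qed
    thus ?thesis using m[OF n] by (simp only:)
  qed
qed

lemma gen_sub_is_sub: "tri d y \<Longrightarrow> is_sub (gen_sub y)"
proof -
  assume t: "tri d y"
  have "comm c (comb y m) (comb y n) \<in> range (comb y)" for m n
    by (rule comb_comm[of m n]) (use tri_ok[OF t] in auto)
  moreover have "comb y m - comb y n \<in> range (comb y)" for m n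
    unfolding comb_diff[symmetric] by simp
  moreover have "0 \<in> range (comb y)" using comb_zero by (metis rangeI)
  ultimately show ?thesis unfolding is_sub_def gen_sub_def using comb_gen_P[OF t] by auto
qed

lemma gen_sub_gens: "j < g \<Longrightarrow> y j \<in> gen_sub y"
  using lyn_delta[of "[j]" y] unfolding gen_sub_def by (metis lyndon_bracket_single magma_eval.simps(1) rangeI single_W)

lemma gen_sub_least:
  assumes M: "is_sub M" and y: "\<And>j. j < g \<Longrightarrow> y j \<in> M"
  shows "gen_sub y \<subseteq> M"
proof -
  have ev: "gens t \<subseteq> {..<g} \<Longrightarrow> meval c y t \<in> M" for t
    by (induction t) (use y is_subD(4)[OF M] in auto)
  have lynM: "lyn c y w \<in> M" if "w \<in> W" for w
    using ev W_D[OF that] by (simp add: gens_lyndon_bracket)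
  have "finite S \<Longrightarrow> S \<subseteq> W \<Longrightarrow> (\<Sum>w\<in>S. iscale (m w) (lyn c y w)) \<in> M" for S m
  proof (induction S rule: finite_induct)
    case empty
    show ?case by (simp only: sum.empty is_subD(2)[OF M])
  next
    case (insert x F)
    show ?case unfolding sum.insert[OF insert.hyps]
      by (rule is_subD(6)[OF M is_subD(7)[OF M lynM]]) (use insert in blast)+
  qed
  hence "comb y m \<in> M" for m unfolding comb_def using finite_W by blast
  thus ?thesis unfolding gen_sub_def by blast
qed

lemma subalgebra_Palg: "subalgebra_of \<Z> Palg M \<longleftrightarrow> is_sub M"
proof -
  interpret F: lie_algebra \<Z> "trunc_lie c" by (rule lie_algebra_trunc_lie)
  have inv: "inv\<^bsub>add_monoid Palg\<^esub> p = - p" if "p \<in> P" for p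
  proof -
    have "- p \<in> P" by (rule P_uminus[OF that])
    thus ?thesis unfolding m_inv_def
      by (intro the_equality) (use that in \<open>auto simp: eq_neg_iff_add_eq_0 add.commute\<close>)
  qed
  show ?thesis
  proof
    assume s: "subalgebra_of \<Z> Palg M"
    hence sg: "subgroup M (add_monoid Palg)" by (simp add: subalgebra_of_def submodule_def)
    have MP: "M \<subseteq> P" using subgroup.subset[OF sg] by simp
    have "p - q \<in> M" if "p \<in> M" "q \<in> M" for p q
      using subgroup.m_closed[OF sg that(1) subgroup.m_inv_closed[OF sg that(2)]] inv[of q] that MP by auto
    thus "is_sub M" using s MP subgroup.one_closed[OF sg] by (auto simp: is_sub_def subalgebra_of_def)
  next
    assume M: "is_sub M"
    have "submodule M \<Z> Palg"
    proof (intro submodule.intro submodule_axioms.intro subgroup.intro)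
      fix p assume "p \<in> M"
      thus "inv\<^bsub>add_monoid Palg\<^esub> p \<in> M" using inv[of p] is_subD(1,5)[OF M] by auto
    qed (use is_subD[OF M] in auto)
    thus "subalgebra_of \<Z> Palg M" using is_subD(4)[OF M] by (simp add: subalgebra_of_def)
  qed
qed

definition cos :: "(nat list \<Rightarrow> int) set \<Rightarrow> (nat list \<Rightarrow> int) \<Rightarrow> (nat list \<Rightarrow> int) set" where
  "cos M x = (\<lambda>m. m + x) ` M"

lemma add_index_Palg: "add_index Palg M = card (cos M ` P)"
proof -
  have "a_rcosets\<^bsub>Palg\<^esub> M = cos M ` P"
    by (auto simp: A_RCOSETS_def' a_r_coset_def' cos_def image_def)
  thus ?thesis by (simp add: add_index_def)
qed

lemma cos_eq:
  assumes "is_sub M"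
  shows "cos M x = cos M y \<longleftrightarrow> x - y \<in> M"
proof
  assume e: "cos M x = cos M y"
  have "x \<in> cos M x" unfolding cos_def using is_subD(2)[OF assms] by (force simp: image_iff)
  then obtain m where "m \<in> M" "x = m + y" using e by (auto simp: cos_def)
  thus "x - y \<in> M" by simp
next
  assume d: "x - y \<in> M"
  have "cos M x \<subseteq> cos M y" if "x - y \<in> M" for x y
  proof
    fix z assume "z \<in> cos M x"
    then obtain m where m: "m \<in> M" "z = m + x" by (auto simp: cos_def)
    have "z = (m + (x - y)) + y" using m by simp
    thus "z \<in> cos M y" unfolding cos_def using is_subD(6)[OF assms m(1) that] by blast
  qed
  from this[OF d] this[of y x] show "cos M x = cos M y"
    using is_subD(5)[OF assms d] by auto
qed

text \<open>
  The elements whose coordinate at each \<open>w\<close> lies between \<open>0\<close> and \<open>d\<^sup>w - 1\<close> represent the cosets, by division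
  with remainder along the triangular system.
\<close>

lemma add_index_gen_sub:
  assumes t: "tri d y"
  shows "int (add_index Palg (gen_sub y)) = (\<Prod>w\<in>W. diagw d w)"
proof -
  let ?R = "PiE W (\<lambda>w. {0..<diagw d w})"
  let ?f = "\<lambda>r. cos (gen_sub y) (comb letter r)"
  note sub = gen_sub_is_sub[OF t]
  have "bij_betw ?f ?R (cos (gen_sub y) ` P)"
  proof (rule bij_betw_imageI)
    show "inj_on ?f ?R"
    proof (rule inj_onI)
      fix r s assume r: "r \<in> ?R" and s: "s \<in> ?R" and e: "?f r = ?f s"
      then obtain m where m: "comb letter r - comb letter s = comb y m"
        using cos_eq[OF sub] by (auto simp: gen_sub_def)
      have "\<bar>coef (comb y m) w\<bar> < diagw d w" if "w \<in> W" for w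
      proof -
        have "r w \<in> {0..<diagw d w}" "s w \<in> {0..<diagw d w}" using r s that by blast+
        thus ?thesis unfolding m[symmetric] comb_diff[symmetric] coef_comb[OF that] by auto
      qed
      hence "comb y m = 0" by (rule comb_gen_zero[OF t])
      hence "comb letter r = comb letter s" using m by simp
      hence "r w = s w" if "w \<in> W" for w using comb_letter_inj that by blast
      thus "r = s" using r s by (intro PiE_ext) auto
    qed
    show "?f ` ?R = cos (gen_sub y) ` P"
    proof (rule subset_antisym)
      show "cos (gen_sub y) ` P \<subseteq> ?f ` ?R"
      proof
        fix X assume "X \<in> cos (gen_sub y) ` P"
        then obtain p where p: "p \<in> P" "X = cos (gen_sub y) p" by blast
        obtain m where m: "\<And>w. w \<in> W \<Longrightarrow> 0 < weight w \<Longrightarrow> coef (p - comb y m) w \<in> {0..<diagw d w}"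
          using comb_gen_reduce[OF t p(1), of 0] by metis
        let ?q = "p - comb y m"
        have q: "?q \<in> P" using P_closed(2)[OF p(1) comb_gen_P[OF t]] .
        define r where "r = restrict (coef ?q) W"
        have "comb letter r = comb letter (coef ?q)" by (rule comb_cong) (simp add: r_def)
        hence "comb letter r = ?q" using comb_coef[OF q] by simp
        hence "p - comb letter r \<in> gen_sub y" by (simp add: gen_sub_def)
        hence "X = ?f r" using cos_eq[OF sub] p by blast
        moreover have "r \<in> ?R" using m weight_pos by (auto simp: r_def)
        ultimately show "X \<in> ?f ` ?R" by blast
      qed
    qed auto
  qed
  hence "add_index Palg (gen_sub y) = card ?R" using bij_betw_same_card add_index_Palg by metis
  also have "\<dots> = (\<Prod>w\<in>W. card {0..<diagw d w})" by (rule card_PiE[OF finite_W])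
  finally have "int (add_index Palg (gen_sub y)) = (\<Prod>w\<in>W. int (card {0..<diagw d w}))" by simp
  also have "\<dots> = (\<Prod>w\<in>W. diagw d w)"
    by (rule prod.cong) (use diagw_pos[OF t] in \<open>auto simp: less_imp_le\<close>)
  finally show ?thesis .
qed

end

section \<open>Normal forms of subalgebras\<close>

inductive_set zspan :: "('a::ab_group_add) set \<Rightarrow> 'a set" for S where
  zspan_zero: "0 \<in> zspan S"
| zspan_base: "x \<in> S \<Longrightarrow> x \<in> zspan S"
| zspan_diff: "x \<in> zspan S \<Longrightarrow> y \<in> zspan S \<Longrightarrow> x - y \<in> zspan S"

lemma zspan_uminus: "x \<in> zspan S \<Longrightarrow> - x \<in> zspan S"
  using zspan_diff[OF zspan_zero, of x] by simp

lemma zspan_add: "x \<in> zspan S \<Longrightarrow> y \<in> zspan S \<Longrightarrow> x + y \<in> zspan S"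
  using zspan_diff[OF _ zspan_uminus, of x S y] by simp

lemma zspan_subset:
  assumes "S \<subseteq> T" "0 \<in> T" "\<And>x y. x \<in> T \<Longrightarrow> y \<in> T \<Longrightarrow> x - y \<in> T"
  shows "zspan S \<subseteq> T"
proof
  fix x assume "x \<in> zspan S"
  thus "x \<in> T" by induction (use assms in auto)
qed

context free_nilp
begin

definition brackets :: "(nat list \<Rightarrow> int) set \<Rightarrow> (nat list \<Rightarrow> int) set" where
  "brackets M = zspan {comm c p q | p q. p \<in> M \<and> q \<in> M}"

text \<open>
  For subalgebras of \<open>P\<close> this says \<open>M \<inter> [P, P] = [M, M]\<close>, since \<open>[P, P]\<close> consists of the elements of \<open>P\<close>
  without words of length one, see \<open>pure_P\<close>. In other words, the abelianisation of \<open>M\<close> embeds into that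
  of \<open>P\<close>.
\<close>

definition pure :: "(nat list \<Rightarrow> int) set \<Rightarrow> bool" where
  "pure M \<longleftrightarrow> M \<inter> filt length 2 \<subseteq> brackets M"

text \<open>
  The form in which the finiteness of the index is used, see \<open>index_cofinite\<close>.
\<close>

definition cofinite :: "(nat list \<Rightarrow> int) set \<Rightarrow> bool" where
  "cofinite M \<longleftrightarrow> (\<exists>N>0. \<forall>p\<in>P. iscale N p \<in> M)"

lemma P_filt_1: "p \<in> P \<Longrightarrow> p \<in> filt length 1"
  using P_carrier by (force simp: filt_def)

text \<open>
  The tuple \<open>y\<close> generates \<open>M\<close> modulo words of length at least two, by elimination of one letter after
  the other. By purity, what remains is a sum of brackets of elements of \<open>M\<close>, and approximating
  these elements by elements of \<open>gen_sub y\<close> improves the approximation of the brackets by one degree.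
  Nilpotency ends this process.
\<close>

lemma gen_sub_eq:
  assumes M: "is_sub M" and C: "pure M" and t: "tri d y" and yM: "\<And>j. j < g \<Longrightarrow> y j \<in> M"
    and dv: "\<And>j p. j < g \<Longrightarrow> p \<in> M \<Longrightarrow> p \<in> filt weight (g + j) \<Longrightarrow> int (d j) dvd coef p [j]"
  shows "M = gen_sub y"
proof (rule subset_antisym)
  show sub: "gen_sub y \<subseteq> M" by (rule gen_sub_least[OF M yM])
  note N = gen_sub_is_sub[OF t]
  have MP: "p \<in> P" if "p \<in> M" for p using is_subD(1)[OF M] that by auto
  have NP: "p \<in> P" if "p \<in> gen_sub y" for p using is_subD(1)[OF N] that by auto
  \<comment> \<open>Elimination of the letters less than \<open>k\<close>.\<close>
  have A: "k \<le> g \<Longrightarrow> \<exists>m0\<in>gen_sub y. \<forall>j<k. coef (m - m0) [j] = 0" if m: "m \<in> M" for m k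
  proof (induction k)
    case 0
    thus ?case using is_subD(2)[OF N] by blast
  next
    case (Suc k)
    have "k \<le> g" using Suc.prems by simp
    from Suc.IH[OF this] obtain m0 where m0: "m0 \<in> gen_sub y" "\<And>j. j < k \<Longrightarrow> coef (m - m0) [j] = 0" by blast
    let ?q = "m - m0"
    have k: "k < g" using Suc by simp
    have q: "?q \<in> M" using is_subD(3)[OF M m] m0 sub by blast
    have "?q \<in> filt weight (g + k)"
      unfolding coef_filt_weight[OF MP[OF q]]
    proof (intro ballI impI)
      fix w assume w: "w \<in> W" "weight w < g + k"
      hence "weight w < 2 * g" using k by simp
      then obtain j where j: "w = [j]" using W_weight_small[OF w(1)] by metis
      thus "coef ?q w = 0" using m0(2)[of j] w by simp
    qed
    from dv[OF k q this] obtain a where a: "coef ?q [k] = int (d k) * a" by (elim dvdE)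
    let ?z = "iscale a (y k)"
    note gy = gen_sub_gens[OF k, of y]
    have z: "?z \<in> gen_sub y" by (rule is_subD(7)[OF N gy])
    have "coef (m - (m0 + ?z)) [j] = 0" if j: "j < Suc k" for j
    proof -
      have jW: "[j] \<in> W" using single_W k j by simp
      have e: "m - (m0 + ?z) = ?q - ?z" by (simp add: diff_diff_eq)
      have "coef (m - (m0 + ?z)) [j] = coef ?q [j] - a * coef (y k) [j]"
        unfolding e using coef_diff[OF MP[OF q] NP[OF z] jW] coef_scale[OF NP[OF gy] jW] by simp
      also have "\<dots> = 0"
      proof (cases "j = k")
        case True
        thus ?thesis using a tri_D(4)[OF t k] by simp
      next
        case False
        hence "j < k" using j by simp
        thus ?thesis using m0(2)[of j] tri_D(3)[OF t k jW] by simp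
      qed
      finally show ?thesis .
    qed
    thus ?case using is_subD(6)[OF N m0(1) z] by blast
  qed
  \<comment> \<open>Approximation up to words of length \<open>i + 2\<close>.\<close>
  have B: "\<exists>m0\<in>gen_sub y. m - m0 \<in> filt length (Suc (Suc i))" if m: "m \<in> M" for m i
    using m
  proof (induction i arbitrary: m)
    case 0
    obtain m0 where m0: "m0 \<in> gen_sub y" "\<And>j. j < g \<Longrightarrow> coef (m - m0) [j] = 0" using A[OF 0 order.refl] by blast
    have "m - m0 \<in> filt length (Suc (Suc 0))"
    proof (rule P_filt_length)
      show "m - m0 \<in> P" using P_closed(2)[OF MP[OF 0] NP[OF m0(1)]] .
      fix w assume "w \<in> W" "length w < Suc (Suc 0)"
      thus "coef (m - m0) w = 0" by (elim W_length_cases) (use m0 in auto)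
    qed
    thus ?case using m0(1) by blast
  next
    case (Suc i)
    let ?f = "filt length (Suc (Suc (Suc i)))"
    obtain m0 where m0: "m0 \<in> gen_sub y" "m - m0 \<in> filt length (Suc (Suc i))" using Suc by blast
    have "m - m0 \<in> M" using is_subD(3)[OF M Suc.prems] m0 sub by blast
    moreover have "m - m0 \<in> filt length 2" using m0(2) filt_mono[of 2 "Suc (Suc i)" length] by auto
    ultimately have "m - m0 \<in> brackets M" using C by (auto simp: pure_def)
    moreover have "\<exists>z0\<in>gen_sub y. z - z0 \<in> ?f" if "z \<in> brackets M" for z
      using that unfolding brackets_def
    proof induction
      case zspan_zero
      have "0 - 0 \<in> ?f" using filt_closed(1) by simp
      thus ?case using is_subD(2)[OF N] by blast
    next
      case (zspan_base x)
      then obtain p q where x: "x = comm c p q" "p \<in> M" "q \<in> M" by blast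
      obtain p0 where p0: "p0 \<in> gen_sub y" "p - p0 \<in> filt length (Suc (Suc i))" using Suc.IH[OF x(2)] by blast
      obtain q0 where q0: "q0 \<in> gen_sub y" "q - q0 \<in> filt length (Suc (Suc i))" using Suc.IH[OF x(3)] by blast
      have e: "x - comm c p0 q0 = comm c (p - p0) q + comm c p0 (q - q0)"
        by (simp add: x comm_diff_left comm_diff_right)
      have "comm c (p - p0) q \<in> ?f"
        using comm_filt[OF _ p0(2) P_filt_1[OF MP[OF x(3)]], of c] by simp
      moreover have "comm c p0 (q - q0) \<in> ?f"
        using comm_filt[OF _ P_filt_1[OF NP[OF p0(1)]] q0(2), of c] by simp
      ultimately have "x - comm c p0 q0 \<in> ?f" unfolding e by (rule filt_closed(2))
      thus ?case using is_subD(4)[OF N p0(1) q0(1)] by blast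
    next
      case (zspan_diff u v)
      then obtain u0 v0 where uv: "u0 \<in> gen_sub y" "u - u0 \<in> ?f" "v0 \<in> gen_sub y" "v - v0 \<in> ?f" by blast
      have "u - v - (u0 - v0) = (u - u0) - (v - v0)" by simp
      also have "\<dots> \<in> ?f" by (rule filt_closed(3)[OF uv(2,4)])
      finally show ?case using is_subD(3)[OF N uv(1,3)] by blast
    qed
    ultimately obtain z0 where z0: "z0 \<in> gen_sub y" "m - m0 - z0 \<in> ?f" by blast
    have "m - (m0 + z0) \<in> ?f" using z0(2) by (simp add: diff_diff_eq)
    thus ?case using is_subD(6)[OF N m0(1) z0(1)] by blast
  qed
  show "M \<subseteq> gen_sub y"
  proof
    fix m assume m: "m \<in> M"
    obtain m0 where m0: "m0 \<in> gen_sub y" "m - m0 \<in> filt length (Suc (Suc c))" using B[OF m] by blast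
    have "m - m0 \<in> P" using P_closed(2)[OF MP[OF m] NP[OF m0(1)]] .
    hence "m - m0 \<in> carrier (trunc_lie c)" using P_carrier by blast
    hence "(m - m0) w = 0" for w using m0(2) by (cases "length w \<le> c") (force simp: filt_def)+
    hence "m = m0" by (auto simp: fun_eq_iff)
    thus "m \<in> gen_sub y" using m0 by simp
  qed
qed

text \<open>
  The condition on the entries beyond the diagonal in a Hermite normal form; the modulus at \<open>w\<close> is the
  diagonal entry \<open>d\<^sup>w\<close> of the triangular system in \<open>lyn_tri\<close>.
\<close>

definition reduced :: "(nat \<Rightarrow> nat) \<Rightarrow> (nat \<Rightarrow> nat list \<Rightarrow> int) \<Rightarrow> bool" where
  "reduced d y \<longleftrightarrow> (\<forall>j<g. \<forall>w\<in>W. g + j < weight w \<longrightarrow> coef (y j) w \<in> {0..<diagw d w})"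

text \<open>
  The leading coefficients at the letter \<open>j\<close> form an ideal of the integers, which is not zero by
  \<open>cofinite\<close>; take a generator.
\<close>

lemma leading_generator:
  assumes M: "is_sub M" and fin: "cofinite M" and j: "j < g"
  obtains n p where "0 < n" "p \<in> M" "p \<in> filt weight (g + j)" "coef p [j] = int n"
    "\<And>q. q \<in> M \<Longrightarrow> q \<in> filt weight (g + j) \<Longrightarrow> int n dvd coef q [j]"
proof -
  let ?Q = "\<lambda>n p. 0 < n \<and> p \<in> M \<and> p \<in> filt weight (g + j) \<and> coef p [j] = int n"
  have jW: "[j] \<in> W" using single_W j by simp
  have MP: "p \<in> P" if "p \<in> M" for p using is_subD(1)[OF M] that by auto
  obtain N where N: "0 < N" "\<And>p. p \<in> P \<Longrightarrow> iscale N p \<in> M" using fin by (auto simp: cofinite_def)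
  have "letter j \<in> filt weight (g + j)"
    unfolding coef_filt_weight[OF letter_P[OF j]] using j by (auto simp: coef_letter)
  hence "?Q (nat N) (iscale N (letter j))"
    using N letter_P[OF j] filt_closed(4) coef_scale[OF letter_P[OF j] jW, of N] coef_letter[OF j jW] by simp
  hence ex: "\<exists>n. \<exists>p. ?Q n p" by blast
  define n where "n = (LEAST n. \<exists>p. ?Q n p)"
  obtain p where p: "?Q n p" using LeastI_ex[OF ex] unfolding n_def by blast
  have "int n dvd coef q [j]" if q: "q \<in> M" "q \<in> filt weight (g + j)" for q
  proof (rule ccontr)
    assume nd: "\<not> int n dvd coef q [j]"
    let ?a = "coef q [j] div int n" and ?r = "coef q [j] mod int n"
    have n: "0 < int n" using p by simp
    have "?r \<noteq> 0" using nd by (simp add: dvd_eq_mod_eq_0)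
    hence pos: "0 < ?r" using pos_mod_sign[OF n, of "coef q [j]"] by linarith
    let ?q = "q - iscale ?a p"
    have s: "iscale ?a p \<in> M" using is_subD(7)[OF M] p by blast
    have "coef ?q [j] = ?r" using coef_diff[OF MP[OF q(1)] MP[OF s] jW] coef_scale[OF MP jW, of p ?a] p
      by (simp add: minus_div_mult_eq_mod)
    hence "?Q (nat ?r) ?q" using pos is_subD(3)[OF M q(1) s] filt_closed(3)[OF q(2) filt_closed(4)] p by simp
    hence "n \<le> nat ?r" unfolding n_def by (intro Least_le) blast
    moreover have "?r < int n" using p by simp
    ultimately show False using pos by linarith
  qed
  thus thesis using that p by blast
qed

text \<open>
  Elements with generating leading coefficients form a triangular tuple, which generates \<open>M\<close> by
  \<open>gen_sub_eq\<close>. Reducing its entries by elements of \<open>M\<close> of higher weight does not affect the leading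
  coefficients, so that \<open>gen_sub_eq\<close> applies to the reduced tuple as well.
\<close>

lemma normal_form_exists:
  assumes M: "is_sub M" and C: "pure M" and fin: "cofinite M"
  obtains d y where "tri d y" "reduced d y" "M = gen_sub y"
proof -
  have MP: "p \<in> P" if "p \<in> M" for p using is_subD(1)[OF M] that by auto
  have "\<exists>n p. j < g \<longrightarrow> 0 < n \<and> p \<in> M \<and> p \<in> filt weight (g + j) \<and> coef p [j] = int n \<and>
      (\<forall>q\<in>M. q \<in> filt weight (g + j) \<longrightarrow> int n dvd coef q [j])" for j
  proof (cases "j < g")
    case True
    show ?thesis by (rule leading_generator[OF M fin True]) blast
  qed simp
  then obtain d z where dz: "\<And>j. j < g \<Longrightarrow> 0 < d j \<and> z j \<in> M \<and> z j \<in> filt weight (g + j) \<and>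
      coef (z j) [j] = int (d j) \<and> (\<forall>q\<in>M. q \<in> filt weight (g + j) \<longrightarrow> int (d j) dvd coef q [j])"
    by metis
  have tz: "tri d z" unfolding tri_def using dz MP coef_filt_weight by blast
  have Mz: "M = gen_sub z" by (rule gen_sub_eq[OF M C tz]) (use dz in auto)
  have "\<forall>j. \<exists>m. j < g \<longrightarrow> (\<forall>w\<in>W. weight w \<le> g + j \<longrightarrow> coef (z j - comb z m) w = coef (z j) w) \<and>
      (\<forall>w\<in>W. g + j < weight w \<longrightarrow> coef (z j - comb z m) w \<in> {0..<diagw d w})"
  proof
    fix j
    show "\<exists>m. j < g \<longrightarrow> (\<forall>w\<in>W. weight w \<le> g + j \<longrightarrow> coef (z j - comb z m) w = coef (z j) w) \<and>
      (\<forall>w\<in>W. g + j < weight w \<longrightarrow> coef (z j - comb z m) w \<in> {0..<diagw d w})"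
    proof (cases "j < g")
      case True
      from comb_gen_reduce[OF tz tri_D(2)[OF tz True], of "g + j"] show ?thesis by metis
    qed simp
  qed
  then obtain m where m: "\<And>j w. j < g \<Longrightarrow> w \<in> W \<Longrightarrow> weight w \<le> g + j \<Longrightarrow> coef (z j - comb z (m j)) w = coef (z j) w"
      "\<And>j w. j < g \<Longrightarrow> w \<in> W \<Longrightarrow> g + j < weight w \<Longrightarrow> coef (z j - comb z (m j)) w \<in> {0..<diagw d w}"
    by metis
  define y where "y j = z j - comb z (m j)" for j
  have yM: "y j \<in> M" if "j < g" for j
    unfolding y_def using is_subD(3)[OF M] dz[OF that] Mz by (auto simp: gen_sub_def)
  have ty: "tri d y"
    unfolding tri_def
  proof (intro allI impI conjI ballI)
    fix j assume j: "j < g"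
    show "0 < d j" "y j \<in> P" using dz[OF j] MP yM[OF j] by auto
    show "coef (y j) [j] = int (d j)" using m(1)[OF j, of "[j]"] tri_D(4)[OF tz j] single_W j by (simp add: y_def)
    fix w assume "w \<in> W" "weight w < g + j"
    thus "coef (y j) w = 0" using m(1)[OF j, of w] tri_D(3)[OF tz j, of w] by (simp add: y_def)
  qed
  have "M = gen_sub y" by (rule gen_sub_eq[OF M C ty yM]) (use dz in auto)
  moreover have "reduced d y" unfolding reduced_def using m(2) by (simp add: y_def)
  ultimately show thesis using that ty by blast
qed

text \<open>
  In an element of \<open>gen_sub y\<close> whose coordinates below the letter \<open>j\<close> vanish, the Lyndon brackets of smaller
  weight do not occur, so that the coordinate at \<open>j\<close> comes from \<open>y\<^sub>j\<close> alone.
\<close>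

lemma gen_sub_dvd:
  assumes t: "tri d y" and p: "p \<in> gen_sub y" "p \<in> filt weight (g + j)" and j: "j < g"
  shows "int (d j) dvd coef p [j]"
proof -
  obtain m where m: "p = comb y m" using p by (auto simp: gen_sub_def)
  have jW: "[j] \<in> W" using single_W j by simp
  have pP: "p \<in> P" using comb_gen_P[OF t] m by simp
  have z: "m w = 0" if "w \<in> W" "weight w < g + j" for w
  proof (rule comb_gen_low[OF t, of "g + j - 1"])
    fix v assume v: "v \<in> W" "weight v \<le> g + j - 1"
    hence "coef p v = 0" using p(2) coef_filt_weight[OF pP] g_pos by auto
    thus "\<bar>coef (comb y m) v\<bar> < diagw d v" using m diagw_pos[OF t v(1)] by simp
  qed (use that in auto)
  have "coef p [j] = (\<Sum>u\<in>W. m u * coef (lyn c y u) [j])" using coef_comb_gen[OF t jW] m by simp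
  also have "\<dots> = (\<Sum>u\<in>{[j]}. m u * coef (lyn c y u) [j])"
  proof (rule sum.mono_neutral_right)
    show "\<forall>u\<in>W - {[j]}. m u * coef (lyn c y u) [j] = 0"
    proof
      fix u assume u: "u \<in> W - {[j]}"
      show "m u * coef (lyn c y u) [j] = 0"
        using z[of u] lyn_tri[OF t, of u "[j]"] u jW by (cases "weight u < g + j") auto
    qed
  qed (use finite_W jW in auto)
  also have "\<dots> = m [j] * int (d j)" using lyn_tri[OF t jW jW] by simp
  finally show ?thesis by simp
qed

text \<open>
  The diagonal entries divide each other by \<open>gen_sub_dvd\<close>. The difference of two reduced generators
  has coordinates smaller than the diagonal entries and lies in the lattice, so it vanishes.
\<close>

lemma normal_form_unique:
  assumes t: "tri d y" "tri d' y'" and r: "reduced d y" "reduced d' y'" and e: "gen_sub y = gen_sub y'" and j: "j < g"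
  shows "d j = d' j" "y j = y' j"
proof -
  have le: "d i dvd d' i"
    if "tri d y" "tri d' y'" "gen_sub y = gen_sub y'" "i < g" for d d' y y' i
  proof -
    have "y' i \<in> gen_sub y" using gen_sub_gens[OF that(4), of y'] that(3) by simp
    moreover have "y' i \<in> filt weight (g + i)"
      using tri_D(2,3)[OF that(2,4)] coef_filt_weight by blast
    ultimately have "int (d i) dvd coef (y' i) [i]" using gen_sub_dvd[OF that(1)] that(4) by blast
    thus ?thesis using tri_D(4)[OF that(2,4)] by simp
  qed
  have dd: "d i = d' i" if "i < g" for i
    using le[OF t e that] le[OF t(2,1) e[symmetric] that] by (rule dvd_antisym)
  show "d j = d' j" using dd j by blast
  have D: "diagw d w = diagw d' w" if "w \<in> W" for w
    unfolding diagw_def using W_D(2)[OF that] dd by (intro arg_cong[of _ _ prod_list] map_cong) auto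
  have yP: "y j \<in> P" "y' j \<in> P" using tri_D(2) t j by auto
  have "y j \<in> gen_sub y" "y' j \<in> gen_sub y" using gen_sub_gens[OF j] e by auto
  hence "y j - y' j \<in> gen_sub y" using is_subD(3)[OF gen_sub_is_sub[OF t(1)]] by blast
  then obtain m where m: "y j - y' j = comb y m" by (auto simp: gen_sub_def)
  have "comb y m = 0"
  proof (rule comb_gen_zero[OF t(1)])
    fix w assume w: "w \<in> W"
    have c: "coef (comb y m) w = coef (y j) w - coef (y' j) w"
      unfolding m[symmetric] by (rule coef_diff[OF yP w])
    consider "weight w < g + j" | "weight w = g + j" | "g + j < weight w" by linarith
    thus "\<bar>coef (comb y m) w\<bar> < diagw d w"
    proof cases
      case 1
      thus ?thesis using c tri_D(3)[OF t(1) j w] tri_D(3)[OF t(2) j w] diagw_pos[OF t(1) w] by simp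
    next
      case 2
      hence "weight w < 2 * g" using j by simp
      then obtain i where "w = [i]" using W_weight_small[OF w] by metis
      hence "w = [j]" using 2 by simp
      thus ?thesis using c tri_D(4)[OF t(1) j] tri_D(4)[OF t(2) j] dd[OF j] diagw_pos[OF t(1) w] by simp
    next
      case 3
      have "coef (y j) w \<in> {0..<diagw d w}" "coef (y' j) w \<in> {0..<diagw d' w}"
        using r j w 3 unfolding reduced_def by blast+
      hence "coef (y j) w \<in> {0..<diagw d w}" "coef (y' j) w \<in> {0..<diagw d w}" using D[OF w] by simp_all
      thus ?thesis using c by auto
    qed
  qed
  thus "y j = y' j" using m by simp
qed

text \<open>
  The isomorphism sends \<open>comb y m\<close> to \<open>comb letter m\<close>. It respects brackets because the structure constants are
  the same for all tuples (\<open>comb_comm\<close>), and it is well defined because triangular systems are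
  independent.
\<close>

lemma gen_sub_iso:
  assumes t: "tri d y"
  shows "alg_iso \<Z> (Palg\<lparr>carrier := gen_sub y\<rparr>) Palg"
proof -
  define r where "r p = (SOME m. comb y m = p)" for p
  have inj: "comb letter m = comb letter n" if "comb y m = comb y n" for m n
  proof (rule comb_cong)
    fix w assume w: "w \<in> W"
    have z: "comb y (\<lambda>w. m w - n w) = 0" using that by (simp add: comb_diff)
    have "coef 0 v = 0" if "v \<in> W" for v using coef_diff[OF P_zero P_zero that] by simp
    hence "m w - n w = 0"
      using comb_gen_low[OF t, of "weight w" "\<lambda>w. m w - n w" w] z w diagw_pos[OF t] by simp
    thus "m w = n w" by simp
  qed
  have r: "comb y (r p) = p" if p: "p \<in> gen_sub y" for p
  proof -
    obtain m where "comb y m = p" using p by (auto simp: gen_sub_def)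
    thus ?thesis unfolding r_def by (rule someI[of "\<lambda>m. comb y m = p"])
  qed
  have h: "comb letter (r (comb y m)) = comb letter m" for m
    by (rule inj, rule r) (simp add: gen_sub_def)
  have inj': "comb y m = comb y n" if "comb letter m = comb letter n" for m n
    by (rule comb_cong) (rule comb_letter_inj[OF that])
  show ?thesis unfolding alg_iso_def
  proof (intro exI[of _ "\<lambda>p. comb letter (r p)"] conjI ballI)
    show "bij_betw (\<lambda>p. comb letter (r p)) (carrier (Palg\<lparr>carrier := gen_sub y\<rparr>)) (carrier Palg)"
    proof (rule bij_betw_imageI)
      show "inj_on (\<lambda>p. comb letter (r p)) (carrier (Palg\<lparr>carrier := gen_sub y\<rparr>))"
      proof (rule inj_onI)
        fix p q assume "p \<in> carrier (Palg\<lparr>carrier := gen_sub y\<rparr>)" "q \<in> carrier (Palg\<lparr>carrier := gen_sub y\<rparr>)"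
          and e: "comb letter (r p) = comb letter (r q)"
        thus "p = q" using inj'[OF e] r[of p] r[of q] by simp
      qed
      show "(\<lambda>p. comb letter (r p)) ` carrier (Palg\<lparr>carrier := gen_sub y\<rparr>) = carrier Palg"
        using h by (auto simp: P_def gen_sub_def image_image)
    qed
    fix p assume "p \<in> carrier (Palg\<lparr>carrier := gen_sub y\<rparr>)"
    then obtain m where m: "p = comb y m" by (auto simp: gen_sub_def)
    show "comb letter (r (k \<odot>\<^bsub>Palg\<lparr>carrier := gen_sub y\<rparr>\<^esub> p)) = k \<odot>\<^bsub>Palg\<^esub> comb letter (r p)" for k
      unfolding m by (simp add: comb_scale[symmetric] h)
    fix q assume "q \<in> carrier (Palg\<lparr>carrier := gen_sub y\<rparr>)"
    then obtain n where n: "q = comb y n" by (auto simp: gen_sub_def)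
    show "comb letter (r (p \<oplus>\<^bsub>Palg\<lparr>carrier := gen_sub y\<rparr>\<^esub> q)) = comb letter (r p) \<oplus>\<^bsub>Palg\<^esub> comb letter (r q)"
      unfolding m n by (simp add: comb_add[symmetric] h)
    obtain k where k: "\<And>y. ok y \<Longrightarrow> comm c (comb y m) (comb y n) = comb y k" using comb_comm by metis
    show "comb letter (r (p \<otimes>\<^bsub>Palg\<lparr>carrier := gen_sub y\<rparr>\<^esub> q)) = comb letter (r p) \<otimes>\<^bsub>Palg\<^esub> comb letter (r q)"
      unfolding m n using k[OF tri_ok[OF t]] k[OF ok_letter] by (simp add: h)
  qed
qed

end

section \<open>Isomorphisms of algebras\<close>

definition iso_via ::
  "('r, 'x) ring_scheme \<Rightarrow> ('a \<Rightarrow> 'b) \<Rightarrow> ('r, 'a) module \<Rightarrow> ('r, 'b) module \<Rightarrow> bool" where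
  "iso_via R h L M \<longleftrightarrow> bij_betw h (carrier L) (carrier M)
     \<and> (\<forall>x\<in>carrier L. \<forall>y\<in>carrier L. h (x \<oplus>\<^bsub>L\<^esub> y) = h x \<oplus>\<^bsub>M\<^esub> h y)
     \<and> (\<forall>r\<in>carrier R. \<forall>x\<in>carrier L. h (r \<odot>\<^bsub>L\<^esub> x) = r \<odot>\<^bsub>M\<^esub> h x)
     \<and> (\<forall>x\<in>carrier L. \<forall>y\<in>carrier L. h (x \<otimes>\<^bsub>L\<^esub> y) = h x \<otimes>\<^bsub>M\<^esub> h y)"

lemma alg_iso_iff: "alg_iso R L M \<longleftrightarrow> (\<exists>h. iso_via R h L M)"
  by (simp add: alg_iso_def iso_via_def)

lemma iso_viaD:
  assumes "iso_via R h L M"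
  shows "bij_betw h (carrier L) (carrier M)"
    "x \<in> carrier L \<Longrightarrow> y \<in> carrier L \<Longrightarrow> h (x \<oplus>\<^bsub>L\<^esub> y) = h x \<oplus>\<^bsub>M\<^esub> h y"
    "r \<in> carrier R \<Longrightarrow> x \<in> carrier L \<Longrightarrow> h (r \<odot>\<^bsub>L\<^esub> x) = r \<odot>\<^bsub>M\<^esub> h x"
    "x \<in> carrier L \<Longrightarrow> y \<in> carrier L \<Longrightarrow> h (x \<otimes>\<^bsub>L\<^esub> y) = h x \<otimes>\<^bsub>M\<^esub> h y"
    "x \<in> carrier L \<Longrightarrow> h x \<in> carrier M" "inj_on h (carrier L)" "h ` carrier L = carrier M"
  using assms unfolding iso_via_def bij_betw_def by auto

text \<open>
  All that is needed to invert and to restrict isomorphisms, and to pass to quotients; unlike the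
  module axioms, it is immediate for the algebra of formal sums from which a tensor product is
  constructed.
\<close>

definition closed_ops :: "('r, 'x) ring_scheme \<Rightarrow> ('r, 'a) module \<Rightarrow> bool" where
  "closed_ops R L \<longleftrightarrow> (\<forall>x\<in>carrier L. \<forall>y\<in>carrier L. x \<oplus>\<^bsub>L\<^esub> y \<in> carrier L \<and> x \<otimes>\<^bsub>L\<^esub> y \<in> carrier L)
     \<and> (\<forall>r\<in>carrier R. \<forall>x\<in>carrier L. r \<odot>\<^bsub>L\<^esub> x \<in> carrier L)"

lemma closed_opsD:
  assumes "closed_ops R L"
  shows "x \<in> carrier L \<Longrightarrow> y \<in> carrier L \<Longrightarrow> x \<oplus>\<^bsub>L\<^esub> y \<in> carrier L"
    "x \<in> carrier L \<Longrightarrow> y \<in> carrier L \<Longrightarrow> x \<otimes>\<^bsub>L\<^esub> y \<in> carrier L"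
    "r \<in> carrier R \<Longrightarrow> x \<in> carrier L \<Longrightarrow> r \<odot>\<^bsub>L\<^esub> x \<in> carrier L"
  using assms by (auto simp: closed_ops_def)

lemma (in nonassoc_algebra) closed_ops: "closed_ops R L"
  by (auto simp: closed_ops_def prod_closed)

lemma iso_via_inv:
  assumes h: "iso_via R h L M" and c: "closed_ops R L"
  shows "iso_via R (inv_into (carrier L) h) M L"
proof -
  note D = iso_viaD[OF h]
  let ?g = "inv_into (carrier L) h"
  have g: "?g (h x) = x" if "x \<in> carrier L" for x using inv_into_f_f[OF D(6) that] .
  have ex: "\<exists>x\<in>carrier L. y = h x" if "y \<in> carrier M" for y using D(7) that by auto
  show ?thesis unfolding iso_via_def
  proof (intro conjI ballI)
    show "bij_betw ?g (carrier M) (carrier L)" by (rule bij_betw_inv_into[OF D(1)])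
    fix x assume "x \<in> carrier M"
    then obtain a where a: "a \<in> carrier L" "x = h a" using ex by blast
    show "?g (r \<odot>\<^bsub>M\<^esub> x) = r \<odot>\<^bsub>L\<^esub> ?g x" if "r \<in> carrier R" for r
      using a D(3)[OF that a(1), symmetric] g closed_opsD(3)[OF c that a(1)] by simp
    fix y assume "y \<in> carrier M"
    then obtain b where b: "b \<in> carrier L" "y = h b" using ex by blast
    show "?g (x \<oplus>\<^bsub>M\<^esub> y) = ?g x \<oplus>\<^bsub>L\<^esub> ?g y"
      using a b D(2)[OF a(1) b(1), symmetric] g closed_opsD(1)[OF c a(1) b(1)] by simp
    show "?g (x \<otimes>\<^bsub>M\<^esub> y) = ?g x \<otimes>\<^bsub>L\<^esub> ?g y"
      using a b D(4)[OF a(1) b(1), symmetric] g closed_opsD(2)[OF c a(1) b(1)] by simp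
  qed
qed

lemma iso_via_comp:
  assumes h: "iso_via R h L M" and k: "iso_via R k M N"
  shows "iso_via R (k \<circ> h) L N"
  unfolding iso_via_def using iso_viaD[OF h] iso_viaD[OF k] bij_betw_trans by auto

lemma iso_via_restrict:
  assumes h: "iso_via R h L L'" and M: "M \<subseteq> carrier L"
  shows "iso_via R h (L\<lparr>carrier := M\<rparr>) (L'\<lparr>carrier := h ` M\<rparr>)"
  unfolding iso_via_def using iso_viaD[OF h] M inj_on_subset[OF iso_viaD(6)[OF h] M]
  by (auto simp: bij_betw_def subset_iff)

lemma alg_iso_trans: "alg_iso R L M \<Longrightarrow> alg_iso R M N \<Longrightarrow> alg_iso R L N"
  unfolding alg_iso_iff using iso_via_comp by blast

lemma subalgebra_closed_ops: "subalgebra_of R L M \<Longrightarrow> closed_ops R (L\<lparr>carrier := M\<rparr>)"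
  unfolding subalgebra_of_def closed_ops_def submodule_def submodule_axioms_def
  by (auto dest: subgroup.m_closed)

lemma iso_via_group_hom:
  assumes h: "iso_via R h L L'" and "abelian_group L" "abelian_group L'"
  shows "group_hom (add_monoid L) (add_monoid L') h"
  by (intro group_hom.intro group_hom_axioms.intro abelian_group.a_group assms)
    (use iso_viaD[OF h] in \<open>auto simp: hom_def\<close>)

lemma iso_via_subalgebra:
  assumes h: "iso_via R h L L'" and L: "nonassoc_algebra R L" and L': "nonassoc_algebra R L'"
    and M: "subalgebra_of R L M"
  shows "subalgebra_of R L' (h ` M)"
proof -
  interpret L: nonassoc_algebra R L by fact
  interpret L': nonassoc_algebra R L' by fact
  interpret H: group_hom "add_monoid L" "add_monoid L'" h
    by (rule iso_via_group_hom[OF h L.M.abelian_group_axioms L'.M.abelian_group_axioms])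
  note D = iso_viaD[OF h]
  have sg: "subgroup M (add_monoid L)" and sm: "\<And>r x. r \<in> carrier R \<Longrightarrow> x \<in> M \<Longrightarrow> r \<odot>\<^bsub>L\<^esub> x \<in> M"
    and mu: "\<And>x y. x \<in> M \<Longrightarrow> y \<in> M \<Longrightarrow> x \<otimes>\<^bsub>L\<^esub> y \<in> M"
    using M by (auto simp: subalgebra_of_def submodule_def submodule_axioms_def)
  have MC: "x \<in> carrier L" if "x \<in> M" for x using subgroup.subset[OF sg] that by auto
  have "submodule (h ` M) R L'"
  proof (intro submodule.intro submodule_axioms.intro)
    show "subgroup (h ` M) (add_monoid L')" by (rule H.subgroup_img_is_subgroup[OF sg])
    fix r x assume r: "r \<in> carrier R" and "x \<in> h ` M"
    then obtain m where m: "m \<in> M" "x = h m" by blast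
    hence "r \<odot>\<^bsub>L'\<^esub> x = h (r \<odot>\<^bsub>L\<^esub> m)" using D(3)[OF r MC[OF m(1)]] by simp
    thus "r \<odot>\<^bsub>L'\<^esub> x \<in> h ` M" using sm[OF r m(1)] by blast
  qed
  moreover have "x \<otimes>\<^bsub>L'\<^esub> y \<in> h ` M" if xy: "x \<in> h ` M" "y \<in> h ` M" for x y
  proof -
    obtain m n where m: "m \<in> M" "x = h m" "n \<in> M" "y = h n" using xy by blast
    hence "x \<otimes>\<^bsub>L'\<^esub> y = h (m \<otimes>\<^bsub>L\<^esub> n)" using D(4)[OF MC[OF m(1)] MC[OF m(3)]] by simp
    thus ?thesis using mu[OF m(1,3)] by blast
  qed
  ultimately show ?thesis by (simp add: subalgebra_of_def)
qed

lemma iso_via_coset: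
  assumes h: "iso_via R h L L'" and "I \<subseteq> carrier L" "x \<in> carrier L"
  shows "h ` (I +>\<^bsub>L\<^esub> x) = h ` I +>\<^bsub>L'\<^esub> h x"
  using iso_viaD(2)[OF h] assms unfolding a_r_coset_def' by (auto simp: subset_iff image_iff) 

lemma iso_via_cosets:
  assumes h: "iso_via R h L L'" and "I \<subseteq> carrier L"
  shows "(`) h ` (a_rcosets\<^bsub>L\<^esub> I) = a_rcosets\<^bsub>L'\<^esub> (h ` I)"
proof -
  have "(`) h ` (a_rcosets\<^bsub>L\<^esub> I) = (\<lambda>x. h ` (I +>\<^bsub>L\<^esub> x)) ` carrier L"
    by (auto simp: A_RCOSETS_def')
  also have "\<dots> = (\<lambda>x. h ` I +>\<^bsub>L'\<^esub> h x) ` carrier L"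
    by (rule image_cong) (use iso_via_coset[OF assms] in auto)
  also have "\<dots> = a_rcosets\<^bsub>L'\<^esub> (h ` I)"
    by (auto simp: A_RCOSETS_def' iso_viaD(7)[OF h, symmetric])
  finally show ?thesis .
qed

lemma cosets_subset:
  assumes "closed_ops R L" "I \<subseteq> carrier L" "X \<in> a_rcosets\<^bsub>L\<^esub> I"
  shows "X \<subseteq> carrier L"
  using assms closed_opsD(1)[OF assms(1)] by (auto simp: A_RCOSETS_def' a_r_coset_def')

lemma iso_via_inj_cosets:
  assumes h: "iso_via R h L L'" and c: "closed_ops R L" and I: "I \<subseteq> carrier L"
  shows "inj_on ((`) h) (a_rcosets\<^bsub>L\<^esub> I)"
  using inj_on_image_eq_iff[OF iso_viaD(6)[OF h]] cosets_subset[OF c I] by (intro inj_onI) blast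

lemma iso_via_add_index:
  assumes h: "iso_via R h L L'" and c: "closed_ops R L" and I: "I \<subseteq> carrier L"
  shows "add_index L' (h ` I) = add_index L I"
  unfolding add_index_def iso_via_cosets[OF h I, symmetric]
  by (rule card_image[OF iso_via_inj_cosets[OF h c I]])

text \<open>An isomorphism maps subalgebras bijectively to subalgebras of the same index.\<close>

lemma count_transfer:
  fixes L :: "('r, 'a) module" and L' :: "('r, 'b) module"
  assumes L: "nonassoc_algebra R L" "nonassoc_algebra R L'" and h: "iso_via R h L L'"
    and Q: "\<And>M. subalgebra_of R L M \<Longrightarrow> Q M \<Longrightarrow> Q' (h ` M)"
    and Q': "\<And>M. subalgebra_of R L' M \<Longrightarrow> Q' M \<Longrightarrow> Q (inv_into (carrier L) h ` M)"
  shows "card {M. subalgebra_of R L M \<and> add_index L M = n \<and> Q M}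
    = card {M. subalgebra_of R L' M \<and> add_index L' M = n \<and> Q' M}"
proof -
  let ?g = "inv_into (carrier L) h"
  note c = nonassoc_algebra.closed_ops[OF L(1)] nonassoc_algebra.closed_ops[OF L(2)]
  note g = iso_via_inv[OF h c(1)]
  have sub: "M \<subseteq> carrier L" if "subalgebra_of R L M" for M
    using that subgroup.subset by (force simp: subalgebra_of_def submodule_def)
  have sub': "M \<subseteq> carrier L'" if "subalgebra_of R L' M" for M
    using that subgroup.subset by (force simp: subalgebra_of_def submodule_def)
  have "bij_betw ((`) h) {M. subalgebra_of R L M \<and> add_index L M = n \<and> Q M}
      {M. subalgebra_of R L' M \<and> add_index L' M = n \<and> Q' M}"
  proof (rule bij_betw_byWitness[of _ "(`) ?g"])
    show "\<forall>M\<in>{M. subalgebra_of R L M \<and> add_index L M = n \<and> Q M}. ?g ` (h ` M) = M"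
      using inv_into_image_cancel[OF iso_viaD(6)[OF h]] sub by blast
    show "\<forall>M\<in>{M. subalgebra_of R L' M \<and> add_index L' M = n \<and> Q' M}. h ` (?g ` M) = M"
      using image_inv_into_cancel[OF iso_viaD(7)[OF h]] sub' by blast
    show "(`) h ` {M. subalgebra_of R L M \<and> add_index L M = n \<and> Q M}
        \<subseteq> {M. subalgebra_of R L' M \<and> add_index L' M = n \<and> Q' M}"
      using iso_via_subalgebra[OF h L] iso_via_add_index[OF h c(1) sub] Q by auto
    show "(`) ?g ` {M. subalgebra_of R L' M \<and> add_index L' M = n \<and> Q' M}
        \<subseteq> {M. subalgebra_of R L M \<and> add_index L M = n \<and> Q M}"
      using iso_via_subalgebra[OF g L(2,1)] iso_via_add_index[OF g c(2) sub'] Q' by auto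
  qed
  thus ?thesis by (rule bij_betw_same_card)
qed

lemma iso_via_lower_central:
  assumes h: "iso_via R h L L'" and "abelian_group L" "abelian_group L'"
    and c: "\<And>x y. x \<in> carrier L \<Longrightarrow> y \<in> carrier L \<Longrightarrow> x \<otimes>\<^bsub>L\<^esub> y \<in> carrier L"
  shows "h ` lower_central L i = lower_central L' i \<and> lower_central L i \<subseteq> carrier L"
proof (induction i)
  case 0
  show ?case using iso_viaD(7)[OF h] by simp
next
  case (Suc i)
  interpret H: group_hom "add_monoid L" "add_monoid L'" h by (rule iso_via_group_hom[OF h assms(2,3)])
  show ?case
  proof (cases i)
    case 0
    show ?thesis using iso_viaD(7)[OF h] 0 by simp
  next
    case (Suc k)
    let ?G = "{x \<otimes>\<^bsub>L\<^esub> y | x y. x \<in> carrier L \<and> y \<in> lower_central L i}"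
    let ?G' = "{x \<otimes>\<^bsub>L'\<^esub> y | x y. x \<in> carrier L' \<and> y \<in> lower_central L' i}"
    have IH: "h ` lower_central L i = lower_central L' i" "lower_central L i \<subseteq> carrier L" using Suc.IH by auto
    have GC: "?G \<subseteq> carrier L" using IH(2) c by blast
    have "h ` ?G = ?G'"
    proof (rule subset_antisym)
      show "h ` ?G \<subseteq> ?G'"
      proof
        fix z assume "z \<in> h ` ?G"
        then obtain x y where xy: "z = h (x \<otimes>\<^bsub>L\<^esub> y)" "x \<in> carrier L" "y \<in> lower_central L i" by blast
        hence "z = h x \<otimes>\<^bsub>L'\<^esub> h y" "h x \<in> carrier L'" "h y \<in> lower_central L' i"
          using iso_viaD(4,5)[OF h] IH by auto
        thus "z \<in> ?G'" by blast
      qed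
      show "?G' \<subseteq> h ` ?G"
      proof
        fix z assume "z \<in> ?G'"
        then obtain x' y' where xy: "z = x' \<otimes>\<^bsub>L'\<^esub> y'" "x' \<in> carrier L'" "y' \<in> lower_central L' i" by blast
        obtain x where x: "x \<in> carrier L" "x' = h x" using xy(2) iso_viaD(7)[OF h] by auto
        obtain y where y: "y \<in> lower_central L i" "y' = h y" using xy(3) IH(1) by auto
        have "z = h (x \<otimes>\<^bsub>L\<^esub> y)" using iso_viaD(4)[OF h x(1), of y] IH(2) x y xy(1) by auto
        thus "z \<in> h ` ?G" using x y by blast
      qed
    qed
    hence "h ` generate (add_monoid L) ?G = generate (add_monoid L') ?G'"
      using H.generate_img[of ?G] GC by simp
    moreover have "generate (add_monoid L) ?G \<subseteq> carrier L"
      using H.G.generate_incl[of ?G] GC by simp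
    ultimately show ?thesis using Suc by simp
  qed
qed

text \<open>
  The operations of a quotient are defined by unions over cosets, so they commute with the image map of
  an isomorphism without any assumption that they are well defined.
\<close>

lemma quot_alg_functor:
  assumes f: "iso_via R f T T'" and c: "closed_ops R T" and I: "I \<subseteq> carrier T"
  shows "iso_via R ((`) f) (quot_alg T I) (quot_alg T' (f ` I))"
proof -
  have sub: "X \<subseteq> carrier T" if "X \<in> a_rcosets\<^bsub>T\<^esub> I" for X by (rule cosets_subset[OF c I that])
  note cs = iso_via_coset[OF f I]
  have "f ` (\<Union>a\<in>X. I +>\<^bsub>T\<^esub> (r \<odot>\<^bsub>T\<^esub> a)) = (\<Union>a\<in>f ` X. f ` I +>\<^bsub>T'\<^esub> (r \<odot>\<^bsub>T'\<^esub> a))"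
    if "r \<in> carrier R" "X \<in> a_rcosets\<^bsub>T\<^esub> I" for r X
  proof -
    have "f ` (\<Union>a\<in>X. I +>\<^bsub>T\<^esub> (r \<odot>\<^bsub>T\<^esub> a)) = (\<Union>a\<in>X. f ` (I +>\<^bsub>T\<^esub> (r \<odot>\<^bsub>T\<^esub> a)))" by blast
    also have "\<dots> = (\<Union>a\<in>X. f ` I +>\<^bsub>T'\<^esub> (r \<odot>\<^bsub>T'\<^esub> f a))"
      using sub[OF that(2)] cs closed_opsD(3)[OF c that(1)] iso_viaD(3)[OF f that(1)]
      by (intro SUP_cong refl) (auto simp: subset_iff)
    finally show ?thesis by simp
  qed
  moreover have "f ` (set_add T X Y) = set_add T' (f ` X) (f ` Y)"
    if "X \<in> a_rcosets\<^bsub>T\<^esub> I" "Y \<in> a_rcosets\<^bsub>T\<^esub> I" for X Y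
  proof -
    have "f ` (set_add T X Y) = (\<Union>x\<in>X. \<Union>y\<in>Y. {f (x \<oplus>\<^bsub>T\<^esub> y)})"
      by (auto simp: set_add_def set_mult_def)
    also have "\<dots> = (\<Union>x\<in>X. \<Union>y\<in>Y. {f x \<oplus>\<^bsub>T'\<^esub> f y})"
      using sub[OF that(1)] sub[OF that(2)] iso_viaD(2)[OF f] by (intro SUP_cong refl) (auto simp: subset_iff)
    finally show ?thesis by (auto simp: set_add_def set_mult_def)
  qed
  moreover have "f ` (rcoset_mult T I X Y) = rcoset_mult T' (f ` I) (f ` X) (f ` Y)"
    if "X \<in> a_rcosets\<^bsub>T\<^esub> I" "Y \<in> a_rcosets\<^bsub>T\<^esub> I" for X Y
  proof -
    have "f ` (rcoset_mult T I X Y) = (\<Union>x\<in>X. \<Union>y\<in>Y. f ` (I +>\<^bsub>T\<^esub> (x \<otimes>\<^bsub>T\<^esub> y)))"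
      unfolding rcoset_mult_def by blast
    also have "\<dots> = (\<Union>x\<in>X. \<Union>y\<in>Y. f ` I +>\<^bsub>T'\<^esub> (f x \<otimes>\<^bsub>T'\<^esub> f y))"
      using sub[OF that(1)] sub[OF that(2)] cs closed_opsD(2)[OF c] iso_viaD(4)[OF f]
      by (intro SUP_cong refl) (auto simp: subset_iff)
    finally show ?thesis unfolding rcoset_mult_def by simp
  qed
  ultimately show ?thesis
    unfolding iso_via_def quot_alg_def bij_betw_def
    using iso_via_cosets[OF f I] iso_via_inj_cosets[OF f c I] by simp
qed

section \<open>Extension of scalars is a functor\<close>

lemma tensor_free_simps [simp]:
  "carrier (tensor_free L A) = {p. Poly_Mapping.keys p \<subseteq> carrier L \<times> carrier A}"
  "x \<oplus>\<^bsub>tensor_free L A\<^esub> y = x + y" "\<zero>\<^bsub>tensor_free L A\<^esub> = 0"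
  by (simp_all add: tensor_free_def)

text \<open>
  The product of formal sums, with the arguments in a form suited to induction over formal sums.
\<close>

definition tmult :: "(int, 'a) module \<Rightarrow> ('b, 'x) ring_scheme \<Rightarrow> ('a \<times> 'b \<Rightarrow>\<^sub>0 int) \<Rightarrow> ('a \<times> 'b \<Rightarrow>\<^sub>0 int) \<Rightarrow> ('a \<times> 'b \<Rightarrow>\<^sub>0 int)" where
  "tmult L A p q = frag_extend (\<lambda>(x, a). frag_extend (\<lambda>(y, b). frag_of (x \<otimes>\<^bsub>L\<^esub> y, a \<otimes>\<^bsub>A\<^esub> b)) q) p"

definition tsmult :: "('b, 'x) ring_scheme \<Rightarrow> 'b \<Rightarrow> ('a \<times> 'b \<Rightarrow>\<^sub>0 int) \<Rightarrow> ('a \<times> 'b \<Rightarrow>\<^sub>0 int)" where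
  "tsmult A b = frag_extend (\<lambda>(x, a). frag_of (x, b \<otimes>\<^bsub>A\<^esub> a))"

lemma tensor_free_mult [simp]: "p \<otimes>\<^bsub>tensor_free L A\<^esub> q = tmult L A p q"
  and tensor_free_smult [simp]: "b \<odot>\<^bsub>tensor_free L A\<^esub> p = tsmult A b p"
  by (simp_all add: tensor_free_def tmult_def tsmult_def)

lemma frag_extend_diff_fun: "frag_extend (\<lambda>x. F x - G x) p = frag_extend F p - frag_extend G p"
proof -
  have "Poly_Mapping.keys p \<subseteq> UNIV" by simp
  thus ?thesis by (induction p rule: frag_induction) (auto simp: frag_extend_diff algebra_simps)
qed

lemma tmult_of [simp]: "tmult L A (frag_of (x, a)) (frag_of (y, b)) = frag_of (x \<otimes>\<^bsub>L\<^esub> y, a \<otimes>\<^bsub>A\<^esub> b)"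
  by (simp add: tmult_def)

lemma tmult_diff_left: "tmult L A (p - p') q = tmult L A p q - tmult L A p' q"
  by (simp add: tmult_def frag_extend_diff)

lemma tmult_diff_right: "tmult L A p (q - q') = tmult L A p q - tmult L A p q'"
  unfolding tmult_def frag_extend_diff frag_extend_diff_fun[symmetric]
  by (rule arg_cong[of _ _ "\<lambda>F. frag_extend F p"]) auto

lemma tmult_zero [simp]: "tmult L A 0 q = 0" "tmult L A p 0 = 0"
  using tmult_diff_left[of L A 0 0 q] tmult_diff_right[of L A p 0 0] by auto

text \<open>
  A property that is additive in both arguments needs to be checked on generators only.
\<close>

lemma tensor_bilinear_induct:
  assumes "Poly_Mapping.keys p \<subseteq> S" "Poly_Mapping.keys q \<subseteq> T"
    and "\<And>q. P 0 q" "\<And>p. P p 0" "\<And>x y. x \<in> S \<Longrightarrow> y \<in> T \<Longrightarrow> P (frag_of x) (frag_of y)"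
    and "\<And>p p' q. P p q \<Longrightarrow> P p' q \<Longrightarrow> P (p - p') q" "\<And>p q q'. P p q \<Longrightarrow> P p q' \<Longrightarrow> P p (q - q')"
  shows "P p q"
  using assms(1)
proof (induction p rule: frag_induction)
  case (one x)
  from assms(2) show ?case
    by (induction q rule: frag_induction) (use assms one in auto)
qed (use assms in auto)

definition tmap :: "('a \<Rightarrow> 'c) \<Rightarrow> ('a \<times> 'b \<Rightarrow>\<^sub>0 int) \<Rightarrow> ('c \<times> 'b \<Rightarrow>\<^sub>0 int)" where
  "tmap h = frag_extend (\<lambda>(x, a). frag_of (h x, a))"

lemma tmap_simps [simp]: "tmap h 0 = 0" "tmap h (frag_of (x, a)) = frag_of (h x, a)"
  "tmap h (p - q) = tmap h p - tmap h q" "tmap h (p + q) = tmap h p + tmap h q"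
  by (simp_all add: tmap_def frag_extend_diff frag_extend_add)

lemma keys_diff_subset:
  fixes p q :: "'a \<Rightarrow>\<^sub>0 int"
  shows "Poly_Mapping.keys p \<subseteq> S \<Longrightarrow> Poly_Mapping.keys q \<subseteq> S \<Longrightarrow> Poly_Mapping.keys (p - q) \<subseteq> S"
  using keys_diff[of p q] by blast

lemma tmap_keys:
  assumes "Poly_Mapping.keys p \<subseteq> S \<times> A" "\<And>x. x \<in> S \<Longrightarrow> h x \<in> S'"
  shows "Poly_Mapping.keys (tmap h p) \<subseteq> S' \<times> A"
  using assms(1)
proof (induction p rule: frag_induction)
  case (one x)
  thus ?case using assms(2) by (cases x) (auto simp: keys_frag_of)
next
  case (diff a b)
  thus ?case by (simp add: keys_diff_subset)
qed simp

lemma tmap_inverse: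
  assumes "Poly_Mapping.keys p \<subseteq> S \<times> A" "\<And>x. x \<in> S \<Longrightarrow> k (h x) = x"
  shows "tmap k (tmap h p) = p"
  using assms(1)
proof (induction p rule: frag_induction)
  case (one x)
  thus ?case using assms(2) by (cases x) auto
qed auto

lemma tmult_keys:
  assumes "Poly_Mapping.keys p \<subseteq> S \<times> B" "Poly_Mapping.keys q \<subseteq> S \<times> B"
    and "\<And>x y. x \<in> S \<Longrightarrow> y \<in> S \<Longrightarrow> x \<otimes>\<^bsub>L\<^esub> y \<in> S" "\<And>x y. x \<in> B \<Longrightarrow> y \<in> B \<Longrightarrow> x \<otimes>\<^bsub>A\<^esub> y \<in> B"
  shows "Poly_Mapping.keys (tmult L A p q) \<subseteq> S \<times> B"
  using assms(1,2)
proof (rule tensor_bilinear_induct)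
  fix x y assume "x \<in> S \<times> B" "y \<in> S \<times> B"
  thus "Poly_Mapping.keys (tmult L A (frag_of x) (frag_of y)) \<subseteq> S \<times> B"
    using assms(3,4) by (cases x; cases y) (simp add: keys_frag_of)
qed (simp_all add: tmult_diff_left tmult_diff_right keys_diff_subset)

lemma tsmult_keys:
  assumes "Poly_Mapping.keys p \<subseteq> S \<times> B" "\<And>x. x \<in> B \<Longrightarrow> b \<otimes>\<^bsub>A\<^esub> x \<in> B"
  shows "Poly_Mapping.keys (tsmult A b p) \<subseteq> S \<times> B"
  using assms(1)
proof (induction p rule: frag_induction)
  case (one x)
  thus ?case using assms(2) by (cases x) (auto simp: tsmult_def keys_frag_of)
next
  case (diff p q)
  thus ?case unfolding tsmult_def frag_extend_diff by (rule keys_diff_subset)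
qed (simp add: tsmult_def)

definition closed_ring :: "('b, 'x) ring_scheme \<Rightarrow> bool" where
  "closed_ring A \<longleftrightarrow> (\<forall>x\<in>carrier A. \<forall>y\<in>carrier A. x \<oplus>\<^bsub>A\<^esub> y \<in> carrier A \<and> x \<otimes>\<^bsub>A\<^esub> y \<in> carrier A)"

lemma closed_ops_tensor_free:
  assumes "closed_ops R L" "closed_ring A"
  shows "closed_ops A (tensor_free L A)"
  unfolding closed_ops_def
proof (intro conjI ballI)
  have A: "x \<otimes>\<^bsub>A\<^esub> y \<in> carrier A" if "x \<in> carrier A" "y \<in> carrier A" for x y
    using assms(2) that by (simp add: closed_ring_def)
  fix p assume p: "p \<in> carrier (tensor_free L A)"
  show "r \<odot>\<^bsub>tensor_free L A\<^esub> p \<in> carrier (tensor_free L A)" if "r \<in> carrier A" for r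
    using tsmult_keys[of p "carrier L" "carrier A", where b = r and A = A] A[OF that] p by simp
  fix q assume q: "q \<in> carrier (tensor_free L A)"
  show "p \<otimes>\<^bsub>tensor_free L A\<^esub> q \<in> carrier (tensor_free L A)"
    using tmult_keys[of p "carrier L" "carrier A" q L A] closed_opsD(2)[OF assms(1)] A p q by simp
  show "p \<oplus>\<^bsub>tensor_free L A\<^esub> q \<in> carrier (tensor_free L A)"
    using p q keys_add[of p q] by auto
qed

lemma abelian_group_tensor_free: "abelian_group (tensor_free L A)"
proof (rule abelian_groupI)
  fix x assume x: "x \<in> carrier (tensor_free L A)"
  show "\<exists>y\<in>carrier (tensor_free L A). y \<oplus>\<^bsub>tensor_free L A\<^esub> x = \<zero>\<^bsub>tensor_free L A\<^esub>"
    using x by (intro bexI[of _ "- x"]) auto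
qed (use keys_add in \<open>fastforce simp: add_ac\<close>)+

lemma tensor_relations_subset:
  assumes "closed_ops R L" "closed_ring A"
  shows "tensor_relations L A \<subseteq> carrier (tensor_free L A)"
proof
  fix r assume "r \<in> tensor_relations L A"
  then consider (1) x y a where "r = frag_of (x \<oplus>\<^bsub>L\<^esub> y, a) - frag_of (x, a) - frag_of (y, a)"
      "x \<in> carrier L" "y \<in> carrier L" "a \<in> carrier A"
    | (2) x a b where "r = frag_of (x, a \<oplus>\<^bsub>A\<^esub> b) - frag_of (x, a) - frag_of (x, b)"
      "x \<in> carrier L" "a \<in> carrier A" "b \<in> carrier A"
    unfolding tensor_relations_def by blast
  hence "Poly_Mapping.keys r \<subseteq> carrier L \<times> carrier A"
  proof cases
    case 1
    have "x \<oplus>\<^bsub>L\<^esub> y \<in> carrier L" using closed_opsD(1)[OF assms(1)] 1 by blast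
    thus ?thesis unfolding 1(1) by (intro keys_diff_subset) (use 1 in \<open>simp_all add: keys_frag_of\<close>)
  next
    case 2
    have "a \<oplus>\<^bsub>A\<^esub> b \<in> carrier A" using assms(2) 2 by (simp add: closed_ring_def)
    thus ?thesis unfolding 2(1) by (intro keys_diff_subset) (use 2 in \<open>simp_all add: keys_frag_of\<close>)
  qed
  thus "r \<in> carrier (tensor_free L A)" by simp
qed

text \<open>
  An isomorphism of the first factors acts on formal sums, where it permutes the biadditivity relations.
\<close>

lemma tensor_functor:
  fixes L :: "(int, 'a) module" and L' :: "(int, 'c) module" and A :: "('b, 'x) ring_scheme"
  assumes h: "iso_via R h L L'" and c: "closed_ops R L" and A: "closed_ring A"
  shows "alg_iso A (tensor L A) (tensor L' A)"
proof -
  let ?f = "tmap h :: ('a \<times> 'b \<Rightarrow>\<^sub>0 int) \<Rightarrow> _" and ?k = "tmap (inv_into (carrier L) h) :: ('c \<times> 'b \<Rightarrow>\<^sub>0 int) \<Rightarrow> _"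
  let ?T = "tensor_free L A" and ?T' = "tensor_free L' A"
  note D = iso_viaD[OF h] and E = iso_viaD[OF iso_via_inv[OF h c]]
  have f: "iso_via A ?f ?T ?T'"
    unfolding iso_via_def
  proof (intro conjI ballI)
    show "bij_betw ?f (carrier ?T) (carrier ?T')"
    proof (rule bij_betw_byWitness[of _ ?k])
      show "\<forall>p\<in>carrier ?T. ?k (?f p) = p"
        using tmap_inverse[of _ "carrier L" "carrier A" "inv_into (carrier L) h" h] inv_into_f_f[OF D(6)] by simp
      show "\<forall>p\<in>carrier ?T'. ?f (?k p) = p"
        using tmap_inverse[of _ "carrier L'" "carrier A" h "inv_into (carrier L) h"]
          f_inv_into_f[of _ h "carrier L"] D(7) by simp
      show "?f ` carrier ?T \<subseteq> carrier ?T'"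
        using tmap_keys[of _ "carrier L" "carrier A" h "carrier L'"] D(5) by (simp add: image_subset_iff)
      show "?k ` carrier ?T' \<subseteq> carrier ?T"
        using tmap_keys[of _ "carrier L'" "carrier A" _ "carrier L"] E(5) by (simp add: image_subset_iff)
    qed
    fix p assume p: "p \<in> carrier ?T"
    hence "Poly_Mapping.keys p \<subseteq> carrier L \<times> carrier A" by simp
    thus "?f (r \<odot>\<^bsub>?T\<^esub> p) = r \<odot>\<^bsub>?T'\<^esub> ?f p" for r
      unfolding tensor_free_smult
    proof (induction p rule: frag_induction)
      case (one x)
      thus ?case by (cases x) (auto simp: tsmult_def)
    qed (auto simp: tsmult_def frag_extend_diff)
    fix q assume q: "q \<in> carrier ?T"
    show "?f (p \<oplus>\<^bsub>?T\<^esub> q) = ?f p \<oplus>\<^bsub>?T'\<^esub> ?f q" by simp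
    have pq: "Poly_Mapping.keys p \<subseteq> carrier L \<times> carrier A" "Poly_Mapping.keys q \<subseteq> carrier L \<times> carrier A"
      using p q by auto
    show "?f (p \<otimes>\<^bsub>?T\<^esub> q) = ?f p \<otimes>\<^bsub>?T'\<^esub> ?f q"
      unfolding tensor_free_mult using pq
      by (rule tensor_bilinear_induct) (auto simp: tmult_diff_left tmult_diff_right D(4))
  qed
  have rel: "?f ` tensor_relations L A = tensor_relations L' A"
  proof (rule subset_antisym)
    show "?f ` tensor_relations L A \<subseteq> tensor_relations L' A"
      unfolding tensor_relations_def image_Un using D(2,5) by (intro Un_mono) (fastforce, fastforce)
    show "tensor_relations L' A \<subseteq> ?f ` tensor_relations L A"
    proof
      fix r assume "r \<in> tensor_relations L' A"
      then consider (1) x y a where "r = frag_of (x \<oplus>\<^bsub>L'\<^esub> y, a) - frag_of (x, a) - frag_of (y, a)"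
          "x \<in> carrier L'" "y \<in> carrier L'" "a \<in> carrier A"
        | (2) x a b where "r = frag_of (x, a \<oplus>\<^bsub>A\<^esub> b) - frag_of (x, a) - frag_of (x, b)"
          "x \<in> carrier L'" "a \<in> carrier A" "b \<in> carrier A"
        unfolding tensor_relations_def by blast
      thus "r \<in> ?f ` tensor_relations L A"
      proof cases
        case 1
        obtain x0 where x0: "x0 \<in> carrier L" "x = h x0" using 1(2) D(7) by auto
        obtain y0 where y0: "y0 \<in> carrier L" "y = h y0" using 1(3) D(7) by auto
        have "r = ?f (frag_of (x0 \<oplus>\<^bsub>L\<^esub> y0, a) - frag_of (x0, a) - frag_of (y0, a))"
          using 1 x0 y0 D(2) by simp
        thus ?thesis unfolding tensor_relations_def using x0 y0 1(4) by blast
      next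
        case 2
        obtain x0 where x0: "x0 \<in> carrier L" "x = h x0" using 2(2) D(7) by auto
        have "r = ?f (frag_of (x0, a \<oplus>\<^bsub>A\<^esub> b) - frag_of (x0, a) - frag_of (x0, b))"
          using 2 x0 by simp
        thus ?thesis unfolding tensor_relations_def using x0 2(3,4) by blast
      qed
    qed
  qed
  interpret H: group_hom "add_monoid ?T" "add_monoid ?T'" ?f
    by (rule iso_via_group_hom[OF f abelian_group_tensor_free abelian_group_tensor_free])
  have sub: "tensor_relations L A \<subseteq> carrier (add_monoid ?T)" using tensor_relations_subset[OF c A] by simp
  have I: "generate (add_monoid ?T) (tensor_relations L A) \<subseteq> carrier ?T"
    using H.G.generate_incl[OF sub] by simp
  show ?thesis
    unfolding tensor_def alg_iso_iff
    using quot_alg_functor[OF f closed_ops_tensor_free[OF c A] I] H.generate_img[OF sub] rel by metis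
qed

lemma iso_count_transfer:
  assumes L: "nonassoc_algebra \<Z> L" "nonassoc_algebra \<Z> L'" and iso: "alg_iso \<Z> L L'"
  shows "iso_count L n = iso_count L' n"
proof -
  obtain h where h: "iso_via \<Z> h L L'" using iso by (auto simp: alg_iso_iff)
  note c = nonassoc_algebra.closed_ops[OF L(1)] nonassoc_algebra.closed_ops[OF L(2)]
  note g = iso_via_inv[OF h c(1)]
  have sub: "M \<subseteq> carrier L" if "subalgebra_of \<Z> L M" for M and L :: "(int, 'z) module"
    using that subgroup.subset by (force simp: subalgebra_of_def submodule_def)
  have main: "alg_iso \<Z> (L'\<lparr>carrier := h ` M\<rparr>) L'"
    if h: "iso_via \<Z> h L L'" and M: "subalgebra_of \<Z> L M" "alg_iso \<Z> (L\<lparr>carrier := M\<rparr>) L"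
    for h and L :: "(int, 'z) module" and L' :: "(int, 'w) module" and M
  proof -
    have "alg_iso \<Z> (L'\<lparr>carrier := h ` M\<rparr>) (L\<lparr>carrier := M\<rparr>)"
      using iso_via_inv[OF iso_via_restrict[OF h sub[OF M(1)]] subalgebra_closed_ops[OF M(1)]]
      by (auto simp: alg_iso_iff)
    from alg_iso_trans[OF alg_iso_trans[OF this M(2)]] show ?thesis using h by (auto simp: alg_iso_iff)
  qed
  show ?thesis unfolding iso_count_def
    by (rule count_transfer[OF L h]) (use main[OF h] main[OF g] in auto)
qed

lemma proiso_count_transfer:
  assumes L: "nonassoc_algebra \<Z> L" "nonassoc_algebra \<Z> L'" and iso: "alg_iso \<Z> L L'"
    and A: "closed_ring profinite_int"
  shows "proiso_count L n = proiso_count L' n"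
proof -
  obtain h where h: "iso_via \<Z> h L L'" using iso by (auto simp: alg_iso_iff)
  note c = nonassoc_algebra.closed_ops[OF L(1)] nonassoc_algebra.closed_ops[OF L(2)]
  note g = iso_via_inv[OF h c(1)]
  have sub: "M \<subseteq> carrier L" if "subalgebra_of \<Z> L M" for M and L :: "(int, 'z) module"
    using that subgroup.subset by (force simp: subalgebra_of_def submodule_def)
  let ?t = "\<lambda>L. tensor L profinite_int"
  have main: "alg_iso profinite_int (?t (L'\<lparr>carrier := h ` M\<rparr>)) (tensor L' profinite_int)"
    if h: "iso_via \<Z> h L L'" and c: "closed_ops \<Z> L" "closed_ops \<Z> L'"
      and M: "subalgebra_of \<Z> L M" "alg_iso profinite_int (tensor (L\<lparr>carrier := M\<rparr>) profinite_int) (tensor L profinite_int)"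
      and hM: "subalgebra_of \<Z> L' (h ` M)"
    for h and L :: "(int, 'z) module" and L' :: "(int, 'w) module" and M
  proof -
    have "alg_iso profinite_int (tensor (L'\<lparr>carrier := h ` M\<rparr>) profinite_int) (tensor (L\<lparr>carrier := M\<rparr>) profinite_int)"
      by (rule tensor_functor[OF iso_via_inv[OF iso_via_restrict[OF h sub[OF M(1)]] subalgebra_closed_ops[OF M(1)]]
        subalgebra_closed_ops[OF hM] A])
    from alg_iso_trans[OF alg_iso_trans[OF this M(2)] tensor_functor[OF h c(1) A]] show ?thesis .
  qed
  show ?thesis unfolding proiso_count_def
    by (rule count_transfer[OF L h])
      (use main[OF h c] iso_via_subalgebra[OF h L] main[OF g c(2,1)] iso_via_subalgebra[OF g L(2,1)] in auto)
qed

section \<open>Profinite integers\<close>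

lemma profinite_simps [simp]:
  "x \<oplus>\<^bsub>profinite_int\<^esub> y = (\<lambda>n. (x n + y n) mod int n)"
  "x \<otimes>\<^bsub>profinite_int\<^esub> y = (\<lambda>n. (x n * y n) mod int n)"
  by (simp_all add: profinite_int_def)

lemma profinite_carrier:
  "x \<in> carrier profinite_int \<longleftrightarrow> x 0 = 0 \<and> (\<forall>n>0. \<forall>m. m dvd n \<longrightarrow> x n mod int m = x m)"
  by (simp add: profinite_int_def)

lemma profiniteD: "x \<in> carrier profinite_int \<Longrightarrow> 0 < n \<Longrightarrow> m dvd n \<Longrightarrow> x n mod int m = x m"
  by (simp add: profinite_carrier)

lemma profinite_mod [simp]: "x \<in> carrier profinite_int \<Longrightarrow> x n mod int n = x n"
  by (cases "n = 0") (auto simp: profinite_carrier)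

text \<open>
  Profinite integers from integers that are only compatible as residues. The entry at \<open>0\<close> is \<open>0\<close> by
  convention, whatever \<open>f\<close> is there.
\<close>

lemma profiniteI:
  assumes "\<And>n m. 0 < n \<Longrightarrow> m dvd n \<Longrightarrow> int m dvd f n - f m"
  shows "(\<lambda>n. if n = 0 then 0 else f n mod int n) \<in> carrier profinite_int"
  unfolding profinite_carrier
proof (intro conjI allI impI)
  fix n m :: nat assume nm: "0 < n" "m dvd n"
  hence m: "m \<noteq> 0" by auto
  have "f n mod int n mod int m = f n mod int m" using nm by (intro mod_mod_cancel) simp
  also have "\<dots> = f m mod int m" using assms[OF nm] by (simp add: mod_eq_dvd_iff)
  finally show "(if n = 0 then 0 else f n mod int n) mod int m = (if m = 0 then 0 else f m mod int m)"
    using nm m by simp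
qed simp

lemma profinite_dvd: "x \<in> carrier profinite_int \<Longrightarrow> 0 < n \<Longrightarrow> m dvd n \<Longrightarrow> int m dvd x n - x m"
  using profiniteD[of x n m] by (metis dvd_minus_mod)

lemma profinite_at_0: "x \<in> carrier profinite_int \<Longrightarrow> x 0 = 0"
  by (simp add: profinite_carrier)

lemma profinite_add_closed:
  assumes x: "x \<in> carrier profinite_int" and y: "y \<in> carrier profinite_int"
  shows "(\<lambda>n. (x n + y n) mod int n) \<in> carrier profinite_int"
proof -
  have "(\<lambda>n. if n = 0 then 0 else (x n + y n) mod int n) \<in> carrier profinite_int"
  proof (rule profiniteI)
    fix n m :: nat assume nm: "0 < n" "m dvd n"
    have "int m dvd (x n - x m) + (y n - y m)" using profinite_dvd[OF x nm] profinite_dvd[OF y nm] by simp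
    thus "int m dvd x n + y n - (x m + y m)" by (simp add: algebra_simps)
  qed
  moreover have "(\<lambda>n. if n = 0 then 0 else (x n + y n) mod int n) = (\<lambda>n. (x n + y n) mod int n)"
    by (intro ext) (simp add: profinite_at_0 x y)
  ultimately show ?thesis by simp
qed

lemma profinite_mult_closed:
  assumes x: "x \<in> carrier profinite_int" and y: "y \<in> carrier profinite_int"
  shows "(\<lambda>n. (x n * y n) mod int n) \<in> carrier profinite_int"
proof -
  have "(\<lambda>n. if n = 0 then 0 else (x n * y n) mod int n) \<in> carrier profinite_int"
  proof (rule profiniteI)
    fix n m :: nat assume nm: "0 < n" "m dvd n"
    have "int m dvd (x n - x m) * y n + x m * (y n - y m)"
      using profinite_dvd[OF x nm] profinite_dvd[OF y nm] by simp
    thus "int m dvd x n * y n - x m * y m" by (simp add: algebra_simps)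
  qed
  moreover have "(\<lambda>n. if n = 0 then 0 else (x n * y n) mod int n) = (\<lambda>n. (x n * y n) mod int n)"
    by (intro ext) (simp add: profinite_at_0 x y)
  ultimately show ?thesis by simp
qed

lemma closed_ring_profinite: "closed_ring profinite_int"
  using profinite_add_closed profinite_mult_closed by (simp add: closed_ring_def)

definition pscale :: "int \<Rightarrow> (nat \<Rightarrow> int) \<Rightarrow> nat \<Rightarrow> int" where
  "pscale k x = (\<lambda>n. (k * x n) mod int n)"

lemma pscale_closed:
  assumes x: "x \<in> carrier profinite_int"
  shows "pscale k x \<in> carrier profinite_int"
proof -
  have "(\<lambda>n. if n = 0 then 0 else (k * x n) mod int n) \<in> carrier profinite_int"
  proof (rule profiniteI)
    fix n m :: nat assume nm: "0 < n" "m dvd n"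
    show "int m dvd k * x n - k * x m"
      using profinite_dvd[OF x nm] by (simp add: right_diff_distrib[symmetric])
  qed
  moreover have "(\<lambda>n. if n = 0 then 0 else (k * x n) mod int n) = pscale k x"
    by (intro ext) (simp add: profinite_at_0 x pscale_def)
  ultimately show ?thesis by simp
qed

definition pone :: "nat \<Rightarrow> int" where "pone = (\<lambda>n. if n = 0 then 0 else 1 mod int n)"

lemma pone_closed: "pone \<in> carrier profinite_int"
  unfolding pone_def by (rule profiniteI) simp

lemma mult_pone: "x \<in> carrier profinite_int \<Longrightarrow> (\<lambda>n. (x n * pone n) mod int n) = x"
  using profinite_mod by (auto simp: fun_eq_iff pone_def mod_mult_right_eq profinite_at_0)

section \<open>Tensor products with the profinite integers\<close>

lemma generate_tensor_free:
  assumes S: "S \<subseteq> carrier (tensor_free L A)"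
  shows "generate (add_monoid (tensor_free L A)) S = zspan S"
proof -
  interpret T: abelian_group "tensor_free L A" by (rule abelian_group_tensor_free)
  have inv: "inv\<^bsub>add_monoid (tensor_free L A)\<^esub> h = - h" if "h \<in> carrier (tensor_free L A)" for h
    using T.minus_equality[of "- h" h] that by (simp add: a_inv_def)
  show ?thesis
  proof (rule subset_antisym)
    show "generate (add_monoid (tensor_free L A)) S \<subseteq> zspan S"
    proof
      fix x assume "x \<in> generate (add_monoid (tensor_free L A)) S"
      thus "x \<in> zspan S"
      proof (induction rule: generate.induct)
        case one
        show ?case using zspan_zero by simp
      next
        case (incl h)
        thus ?case by (rule zspan_base)
      next
        case (inv h)
        hence "h \<in> carrier (tensor_free L A)" using S by blast
        thus ?case using \<open>\<And>h. h \<in> carrier (tensor_free L A) \<Longrightarrow> _\<close> zspan_uminus[OF zspan_base[OF inv]] by simp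
      next
        case (eng a b)
        thus ?case using zspan_add by simp
      qed
    qed
    note sg = T.add.generate_is_subgroup[of S]
    have "subgroup (generate (add_monoid (tensor_free L A)) S) (add_monoid (tensor_free L A))"
      using sg S by simp
    note sg = this
    show "zspan S \<subseteq> generate (add_monoid (tensor_free L A)) S"
    proof (rule zspan_subset)
      show "S \<subseteq> generate (add_monoid (tensor_free L A)) S" by (auto intro: generate.incl)
      show "0 \<in> generate (add_monoid (tensor_free L A)) S" using subgroup.one_closed[OF sg] by simp
      fix x y assume xy: "x \<in> generate (add_monoid (tensor_free L A)) S" "y \<in> generate (add_monoid (tensor_free L A)) S"
      hence "y \<in> carrier (tensor_free L A)" using subgroup.subset[OF sg] by auto
      thus "x - y \<in> generate (add_monoid (tensor_free L A)) S"
        using subgroup.m_closed[OF sg xy(1) subgroup.m_inv_closed[OF sg xy(2)]] inv by simp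
    qed
  qed
qed

lemma zspan_mono: "S \<subseteq> T \<Longrightarrow> zspan S \<subseteq> zspan T"
  by (rule zspan_subset) (auto intro: zspan.intros)

lemma zspan_trans: "x - y \<in> zspan S \<Longrightarrow> y - z \<in> zspan S \<Longrightarrow> x - z \<in> zspan S"
  using zspan_add[of "x - y" S "y - z"] by simp

text \<open>
  The additive extension of \<open>\<phi>\<close> to formal sums. The parameter \<open>b\<close> allows values in functions on any type,
  in particular in profinite integers before reduction and in polynomials.
\<close>

definition fsum :: "('a \<Rightarrow> 'b \<Rightarrow> int) \<Rightarrow> ('a \<Rightarrow>\<^sub>0 int) \<Rightarrow> 'b \<Rightarrow> int" where
  "fsum \<phi> f b = (\<Sum>x\<in>Poly_Mapping.keys f. Poly_Mapping.lookup f x * \<phi> x b)"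

lemma fsum_superset:
  assumes "finite S" "Poly_Mapping.keys f \<subseteq> S"
  shows "fsum \<phi> f b = (\<Sum>x\<in>S. Poly_Mapping.lookup f x * \<phi> x b)"
  unfolding fsum_def using assms by (intro sum.mono_neutral_left) (auto simp: in_keys_iff)

lemma fsum_diff: "fsum \<phi> (f - f') b = fsum \<phi> f b - fsum \<phi> f' b"
proof -
  let ?S = "Poly_Mapping.keys f \<union> Poly_Mapping.keys f'"
  have S: "finite ?S" by simp
  have k: "Poly_Mapping.keys (f - f') \<subseteq> ?S" by (rule keys_diff)
  show ?thesis
    unfolding fsum_superset[OF S k] fsum_superset[OF S Un_upper1] fsum_superset[OF S Un_upper2]
    by (simp add: lookup_minus left_diff_distrib sum_subtractf)
qed

lemma fsum_zero [simp]: "fsum \<phi> 0 b = 0" by (simp add: fsum_def)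

lemma fsum_of [simp]: "fsum \<phi> (frag_of x) b = \<phi> x b" by (simp add: fsum_def keys_frag_of)

context free_nilp
begin

text \<open>
  For a subalgebra \<open>M\<close> of the model, viewed as the algebra \<open>LM M\<close>, the profinite extension is \<open>T M\<close>; it is a
  quotient of the algebra \<open>TF M\<close> of formal sums by the span of the biadditivity relations \<open>rels M\<close>, and
  \<open>tclass M f\<close> is the class of the formal sum \<open>f\<close>. All computations take place in \<open>TF M\<close>.
\<close>

abbreviation PI :: "(nat \<Rightarrow> int) ring" where "PI \<equiv> profinite_int"

definition LM :: "(nat list \<Rightarrow> int) set \<Rightarrow> (int, nat list \<Rightarrow> int) module" where
  "LM M = Palg\<lparr>carrier := M\<rparr>"

lemma LM_simps [simp]:
  "carrier (LM M) = M" "x \<otimes>\<^bsub>LM M\<^esub> y = comm c x y" "x \<oplus>\<^bsub>LM M\<^esub> y = x + y" "k \<odot>\<^bsub>LM M\<^esub> x = iscale k x"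
  by (simp_all add: LM_def Palg_def trunc_lie_def)

lemma LM_P: "LM P = Palg" by (simp add: LM_def Palg_def)

abbreviation TF where "TF M \<equiv> tensor_free (LM M) PI"

abbreviation tprod where "tprod M \<equiv> tmult (LM M) PI"

definition rels where "rels M = tensor_relations (LM M) PI"

definition tclass where "tclass M f = zspan (rels M) +>\<^bsub>TF M\<^esub> f"

text \<open>
  The formal sums whose class lies in the derived algebra of \<open>T M\<close>, see \<open>T_lower_central\<close>.
\<close>

definition derived_sums where "derived_sums M = zspan (rels M \<union> {tprod M p q | p q. p \<in> carrier (TF M) \<and> q \<in> carrier (TF M)})"

lemma closed_ops_LM: "is_sub M \<Longrightarrow> closed_ops \<Z> (LM M)"
  by (auto simp: closed_ops_def is_subD)

lemma rels_subset: "is_sub M \<Longrightarrow> rels M \<subseteq> carrier (TF M)"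
  unfolding rels_def by (rule tensor_relations_subset[OF closed_ops_LM closed_ring_profinite])

lemma zspan_carrier: "S \<subseteq> carrier (TF M) \<Longrightarrow> zspan S \<subseteq> carrier (TF M)"
  by (rule zspan_subset) (auto dest: keys_diff_subset)

lemma tensor_eq: "is_sub M \<Longrightarrow> tensor (LM M) PI = quot_alg (TF M) (zspan (rels M))"
  unfolding tensor_def rels_def using generate_tensor_free[OF rels_subset[unfolded rels_def]] by simp

lemma tprod_closed: "is_sub M \<Longrightarrow> p \<in> carrier (TF M) \<Longrightarrow> q \<in> carrier (TF M) \<Longrightarrow> tprod M p q \<in> carrier (TF M)"
  using closed_opsD(2)[OF closed_ops_tensor_free[OF closed_ops_LM closed_ring_profinite], of M p q] by simp

lemma derived_sums_carrier: "is_sub M \<Longrightarrow> derived_sums M \<subseteq> carrier (TF M)"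
  unfolding derived_sums_def using rels_subset tprod_closed by (intro zspan_carrier) blast

lemma rels_add_left: "x \<in> M \<Longrightarrow> y \<in> M \<Longrightarrow> a \<in> carrier PI \<Longrightarrow>
    frag_of (x + y, a) - frag_of (x, a) - frag_of (y, a) \<in> rels M"
  unfolding rels_def tensor_relations_def LM_simps by blast

lemma rels_add_right: "x \<in> M \<Longrightarrow> a \<in> carrier PI \<Longrightarrow> b \<in> carrier PI \<Longrightarrow>
    frag_of (x, \<lambda>n. (a n + b n) mod int n) - frag_of (x, a) - frag_of (x, b) \<in> rels M"
  unfolding rels_def tensor_relations_def LM_simps profinite_simps by blast

lemma relsE:
  assumes "r \<in> rels M"
  obtains x y a where "r = frag_of (x + y, a) - frag_of (x, a) - frag_of (y, a)" "x \<in> M" "y \<in> M" "a \<in> carrier PI"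
    | x a b where "r = frag_of (x, \<lambda>n. (a n + b n) mod int n) - frag_of (x, a) - frag_of (x, b)"
      "x \<in> M" "a \<in> carrier PI" "b \<in> carrier PI"
  using assms unfolding rels_def tensor_relations_def LM_simps profinite_simps by blast

lemma rels_mult_single:
  assumes M: "is_sub M" and r: "r \<in> rels M" and y: "y \<in> M" "b \<in> carrier PI"
  shows "tprod M r (frag_of (y, b)) \<in> rels M" "tprod M (frag_of (y, b)) r \<in> rels M"
proof -
  note mc = profinite_mult_closed
  have "tprod M r (frag_of (y, b)) \<in> rels M \<and> tprod M (frag_of (y, b)) r \<in> rels M"
    using r
  proof (cases rule: relsE)
    case (1 x x' a)
    thus ?thesis
      using rels_add_left[OF is_subD(4)[OF M 1(2) y(1)] is_subD(4)[OF M 1(3) y(1)] mc[OF 1(4) y(2)]]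
        rels_add_left[OF is_subD(4)[OF M y(1) 1(2)] is_subD(4)[OF M y(1) 1(3)] mc[OF y(2) 1(4)]]
      by (simp add: tmult_diff_left tmult_diff_right comm_add_left comm_add_right)
  next
    case (2 x a a')
    have e1: "(\<lambda>n. ((a n + a' n) mod int n * b n) mod int n) = (\<lambda>n. ((a n * b n) mod int n + (a' n * b n) mod int n) mod int n)"
      by (simp add: mod_mult_left_eq mod_add_eq distrib_right)
    have e2: "(\<lambda>n. (b n * ((a n + a' n) mod int n)) mod int n) = (\<lambda>n. ((b n * a n) mod int n + (b n * a' n) mod int n) mod int n)"
      by (simp add: mod_mult_right_eq mod_add_eq distrib_left)
    show ?thesis
      using rels_add_right[OF is_subD(4)[OF M 2(2) y(1)] mc[OF 2(3) y(2)] mc[OF 2(4) y(2)]]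
        rels_add_right[OF is_subD(4)[OF M y(1) 2(2)] mc[OF y(2) 2(3)] mc[OF y(2) 2(4)]]
      unfolding 2(1) tmult_diff_left tmult_diff_right tmult_of LM_simps profinite_simps e1 e2 by blast
  qed
  thus "tprod M r (frag_of (y, b)) \<in> rels M" "tprod M (frag_of (y, b)) r \<in> rels M" by auto
qed

lemma zspan_rels_mult:
  assumes M: "is_sub M" and i: "i \<in> zspan (rels M)" and q: "q \<in> carrier (TF M)"
  shows "tprod M i q \<in> zspan (rels M)" "tprod M q i \<in> zspan (rels M)"
proof -
  have "Poly_Mapping.keys q \<subseteq> M \<times> carrier PI" using q by simp
  hence 1: "tprod M r q \<in> zspan (rels M) \<and> tprod M q r \<in> zspan (rels M)" if r: "r \<in> rels M" for r
  proof (induction q rule: frag_induction)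
    case zero
    show ?case by (simp add: zspan_zero)
  next
    case (one x)
    then obtain y b where x: "x = (y, b)" "y \<in> M" "b \<in> carrier PI" by (cases x) auto
    show ?case unfolding x(1) using zspan_base[OF rels_mult_single(1)[OF M r x(2,3)]]
      zspan_base[OF rels_mult_single(2)[OF M r x(2,3)]] by blast
  next
    case (diff a b)
    thus ?case by (simp add: tmult_diff_left tmult_diff_right zspan_diff)
  qed
  have "tprod M i q \<in> zspan (rels M) \<and> tprod M q i \<in> zspan (rels M)" using i
    by induction (use 1 in \<open>auto simp: tmult_diff_left tmult_diff_right zspan_zero zspan_diff\<close>)
  thus "tprod M i q \<in> zspan (rels M)" "tprod M q i \<in> zspan (rels M)" by auto
qed

lemma tclass_mem: "x \<in> tclass M f \<longleftrightarrow> x - f \<in> zspan (rels M)"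
  unfolding tclass_def a_r_coset_def' by (auto simp: algebra_simps intro!: bexI[of _ "x - f"])

lemma tclass_eq: "tclass M f = tclass M f' \<longleftrightarrow> f - f' \<in> zspan (rels M)"
proof
  assume "tclass M f = tclass M f'"
  moreover have "f \<in> tclass M f" by (simp add: tclass_mem zspan_zero)
  ultimately show "f - f' \<in> zspan (rels M)" using tclass_mem by blast
next
  assume d: "f - f' \<in> zspan (rels M)"
  have d': "f' - f \<in> zspan (rels M)" using zspan_uminus[OF d] by simp
  show "tclass M f = tclass M f'"
  proof (rule Set.set_eqI)
    fix x
    show "x \<in> tclass M f \<longleftrightarrow> x \<in> tclass M f'" unfolding tclass_mem using zspan_trans d d' by blast
  qed
qed

abbreviation T where "T M \<equiv> tensor (LM M) PI"

lemma T_carrier: "is_sub M \<Longrightarrow> X \<in> carrier (T M) \<longleftrightarrow> (\<exists>f\<in>carrier (TF M). X = tclass M f)"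
  unfolding tensor_eq by (auto simp: quot_alg_def A_RCOSETS_def' tclass_def)

lemma T_carrierE:
  assumes "is_sub M" "X \<in> carrier (T M)"
  obtains f where "f \<in> carrier (TF M)" "X = tclass M f"
  using T_carrier[OF assms(1), of X] assms(2) by auto

lemma T_carrierI: "is_sub M \<Longrightarrow> f \<in> carrier (TF M) \<Longrightarrow> tclass M f \<in> carrier (T M)"
  using T_carrier[of M "tclass M f"] by auto

lemma T_zero: "is_sub M \<Longrightarrow> \<zero>\<^bsub>T M\<^esub> = tclass M 0"
  unfolding tensor_eq by (auto simp: quot_alg_def tclass_mem)

lemma T_add: "is_sub M \<Longrightarrow> tclass M f \<oplus>\<^bsub>T M\<^esub> tclass M f' = tclass M (f + f')"
proof -
  assume M: "is_sub M"
  have "set_add (TF M) (tclass M f) (tclass M f') = tclass M (f + f')"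
  proof (rule Set.set_eqI)
    fix x
    show "x \<in> set_add (TF M) (tclass M f) (tclass M f') \<longleftrightarrow> x \<in> tclass M (f + f')"
    proof
      assume "x \<in> set_add (TF M) (tclass M f) (tclass M f')"
      then obtain u v where uv: "x = u + v" "u \<in> tclass M f" "v \<in> tclass M f'" by (auto simp: set_add_def set_mult_def)
      thus "x \<in> tclass M (f + f')" using zspan_add[of "u - f" "rels M" "v - f'"] by (simp add: tclass_mem algebra_simps)
    next
      assume "x \<in> tclass M (f + f')"
      hence "x - f' \<in> tclass M f" "f' \<in> tclass M f'" by (simp_all add: tclass_mem zspan_zero diff_diff_eq add.commute)
      hence "(x - f') + f' \<in> set_add (TF M) (tclass M f) (tclass M f')" unfolding set_add_def set_mult_def by fastforce
      thus "x \<in> set_add (TF M) (tclass M f) (tclass M f')" by simp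
    qed
  qed
  thus ?thesis unfolding tensor_eq[OF M] by (simp add: quot_alg_def)
qed

lemma T_mult:
  assumes M: "is_sub M" and f: "f \<in> carrier (TF M)" "f' \<in> carrier (TF M)"
  shows "tclass M f \<otimes>\<^bsub>T M\<^esub> tclass M f' = tclass M (tprod M f f')"
proof -
  have Z: "zspan (rels M) \<subseteq> carrier (TF M)" by (rule zspan_carrier[OF rels_subset[OF M]])
  have "tclass M (tprod M u v) = tclass M (tprod M f f')" if uv: "u \<in> tclass M f" "v \<in> tclass M f'" for u v
  proof -
    have "v - f' \<in> carrier (TF M)" using uv Z by (auto simp: tclass_mem)
    hence "v \<in> carrier (TF M)" using f(2) keys_add[of "v - f'" f'] by auto
    hence "tprod M (u - f) v \<in> zspan (rels M)" "tprod M f (v - f') \<in> zspan (rels M)"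
      using zspan_rels_mult[OF M] uv f by (auto simp: tclass_mem)
    from zspan_add[OF this] show ?thesis by (simp add: tclass_eq tmult_diff_left tmult_diff_right)
  qed
  moreover have "f \<in> tclass M f" "f' \<in> tclass M f'" by (auto simp: tclass_mem zspan_zero)
  ultimately have "(\<Union>u\<in>tclass M f. \<Union>v\<in>tclass M f'. tclass M (tprod M u v)) = tclass M (tprod M f f')" by blast
  thus ?thesis unfolding tensor_eq[OF M] by (simp add: quot_alg_def rcoset_mult_def tclass_def)
qed

lemma T_abelian_group: "is_sub M \<Longrightarrow> abelian_group (T M)"
proof -
  assume M: "is_sub M"
  note I = T_carrierI[OF M]
  have add: "f + f' \<in> carrier (TF M)" if "f \<in> carrier (TF M)" "f' \<in> carrier (TF M)" for f f'
    using that keys_add[of f f'] by auto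
  have z: "0 \<in> carrier (TF M)" by simp
  show ?thesis
  proof (rule abelian_groupI)
    fix X Y assume "X \<in> carrier (T M)" "Y \<in> carrier (T M)"
    obtain f where f: "f \<in> carrier (TF M)" "X = tclass M f" by (rule T_carrierE[OF M \<open>X \<in> carrier (T M)\<close>])
    obtain f' where f': "f' \<in> carrier (TF M)" "Y = tclass M f'" by (rule T_carrierE[OF M \<open>Y \<in> carrier (T M)\<close>])
    show "X \<oplus>\<^bsub>T M\<^esub> Y \<in> carrier (T M)"
      unfolding f(2) f'(2) T_add[OF M] by (rule I[OF add[OF f(1) f'(1)]])
    show "X \<oplus>\<^bsub>T M\<^esub> Y = Y \<oplus>\<^bsub>T M\<^esub> X" using f f' T_add[OF M] by (simp add: add.commute)
    fix Z assume "Z \<in> carrier (T M)"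
    then obtain f'' where "Z = tclass M f''" by (rule T_carrierE[OF M])
    thus "X \<oplus>\<^bsub>T M\<^esub> Y \<oplus>\<^bsub>T M\<^esub> Z = X \<oplus>\<^bsub>T M\<^esub> (Y \<oplus>\<^bsub>T M\<^esub> Z)"
      using f f' T_add[OF M] by (simp add: add.assoc)
  next
    show "\<zero>\<^bsub>T M\<^esub> \<in> carrier (T M)" unfolding T_zero[OF M] by (rule I[OF z])
    fix X assume "X \<in> carrier (T M)"
    then obtain f where f: "f \<in> carrier (TF M)" "X = tclass M f" by (rule T_carrierE[OF M])
    show "\<zero>\<^bsub>T M\<^esub> \<oplus>\<^bsub>T M\<^esub> X = X" using f T_add[OF M] T_zero[OF M] by simp
    have "- f \<in> carrier (TF M)" using f by simp
    hence "tclass M (- f) \<in> carrier (T M)" by (rule I)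
    thus "\<exists>Y\<in>carrier (T M). Y \<oplus>\<^bsub>T M\<^esub> X = \<zero>\<^bsub>T M\<^esub>"
      by (rule bexI[rotated]) (simp add: f(2) T_add[OF M] T_zero[OF M])
  qed
qed

text \<open>
  The derived algebra is the second term of the lower central series. It is the additive span of the classes
  of products of formal sums.
\<close>

lemma T_lower_central:
  assumes M: "is_sub M" and f: "f \<in> carrier (TF M)"
  shows "tclass M f \<in> lower_central (T M) (Suc (Suc 0)) \<longleftrightarrow> f \<in> derived_sums M"
proof -
  interpret A: abelian_group "T M" by (rule T_abelian_group[OF M])
  let ?G = "{X \<otimes>\<^bsub>T M\<^esub> Y | X Y. X \<in> carrier (T M) \<and> Y \<in> carrier (T M)}"
  have G: "?G = {tclass M (tprod M p q) | p q. p \<in> carrier (TF M) \<and> q \<in> carrier (TF M)}"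
  proof (rule subset_antisym; rule subsetI)
    fix Z assume "Z \<in> ?G"
    then obtain X Y where XY: "Z = X \<otimes>\<^bsub>T M\<^esub> Y" "X \<in> carrier (T M)" "Y \<in> carrier (T M)" by blast
    obtain p where p: "p \<in> carrier (TF M)" "X = tclass M p" by (rule T_carrierE[OF M XY(2)])
    obtain q where q: "q \<in> carrier (TF M)" "Y = tclass M q" by (rule T_carrierE[OF M XY(3)])
    have "Z = tclass M (tprod M p q)" using XY(1) T_mult[OF M p(1) q(1)] p q by simp
    thus "Z \<in> {tclass M (tprod M p q) | p q. p \<in> carrier (TF M) \<and> q \<in> carrier (TF M)}" using p q by blast
  next
    fix Z assume "Z \<in> {tclass M (tprod M p q) | p q. p \<in> carrier (TF M) \<and> q \<in> carrier (TF M)}"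
    then obtain p q where pq: "Z = tclass M (tprod M p q)" "p \<in> carrier (TF M)" "q \<in> carrier (TF M)" by blast
    hence "Z = tclass M p \<otimes>\<^bsub>T M\<^esub> tclass M q" using T_mult[OF M pq(2,3)] by simp
    thus "Z \<in> ?G" using T_carrierI[OF M] pq by blast
  qed
  have GC: "?G \<subseteq> carrier (T M)"
    unfolding G using T_carrierI[OF M tprod_closed[OF M]] by auto
  have eq: "lower_central (T M) (Suc (Suc 0)) = generate (add_monoid (T M)) ?G" by simp
  note sg = A.add.generate_is_subgroup[OF GC]
  have inv: "inv\<^bsub>add_monoid (T M)\<^esub> (tclass M p) = tclass M (- p)" if "p \<in> carrier (TF M)" for p
  proof -
    have "\<ominus>\<^bsub>T M\<^esub> tclass M p = tclass M (- p)"
      by (rule A.minus_equality)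
        (use that T_carrierI[OF M, of p] T_carrierI[OF M, of "- p"] T_add[OF M] T_zero[OF M] in auto)
    thus ?thesis by (simp add: a_inv_def)
  qed
  have rel: "rels M \<subseteq> derived_sums M" "zspan (rels M) \<subseteq> derived_sums M"
    unfolding derived_sums_def by (auto intro: zspan_base subsetD[OF zspan_mono])
  show ?thesis
  proof
    assume "tclass M f \<in> lower_central (T M) (Suc (Suc 0))"
    hence "tclass M f \<in> generate (add_monoid (T M)) ?G" by simp
    hence "\<exists>p\<in>derived_sums M. tclass M f = tclass M p"
    proof (induction "tclass M f" arbitrary: f rule: generate.induct)
      case one
      have "0 \<in> derived_sums M" unfolding derived_sums_def by (rule zspan_zero)
      thus ?case using one T_zero[OF M] by auto
    next
      case (incl f)
      then obtain p q where pq: "p \<in> carrier (TF M)" "q \<in> carrier (TF M)" "tclass M f = tclass M (tprod M p q)"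
        unfolding G by blast
      hence "tprod M p q \<in> derived_sums M" unfolding derived_sums_def by (intro zspan_base) blast
      thus ?case using pq by blast
    next
      case (inv h f)
      then obtain p q where pq: "p \<in> carrier (TF M)" "q \<in> carrier (TF M)" "h = tclass M (tprod M p q)"
        unfolding G by blast
      hence "- tprod M p q \<in> derived_sums M" unfolding derived_sums_def by (intro zspan_uminus[OF zspan_base]) blast
      moreover have "tclass M f = tclass M (- tprod M p q)"
        using inv.hyps(2) \<open>\<And>p. p \<in> carrier (TF M) \<Longrightarrow> _\<close>[OF tprod_closed[OF M pq(1,2)]] pq(3) by simp
      ultimately show ?case by blast
    next
      case (eng h1 h2 f)
      have h: "h1 \<in> carrier (T M)" "h2 \<in> carrier (T M)"
        using eng.hyps(1,3) subgroup.subset[OF sg] by auto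
      obtain f1 where "h1 = tclass M f1" by (rule T_carrierE[OF M h(1)])
      moreover obtain f2 where "h2 = tclass M f2" by (rule T_carrierE[OF M h(2)])
      ultimately obtain p q where pq: "p \<in> derived_sums M" "h1 = tclass M p" "q \<in> derived_sums M" "h2 = tclass M q"
        using eng.hyps(2)[of f1] eng.hyps(4)[of f2] by auto
      have "p + q \<in> derived_sums M" using pq unfolding derived_sums_def by (intro zspan_add) auto
      moreover have "tclass M f = tclass M (p + q)" using eng.hyps(5) pq T_add[OF M] by simp
      ultimately show ?case by blast
    qed
    then obtain p where p: "p \<in> derived_sums M" "f - p \<in> zspan (rels M)" using tclass_eq by blast
    hence "f - p \<in> derived_sums M" using rel by blast
    from zspan_add[OF this[unfolded derived_sums_def] p(1)[unfolded derived_sums_def]] show "f \<in> derived_sums M" unfolding derived_sums_def by simp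
  next
    assume "f \<in> derived_sums M"
    thus "tclass M f \<in> lower_central (T M) (Suc (Suc 0))"
      unfolding eq derived_sums_def
    proof induction
      case zspan_zero
      show ?case using subgroup.one_closed[OF sg] T_zero[OF M] by simp
    next
      case (zspan_base x)
      thus ?case
      proof
        assume "x \<in> rels M"
        hence "tclass M x = tclass M 0" by (simp add: tclass_eq zspan.zspan_base)
        thus ?thesis using subgroup.one_closed[OF sg] T_zero[OF M] by simp
      next
        assume "x \<in> {tprod M p q | p q. p \<in> carrier (TF M) \<and> q \<in> carrier (TF M)}"
        hence "tclass M x \<in> ?G" unfolding G by blast
        thus ?thesis by (rule generate.incl)
      qed
    next
      case (zspan_diff x y)
      have "x \<in> derived_sums M" "y \<in> derived_sums M" using zspan_diff.hyps unfolding derived_sums_def by auto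
      hence xy: "x \<in> carrier (TF M)" "y \<in> carrier (TF M)" using derived_sums_carrier[OF M] by blast+
      have "tclass M (x - y) = tclass M x \<oplus>\<^bsub>T M\<^esub> tclass M (- y)" using T_add[OF M] by simp
      thus ?case using subgroup.m_closed[OF sg zspan_diff.IH(1) subgroup.m_inv_closed[OF sg zspan_diff.IH(2)]] inv[OF xy(2)]
        by simp
    qed
  qed
qed

end

section \<open>Pro-isomorphic subalgebras are pure\<close>

context free_nilp
begin

lemma brackets_sub:
  assumes M: "is_sub M"
  shows "brackets M \<subseteq> M" "brackets M \<subseteq> filt length 2"
proof -
  show "brackets M \<subseteq> M"
    unfolding brackets_def by (rule zspan_subset) (use is_subD[OF M] in auto)
  have f: "p \<in> filt length 1" if "p \<in> M" for p using P_filt_1 is_subD(1)[OF M] that by blast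
  show "brackets M \<subseteq> filt length 2"
    unfolding brackets_def
  proof (rule zspan_subset)
    show "{comm c p q | p q. p \<in> M \<and> q \<in> M} \<subseteq> filt length 2"
    proof
      fix z assume "z \<in> {comm c p q | p q. p \<in> M \<and> q \<in> M}"
      then obtain p q where pq: "z = comm c p q" "p \<in> M" "q \<in> M" by blast
      have "comm c p q \<in> filt length (1 + 1)" by (rule comm_filt[OF _ f[OF pq(2)] f[OF pq(3)]]) simp
      thus "z \<in> filt length 2" by (simp add: pq(1) numeral_2_eq_2)
    qed
  qed (auto intro: filt_closed)
qed

lemma zspan_sum: "(\<And>x. x \<in> A \<Longrightarrow> f x \<in> zspan S) \<Longrightarrow> sum f A \<in> zspan S" for f :: "'x \<Rightarrow> 'y::ab_group_add"
  by (induction A rule: infinite_finite_induct) (auto intro: zspan_zero zspan_add)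

lemma is_sub_P: "is_sub P"
  unfolding is_sub_def using P_closed(2,4) by auto

lemma brackets_iscale:
  assumes M: "is_sub M" and z: "z \<in> brackets M"
  shows "iscale k z \<in> brackets M"
  using z unfolding brackets_def
proof induction
  case zspan_zero
  have "iscale k 0 \<in> zspan {comm c p q | p q. p \<in> M \<and> q \<in> M}" by (simp add: zspan.zspan_zero)
  thus ?case .
next
  case (zspan_base x)
  then obtain p q where x: "x = comm c p q" "p \<in> M" "q \<in> M" by blast
  have "iscale k x = comm c (iscale k p) q" by (simp add: x comm_scale_left)
  thus ?case using is_subD(7)[OF M x(2)] x(3) by (intro zspan.zspan_base) blast
next
  case (zspan_diff x y)
  thus ?case unfolding iscale_diff_right by (intro zspan.zspan_diff)
qed

text \<open>
  The Lyndon basis element of a word of length at least two is a bracket by construction.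
\<close>

lemma pure_P: "pure P"
  unfolding pure_def
proof
  fix p assume "p \<in> P \<inter> filt length 2"
  hence p: "p \<in> P" "p \<in> filt length 2" by auto
  have lP: "lyn c letter w \<in> P" if "lyndon w" "set w \<subseteq> {..<g}" for w
    by (rule meval_P) (use that letter_P in \<open>auto simp: gens_lyndon_bracket\<close>)
  have "iscale (coef p w) (lyn c letter w) \<in> brackets P" if w: "w \<in> W" for w
  proof (cases "2 \<le> length w")
    case True
    have "lyn c letter w = comm c (lyn c letter (minpre w)) (lyn c letter (minsuf w))"
      by (simp add: lyndon_bracket_step[OF True])
    moreover have "set (minpre w) \<subseteq> {..<g}" "set (minsuf w) \<subseteq> {..<g}"
      using W_D(2)[OF w] minpre_append_minsuf(1)[OF True] by (metis le_sup_iff set_append)+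
    hence "lyn c letter (minpre w) \<in> P" "lyn c letter (minsuf w) \<in> P"
      using lP lyndon_minpre[OF True W_D(1)[OF w]] lyndon_minsuf[OF True] by auto
    ultimately have "lyn c letter w \<in> brackets P" unfolding brackets_def by (intro zspan_base) blast
    thus ?thesis by (rule brackets_iscale[OF is_sub_P])
  next
    case False
    hence "coef p w = 0" using coef_filt_length[OF p w] by simp
    thus ?thesis by (simp add: brackets_def zspan_zero)
  qed
  hence "comb letter (coef p) \<in> brackets P" unfolding comb_def brackets_def by (rule zspan_sum)
  thus "p \<in> brackets P" using comb_coef[OF p(1)] by simp
qed

lemma rel_diff_left:
  assumes M: "is_sub M" and "x \<in> M" "y \<in> M" "a \<in> carrier PI"
  shows "frag_of (x - y, a) - (frag_of (x, a) - frag_of (y, a)) \<in> zspan (rels M)"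
proof -
  have "frag_of (x - y, a) - (frag_of (x, a) - frag_of (y, a)) =
    - (frag_of (x - y + y, a) - frag_of (x - y, a) - frag_of (y, a))" by simp
  also have "\<dots> \<in> zspan (rels M)"
    by (rule zspan_uminus[OF zspan_base[OF rels_add_left[OF is_subD(3)[OF M assms(2,3)] assms(3,4)]]])
  finally show ?thesis .
qed

lemma rel_zero_left:
  assumes M: "is_sub M" and "a \<in> carrier PI"
  shows "frag_of (0, a) \<in> zspan (rels M)"
  using rel_diff_left[OF M is_subD(2)[OF M] is_subD(2)[OF M] assms(2)] by simp

lemma rel_diff_right:
  assumes "x \<in> M" "a \<in> carrier PI" "b \<in> carrier PI" "d \<in> carrier PI"
    and "\<And>n. a n = (d n + b n) mod int n"
  shows "frag_of (x, d) - (frag_of (x, a) - frag_of (x, b)) \<in> zspan (rels M)"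
proof -
  have "a = (\<lambda>n. (d n + b n) mod int n)" using assms(5) by auto
  hence "frag_of (x, d) - (frag_of (x, a) - frag_of (x, b)) =
    - (frag_of (x, \<lambda>n. (d n + b n) mod int n) - frag_of (x, d) - frag_of (x, b))" by simp
  also have "\<dots> \<in> zspan (rels M)"
    by (rule zspan_uminus[OF zspan_base[OF rels_add_right[OF assms(1,4,3)]]])
  finally show ?thesis .
qed

lemma PI_zero: "(\<lambda>n. 0) \<in> carrier PI" by (simp add: profinite_carrier)

lemma rel_zero_right:
  assumes "x \<in> M"
  shows "frag_of (x, \<lambda>n. 0) \<in> zspan (rels M)"
  using rel_diff_right[OF assms PI_zero PI_zero PI_zero] by simp

text \<open>
  Biadditivity implies that integers move across the tensor sign; both sides are additive in \<open>k\<close>.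
\<close>

lemma rel_iscale:
  assumes M: "is_sub M" and x: "x \<in> M" and a: "a \<in> carrier PI"
  shows "frag_of (iscale k x, a) - frag_of (x, pscale k a) \<in> zspan (rels M)"
proof -
  let ?d = "\<lambda>k. frag_of (iscale k x, a) - frag_of (x, pscale k a)"
  note ix = is_subD(7)[OF M x] and pa = pscale_closed[OF a]
  \<comment> \<open>Additivity of the difference in \<open>k\<close>, from which the claim follows by induction on \<open>k\<close>.\<close>
  have step: "?d k - ?d l - ?d (k - l) \<in> zspan (rels M)" for k l
  proof -
    have "iscale k x - iscale l x = iscale (k - l) x" by (auto simp: fun_eq_iff left_diff_distrib)
    hence 1: "frag_of (iscale (k - l) x, a) - (frag_of (iscale k x, a) - frag_of (iscale l x, a)) \<in> zspan (rels M)"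
      using rel_diff_left[OF M ix ix a, of k l] by simp
    have 2: "frag_of (x, pscale (k - l) a) - (frag_of (x, pscale k a) - frag_of (x, pscale l a)) \<in> zspan (rels M)"
      by (rule rel_diff_right[OF x pa pa pa]) (simp add: pscale_def mod_add_eq left_diff_distrib)
    from zspan_diff[OF 2 1] show ?thesis by (simp add: algebra_simps)
  qed
  have 0: "?d 0 \<in> zspan (rels M)"
    using zspan_diff[OF rel_zero_left[OF M a] rel_zero_right[OF x]] by (simp add: pscale_def)
  have 1: "?d 1 \<in> zspan (rels M)"
    using a by (simp add: pscale_def zspan_zero)
  have n: "?d (int n) \<in> zspan (rels M)" for n
  proof (induction n)
    case 0
    have "?d (int 0) \<in> zspan (rels M)" using \<open>?d 0 \<in> zspan (rels M)\<close> by simp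
    thus ?case .
  next
    case (Suc n)
    have "?d (int (Suc n)) = (?d (int (Suc n)) - ?d (int n) - ?d (int (Suc n) - int n)) + ?d (int n) + ?d 1" by simp
    also have "\<dots> \<in> zspan (rels M)" by (intro zspan_add step Suc 1)
    finally show ?case .
  qed
  show ?thesis
  proof (cases k)
    case (nonneg m)
    thus ?thesis using n by simp
  next
    case (neg m)
    have "?d k = - (?d 0 - ?d (int (Suc m)) - ?d (0 - int (Suc m))) + ?d 0 - ?d (int (Suc m))"
      using neg by simp
    also have "\<dots> \<in> zspan (rels M)" by (intro zspan_add zspan_diff zspan_uminus step 0 n)
    finally show ?thesis .
  qed
qed

lemma rel_sum:
  assumes M: "is_sub M" and a: "a \<in> carrier PI" and f: "\<And>j. j \<in> S \<Longrightarrow> f j \<in> M" and S: "finite S"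
  shows "sum f S \<in> M \<and> frag_of (sum f S, a) - (\<Sum>j\<in>S. frag_of (f j, a)) \<in> zspan (rels M)"
  using S f
proof (induction S rule: finite_induct)
  case empty
  show ?case by (simp only: sum.empty is_subD(2)[OF M] rel_zero_left[OF M a] simp_thms diff_zero)
next
  case (insert x F)
  hence IH: "sum f F \<in> M" "frag_of (sum f F, a) - (\<Sum>j\<in>F. frag_of (f j, a)) \<in> zspan (rels M)" "f x \<in> M"
    by blast+
  have "f x + sum f F \<in> M \<and> frag_of (f x + sum f F, a) - (frag_of (f x, a) + (\<Sum>j\<in>F. frag_of (f j, a))) \<in> zspan (rels M)"
    using is_subD(6)[OF M IH(3,1)] zspan_add[OF zspan_base[OF rels_add_left[OF IH(3,1) a]] IH(2)]
    by (simp add: algebra_simps)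
  thus ?case unfolding sum.insert[OF insert.hyps] .
qed

lemma zspan_rels_derived_sums: "zspan (rels M) \<subseteq> derived_sums M"
  unfolding derived_sums_def by (rule zspan_mono) blast

lemma derived_sums_diff: "x \<in> derived_sums M \<Longrightarrow> y \<in> derived_sums M \<Longrightarrow> x - y \<in> derived_sums M"
  and derived_sums_add: "x \<in> derived_sums M \<Longrightarrow> y \<in> derived_sums M \<Longrightarrow> x + y \<in> derived_sums M"
  and derived_sums_zero: "0 \<in> derived_sums M"
  unfolding derived_sums_def by (rule zspan_diff zspan_add zspan_zero; assumption?)+

text \<open>\<open>[p, q] \<otimes> a = [p \<otimes> a, q \<otimes> 1]\<close>.\<close>

lemma brackets_derived_sums:
  assumes M: "is_sub M" and a: "a \<in> carrier PI" and z: "z \<in> brackets M"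
  shows "frag_of (z, a) \<in> derived_sums M"
proof -
  have "z \<in> M \<and> frag_of (z, a) \<in> derived_sums M" using z unfolding brackets_def
  proof induction
    case zspan_zero
    have "0 \<in> M \<and> frag_of (0, a) \<in> derived_sums M" using is_subD(2)[OF M] rel_zero_left[OF M a] zspan_rels_derived_sums by blast
    thus ?case .
  next
    case (zspan_base x)
    then obtain p q where x: "x = comm c p q" "p \<in> M" "q \<in> M" by blast
    have k: "frag_of (p, a) \<in> carrier (TF M)" "frag_of (q, pone) \<in> carrier (TF M)"
      using x a pone_closed by (simp_all add: keys_frag_of)
    have "tprod M (frag_of (p, a)) (frag_of (q, pone)) = frag_of (x, a)"
      by (simp add: x(1) mult_pone[OF a])
    hence "frag_of (x, a) \<in> {tprod M p q | p q. p \<in> carrier (TF M) \<and> q \<in> carrier (TF M)}"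
      using k by (intro CollectI exI[of _ "frag_of (p, a)"] exI[of _ "frag_of (q, pone)"]) (simp del: tensor_free_simps)
    hence "frag_of (x, a) \<in> derived_sums M" unfolding derived_sums_def by (intro zspan.zspan_base) blast
    thus ?case using is_subD(4)[OF M x(2,3)] x(1) by blast
  next
    case (zspan_diff x y)
    hence xy: "x \<in> M" "y \<in> M" "frag_of (x, a) \<in> derived_sums M" "frag_of (y, a) \<in> derived_sums M" by blast+
    have "frag_of (x - y, a) - (frag_of (x, a) - frag_of (y, a)) \<in> derived_sums M"
      using rel_diff_left[OF M xy(1,2) a] zspan_rels_derived_sums by blast
    from derived_sums_add[OF this derived_sums_diff[OF xy(3,4)]]
    have "x - y \<in> M \<and> frag_of (x - y, a) \<in> derived_sums M" using is_subD(3)[OF M xy(1,2)] by simp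
    thus ?case .
  qed
  thus ?thesis ..
qed

text \<open>
  The coordinate of \<open>p \<otimes> a\<close> at the letter \<open>j\<close>, not yet reduced to residues.
\<close>

definition letter_part :: "nat \<Rightarrow> (nat list \<Rightarrow> int) \<times> (nat \<Rightarrow> int) \<Rightarrow> nat \<Rightarrow> int" where
  "letter_part j = (\<lambda>(p, a) n. p [j] * a n)"

lemma letter_part_simp [simp]: "letter_part j (p, a) n = p [j] * a n" by (simp add: letter_part_def)

lemma fsum_letter_part_dvd:
  assumes f: "f \<in> carrier (TF M)" and n: "0 < n" "m dvd n"
  shows "int m dvd fsum (letter_part j) f n - fsum (letter_part j) f m"
proof -
  have "Poly_Mapping.keys f \<subseteq> M \<times> carrier PI" using f by simp
  thus ?thesis
  proof (induction f rule: frag_induction)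
    case (one x)
    then obtain p a where x: "x = (p, a)" "a \<in> carrier PI" by (cases x) auto
    show ?case using profinite_dvd[OF x(2) n] by (simp add: x(1) right_diff_distrib[symmetric])
  next
    case (diff a b)
    have "int m dvd (fsum (letter_part j) a n - fsum (letter_part j) a m) - (fsum (letter_part j) b n - fsum (letter_part j) b m)"
      using diff by (rule dvd_diff)
    thus ?case by (simp add: fsum_diff algebra_simps)
  qed simp
qed

text \<open>
  Brackets contain no words of length one, and the relations change the coordinates of a formal sum by
  multiples of \<open>n\<close> in the residue modulo \<open>n\<close>.
\<close>

lemma derived_sums_letter_part:
  assumes f: "f \<in> derived_sums M" and M: "is_sub M" and n: "0 < n"
  shows "int n dvd fsum (letter_part j) f n"
  using f unfolding derived_sums_def
proof induction
  case (zspan_base x)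
  thus ?case
  proof
    assume "x \<in> rels M"
    thus ?thesis
    proof (cases rule: relsE)
      case (1 p q a)
      show ?thesis unfolding 1(1) by (simp add: fsum_diff distrib_right)
    next
      case (2 p a b)
      have "fsum (letter_part j) x n = p [j] * ((a n + b n) mod int n - (a n + b n))"
        unfolding 2(1) fsum_diff fsum_of letter_part_simp by (simp add: algebra_simps)
      moreover have "int n dvd (a n + b n) mod int n - (a n + b n)" by (metis dvd_minus_mod dvd_diff_commute)
      ultimately show ?thesis by simp
    qed
  next
    assume "x \<in> {tprod M p q | p q. p \<in> carrier (TF M) \<and> q \<in> carrier (TF M)}"
    then obtain p q where pq: "x = tprod M p q" "Poly_Mapping.keys p \<subseteq> M \<times> carrier PI" "Poly_Mapping.keys q \<subseteq> M \<times> carrier PI" by auto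
    have "fsum (letter_part j) (tprod M p q) n = 0" using pq(2,3)
    proof (rule tensor_bilinear_induct)
      fix x y assume "x \<in> M \<times> carrier PI" "y \<in> M \<times> carrier PI"
      then obtain p a q b where xy: "x = (p, a)" "y = (q, b)" "p \<in> M" "q \<in> M" by (cases x; cases y) auto
      have "comm c p q \<in> brackets M" unfolding brackets_def using xy by (intro zspan.zspan_base) blast
      hence "comm c p q [j] = 0" using brackets_sub(2)[OF M] by (auto simp: filt_def)
      thus "fsum (letter_part j) (tprod M (frag_of x) (frag_of y)) n = 0" by (simp add: xy)
    qed (simp_all add: tmult_diff_left tmult_diff_right fsum_diff)
    thus ?thesis using pq(1) by simp
  qed
next
  case (zspan_diff x y)
  thus ?case by (simp add: fsum_diff)
qed simp

lemma coef_single: "p \<in> P \<Longrightarrow> j < g \<Longrightarrow> coef p [j] = p [j]"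
proof -
  assume p: "p \<in> P" and j: "j < g"
  have jW: "[j] \<in> W" using single_W j by simp
  have "p [j] = comb letter (coef p) [j]" using comb_coef[OF p] by simp
  also have "\<dots> = (\<Sum>w\<in>{[j]}. coef p w * lyn c letter w [j])"
    unfolding comb_apply
  proof (rule sum.mono_neutral_right)
    show "\<forall>w\<in>W - {[j]}. coef p w * lyn c letter w [j] = 0"
    proof
      fix w assume w: "w \<in> W - {[j]}"
      have "lyn c letter w [j] = 0"
        using lyn_support(1)[of w c "[j]"] w W_D(1)[of w] by auto
      thus "coef p w * lyn c letter w [j] = 0" by simp
    qed
  qed (use finite_W jW in auto)
  finally show ?thesis by (simp add: letter_def)
qed

text \<open>
  The coordinates of the class of \<open>f\<close> in the abelianisation of \<open>T P\<close>, which is free over the profinite integers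
  with the letters as a basis. The entry at \<open>0\<close> follows the convention for profinite integers.
\<close>

definition letter_coord :: "nat \<Rightarrow> ((nat list \<Rightarrow> int) \<times> (nat \<Rightarrow> int) \<Rightarrow>\<^sub>0 int) \<Rightarrow> nat \<Rightarrow> int" where
  "letter_coord j f = (\<lambda>n. if n = 0 then 0 else fsum (letter_part j) f n mod int n)"

lemma letter_coord_closed: "f \<in> carrier (TF M) \<Longrightarrow> letter_coord j f \<in> carrier PI"
  unfolding letter_coord_def by (rule profiniteI[OF fsum_letter_part_dvd])

text \<open>
  An element \<open>p\<close> of \<open>P\<close> differs from its part \<open>q\<close> in the letters by a sum of brackets, and the coefficients of
  \<open>q\<close> move across the tensor sign.
\<close>

lemma mod_derived_sums_letters:
  assumes f: "f \<in> carrier (TF P)"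
  shows "f - (\<Sum>j<g. frag_of (letter j, letter_coord j f)) \<in> derived_sums P"
proof -
  have k: "Poly_Mapping.keys f \<subseteq> P \<times> carrier PI" using f by simp
  hence "f \<in> carrier (TF P) \<and> f - (\<Sum>j<g. frag_of (letter j, letter_coord j f)) \<in> derived_sums P"
  proof (induction f rule: frag_induction)
    case zero
    have A0: "letter_coord j 0 = (\<lambda>n. 0)" for j by (auto simp: letter_coord_def fun_eq_iff)
    have "(\<Sum>j<g. frag_of (letter j, letter_coord j 0)) \<in> zspan (rels P)"
      unfolding A0 by (rule zspan_sum) (use rel_zero_right letter_P in auto)
    thus ?case using derived_sums_diff[OF derived_sums_zero] zspan_rels_derived_sums by auto
  next
    case (one x)
    then obtain p a where x: "x = (p, a)" "p \<in> P" "a \<in> carrier PI" by (cases x) auto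
    define q where "q = (\<Sum>j<g. iscale (p [j]) (letter j))"
    have lj: "iscale (p [j]) (letter j) \<in> P" if "j \<in> {..<g}" for j
      using P_closed(3)[OF letter_P P_zero] that by simp
    have q: "q \<in> P \<and> frag_of (q, a) - (\<Sum>j<g. frag_of (iscale (p [j]) (letter j), a)) \<in> zspan (rels P)"
      unfolding q_def by (rule rel_sum[OF is_sub_P x(3) lj]) auto
    have qP: "q \<in> P" using q by simp
    have d: "p - q \<in> P" by (rule P_closed(2)[OF x(2) qP])
    have "p - q \<in> filt length 2"
    proof (rule P_filt_length[OF d])
      fix w assume w: "w \<in> W" "length w < 2"
      from w show "coef (p - q) w = 0"
      proof (elim W_length_cases)
        fix j assume j: "j < g" "w = [j]"
        have "q [j] = (\<Sum>i<g. if i = j then p [j] else 0)"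
          unfolding q_def sum_fun_apply by (rule sum.cong) (auto simp: letter_def)
        hence "q [j] = p [j]" using j(1) by simp
        thus "coef (p - q) w = 0" using coef_single[OF d j(1)] j(2) by simp
      qed simp
    qed
    hence "p - q \<in> brackets P" using pure_P d by (auto simp: pure_def)
    hence 1: "frag_of (p - q, a) \<in> derived_sums P" by (rule brackets_derived_sums[OF is_sub_P x(3)])
    have 2: "frag_of (p - q, a) - (frag_of (p, a) - frag_of (q, a)) \<in> derived_sums P"
      using rel_diff_left[OF is_sub_P x(2) qP x(3)] zspan_rels_derived_sums by blast
    have 3: "frag_of (q, a) - (\<Sum>j<g. frag_of (iscale (p [j]) (letter j), a)) \<in> derived_sums P"
      using q zspan_rels_derived_sums by auto
    have A: "letter_coord j (frag_of x) = pscale (p [j]) a" for j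
      using profinite_at_0[OF x(3)] by (auto simp: letter_coord_def pscale_def x(1))
    have 4: "(\<Sum>j<g. frag_of (iscale (p [j]) (letter j), a)) - (\<Sum>j<g. frag_of (letter j, letter_coord j (frag_of x))) \<in> derived_sums P"
      unfolding A sum_subtractf[symmetric] derived_sums_def
      by (rule zspan_sum) (use rel_iscale[OF is_sub_P letter_P x(3)] zspan_rels_derived_sums[unfolded derived_sums_def] in blast)
    have "frag_of x - (\<Sum>j<g. frag_of (letter j, letter_coord j (frag_of x))) =
      (frag_of (p - q, a) - (frag_of (p - q, a) - (frag_of (p, a) - frag_of (q, a)))) +
      ((frag_of (q, a) - (\<Sum>j<g. frag_of (iscale (p [j]) (letter j), a))) +
      ((\<Sum>j<g. frag_of (iscale (p [j]) (letter j), a)) - (\<Sum>j<g. frag_of (letter j, letter_coord j (frag_of x)))))"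
      by (simp add: x(1))
    also have "\<dots> \<in> derived_sums P" by (intro derived_sums_add derived_sums_diff 1 2 3 4)
    finally show ?case using x by (simp add: keys_frag_of)
  next
    case (diff a b)
    let ?s = "\<lambda>f. \<Sum>j<g. frag_of (letter j, letter_coord j f)"
    have ab: "a \<in> carrier (TF P)" "b \<in> carrier (TF P)" using diff by auto
    have abc: "a - b \<in> carrier (TF P)" using ab keys_diff_subset[of a "P \<times> carrier PI" b] by simp
    have "(\<Sum>j<g. frag_of (letter j, letter_coord j (a - b)) - (frag_of (letter j, letter_coord j a) - frag_of (letter j, letter_coord j b))) \<in> zspan (rels P)"
    proof (rule zspan_sum)
      fix j assume "j \<in> {..<g}"
      show "frag_of (letter j, letter_coord j (a - b)) - (frag_of (letter j, letter_coord j a) - frag_of (letter j, letter_coord j b)) \<in> zspan (rels P)"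
        by (rule rel_diff_right[OF letter_P letter_coord_closed[OF ab(1)] letter_coord_closed[OF ab(2)] letter_coord_closed[OF abc]])
          (use \<open>j \<in> {..<g}\<close> in \<open>auto simp: letter_coord_def fsum_diff mod_add_eq\<close>)
    qed
    hence h: "?s (a - b) - (?s a - ?s b) \<in> derived_sums P" using zspan_rels_derived_sums by (auto simp: sum_subtractf)
    have "(a - ?s a) - (b - ?s b) - (?s (a - b) - (?s a - ?s b)) \<in> derived_sums P"
      by (rule derived_sums_diff[OF derived_sums_diff[OF conjunct2[OF diff.IH(1)] conjunct2[OF diff.IH(2)]] h])
    moreover have "a - b - ?s (a - b) = (a - ?s a) - (b - ?s b) - (?s (a - b) - (?s a - ?s b))" by simp
    ultimately have "a - b - ?s (a - b) \<in> derived_sums P" by (simp only:)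
    with abc show ?case by blast
  qed
  thus ?thesis ..
qed

text \<open>
  In coordinates, this says that a profinite integer \<open>x\<close> with \<open>N x = 0\<close> vanishes: its entry at \<open>N n\<close> is
  divisible by \<open>n\<close>, and reducing it modulo \<open>n\<close> gives the entry at \<open>n\<close>.
\<close>

lemma derived_sums_torsion_free:
  assumes f: "f \<in> carrier (TF P)" and N: "0 < N" and Nf: "frag_cmul (int N) f \<in> derived_sums P"
  shows "f \<in> derived_sums P"
proof -
  have fs: "fsum \<phi> (frag_cmul (int N) f) n = int N * fsum \<phi> f n" for \<phi> :: "_ \<Rightarrow> nat \<Rightarrow> int" and n
  proof -
    have "Poly_Mapping.keys (frag_cmul (int N) f) = Poly_Mapping.keys f" using N by auto
    thus ?thesis by (simp add: fsum_def sum_distrib_left mult.assoc)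
  qed
  have "letter_coord j f = (\<lambda>n. 0)" for j
  proof
    fix n :: nat
    show "letter_coord j f n = 0"
    proof (cases "n = 0")
      case False
      \<comment> \<open>The entry at \<open>N * n\<close> is needed, since \<open>N\<close> need not be invertible modulo \<open>n\<close>.\<close>
      hence nN: "0 < N * n" using N by simp
      have "int (N * n) dvd int N * fsum (letter_part j) f (N * n)"
        using derived_sums_letter_part[OF Nf is_sub_P nN, of j] fs by simp
      hence "int n dvd fsum (letter_part j) f (N * n)" using N by simp
      moreover have "int n dvd fsum (letter_part j) f (N * n) - fsum (letter_part j) f n"
        by (rule fsum_letter_part_dvd[OF f nN]) simp
      ultimately have "int n dvd fsum (letter_part j) f n" using dvd_diff_right_iff by blast
      thus ?thesis using False by (simp add: letter_coord_def)
    qed (simp add: letter_coord_def)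
  qed
  hence "f - (\<Sum>j<g. frag_of (letter j, \<lambda>n. 0)) \<in> derived_sums P" using mod_derived_sums_letters[OF f] by simp
  moreover have "(\<Sum>j<g. frag_of (letter j, \<lambda>n. 0 :: int)) \<in> zspan (rels P)"
    by (rule zspan_sum) (use rel_zero_right letter_P in auto)
  hence "(\<Sum>j<g. frag_of (letter j, \<lambda>n. 0 :: int)) \<in> derived_sums P" using zspan_rels_derived_sums by blast
  ultimately show ?thesis using derived_sums_add[of "f - (\<Sum>j<g. frag_of (letter j, \<lambda>n. 0))" P] by fastforce
qed

text \<open>
  Sending \<open>p \<otimes> a\<close> to \<open>a\<^sub>n p\<close> is well defined modulo \<open>n M\<close> and compatible with brackets, so that it maps the
  derived algebra of \<open>T M\<close> to \<open>[M, M]\<close> modulo \<open>n M\<close>.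
\<close>

lemma derived_sums_component:
  assumes M: "is_sub M" and f: "f \<in> derived_sums M" and n: "0 < n"
  shows "\<exists>u\<in>brackets M. \<exists>m\<in>M. fsum (\<lambda>(x, a). iscale (a n) x) f = u + iscale (int n) m"
  using f unfolding derived_sums_def
proof induction
  let ?\<Theta> = "\<lambda>(x :: nat list \<Rightarrow> int, a :: nat \<Rightarrow> int). iscale (a n) x"
  have bz: "0 \<in> brackets M" unfolding brackets_def by (rule zspan_zero)
  {
    case zspan_zero
    have "fsum ?\<Theta> 0 = 0 + iscale (int n) 0" by (simp add: fun_eq_iff)
    thus ?case using bz is_subD(2)[OF M] by blast
  next
    case (zspan_base x)
    thus ?case
    proof
      assume "x \<in> rels M"
      thus ?thesis
      proof (cases rule: relsE)
        case (1 p q a)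
        have "fsum ?\<Theta> x = 0 + iscale (int n) 0" unfolding 1(1) by (simp add: fun_eq_iff fsum_diff distrib_left)
        thus ?thesis using bz is_subD(2)[OF M] by blast
      next
        case (2 p a b)
        have "int n dvd (a n + b n) mod int n - (a n + b n)" by (metis dvd_minus_mod dvd_diff_commute)
        then obtain k where k: "(a n + b n) mod int n - (a n + b n) = int n * k" by (elim dvdE)
        have "fsum ?\<Theta> x w = (0 + iscale (int n) (iscale k p)) w" for w
        proof -
          have "fsum ?\<Theta> x w = ((a n + b n) mod int n - (a n + b n)) * p w"
            unfolding 2(1) fsum_diff fsum_of by (simp add: left_diff_distrib distrib_right)
          thus ?thesis unfolding k by simp
        qed
        hence "fsum ?\<Theta> x = 0 + iscale (int n) (iscale k p)" by blast
        thus ?thesis using bz is_subD(7)[OF M 2(2)] by blast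
      qed
    next
      assume "x \<in> {tprod M p q | p q. p \<in> carrier (TF M) \<and> q \<in> carrier (TF M)}"
      then obtain p q where pq: "x = tprod M p q" "Poly_Mapping.keys p \<subseteq> M \<times> carrier PI" "Poly_Mapping.keys q \<subseteq> M \<times> carrier PI" by auto
      have d: "fsum ?\<Theta> (u - v) = fsum ?\<Theta> u - fsum ?\<Theta> v" for u v by (simp add: fun_eq_iff fsum_diff)
      have z: "fsum ?\<Theta> 0 = 0" by (simp add: fun_eq_iff)
      have "fsum ?\<Theta> (tprod M p q) \<in> brackets M" using pq(2,3)
      proof (rule tensor_bilinear_induct)
        fix x y assume "x \<in> M \<times> carrier PI" "y \<in> M \<times> carrier PI"
        then obtain p a q b where xy: "x = (p, a)" "y = (q, b)" "p \<in> M" "q \<in> M" by (cases x; cases y) auto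
        have "comm c p q \<in> brackets M" unfolding brackets_def using xy by (intro zspan.zspan_base) blast
        from brackets_iscale[OF M this, of "a n * b n mod int n"]
        have "iscale (a n * b n mod int n) (comm c p q) \<in> brackets M" .
        moreover have "fsum ?\<Theta> (tprod M (frag_of x) (frag_of y)) = iscale (a n * b n mod int n) (comm c p q)"
          by (simp add: xy fun_eq_iff)
        ultimately show "fsum ?\<Theta> (tprod M (frag_of x) (frag_of y)) \<in> brackets M" by (simp only:)
      next
        show "fsum ?\<Theta> (tprod M 0 q) \<in> brackets M" "fsum ?\<Theta> (tprod M p 0) \<in> brackets M" for p q
          using bz by (simp_all only: tmult_zero z)
        show "fsum ?\<Theta> (tprod M (p - p') q) \<in> brackets M"
          if "fsum ?\<Theta> (tprod M p q) \<in> brackets M" "fsum ?\<Theta> (tprod M p' q) \<in> brackets M" for p p' q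
          using that unfolding tmult_diff_left d brackets_def by (rule zspan_diff)
        show "fsum ?\<Theta> (tprod M p (q - q')) \<in> brackets M"
          if "fsum ?\<Theta> (tprod M p q) \<in> brackets M" "fsum ?\<Theta> (tprod M p q') \<in> brackets M" for p q q'
          using that unfolding tmult_diff_right d brackets_def by (rule zspan_diff)
      qed
      moreover have "fsum ?\<Theta> x = fsum ?\<Theta> (tprod M p q) + iscale (int n) 0" using pq(1) by (simp add: fun_eq_iff)
      ultimately show ?thesis using is_subD(2)[OF M] by blast
    qed
  next
    case (zspan_diff x y)
    then obtain u m v l where um: "u \<in> brackets M" "m \<in> M" "fsum ?\<Theta> x = u + iscale (int n) m"
      "v \<in> brackets M" "l \<in> M" "fsum ?\<Theta> y = v + iscale (int n) l" by blast
    have "fsum ?\<Theta> (x - y) = fsum ?\<Theta> x - fsum ?\<Theta> y" by (simp add: fun_eq_iff fsum_diff)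
    also have "\<dots> = (u - v) + iscale (int n) (m - l)"
      unfolding um(3,6) iscale_diff_right by simp
    finally have "fsum ?\<Theta> (x - y) = (u - v) + iscale (int n) (m - l)" .
    moreover have "u - v \<in> brackets M" using um(1,4) unfolding brackets_def by (rule zspan.zspan_diff)
    ultimately show ?case using is_subD(3)[OF M um(2,5)] by blast
  }
qed

text \<open>\<open>N\<^sup>2 [p, q] = [N p, N q]\<close>.\<close>

lemma cofinite_brackets:
  assumes M: "is_sub M" and N: "\<And>p. p \<in> P \<Longrightarrow> iscale N p \<in> M" and z: "z \<in> M" "z \<in> filt length 2"
  shows "iscale (N * N) z \<in> brackets M"
proof -
  have "z \<in> brackets P" using pure_P z is_subD(1)[OF M] by (auto simp: pure_def)
  thus ?thesis unfolding brackets_def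
  proof induction
    case zspan_zero
    have "iscale (N * N) 0 \<in> zspan {comm c p q | p q. p \<in> M \<and> q \<in> M}" by (simp add: zspan.zspan_zero)
    thus ?case .
  next
    case (zspan_base x)
    then obtain p q where x: "x = comm c p q" "p \<in> P" "q \<in> P" by blast
    have "iscale (N * N) x = comm c (iscale N p) (iscale N q)"
      by (simp add: x comm_scale_left comm_scale_right iscale_iscale)
    thus ?case using N[OF x(2)] N[OF x(3)] by (intro zspan.zspan_base) blast
  next
    case (zspan_diff x y)
    thus ?case unfolding iscale_diff_right by (intro zspan.zspan_diff)
  qed
qed

text \<open>
  Let \<open>z\<close> be in \<open>M \<inter> [P, P]\<close>. Some positive multiple \<open>N z\<close> lies in \<open>[M, M]\<close>, so \<open>N (z \<otimes> 1)\<close> lies in the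
  derived algebra of \<open>T M\<close>. The abelianisation of \<open>T M\<close> is isomorphic to that of \<open>T P\<close>, which is torsion
  free; hence \<open>z \<otimes> 1\<close> itself lies in the derived algebra. Reducing coefficients modulo \<open>N\<close> gives
  \<open>z = u + N m\<close> with \<open>u\<close> in \<open>[M, M]\<close> and \<open>m\<close> in \<open>M\<close>. Now \<open>N m\<close> is in \<open>[P, P]\<close>, so \<open>m\<close> is in \<open>[P, P]\<close>, and by
  the choice of \<open>N\<close> the element \<open>N m\<close> is in \<open>[M, M]\<close> too.
\<close>

lemma proiso_pure:
  assumes M: "is_sub M" and fin: "cofinite M"
    and iso: "alg_iso PI (T M) (T P)"
  shows "pure M"
  unfolding pure_def
proof
  fix z assume "z \<in> M \<inter> filt length 2"
  hence z: "z \<in> M" "z \<in> filt length 2" by auto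
  obtain N0 where N0: "0 < N0" "\<And>p. p \<in> P \<Longrightarrow> iscale N0 p \<in> M" using fin by (auto simp: cofinite_def)
  define N where "N = nat (N0 * N0)"
  have N: "0 < N" "int N = N0 * N0" using N0(1) by (auto simp: N_def)
  have Nz: "iscale (int N) p \<in> brackets M" if "p \<in> M" "p \<in> filt length 2" for p
    unfolding N by (rule cofinite_brackets[OF M N0(2) that])
  obtain h where h: "iso_via PI h (T M) (T P)" using iso by (auto simp: alg_iso_iff)
  have co: "X \<otimes>\<^bsub>T M\<^esub> Y \<in> carrier (T M)" if X: "X \<in> carrier (T M)" and Y: "Y \<in> carrier (T M)" for X Y
  proof -
    obtain p where p: "p \<in> carrier (TF M)" "X = tclass M p" by (rule T_carrierE[OF M X])
    obtain q where q: "q \<in> carrier (TF M)" "Y = tclass M q" by (rule T_carrierE[OF M Y])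
    show ?thesis
      unfolding p(2) q(2) T_mult[OF M p(1) q(1)] by (rule T_carrierI[OF M tprod_closed[OF M p(1) q(1)]])
  qed
  note G = T_abelian_group[OF M] T_abelian_group[OF is_sub_P]
  note lc' = iso_via_lower_central[OF h G co, of "Suc (Suc 0)"]
  note lc = conjunct1[OF lc'] conjunct2[OF lc']
  interpret H: group_hom "add_monoid (T M)" "add_monoid (T P)" h by (rule iso_via_group_hom[OF h G])
  define e where "e = frag_of (z, pone)"
  have e: "e \<in> carrier (TF M)" using z pone_closed by (simp add: e_def keys_frag_of)
  have "h (tclass M e) \<in> carrier (T P)" using iso_viaD(5)[OF h T_carrierI[OF M e]] .
  then obtain f where f: "f \<in> carrier (TF P)" "h (tclass M e) = tclass P f" by (rule T_carrierE[OF is_sub_P])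
  have ck: "frag_cmul k x \<in> carrier (TF L)" if "x \<in> carrier (TF L)" for k x L
    using that keys_cmul[of k x] by auto
  have mult: "h (tclass M (frag_cmul (int k) e)) = tclass P (frag_cmul (int k) f)" for k
  proof (induction k)
    case 0
    show ?case using H.hom_one T_zero[OF M] T_zero[OF is_sub_P] by simp
  next
    case (Suc k)
    have s: "frag_cmul (int (Suc k)) x = frag_cmul (int k) x + x" for x :: "(nat list \<Rightarrow> int) \<times> (nat \<Rightarrow> int) \<Rightarrow>\<^sub>0 int"
      by (simp add: frag_cmul_distrib)
    show ?case
      unfolding s T_add[OF M, symmetric] T_add[OF is_sub_P, symmetric]
      using iso_viaD(2)[OF h T_carrierI[OF M ck[OF e]] T_carrierI[OF M e]] Suc f(2) by simp
  qed
  have "frag_cmul (int k) e - frag_of (iscale (int k) z, pone) \<in> zspan (rels M)" for k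
  proof (induction k)
    case 0
    have "frag_cmul (int 0) e - frag_of (iscale (int 0) z, pone) \<in> zspan (rels M)"
      using zspan_uminus[OF rel_zero_left[OF M pone_closed]] by simp
    thus ?case .
  next
    case (Suc k)
    have s: "iscale (int (Suc k)) z = iscale (int k) z + z" by (simp add: fun_eq_iff algebra_simps)
    have s': "frag_cmul (int (Suc k)) e = frag_cmul (int k) e + e" by (simp add: frag_cmul_distrib)
    have "frag_of (iscale (int k) z + z, pone) - frag_of (iscale (int k) z, pone) - e \<in> zspan (rels M)"
      unfolding e_def by (rule zspan_base[OF rels_add_left[OF is_subD(7)[OF M z(1)] z(1) pone_closed]])
    note zspan_diff[OF Suc this]
    moreover have "frag_cmul (int k) e - frag_of (iscale (int k) z, pone) -
      (frag_of (iscale (int k) z + z, pone) - frag_of (iscale (int k) z, pone) - e) =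
      frag_cmul (int (Suc k)) e - frag_of (iscale (int (Suc k)) z, pone)" unfolding s s' by simp
    ultimately show ?case by (simp only:)
  qed
  from this[of N] have 1: "frag_cmul (int N) e - frag_of (iscale (int N) z, pone) \<in> derived_sums M"
    using zspan_rels_derived_sums by blast
  have 2: "frag_of (iscale (int N) z, pone) \<in> derived_sums M" by (rule brackets_derived_sums[OF M pone_closed Nz[OF z]])
  have "frag_cmul (int N) e \<in> derived_sums M" using derived_sums_add[OF 1 2] by simp
  hence "tclass M (frag_cmul (int N) e) \<in> lower_central (T M) (Suc (Suc 0))"
    using T_lower_central[OF M ck[OF e]] by blast
  hence "tclass P (frag_cmul (int N) f) \<in> lower_central (T P) (Suc (Suc 0))"
    using lc(1) mult by (metis imageI)
  hence "frag_cmul (int N) f \<in> derived_sums P" using T_lower_central[OF is_sub_P ck[OF f(1)]] by blast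
  hence "f \<in> derived_sums P" by (rule derived_sums_torsion_free[OF f(1) N(1)])
  hence "h (tclass M e) \<in> lower_central (T P) (Suc (Suc 0))" using T_lower_central[OF is_sub_P f(1)] f(2) by simp
  then obtain X where X: "X \<in> lower_central (T M) (Suc (Suc 0))" "h (tclass M e) = h X" using lc(1) by auto
  hence "tclass M e = X" using inj_onD[OF iso_viaD(6)[OF h] X(2) T_carrierI[OF M e]] lc(2) by blast
  hence "e \<in> derived_sums M" using X(1) T_lower_central[OF M e] by simp
  then obtain u m where um: "u \<in> brackets M" "m \<in> M" "fsum (\<lambda>(x, a). iscale (a N) x) e = u + iscale (int N) m"
    using derived_sums_component[OF M _ N(1)] by blast
  have "fsum (\<lambda>(x, a). iscale (a N) x) e = iscale (pone N) z" by (simp add: e_def fun_eq_iff)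
  \<comment> \<open>The profinite integer \<open>pone\<close> has the entry \<open>1\<close> at \<open>N\<close>, except that it is \<open>0\<close> if \<open>N = 1\<close>.\<close>
  moreover have "iscale (pone N) z - z \<in> brackets M"
  proof (cases "N = 1")
    case True
    hence "iscale (int N) z = z" by simp
    hence "z \<in> brackets M" using Nz[OF z] by simp
    hence "- z \<in> brackets M" unfolding brackets_def by (rule zspan_uminus)
    moreover have "iscale (pone N) z - z = - z" using True by (simp add: pone_def)
    ultimately show ?thesis by simp
  next
    case False
    hence "pone N = 1" using N(1) by (simp add: pone_def)
    thus ?thesis by (simp add: brackets_def zspan_zero)
  qed
  ultimately have zz: "(u + iscale (int N) m) - z \<in> brackets M" using um(3) by simp
  have "iscale (int N) m \<in> filt length 2"
  proof -
    have "iscale (int N) m = ((u + iscale (int N) m) - z) + z - u" by simp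
    also have "\<dots> \<in> filt length 2"
      by (rule filt_closed(3)[OF filt_closed(2)]) (use brackets_sub(2)[OF M] zz z(2) um(1) in auto)
    finally show ?thesis .
  qed
  hence "m \<in> filt length 2" using N(1) by (auto simp: filt_def)
  hence "iscale (int N) m \<in> brackets M" by (rule Nz[OF um(2)])
  from zspan_diff[OF zspan_add[OF um(1)[unfolded brackets_def] this[unfolded brackets_def]] zz[unfolded brackets_def]]
  have "u + iscale (int N) m - ((u + iscale (int N) m) - z) \<in> brackets M" unfolding brackets_def .
  thus "z \<in> brackets M" by simp
qed

end

section \<open>Counting normal forms\<close>

context free_nilp
begin

lemma lie_algebra_Palg: "lie_algebra \<Z> Palg"
proof -
  have ag: "abelian_group Palg"
  proof (rule abelian_groupI)
    fix p assume "p \<in> carrier Palg"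
    thus "\<exists>q\<in>carrier Palg. q \<oplus>\<^bsub>Palg\<^esub> p = \<zero>\<^bsub>Palg\<^esub>"
      using P_uminus by (intro bexI[of _ "- p"]) auto
  qed (auto simp: add_ac P_closed)
  have m: "Module.module \<Z> Palg"
    by (rule moduleI[OF int_is_cring ag])
      (auto simp: P_closed iscale_add_left iscale_add_right iscale_iscale)
  show ?thesis
  proof (intro lie_algebra.intro lie_algebra_axioms.intro nonassoc_algebra.intro
      nonassoc_algebra_axioms.intro m)
    fix x y assume "x \<in> carrier Palg" "y \<in> carrier Palg"
    thus "x \<otimes>\<^bsub>Palg\<^esub> y \<in> carrier Palg" by (simp add: P_closed)
  next
    fix x assume "x \<in> carrier Palg"
    show "x \<otimes>\<^bsub>Palg\<^esub> x = \<zero>\<^bsub>Palg\<^esub>" by (simp add: comm_def)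
  next
    fix x y z
    have "comm c x (comm c y z) + comm c y (comm c z x) + comm c z (comm c x y) = 0"
      by (simp add: comm_def conv_diff_left conv_diff_right conv_assoc)
    thus "x \<otimes>\<^bsub>Palg\<^esub> (y \<otimes>\<^bsub>Palg\<^esub> z) \<oplus>\<^bsub>Palg\<^esub> y \<otimes>\<^bsub>Palg\<^esub> (z \<otimes>\<^bsub>Palg\<^esub> x) \<oplus>\<^bsub>Palg\<^esub>
      z \<otimes>\<^bsub>Palg\<^esub> (x \<otimes>\<^bsub>Palg\<^esub> y) = \<zero>\<^bsub>Palg\<^esub>" by simp
  qed (auto simp: comm_add_left comm_add_right comm_scale_left comm_scale_right)
qed

lemma nonassoc_algebra_Palg: "nonassoc_algebra \<Z> Palg"
  by (rule lie_algebra.axioms(1)[OF lie_algebra_Palg])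

text \<open>
  Among \<open>n + 1\<close> multiples of \<open>p\<close> two lie in the same coset of \<open>M\<close>, and the difference of the two factors
  divides \<open>n!\<close>. So \<open>n!\<close> works for all \<open>p\<close> at once.
\<close>

lemma index_cofinite:
  assumes M: "is_sub M" and n: "add_index Palg M = n" "1 \<le> n"
  shows "cofinite M"
  unfolding cofinite_def
proof (intro exI[of _ "fact n :: int"] conjI ballI)
  fix p assume p: "p \<in> P"
  have ip: "iscale k p \<in> P" for k using P_closed(3)[OF p P_zero] .
  have cd: "card (cos M ` P) = n" using n(1) add_index_Palg[of M] by simp
  hence fin: "finite (cos M ` P)" using n(2) card_gt_0_iff[of "cos M ` P"] by simp
  have "\<not> inj_on (\<lambda>k. cos M (iscale (int k) p)) {0..n}"
  proof
    assume "inj_on (\<lambda>k. cos M (iscale (int k) p)) {0..n}"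
    hence "card {0..n} \<le> card (cos M ` P)"
      using fin ip by (intro card_inj_on_le[of "\<lambda>k. cos M (iscale (int k) p)"]) auto
    thus False using cd by simp
  qed
  then obtain k l where kl: "k \<in> {0..n}" "l \<in> {0..n}" "k < l" "cos M (iscale (int l) p) = cos M (iscale (int k) p)"
    unfolding inj_on_def by (metis linorder_neqE_nat)
  hence "iscale (int l) p - iscale (int k) p \<in> M" using cos_eq[OF M] by blast
  moreover have "iscale (int l) p - iscale (int k) p = iscale (int (l - k)) p"
    using kl(3) by (simp add: fun_eq_iff of_nat_diff left_diff_distrib)
  ultimately have m: "iscale (int (l - k)) p \<in> M" by simp
  have "l - k dvd fact n" by (rule dvd_fact) (use kl in auto)
  then obtain q where q: "fact n = (l - k) * q" by (elim dvdE)
  hence "(fact n :: int) = int q * int (l - k)" by (metis of_nat_fact of_nat_mult mult.commute)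
  hence "iscale (fact n) p = iscale (int q) (iscale (int (l - k)) p)" by (simp add: iscale_iscale)
  thus "iscale (fact n) p \<in> M" using is_subD(7)[OF M m] by simp
qed simp

text \<open>
  Subalgebras in normal form are isomorphic to the model, isomorphic subalgebras are pro-isomorphic, and
  pro-isomorphic subalgebras are pure and hence have a normal form.
\<close>

lemma normal_forms:
  assumes n: "1 \<le> n"
  shows "{M. subalgebra_of \<Z> Palg M \<and> add_index Palg M = n \<and> alg_iso \<Z> (Palg\<lparr>carrier := M\<rparr>) Palg}
      = {gen_sub y | d y. tri d y \<and> reduced d y \<and> add_index Palg (gen_sub y) = n}" (is "?I = ?N")
    and "{M. subalgebra_of \<Z> Palg M \<and> add_index Palg M = n \<and>
        alg_iso profinite_int (tensor (Palg\<lparr>carrier := M\<rparr>) profinite_int) (tensor Palg profinite_int)}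
      = {gen_sub y | d y. tri d y \<and> reduced d y \<and> add_index Palg (gen_sub y) = n}" (is "?J = _")
proof -
  have 1: "?N \<subseteq> ?I" using gen_sub_iso gen_sub_is_sub subalgebra_Palg by blast
  have 2: "?I \<subseteq> ?J"
    using tensor_functor[OF _ closed_ops_LM closed_ring_profinite] subalgebra_Palg
    by (auto simp: alg_iso_iff LM_def)
  have 3: "?J \<subseteq> ?N"
  proof
    fix M assume "M \<in> ?J"
    hence M: "is_sub M" "add_index Palg M = n" "alg_iso PI (T M) (T P)"
      by (auto simp: subalgebra_Palg LM_P) (simp add: LM_def)
    have fin: "cofinite M" by (rule index_cofinite[OF M(1,2) n])
    obtain d y where "tri d y" "reduced d y" "M = gen_sub y"
      by (rule normal_form_exists[OF M(1) proiso_pure[OF M(1) fin M(3)] fin])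
    thus "M \<in> ?N" using M(2) by blast
  qed
  show "?I = ?N" "?J = ?N" using 1 2 3 by blast+
qed

text \<open>
  The values that a reduced tuple with diagonal \<open>d\<close> may have at the word \<open>w\<close> of its generator \<open>j\<close>.
\<close>

definition entries :: "(nat \<Rightarrow> nat) \<Rightarrow> nat \<Rightarrow> nat list \<Rightarrow> int set" where
  "entries d j w = (if weight w < g + j then {0} else if w = [j] then {int (d j)} else {0..<diagw d w})"

definition reduced_data :: "(nat \<Rightarrow> nat) \<Rightarrow> (nat \<Rightarrow> nat list \<Rightarrow> int) set" where
  "reduced_data d = PiE {..<g} (\<lambda>j. PiE W (entries d j))"

text \<open>
  Extensional functions, so that different members differ at one of the \<open>g\<close> indices.
\<close>

definition diagonals :: "(nat \<Rightarrow> nat) set" where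
  "diagonals = PiE {..<g} (\<lambda>_. {1..})"

lemma W_weight_eq: "w \<in> W \<Longrightarrow> j < g \<Longrightarrow> weight w = g + j \<Longrightarrow> w = [j]"
proof -
  assume w: "w \<in> W" "j < g" "weight w = g + j"
  hence "weight w < 2 * g" by simp
  then obtain i where "w = [i]" using W_weight_small[OF w(1)] by metis
  thus "w = [j]" using w(3) by simp
qed

lemma reduced_data_tri:
  assumes d: "d \<in> diagonals" and r: "r \<in> reduced_data d"
  shows "tri d (\<lambda>j. comb letter (r j))" "reduced d (\<lambda>j. comb letter (r j))"
proof -
  have rj: "r j w \<in> entries d j w" if "j < g" "w \<in> W" for j w
    using r that unfolding reduced_data_def by (auto simp: PiE_iff)
  show "tri d (\<lambda>j. comb letter (r j))"
    unfolding tri_def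
  proof (intro allI impI conjI ballI)
    fix j assume j: "j < g"
    show "0 < d j" using d j by (auto simp: diagonals_def PiE_iff Suc_le_eq)
    show "comb letter (r j) \<in> P" by simp
    show "coef (comb letter (r j)) [j] = int (d j)"
      using rj[OF j, of "[j]"] j by (simp add: coef_comb single_W entries_def)
    fix w assume "w \<in> W" "weight w < g + j"
    thus "coef (comb letter (r j)) w = 0" using rj[OF j, of w] by (simp add: coef_comb entries_def)
  qed
  show "reduced d (\<lambda>j. comb letter (r j))"
    unfolding reduced_def
  proof (intro allI impI ballI)
    fix j w assume jw: "j < g" "w \<in> W" "g + j < weight w"
    hence "w \<noteq> [j]" by auto
    thus "coef (comb letter (r j)) w \<in> {0..<diagw d w}"
      using rj[OF jw(1,2)] jw(2,3) by (simp add: coef_comb entries_def)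
  qed
qed

lemma diagw_cong: "w \<in> W \<Longrightarrow> (\<And>j. j < g \<Longrightarrow> d j = d' j) \<Longrightarrow> diagw d w = diagw d' w"
  unfolding diagw_def using W_D(2)[of w] by (intro arg_cong[of _ _ prod_list] map_cong) auto

lemma gen_sub_cong:
  assumes "tri d y" "tri d' y'" "\<And>j. j < g \<Longrightarrow> y j = y' j"
  shows "gen_sub y = gen_sub y'"
proof (rule subset_antisym)
  show "gen_sub y \<subseteq> gen_sub y'"
    by (rule gen_sub_least[OF gen_sub_is_sub[OF assms(2)]]) (simp add: assms(3) gen_sub_gens)
  show "gen_sub y' \<subseteq> gen_sub y"
    by (rule gen_sub_least[OF gen_sub_is_sub[OF assms(1)]]) (simp add: assms(3)[symmetric] gen_sub_gens)
qed

lemma normal_form_data: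
  assumes t: "tri d y" and r: "reduced d y"
  obtains d' r' where "d' \<in> diagonals" "r' \<in> reduced_data d'" "gen_sub y = gen_sub (\<lambda>j. comb letter (r' j))"
proof -
  define d' where "d' = restrict d {..<g}"
  define r' where "r' = restrict (\<lambda>j. restrict (coef (y j)) W) {..<g}"
  have dd: "diagw d' w = diagw d w" if "w \<in> W" for w by (rule diagw_cong[OF that]) (simp add: d'_def)
  have d': "d' \<in> diagonals" using tri_D(1)[OF t] by (auto simp: diagonals_def d'_def Suc_le_eq)
  have r': "r' \<in> reduced_data d'"
    unfolding reduced_data_def
  proof (rule PiE_I)
    fix j assume "j \<in> {..<g}"
    hence j: "j < g" by simp
    show "r' j \<in> PiE W (entries d' j)"
    proof (rule PiE_I)
      fix w assume w: "w \<in> W"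
      have e: "r' j w = coef (y j) w" using j w by (simp add: r'_def)
      consider "weight w < g + j" | "w = [j]" | "g + j < weight w" "w \<noteq> [j]"
        using W_weight_eq[OF w j] linorder_less_linear[of "weight w" "g + j"] by blast
      thus "r' j w \<in> entries d' j w"
      proof cases
        case 1
        thus ?thesis using tri_D(3)[OF t j w] e by (simp add: entries_def)
      next
        case 2
        thus ?thesis using tri_D(4)[OF t j] e j by (simp add: entries_def d'_def)
      next
        case 3
        hence "coef (y j) w \<in> {0..<diagw d w}" using r j w unfolding reduced_def by blast
        thus ?thesis using 3 e dd[OF w] by (simp add: entries_def)
      qed
    qed (use j in \<open>simp add: r'_def\<close>)
  qed (simp add: r'_def)
  have "y j = comb letter (r' j)" if "j < g" for j
  proof -
    have "comb letter (r' j) = comb letter (coef (y j))" by (rule comb_cong) (simp add: r'_def that)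
    thus ?thesis using comb_coef[OF tri_D(2)[OF t that]] by simp
  qed
  hence "gen_sub y = gen_sub (\<lambda>j. comb letter (r' j))" by (rule gen_sub_cong[OF t reduced_data_tri(1)[OF d' r']])
  thus thesis using that d' r' by blast
qed

lemma normal_form_card:
  "card {gen_sub y | d y. tri d y \<and> reduced d y \<and> add_index Palg (gen_sub y) = n}
    = card (SIGMA d:{d \<in> diagonals. (\<Prod>w\<in>W. diagw d w) = int n}. reduced_data d)"
proof -
  let ?f = "\<lambda>(d :: nat \<Rightarrow> nat, r). gen_sub (\<lambda>j. comb letter (r j))"
  let ?D = "SIGMA d:{d \<in> diagonals. (\<Prod>w\<in>W. diagw d w) = int n}. reduced_data d"
  have "bij_betw ?f ?D {gen_sub y | d y. tri d y \<and> reduced d y \<and> add_index Palg (gen_sub y) = n}"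
  proof (rule bij_betw_imageI)
    show "inj_on ?f ?D"
    proof (rule inj_onI, clarify)
      fix d r d' r'
      assume d: "d \<in> diagonals" "d' \<in> diagonals" and r: "r \<in> reduced_data d" "r' \<in> reduced_data d'"
        and e: "gen_sub (\<lambda>j. comb letter (r j)) = gen_sub (\<lambda>j. comb letter (r' j))"
      have u: "d j = d' j" "comb letter (r j) = comb letter (r' j)" if "j < g" for j
        using normal_form_unique[OF reduced_data_tri(1)[OF d(1) r(1)] reduced_data_tri(1)[OF d(2) r(2)]
          reduced_data_tri(2)[OF d(1) r(1)] reduced_data_tri(2)[OF d(2) r(2)] e that] by auto
      have "d = d'" using d u(1) unfolding diagonals_def by (intro PiE_ext[of d "{..<g}" _ d']) auto
      moreover have "r = r'"
      proof (rule PiE_ext[OF r[unfolded reduced_data_def \<open>d = d'\<close>]])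
        fix j assume j: "j \<in> {..<g}"
        hence "r j \<in> PiE W (entries d' j)" "r' j \<in> PiE W (entries d' j)"
          using r unfolding reduced_data_def \<open>d = d'\<close> by (auto simp: PiE_iff)
        thus "r j = r' j" by (rule PiE_ext) (use comb_letter_inj u(2) j in auto)
      qed
      ultimately show "d = d' \<and> r = r'" by blast
    qed
    show "?f ` ?D = {gen_sub y | d y. tri d y \<and> reduced d y \<and> add_index Palg (gen_sub y) = n}"
    proof (rule subset_antisym; rule subsetI)
      fix M assume "M \<in> ?f ` ?D"
      then obtain d r where dr: "d \<in> diagonals" "(\<Prod>w\<in>W. diagw d w) = int n" "r \<in> reduced_data d"
        "M = gen_sub (\<lambda>j. comb letter (r j))" by auto
      note t = reduced_data_tri[OF dr(1,3)]
      have "add_index Palg M = n" using add_index_gen_sub[OF t(1)] dr by simp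
      thus "M \<in> {gen_sub y | d y. tri d y \<and> reduced d y \<and> add_index Palg (gen_sub y) = n}" using t dr(4) by blast
    next
      fix M assume "M \<in> {gen_sub y | d y. tri d y \<and> reduced d y \<and> add_index Palg (gen_sub y) = n}"
      then obtain d y where dy: "M = gen_sub y" "tri d y" "reduced d y" "add_index Palg (gen_sub y) = n" by blast
      obtain d' r where dr: "d' \<in> diagonals" "r \<in> reduced_data d'" "gen_sub y = gen_sub (\<lambda>j. comb letter (r j))"
        by (rule normal_form_data[OF dy(2,3)])
      have "(\<Prod>w\<in>W. diagw d' w) = int n" using add_index_gen_sub[OF reduced_data_tri(1)[OF dr(1,2)]] dr(3) dy(4) by simp
      hence "(d', r) \<in> ?D" using dr by blast
      thus "M \<in> ?f ` ?D" using dr(3) dy(1) by force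
    qed
  qed
  thus ?thesis by (rule bij_betw_same_card[symmetric])
qed

subsection \<open>Weights of the letters\<close>

definition letter_count :: "nat \<Rightarrow> nat" where
  "letter_count j = (\<Sum>w\<in>W. count_list w j)"

lemma diagw_count: "set w \<subseteq> {..<g} \<Longrightarrow> diagw d w = (\<Prod>j<g. int (d j) ^ count_list w j)"
proof (induction w)
  case Nil
  show ?case by (simp add: diagw_def)
next
  case (Cons a w)
  have a: "a \<in> {..<g}" using Cons.prems by simp
  have "(\<Prod>j<g. int (d j) ^ count_list (a # w) j) = (\<Prod>j<g. (if a = j then int (d j) else 1) * int (d j) ^ count_list w j)"
    by (rule prod.cong) auto
  also have "\<dots> = (\<Prod>j<g. if a = j then int (d j) else 1) * diagw d w"
    using Cons by (simp add: prod.distrib)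
  also have "(\<Prod>j<g. if a = j then int (d j) else 1) = int (d a)" using a by simp
  finally show ?case by (simp add: diagw_def)
qed

lemma prod_diagw: "(\<Prod>w\<in>W. diagw d w) = (\<Prod>j<g. int (d j) ^ letter_count j)"
proof -
  have "(\<Prod>w\<in>W. diagw d w) = (\<Prod>w\<in>W. \<Prod>j<g. int (d j) ^ count_list w j)"
    by (rule prod.cong) (use diagw_count W_D(2) in auto)
  also have "\<dots> = (\<Prod>j<g. \<Prod>w\<in>W. int (d j) ^ count_list w j)" by (rule prod.swap)
  also have "\<dots> = (\<Prod>j<g. int (d j) ^ letter_count j)" by (simp add: letter_count_def power_sum)
  finally show ?thesis .
qed

text \<open>
  Precomposition with \<open>\<sigma>\<close> on words. It replaces each letter by its preimage under \<open>\<sigma>\<close>, which for an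
  involution is its image.
\<close>

definition relabel :: "(nat \<Rightarrow> nat) \<Rightarrow> (nat list \<Rightarrow> int) \<Rightarrow> nat list \<Rightarrow> int" where
  "relabel \<sigma> p = (\<lambda>w. p (map \<sigma> w))"

lemma relabel_simps: "relabel \<sigma> (p + q) = relabel \<sigma> p + relabel \<sigma> q"
  "relabel \<sigma> (p - q) = relabel \<sigma> p - relabel \<sigma> q" "relabel \<sigma> (iscale k p) = iscale k (relabel \<sigma> p)"
  "relabel \<sigma> 0 = 0" "relabel \<sigma> (comm c p q) = comm c (relabel \<sigma> p) (relabel \<sigma> q)"
  by (auto simp: relabel_def fun_eq_iff comm_def conv_def take_map drop_map)

lemma relabel_gen_sub:
  assumes N: "is_sub N" and t: "tri d y" and y: "\<And>j. j < g \<Longrightarrow> relabel \<sigma> (y j) \<in> N"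
  shows "relabel \<sigma> ` gen_sub y \<subseteq> N"
proof -
  have "is_sub {p \<in> P. relabel \<sigma> p \<in> N}"
    using is_subD[OF N] P_closed unfolding is_sub_def by (auto simp: relabel_simps)
  hence "gen_sub y \<subseteq> {p \<in> P. relabel \<sigma> p \<in> N}"
    by (rule gen_sub_least) (use y tri_D(2)[OF t] in auto)
  thus ?thesis by blast
qed

definition double_at :: "nat \<Rightarrow> nat \<Rightarrow> nat" where "double_at j l = (if l = j then 2 else 1)"

lemma tri_scaled_letters: "(\<And>j. j < g \<Longrightarrow> 0 < d j) \<Longrightarrow> tri d (\<lambda>j. iscale (int (d j)) (letter j))"
  unfolding tri_def using P_closed(3)[OF letter_P P_zero] coef_scale[OF letter_P] coef_letter single_W by auto

lemma gen_sub_letter: "gen_sub letter = P"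
  by (simp add: gen_sub_def P_def)

text \<open>
  Renaming letters does not preserve Lyndon words, since these depend on the order of the letters, so the
  symmetry is deduced from the algebra. The automorphism of \<open>P\<close> that exchanges the letters \<open>j\<close> and \<open>k\<close>
  carries the subalgebra generated by \<open>2 x\<^sub>j\<close> and the other letters to that generated by \<open>2 x\<^sub>k\<close> and the other
  letters. So these have the same index, and it is \<open>2\<close> to the power \<open>letter_count j\<close> and \<open>letter_count k\<close>,
  respectively.
\<close>

lemma letter_count_eq:
  assumes j: "j < g" and k: "k < g"
  shows "letter_count j = letter_count k"
proof -
  let ?\<sigma> = "Transposition.transpose j k"
  let ?s = "relabel ?\<sigma>"
  let ?y = "\<lambda>j l. iscale (int (double_at j l)) (letter l)"
  have inv: "?s (?s p) = p" for p by (simp add: relabel_def o_def)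
  have lt: "?\<sigma> l < g" if "l < g" for l using that j k by (simp add: Transposition.transpose_def)
  have sl: "?s (letter l) = letter (?\<sigma> l)" for l
  proof
    fix w
    have "map ?\<sigma> w = [l] \<longleftrightarrow> w = [?\<sigma> l]"
      by (cases w) (auto simp: Transposition.transpose_def)
    thus "?s (letter l) w = letter (?\<sigma> l) w" by (simp add: relabel_def letter_def)
  qed
  have t: "tri (double_at i) (?y i)" for i by (rule tri_scaled_letters) (simp add: double_at_def)
  have tl: "tri (\<lambda>_. 1) letter" using tri_scaled_letters[of "\<lambda>_. 1"] by simp
  have sP: "?s ` P \<subseteq> P"
    using relabel_gen_sub[OF is_sub_P tl, of ?\<sigma>] sl letter_P lt by (simp add: gen_sub_letter)
  have incl: "?s ` gen_sub (?y i) \<subseteq> gen_sub (?y i')" if "i' = ?\<sigma> i" for i i'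
  proof (rule relabel_gen_sub[OF gen_sub_is_sub[OF t] t])
    fix l assume l: "l < g"
    have "double_at i l = double_at i' (?\<sigma> l)" unfolding that double_at_def by (metis transpose_involutory)
    hence "?s (?y i l) = ?y i' (?\<sigma> l)" by (simp add: relabel_simps sl)
    thus "?s (?y i l) \<in> gen_sub (?y i')" using gen_sub_gens[OF lt[OF l], of "?y i'"] by simp
  qed
  have "gen_sub (?y k) \<subseteq> ?s ` gen_sub (?y j)"
  proof
    fix p assume "p \<in> gen_sub (?y k)"
    hence "?s p \<in> gen_sub (?y j)" using incl[of j k] by (auto simp: image_subset_iff)
    thus "p \<in> ?s ` gen_sub (?y j)" using inv by (metis imageI)
  qed
  hence eq: "?s ` gen_sub (?y j) = gen_sub (?y k)" using incl[of k j] by auto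
  have iso: "iso_via \<Z> ?s Palg Palg"
    unfolding iso_via_def
    using sP inv by (auto simp: relabel_simps intro!: bij_betw_byWitness[of _ ?s])
  have "add_index Palg (gen_sub (?y k)) = add_index Palg (gen_sub (?y j))"
    using iso_via_add_index[OF iso nonassoc_algebra.closed_ops[OF nonassoc_algebra_Palg], of "gen_sub (?y j)"]
      is_subD(1)[OF gen_sub_is_sub[OF t]] eq by simp
  hence "(\<Prod>l<g. int (double_at k l) ^ letter_count l) = (\<Prod>l<g. int (double_at j l) ^ letter_count l)"
    using add_index_gen_sub[OF t] prod_diagw by metis
  moreover have "(\<Prod>l<g. int (double_at i l) ^ letter_count l) = 2 ^ letter_count i" if "i < g" for i
  proof -
    have "(\<Prod>l<g. int (double_at i l) ^ letter_count l) = (\<Prod>l<g. if l = i then 2 ^ letter_count i else 1)"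
      by (rule prod.cong) (auto simp: double_at_def)
    thus ?thesis using that by simp
  qed
  ultimately have "(2::int) ^ letter_count k = 2 ^ letter_count j" using j k by simp
  thus ?thesis by simp
qed

text \<open>
  The number \<open>\<alpha>\<close> of the theorem, see \<open>sum_rank\<close>. By \<open>letter_count_alpha\<close>, any letter could be used here.
\<close>

definition alpha :: nat where "alpha = letter_count 0"

lemma letter_count_alpha: "j < g \<Longrightarrow> letter_count j = alpha"
  unfolding alpha_def using letter_count_eq[of j 0] g_pos by simp

definition W_long where "W_long = {w \<in> W. 2 \<le> length w}"

lemma W_split: "W = (\<lambda>j. [j]) ` {..<g} \<union> W_long" "(\<lambda>j. [j]) ` {..<g} \<inter> W_long = {}" "finite W_long"
proof -
  show "W = (\<lambda>j. [j]) ` {..<g} \<union> W_long"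
  proof (rule subset_antisym; rule subsetI)
    fix w assume w: "w \<in> W"
    show "w \<in> (\<lambda>j. [j]) ` {..<g} \<union> W_long" by (rule W_length_cases[OF w]) (use w in \<open>auto simp: W_long_def\<close>)
  qed (auto simp: W_long_def single_W)
qed (auto simp: W_long_def finite_W)

lemma sum_W_split: "(\<Sum>w\<in>W. f w) = (\<Sum>j<g. f [j]) + (\<Sum>w\<in>W_long. f w)" for f :: "_ \<Rightarrow> nat"
  by (subst W_split(1), subst sum.union_disjoint) (auto simp: W_split sum.reindex inj_on_def)

lemma prod_W_split: "(\<Prod>w\<in>W. f w) = (\<Prod>j<g. f [j]) * (\<Prod>w\<in>W_long. f w)" for f :: "_ \<Rightarrow> nat"
  by (subst W_split(1), subst prod.union_disjoint) (auto simp: W_split prod.reindex inj_on_def)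

lemma letter_count_long: "j < g \<Longrightarrow> (\<Sum>w\<in>W_long. count_list w j) = alpha - 1" and alpha_pos: "1 \<le> alpha"
proof -
  have e: "alpha = 1 + (\<Sum>w\<in>W_long. count_list w j)" if j: "j < g" for j
  proof -
    have "alpha = (\<Sum>i<g. count_list [i] j) + (\<Sum>w\<in>W_long. count_list w j)"
      using letter_count_alpha[OF j] sum_W_split[of "\<lambda>w. count_list w j"] by (simp add: letter_count_def)
    moreover have "(\<Sum>i<g. count_list [i] j) = (\<Sum>i<g. if i = j then 1 else 0)" by (rule sum.cong) auto
    ultimately show ?thesis using j by simp
  qed
  show "j < g \<Longrightarrow> (\<Sum>w\<in>W_long. count_list w j) = alpha - 1" using e[of j] by simp
  show "1 \<le> alpha" using e[of 0] g_pos by simp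
qed

text \<open>
  The letter \<open>l\<close> may occur beyond the diagonal in the generators \<open>j < l\<close>, with \<open>d\<^sub>l\<close> possible coefficients in
  each of them; this gives \<open>d\<^sub>l\<^sup>l\<close>. A longer word \<open>w\<close> may occur in all \<open>g\<close> generators, with \<open>d\<^sup>w\<close> possible
  coefficients.
\<close>

lemma card_reduced_data:
  assumes d: "d \<in> diagonals"
  shows "card (reduced_data d) = (\<Prod>j<g. d j ^ (j + g * (alpha - 1)))"
proof -
  have cS1: "card (entries d j [l]) = (if j < l then d l else 1)" if "j < g" for j l
    using that by (auto simp: entries_def)
  have cS2: "card (entries d j w) = (\<Prod>l<g. d l ^ count_list w l)" if "j < g" "w \<in> W_long" for j w
  proof -
    have w: "w \<in> W" "2 \<le> length w" using that by (auto simp: W_long_def)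
    have "2 * g \<le> length w * g" using w(2) by (intro mult_right_mono) auto
    hence "\<not> weight w < g + j" using weight_length[of w] that(1) by linarith
    moreover have "w \<noteq> [j]" using w(2) by auto
    ultimately have "card (entries d j w) = nat (diagw d w)" by (simp add: entries_def)
    also have "diagw d w = int (\<Prod>l<g. d l ^ count_list w l)" using diagw_count[OF W_D(2)[OF w(1)]] by simp
    finally show ?thesis by (simp only: nat_int)
  qed
  have "card (reduced_data d) = (\<Prod>j<g. \<Prod>w\<in>W. card (entries d j w))"
    unfolding reduced_data_def by (simp add: card_PiE finite_W)
  also have "\<dots> = (\<Prod>j<g. (\<Prod>l<g. if j < l then d l else 1) * (\<Prod>w\<in>W_long. \<Prod>l<g. d l ^ count_list w l))"
    unfolding prod_W_split using cS1 cS2 by (intro prod.cong arg_cong2[of _ _ _ _ "(*)"]) auto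
  also have "\<dots> = (\<Prod>j<g. \<Prod>l<g. if j < l then d l else 1) * (\<Prod>w\<in>W_long. \<Prod>l<g. d l ^ count_list w l) ^ g"
    by (simp add: prod.distrib)
  also have "(\<Prod>j<g. \<Prod>l<g. if j < l then d l else 1) = (\<Prod>l<g. \<Prod>j<g. if j < l then d l else 1)"
    by (rule prod.swap)
  also have "\<dots> = (\<Prod>l<g. d l ^ l)"
  proof (rule prod.cong)
    fix l assume l: "l \<in> {..<g}"
    have "(\<Prod>j<g. if j < l then d l else 1) = (\<Prod>j\<in>{..<g} \<inter> {j. j < l}. d l)"
      by (simp add: prod.If_cases)
    also have "{..<g} \<inter> {j. j < l} = {..<l}" using l by auto
    finally show "(\<Prod>j<g. if j < l then d l else 1) = d l ^ l" by simp
  qed simp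
  also have "(\<Prod>w\<in>W_long. \<Prod>l<g. d l ^ count_list w l) = (\<Prod>l<g. \<Prod>w\<in>W_long. d l ^ count_list w l)"
    by (rule prod.swap)
  also have "\<dots> = (\<Prod>l<g. d l ^ (alpha - 1))"
    by (rule prod.cong) (use letter_count_long in \<open>auto simp: power_sum[symmetric]\<close>)
  also have "(\<Prod>l<g. d l ^ (alpha - 1)) ^ g = (\<Prod>l<g. d l ^ (g * (alpha - 1)))"
    by (simp add: prod_power_distrib power_mult[symmetric] mult.commute)
  finally show ?thesis by (simp add: prod.distrib power_add)
qed

definition diagonals_of_index :: "nat \<Rightarrow> (nat \<Rightarrow> nat) set" where
  "diagonals_of_index n = {d \<in> diagonals. (\<Prod>j<g. d j) ^ alpha = n}"

lemma finite_diagonals_of_index: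
  assumes "1 \<le> n"
  shows "finite (diagonals_of_index n)"
proof (rule finite_subset)
  show "diagonals_of_index n \<subseteq> PiE {..<g} (\<lambda>_. {..n})"
  proof
    fix d assume d: "d \<in> diagonals_of_index n"
    hence dD: "d \<in> diagonals" and e: "(\<Prod>j<g. d j) ^ alpha = n" by (auto simp: diagonals_of_index_def)
    have "d j \<le> n" if j: "j < g" for j
    proof -
      have "d j dvd (\<Prod>j<g. d j)" using j by (intro dvd_prodI) auto
      also have "(\<Prod>j<g. d j) dvd (\<Prod>j<g. d j) ^ alpha" using alpha_pos by (intro dvd_power) auto
      finally show ?thesis using e assms by (intro dvd_imp_le) auto
    qed
    thus "d \<in> PiE {..<g} (\<lambda>_. {..n})" using dD by (auto simp: diagonals_def PiE_iff)
  qed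
qed (auto intro: finite_PiE)

lemma count_formula:
  assumes n: "1 \<le> n"
  shows "iso_count Palg n = (\<Sum>d\<in>diagonals_of_index n. \<Prod>j<g. d j ^ (j + g * (alpha - 1)))"
    and "proiso_count Palg n = (\<Sum>d\<in>diagonals_of_index n. \<Prod>j<g. d j ^ (j + g * (alpha - 1)))"
proof -
  have idx: "(\<Prod>w\<in>W. diagw d w) = int ((\<Prod>j<g. d j) ^ alpha)" for d
  proof -
    have "(\<Prod>w\<in>W. diagw d w) = (\<Prod>j<g. int (d j) ^ alpha)"
      unfolding prod_diagw by (rule prod.cong) (use letter_count_alpha in auto)
    thus ?thesis by (simp add: prod_power_distrib)
  qed
  have "card (SIGMA d:{d \<in> diagonals. (\<Prod>w\<in>W. diagw d w) = int n}. reduced_data d) = card (SIGMA d:diagonals_of_index n. reduced_data d)"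
    unfolding idx diagonals_of_index_def by (simp only: of_nat_eq_iff)
  also have "\<dots> = (\<Sum>d\<in>diagonals_of_index n. card (reduced_data d))"
  proof (rule card_SigmaI[OF finite_diagonals_of_index[OF n]])
    have "finite (entries d j w)" for d j w by (simp add: entries_def)
    hence "finite (reduced_data d)" for d unfolding reduced_data_def by (intro finite_PiE finite_W) auto
    thus "\<forall>d\<in>diagonals_of_index n. finite (reduced_data d)" by blast
  qed
  also have "\<dots> = (\<Sum>d\<in>diagonals_of_index n. \<Prod>j<g. d j ^ (j + g * (alpha - 1)))"
    by (rule sum.cong) (use card_reduced_data in \<open>auto simp: diagonals_of_index_def\<close>)
  finally have *: "card (SIGMA d:{d \<in> diagonals. (\<Prod>w\<in>W. diagw d w) = int n}. reduced_data d)
    = (\<Sum>d\<in>diagonals_of_index n. \<Prod>j<g. d j ^ (j + g * (alpha - 1)))" .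
  show "iso_count Palg n = (\<Sum>d\<in>diagonals_of_index n. \<Prod>j<g. d j ^ (j + g * (alpha - 1)))"
    unfolding iso_count_def normal_forms(1)[OF n] normal_form_card * ..
  show "proiso_count Palg n = (\<Sum>d\<in>diagonals_of_index n. \<Prod>j<g. d j ^ (j + g * (alpha - 1)))"
    unfolding proiso_count_def normal_forms(2)[OF n] normal_form_card * ..
qed

end

section \<open>Ranks of the lower central factors\<close>

text \<open>
  Gaussian elimination without division: multiplying by the pivot \<open>f x0 b\<close> removes the coordinate \<open>b\<close> from the
  other vectors.
\<close>

lemma integer_relation:
  fixes f :: "'a \<Rightarrow> 'b \<Rightarrow> int"
  assumes "finite B" "finite S" "card B < card S"
  shows "\<exists>k :: 'a \<Rightarrow> int. (\<exists>x\<in>S. k x \<noteq> 0) \<and> (\<forall>b\<in>B. (\<Sum>x\<in>S. k x * f x b) = 0)"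
  using assms
proof (induction B arbitrary: S f rule: finite_induct)
  case empty
  hence "S \<noteq> {}" by auto
  thus ?case by (intro exI[of _ "\<lambda>_. 1"]) auto
next
  case (insert b B)
  show ?case
  proof (cases "\<forall>x\<in>S. f x b = 0")
    case True
    have "card B < card S" using insert by simp
    from insert.IH[OF insert.prems(1) this, of f] obtain k :: "'a \<Rightarrow> int"
      where k: "\<exists>x\<in>S. k x \<noteq> 0" "\<forall>b\<in>B. (\<Sum>x\<in>S. k x * f x b) = 0" by blast
    moreover have "(\<Sum>x\<in>S. k x * f x b) = 0" using True by simp
    ultimately show ?thesis by blast
  next
    case False
    then obtain x0 where x0: "x0 \<in> S" "f x0 b \<noteq> 0" by blast
    let ?S = "S - {x0}"
    define f' where "f' x c = f x0 b * f x c - f x b * f x0 c" for x c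
    have "card B < card ?S" using insert x0 by (simp add: card_Diff_singleton)
    from insert.IH[OF _ this, of f'] insert.prems(1) obtain k :: "'a \<Rightarrow> int"
      where k: "\<exists>x\<in>?S. k x \<noteq> 0" "\<And>c. c \<in> B \<Longrightarrow> (\<Sum>x\<in>?S. k x * f' x c) = 0" by auto
    define l where "l x = (if x = x0 then - (\<Sum>y\<in>?S. k y * f y b) else k x * f x0 b)" for x
    have split: "(\<Sum>x\<in>S. l x * f x c) = (\<Sum>x\<in>?S. k x * f' x c)" for c
    proof -
      have "(\<Sum>x\<in>S. l x * f x c) = l x0 * f x0 c + (\<Sum>x\<in>?S. l x * f x c)"
        using x0 insert.prems(1) by (simp add: sum.remove)
      also have "(\<Sum>x\<in>?S. l x * f x c) = (\<Sum>x\<in>?S. k x * f x0 b * f x c)"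
        by (rule sum.cong) (auto simp: l_def)
      also have "l x0 * f x0 c = (\<Sum>x\<in>?S. - (k x * f x b * f x0 c))"
        by (simp add: l_def sum_distrib_right sum_negf)
      finally show ?thesis by (simp add: f'_def algebra_simps sum.distrib sum_subtractf sum_negf)
    qed
    have "\<exists>x\<in>S. l x \<noteq> 0" using k(1) x0(2) by (auto simp: l_def)
    moreover have "(\<Sum>x\<in>S. l x * f x c) = 0" if "c \<in> insert b B" for c
    proof (cases "c = b")
      case True
      thus ?thesis unfolding split by (simp add: f'_def mult.commute)
    next
      case False
      thus ?thesis unfolding split using k(2) that by blast
    qed
    ultimately show ?thesis by blast
  qed
qed

text \<open>
  The additive group of integer functions, in multiplicative notation in order to be compared with the
  factors of the lower central series.
\<close>

definition int_functions :: "('b \<Rightarrow> int) monoid" where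
  "int_functions = \<lparr>carrier = UNIV, mult = (+), one = 0\<rparr>"

lemma int_functions_simps [simp]: "carrier int_functions = UNIV" "x \<otimes>\<^bsub>int_functions\<^esub> y = x + y"
  "\<one>\<^bsub>int_functions\<^esub> = 0"
  by (simp_all add: int_functions_def)

lemma comm_group_int_functions: "comm_group int_functions"
proof (rule comm_groupI)
  fix x :: "'b \<Rightarrow> int"
  show "\<exists>y\<in>carrier int_functions. y \<otimes>\<^bsub>int_functions\<^esub> x = \<one>\<^bsub>int_functions\<^esub>"
    by (intro bexI[of _ "- x"]) auto
qed (auto simp: add_ac)

lemma int_functions_pow: "x [^]\<^bsub>int_functions\<^esub> (k :: int) = iscale k x"
proof -
  interpret comm_group int_functions by (rule comm_group_int_functions)
  have n: "x [^]\<^bsub>int_functions\<^esub> (n :: nat) = iscale (int n) x" for n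
  proof (induction n)
    case 0
    have "x [^]\<^bsub>int_functions\<^esub> (0 :: nat) = iscale (int 0) x" by simp
    thus ?case .
  next
    case (Suc n)
    have "iscale (int (Suc n)) x = iscale (int n) x + x" by (simp add: fun_eq_iff algebra_simps)
    moreover have "x [^]\<^bsub>int_functions\<^esub> Suc n = x [^]\<^bsub>int_functions\<^esub> n + x" by simp
    ultimately show ?case using Suc by (simp only:)
  qed
  have inv: "inv\<^bsub>int_functions\<^esub> y = - y" for y :: "'a \<Rightarrow> int"
    by (rule inv_equality) auto
  show ?thesis
  proof (cases "k < 0")
    case True
    have "iscale k x = - iscale (int (nat (- k))) x" using True by (simp add: fun_eq_iff)
    moreover have "x [^]\<^bsub>int_functions\<^esub> k = inv\<^bsub>int_functions\<^esub> (x [^]\<^bsub>int_functions\<^esub> nat (- k))"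
      using True by (simp only: int_pow_def2 if_True)
    ultimately show ?thesis unfolding n inv by (simp only:)
  next
    case False
    hence "x [^]\<^bsub>int_functions\<^esub> k = x [^]\<^bsub>int_functions\<^esub> nat k"
      by (simp only: int_pow_def2 if_False)
    also have "\<dots> = iscale k x" unfolding n using False by simp
    finally show ?thesis .
  qed
qed

text \<open>
  The group is identified with \<open>\<int>\<^sup>W\<close>, whose unit vectors are independent and in which more than \<open>card W\<close>
  vectors satisfy a relation.
\<close>

lemma ab_rank_eq:
  fixes \<psi> :: "'a \<Rightarrow> 'b \<Rightarrow> int"
  assumes G: "comm_group G" and hom: "\<psi> \<in> hom G int_functions" and inj: "inj_on \<psi> (carrier G)"
    and W: "finite W" and supp: "\<And>x b. x \<in> carrier G \<Longrightarrow> b \<notin> W \<Longrightarrow> \<psi> x b = 0"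
    and surj: "\<And>w. w \<in> W \<Longrightarrow> \<exists>x\<in>carrier G. \<psi> x = (\<lambda>b. if b = w then 1 else 0)"
  shows "ab_rank G = card W"
proof -
  interpret G: comm_group G by fact
  interpret Z: comm_group "int_functions :: ('b \<Rightarrow> int) monoid" by (rule comm_group_int_functions)
  interpret H: group_hom G "int_functions :: ('b \<Rightarrow> int) monoid" \<psi>
    by (intro group_hom.intro group_hom_axioms.intro G.is_group Z.is_group hom)
  have pow: "\<psi> (x [^]\<^bsub>G\<^esub> (k :: int)) = iscale k (\<psi> x)" if "x \<in> carrier G" for x k
    using H.hom_int_pow[OF that, of k] int_functions_pow[of "\<psi> x" k] by simp
  have fp: "\<psi> (finprod G (\<lambda>x. x [^]\<^bsub>G\<^esub> (k x :: int)) S) b = (\<Sum>x\<in>S. k x * \<psi> x b)"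
    if "finite S" "S \<subseteq> carrier G" for S k b
    using that
  proof (induction S rule: finite_induct)
    case (insert x F)
    have c: "(\<lambda>x. x [^]\<^bsub>G\<^esub> k x) \<in> F \<rightarrow> carrier G" "x [^]\<^bsub>G\<^esub> k x \<in> carrier G" using insert.prems by auto
    have "\<psi> (finprod G (\<lambda>x. x [^]\<^bsub>G\<^esub> k x) (insert x F)) = \<psi> (x [^]\<^bsub>G\<^esub> k x) + \<psi> (finprod G (\<lambda>x. x [^]\<^bsub>G\<^esub> k x) F)"
      using insert.hyps c by (simp add: G.finprod_closed)
    thus ?case using insert pow[of x "k x"] by simp
  qed simp
  have one: "finprod G (\<lambda>x. x [^]\<^bsub>G\<^esub> (k x :: int)) S = \<one>\<^bsub>G\<^esub> \<longleftrightarrow> (\<forall>b\<in>W. (\<Sum>x\<in>S. k x * \<psi> x b) = 0)"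
    if "finite S" "S \<subseteq> carrier G" for S k
  proof
    assume "finprod G (\<lambda>x. x [^]\<^bsub>G\<^esub> (k x :: int)) S = \<one>\<^bsub>G\<^esub>"
    thus "\<forall>b\<in>W. (\<Sum>x\<in>S. k x * \<psi> x b) = 0" using fp[OF that, of k] H.hom_one by simp
  next
    assume z: "\<forall>b\<in>W. (\<Sum>x\<in>S. k x * \<psi> x b) = 0"
    have c: "finprod G (\<lambda>x. x [^]\<^bsub>G\<^esub> (k x :: int)) S \<in> carrier G"
      using that by (intro G.finprod_closed) auto
    have "\<psi> (finprod G (\<lambda>x. x [^]\<^bsub>G\<^esub> (k x :: int)) S) b = 0" for b
      using z supp[OF c, of b] fp[OF that, of k b] by (cases "b \<in> W") auto
    hence "\<psi> (finprod G (\<lambda>x. x [^]\<^bsub>G\<^esub> (k x :: int)) S) = \<psi> \<one>\<^bsub>G\<^esub>" using H.hom_one by (auto simp: fun_eq_iff)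
    thus "finprod G (\<lambda>x. x [^]\<^bsub>G\<^esub> (k x :: int)) S = \<one>\<^bsub>G\<^esub>" using inj_onD[OF inj _ c] by simp
  qed
  have upper: "card S \<le> card W" if "int_independent G S" for S
  proof (rule ccontr)
    assume "\<not> card S \<le> card W"
    hence l: "card W < card S" by simp
    have S: "finite S" "S \<subseteq> carrier G"
      "\<And>k :: 'a \<Rightarrow> int. finprod G (\<lambda>x. x [^]\<^bsub>G\<^esub> k x) S = \<one>\<^bsub>G\<^esub> \<Longrightarrow> \<forall>x\<in>S. k x = 0"
      using that by (auto simp: int_independent_def)
    obtain k :: "'a \<Rightarrow> int" where k: "\<exists>x\<in>S. k x \<noteq> 0" "\<forall>b\<in>W. (\<Sum>x\<in>S. k x * \<psi> x b) = 0"
      using integer_relation[OF W S(1) l, of \<psi>] by blast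
    show False using S(3)[of k] one[OF S(1,2), of k] k by blast
  qed
  have "\<forall>w. \<exists>x. w \<in> W \<longrightarrow> x \<in> carrier G \<and> \<psi> x = (\<lambda>b. if b = w then 1 else 0)" using surj by blast
  then obtain e where e: "\<And>w. w \<in> W \<Longrightarrow> e w \<in> carrier G" "\<And>w. w \<in> W \<Longrightarrow> \<psi> (e w) = (\<lambda>b. if b = w then 1 else 0)"
    by metis
  have inje: "inj_on e W"
  proof (rule inj_onI)
    fix v w assume vw: "v \<in> W" "w \<in> W" "e v = e w"
    hence "(\<lambda>b. if b = v then 1 else (0::int)) = (\<lambda>b. if b = w then 1 else 0)" using e(2)[of v] e(2)[of w] by simp
    from fun_cong[OF this, of v] show "v = w" by (simp split: if_splits)
  qed
  have ind: "int_independent G (e ` W)"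
    unfolding int_independent_def
  proof (intro conjI allI impI)
    show f: "finite (e ` W)" and c: "e ` W \<subseteq> carrier G" using W e by auto
    fix k :: "'a \<Rightarrow> int" assume "finprod G (\<lambda>x. x [^]\<^bsub>G\<^esub> k x) (e ` W) = \<one>\<^bsub>G\<^esub>"
    hence z: "\<forall>b\<in>W. (\<Sum>x\<in>e ` W. k x * \<psi> x b) = 0" using one[OF f c] by simp
    have "k (e w) = 0" if w: "w \<in> W" for w
    proof -
      have "(\<Sum>x\<in>e ` W. k x * \<psi> x w) = (\<Sum>v\<in>W. k (e v) * \<psi> (e v) w)" by (simp add: sum.reindex[OF inje])
      also have "\<dots> = (\<Sum>v\<in>W. if v = w then k (e w) else 0)" by (rule sum.cong) (auto simp: e(2))
      also have "\<dots> = k (e w)" using W w by simp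
      finally show ?thesis using z w by simp
    qed
    thus "\<forall>x\<in>e ` W. k x = 0" by blast
  qed
  have "card W \<in> {card S | S. int_independent G S}" using ind card_image[OF inje] by force
  moreover have "x \<le> card W" if "x \<in> {card S | S. int_independent G S}" for x using that upper by blast
  ultimately show ?thesis unfolding ab_rank_def by (rule cSup_eq_maximum)
qed

context free_nilp
begin

text \<open>
  Brackets add degrees; conversely, the Lyndon bracket of a word of length \<open>k\<close> is an iterated bracket of
  \<open>k\<close> letters.
\<close>

lemma lower_central_Palg: "lower_central Palg (Suc i) = P \<inter> filt length (Suc i)"
proof (rule subset_antisym)
  interpret L: lie_algebra \<Z> Palg by (rule lie_algebra_Palg)
  have "lower_central Palg (Suc i) \<subseteq> filt length (Suc i)"
  proof (induction i)
    case 0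
    show ?case using P_filt_1 by auto
  next
    case (Suc i)
    let ?G = "{x \<otimes>\<^bsub>Palg\<^esub> y | x y. x \<in> carrier Palg \<and> y \<in> lower_central Palg (Suc i)}"
    have GP: "?G \<subseteq> P" using L.lower_central_subset[of "Suc i"] P_closed(4) by auto
    have sg: "subgroup (P \<inter> filt length (Suc (Suc i))) (add_monoid Palg)"
    proof (rule subgroup.intro)
      fix p assume p: "p \<in> P \<inter> filt length (Suc (Suc i))"
      have "\<ominus>\<^bsub>Palg\<^esub> p = - p"
        by (rule L.M.minus_equality) (use p P_uminus in auto)
      moreover have "- p \<in> filt length (Suc (Suc i))" using p by (auto simp: filt_def)
      ultimately show "inv\<^bsub>add_monoid Palg\<^esub> p \<in> P \<inter> filt length (Suc (Suc i))"
        using p P_uminus by (simp add: a_inv_def)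
    qed (auto intro: P_closed filt_closed)
    have "?G \<subseteq> P \<inter> filt length (Suc (Suc i))"
    proof
      fix z assume "z \<in> ?G"
      then obtain x y where xy: "z = comm c x y" "x \<in> P" "y \<in> lower_central Palg (Suc i)" by auto
      have "comm c x y \<in> filt length (1 + Suc i)"
        by (rule comm_filt[OF _ P_filt_1[OF xy(2)] subsetD[OF Suc.IH xy(3)]]) simp
      thus "z \<in> P \<inter> filt length (Suc (Suc i))" using GP \<open>z \<in> ?G\<close> xy(1) by auto
    qed
    from L.add.generate_subgroup_incl[OF this sg] show ?case by simp
  qed
  thus "lower_central Palg (Suc i) \<subseteq> P \<inter> filt length (Suc i)" using L.lower_central_subset[of "Suc i"] by auto
  show "P \<inter> filt length (Suc i) \<subseteq> lower_central Palg (Suc i)"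
  proof
    fix p assume "p \<in> P \<inter> filt length (Suc i)"
    hence p: "p \<in> P" "p \<in> filt length (Suc i)" by auto
    note sg = L.lower_central_subgroup[of "Suc i"]
    have ev: "magma_eval Palg letter t = meval c letter t" for t by (induction t) auto
    have sc: "iscale k x \<in> lower_central Palg (Suc i)" if "x \<in> lower_central Palg (Suc i)" for k x
      using L.lower_central_ideal[of "Suc i"] that submodule.smult_closed[of "lower_central Palg (Suc i)" \<Z> Palg k x]
      by (auto simp: two_sided_ideal_def simp del: lower_central.simps)
    have z: "0 \<in> lower_central Palg (Suc i)" using subgroup.one_closed[OF sg] by simp
    have "iscale (coef p w) (lyn c letter w) \<in> lower_central Palg (Suc i)" if w: "w \<in> W" for w
    proof (cases "length w < Suc i")
      case True
      hence "coef p w = 0" by (rule coef_filt_length[OF p w])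
      thus ?thesis using z by simp
    next
      case False
      have "lyn c letter w \<in> lower_central Palg (length w)"
        using L.magma_eval_lower_central[of "lyndon_bracket w" letter] letter_P W_D[OF w] ev
        by (auto simp: foliage_lyndon_bracket gens_lyndon_bracket)
      hence "lyn c letter w \<in> lower_central Palg (Suc i)"
        using L.lower_central_antimono[of "Suc i" "length w"] False by auto
      thus ?thesis by (rule sc)
    qed
    note t = this
    have "finite F \<Longrightarrow> F \<subseteq> W \<Longrightarrow> (\<Sum>w\<in>F. iscale (coef p w) (lyn c letter w)) \<in> lower_central Palg (Suc i)" for F
    proof (induction F rule: finite_induct)
      case empty
      show ?case by (simp only: sum.empty z)
    next
      case (insert w F)
      have "iscale (coef p w) (lyn c letter w) + (\<Sum>w\<in>F. iscale (coef p w) (lyn c letter w)) \<in> lower_central Palg (Suc i)"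
      proof -
        have "w \<in> W" "(\<Sum>w\<in>F. iscale (coef p w) (lyn c letter w)) \<in> lower_central Palg (Suc i)"
          using insert.prems insert.IH by blast+
        thus ?thesis using subgroup.m_closed[OF sg t[of w]] by (simp del: lower_central.simps)
      qed
      thus ?case unfolding sum.insert[OF insert.hyps] .
    qed
    hence "comb letter (coef p) \<in> lower_central Palg (Suc i)" unfolding comb_def using finite_W by blast
    thus "p \<in> lower_central Palg (Suc i)" using comb_coef[OF p(1)] by simp
  qed
qed

text \<open>
  The coordinates at the Lyndon words of length \<open>i\<close> define a homomorphism on the \<open>i\<close>-th term of the lower
  central series, whose kernel is the next term by \<open>lower_central_Palg\<close>.
\<close>

lemma rank_lower_central_factor:
  assumes i: "1 \<le> i" "i \<le> c"
  shows "ab_rank (lower_central_factor (free_nilpotent c g) i) = card {w \<in> W. length w = i}"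
proof -
  let ?F = "free_nilpotent c g" and ?W = "{w \<in> W. length w = i}"
  interpret F: lie_algebra \<Z> ?F by (rule lie_algebra_free_nilpotent)
  interpret L: lie_algebra \<Z> Palg by (rule lie_algebra_Palg)
  obtain i0 where i0: "i = Suc i0" using i by (cases i) auto
  obtain h where h: "iso_via \<Z> h ?F Palg" using free_nilpotent_iso by (auto simp: alg_iso_iff)
  note hD = iso_viaD[OF h]
  have lc: "h ` lower_central ?F (Suc k) = P \<inter> filt length (Suc k)" for k
    using iso_via_lower_central[OF h F.M.abelian_group_axioms L.M.abelian_group_axioms F.prod_closed, of "Suc k"]
    unfolding lower_central_Palg by blast
  let ?G = "add_monoid ?F\<lparr>carrier := lower_central ?F i\<rparr>" and ?H = "lower_central ?F (Suc i)"
  have sgi: "subgroup (lower_central ?F i) (add_monoid ?F)" by (rule F.lower_central_subgroup)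
  have sub: "lower_central ?F i \<subseteq> carrier ?F" by (rule F.lower_central_subset)
  have G: "comm_group ?G"
  proof (rule group.group_comm_groupI)
    show "group ?G" by (rule F.add.subgroup_imp_group[OF sgi])
    fix x y assume "x \<in> carrier ?G" "y \<in> carrier ?G"
    hence "x \<in> carrier ?F" "y \<in> carrier ?F" using sub by auto
    thus "x \<otimes>\<^bsub>?G\<^esub> y = y \<otimes>\<^bsub>?G\<^esub> x" by (simp add: F.M.a_comm)
  qed
  interpret G: comm_group ?G by (rule G)
  define \<phi> where "\<phi> x = (\<lambda>w. if w \<in> ?W then coef (h x) w else 0)" for x
  have hi: "h x \<in> P" "h x \<in> filt length i" if "x \<in> lower_central ?F i" for x
    using lc[of i0] that unfolding i0 by auto
  have iC: "x \<in> carrier ?F" if "x \<in> lower_central ?F i" for x using F.lower_central_subset that by blast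
  have hom: "\<phi> \<in> hom ?G int_functions"
  proof (rule homI)
    fix x y assume "x \<in> carrier ?G" "y \<in> carrier ?G"
    hence xy: "x \<in> lower_central ?F i" "y \<in> lower_central ?F i" by auto
    have e: "h (x \<oplus>\<^bsub>?F\<^esub> y) = h x + h y" using hD(2)[OF iC[OF xy(1)] iC[OF xy(2)]] by simp
    have "coef (h (x \<oplus>\<^bsub>?F\<^esub> y)) w = coef (h x) w + coef (h y) w" if "w \<in> W" for w
      unfolding e by (rule coef_add[OF hi(1)[OF xy(1)] hi(1)[OF xy(2)] that])
    hence "\<phi> (x \<oplus>\<^bsub>?F\<^esub> y) w = (\<phi> x + \<phi> y) w" for w by (simp add: \<phi>_def)
    thus "\<phi> (x \<otimes>\<^bsub>?G\<^esub> y) = \<phi> x \<otimes>\<^bsub>int_functions\<^esub> \<phi> y" by auto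
  qed simp
  interpret H: group_hom ?G "int_functions :: (nat list \<Rightarrow> int) monoid" \<phi>
    by (intro group_hom.intro group_hom_axioms.intro G.is_group hom
        comm_group.axioms(2)[OF comm_group_int_functions])
  have ker: "kernel ?G (int_functions :: (nat list \<Rightarrow> int) monoid) \<phi> = ?H"
  proof (rule subset_antisym; rule subsetI)
    fix x assume "x \<in> kernel ?G (int_functions :: (nat list \<Rightarrow> int) monoid) \<phi>"
    hence x: "x \<in> lower_central ?F i" "\<phi> x = 0" by (auto simp: kernel_def)
    have "h x \<in> filt length (Suc i)"
    proof (rule P_filt_length[OF hi(1)[OF x(1)]])
      fix w assume w: "w \<in> W" "length w < Suc i"
      show "coef (h x) w = 0"
      proof (cases "length w = i")
        case True
        thus ?thesis using fun_cong[OF x(2), of w] w by (simp add: \<phi>_def)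
      next
        case False
        thus ?thesis using coef_filt_length[OF hi[OF x(1)] w(1)] w(2) by simp
      qed
    qed
    hence "h x \<in> h ` ?H" using lc[of i] hi(1)[OF x(1)] by blast
    then obtain y where y: "y \<in> ?H" "h x = h y" by blast
    have "x = y" using inj_onD[OF hD(6) y(2) iC[OF x(1)]] y(1) F.lower_central_subset by blast
    thus "x \<in> ?H" using y by simp
  next
    fix x assume x: "x \<in> ?H"
    hence xi: "x \<in> lower_central ?F i" using F.lower_central_Suc_subset by blast
    have "h x \<in> filt length (Suc i)" using lc[of i] x by blast
    hence "\<phi> x w = 0" for w using coef_filt_length[OF hi(1)[OF xi], of "Suc i" w] by (simp add: \<phi>_def)
    hence "\<phi> x = 0" by (auto simp: fun_eq_iff)
    thus "x \<in> kernel ?G (int_functions :: (nat list \<Rightarrow> int) monoid) \<phi>" using xi by (simp add: kernel_def)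
  qed
  define \<psi> where "\<psi> X = the_elem (\<phi> ` X)" for X
  have fe: "lower_central_factor ?F i = ?G Mod ?H" by (simp add: lower_central_factor_def)
  have psi: "\<psi> \<in> hom (?G Mod ?H) int_functions" "inj_on \<psi> (carrier (?G Mod ?H))"
    using H.FactGroup_hom H.FactGroup_inj_on unfolding ker \<psi>_def by auto
  have cos: "\<exists>x\<in>lower_central ?F i. X = ?H #>\<^bsub>?G\<^esub> x \<and> \<psi> X = \<phi> x" if X: "X \<in> carrier (?G Mod ?H)" for X
  proof -
    obtain x where x: "x \<in> lower_central ?F i" "X = ?H #>\<^bsub>?G\<^esub> x"
      using X by (auto simp: FactGroup_def RCOSETS_def)
    have "\<phi> ` X = {\<phi> x}"
    proof (rule subset_antisym; rule subsetI)
      fix z assume "z \<in> \<phi> ` X"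
      then obtain k where k: "k \<in> ?H" "z = \<phi> (k \<otimes>\<^bsub>?G\<^esub> x)" using x by (auto simp: r_coset_def)
      have "k \<in> kernel ?G (int_functions :: (nat list \<Rightarrow> int) monoid) \<phi>" using k(1) ker by simp
      hence k': "k \<in> carrier ?G" "\<phi> k = 0" by (auto simp: kernel_def)
      thus "z \<in> {\<phi> x}" using H.hom_mult[OF k'(1), of x] x(1) k(2) by simp
    next
      fix z assume "z \<in> {\<phi> x}"
      have "\<one>\<^bsub>?G\<^esub> \<in> kernel ?G (int_functions :: (nat list \<Rightarrow> int) monoid) \<phi>"
        using H.hom_one G.one_closed by (simp add: kernel_def)
      hence "\<one>\<^bsub>?G\<^esub> \<otimes>\<^bsub>?G\<^esub> x \<in> X" using ker x(2) unfolding r_coset_def by blast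
      hence "x \<in> X" using G.l_one[of x] x(1) by simp
      thus "z \<in> \<phi> ` X" using \<open>z \<in> {\<phi> x}\<close> by blast
    qed
    thus ?thesis using x by (auto simp: \<psi>_def)
  qed
  have sgH: "subgroup ?H ?G" using H.subgroup_kernel ker by simp
  show ?thesis
    unfolding fe
  proof (rule ab_rank_eq[OF G.abelian_FactGroup[OF sgH] psi])
    show "finite ?W" using finite_W by simp
    fix X b assume "X \<in> carrier (?G Mod ?H)" "b \<notin> ?W"
    thus "\<psi> X b = 0" using cos[of X] by (auto simp: \<phi>_def)
  next
    fix w assume w: "w \<in> ?W"
    have wW: "w \<in> W" using w by simp
    have lP: "lyn c letter w \<in> P" unfolding lyn_delta[OF wW, symmetric] by (rule comb_P)
    have "lyn c letter w \<in> filt length i"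
      by (rule P_filt_length[OF lP]) (use w coef_lyn[of w] in auto)
    hence "lyn c letter w \<in> h ` lower_central ?F i" using lc[of i0] lP unfolding i0[symmetric] by blast
    then obtain x where x: "x \<in> lower_central ?F i" "h x = lyn c letter w" by (metis imageE)
    have pw: "\<phi> x = (\<lambda>b. if b = w then 1 else 0)"
      using w by (auto simp: \<phi>_def x(2) coef_lyn fun_eq_iff)
    let ?X = "?H #>\<^bsub>?G\<^esub> x"
    have X: "?X \<in> carrier (?G Mod ?H)" using x(1) by (auto simp: FactGroup_def RCOSETS_def)
    obtain x' where x': "x' \<in> lower_central ?F i" "?X = ?H #>\<^bsub>?G\<^esub> x'" "\<psi> ?X = \<phi> x'" using cos[OF X] by blast
    have "x \<in> ?X" using subgroup.one_closed[OF sgH] G.l_one[of x] x(1) unfolding r_coset_def by force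
    hence "x \<in> ?H #>\<^bsub>?G\<^esub> x'" by (simp only: x'(2))
    then obtain k where k: "k \<in> ?H" "x = k \<otimes>\<^bsub>?G\<^esub> x'" unfolding r_coset_def by blast
    have "k \<in> kernel ?G (int_functions :: (nat list \<Rightarrow> int) monoid) \<phi>" using k(1) ker by simp
    hence k': "k \<in> carrier ?G" "\<phi> k = 0" by (auto simp: kernel_def)
    hence "\<phi> x = \<phi> x'" using H.hom_mult[OF k'(1), of x'] x'(1) k(2) by simp
    thus "\<exists>X\<in>carrier (?G Mod ?H). \<psi> X = (\<lambda>b. if b = w then 1 else 0)" using X x'(3) pw by auto
  qed
qed

end

section \<open>Dirichlet series\<close>

text \<open>
  A finite set of tuples is contained in a finite box, and over a box the sum of the products is the
  product of the sums.
\<close>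

lemma abs_summable_prod_PiE:
  fixes f :: "'a \<Rightarrow> 'b \<Rightarrow> complex"
  assumes A: "finite A" and f: "\<And>x. x \<in> A \<Longrightarrow> f x abs_summable_on B x"
  shows "(\<lambda>h. \<Prod>x\<in>A. f x (h x)) abs_summable_on PiE A B"
proof (rule nonneg_bdd_above_summable_on)
  define s where "s x = infsum (\<lambda>y. norm (f x y)) (B x)" for x
  show "bdd_above (sum (\<lambda>h. norm (\<Prod>x\<in>A. f x (h x))) ` {F. F \<subseteq> PiE A B \<and> finite F})"
  proof (rule bdd_aboveI2)
    fix Q assume "Q \<in> {F. F \<subseteq> PiE A B \<and> finite F}"
    hence Q: "Q \<subseteq> PiE A B" "finite Q" by auto
    define B' where "B' x = (\<lambda>h. h x) ` Q" for x
    have B': "finite (B' x)" for x using Q by (simp add: B'_def)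
    have B'B: "B' x \<subseteq> B x" if "x \<in> A" for x using Q that by (auto simp: B'_def PiE_iff)
    have sub: "Q \<subseteq> PiE A B'"
    proof
      fix h assume h: "h \<in> Q"
      hence "h \<in> PiE A B" using Q by blast
      thus "h \<in> PiE A B'" using h by (auto simp: PiE_iff B'_def)
    qed
    have "(\<Sum>h\<in>Q. norm (\<Prod>x\<in>A. f x (h x))) \<le> (\<Sum>h\<in>PiE A B'. norm (\<Prod>x\<in>A. f x (h x)))"
      by (rule sum_mono2[OF finite_PiE[OF A] sub]) (use B' in auto)
    also have "\<dots> = (\<Prod>x\<in>A. \<Sum>y\<in>B' x. norm (f x y))"
      using prod_sum_PiE[OF A, of B' "\<lambda>x y. norm (f x y)"] B' by (simp add: prod_norm)
    also have "\<dots> \<le> (\<Prod>x\<in>A. s x)"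
    proof (rule prod_mono, intro conjI)
      fix x assume x: "x \<in> A"
      show "0 \<le> (\<Sum>y\<in>B' x. norm (f x y))" by (intro sum_nonneg) auto
      show "(\<Sum>y\<in>B' x. norm (f x y)) \<le> s x"
        unfolding s_def by (rule finite_sum_le_infsum[OF f[OF x] B' B'B[OF x]]) auto
    qed
    finally show "(\<Sum>h\<in>Q. norm (\<Prod>x\<in>A. f x (h x))) \<le> (\<Prod>x\<in>A. s x)" .
  qed
qed auto

lemma of_nat_powr_eq_exp: "0 < m \<Longrightarrow> (of_nat m :: complex) powr w = exp (w * of_real (ln (real m)))"
  by (simp add: powr_def Ln_of_nat)

lemma dirichlet_converges_zeta:
  assumes "1 < Re z"
  shows "dirichlet_converges (\<lambda>_. 1) z"
proof -
  have "summable (\<lambda>n. real n powr (- Re z))" using assms by (subst summable_real_powr_iff) auto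
  hence "(\<lambda>n. real n powr (- Re z)) summable_on UNIV"
    by (intro norm_summable_imp_summable_on) simp
  hence "(\<lambda>n. real n powr (- Re z)) summable_on {1..}" by (rule summable_on_subset_banach) simp
  moreover have "norm (dirichlet_term (\<lambda>_. 1) z n) = real n powr (- Re z)" if "n \<in> {1..}" for n
    using that by (simp add: dirichlet_term_def of_nat_powr_eq_exp powr_def)
  ultimately show ?thesis unfolding dirichlet_converges_def
    by (subst summable_on_cong[where g = "\<lambda>n. real n powr (- Re z)"]) auto
qed

context free_nilp
begin

text \<open>
  The argument \<open>\<alpha> s - \<beta> - j\<close>, with \<open>\<beta> = g (\<alpha> - 1)\<close> by \<open>sum_rank\<close>.
\<close>

definition zeta_arg :: "complex \<Rightarrow> nat \<Rightarrow> complex" where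
  "zeta_arg s j = of_nat alpha * s - of_nat (g * (alpha - 1)) - of_nat j"

definition zeta_term :: "complex \<Rightarrow> (nat \<Rightarrow> nat) \<Rightarrow> complex" where
  "zeta_term s d = (\<Prod>j<g. dirichlet_term (\<lambda>_. 1) (zeta_arg s j) (d j))"

lemma diagonals_pos: "d \<in> diagonals \<Longrightarrow> j < g \<Longrightarrow> 0 < d j"
  by (auto simp: diagonals_def PiE_iff Suc_le_eq)

text \<open>
  The tuple \<open>d\<close> contributes \<open>\<Prod>\<^sub>j d\<^sub>j\<^bsup>j + \<beta>\<^esup>\<close> subalgebras of index \<open>n = (\<Prod>\<^sub>j d\<^sub>j)\<^sup>\<alpha>\<close>. All powers are written
  as exponentials of real logarithms, so that no branch of the complex logarithm has to be considered.
\<close>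

lemma zeta_term_eq:
  assumes d: "d \<in> diagonals_of_index n"
  shows "of_nat (\<Prod>j<g. d j ^ (j + g * (alpha - 1))) * of_nat n powr (- s) = zeta_term s d"
proof -
  have D: "d \<in> diagonals" and n: "n = (\<Prod>j<g. d j) ^ alpha" using d by (auto simp: diagonals_of_index_def)
  let ?e = "g * (alpha - 1)"
  define L where "L j = (of_real (ln (real (d j))) :: complex)" for j
  have eL: "exp (L j) = of_nat (d j)" if "j < g" for j
  proof -
    have "exp (L j) = of_real (exp (ln (real (d j))))" unfolding L_def by (rule exp_of_real)
    also have "exp (ln (real (d j))) = real (d j)" using diagonals_pos[OF D that] by simp
    finally show ?thesis by (simp only: of_real_of_nat_eq)
  qed
  have n0: "0 < n" using diagonals_pos[OF D] by (simp add: n prod_pos)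
  have "ln (real n) = real alpha * ln (\<Prod>j<g. real (d j))"
    unfolding n using diagonals_pos[OF D] by (simp add: ln_realpow prod_pos)
  also have "ln (\<Prod>j<g. real (d j)) = (\<Sum>j<g. ln (real (d j)))"
    by (rule ln_prod) (use diagonals_pos[OF D] in auto)
  finally have ln: "of_real (ln (real n)) = of_nat alpha * (\<Sum>j<g. L j)" by (simp add: L_def)
  have "of_nat n powr (- s) = exp (\<Sum>j<g. - s * of_nat alpha * L j)"
    unfolding of_nat_powr_eq_exp[OF n0] ln by (simp add: sum_distrib_left mult.assoc sum_negf)
  also have "\<dots> = (\<Prod>j<g. exp (- s * of_nat alpha * L j))" by (rule exp_sum) simp
  finally have 1: "of_nat n powr (- s) = (\<Prod>j<g. exp (- s * of_nat alpha * L j))" .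
  have 2: "(of_nat (\<Prod>j<g. d j ^ (j + ?e)) :: complex) = (\<Prod>j<g. exp (of_nat (j + ?e) * L j))"
    by (simp add: eL exp_of_nat_mult del: of_nat_add)
  have "zeta_term s d = (\<Prod>j<g. exp (of_nat (j + ?e) * L j) * exp (- s * of_nat alpha * L j))"
    unfolding zeta_term_def
  proof (rule prod.cong)
    fix j assume "j \<in> {..<g}"
    hence j: "0 < d j" using diagonals_pos[OF D] by simp
    show "dirichlet_term (\<lambda>_. 1) (zeta_arg s j) (d j) = exp (of_nat (j + ?e) * L j) * exp (- s * of_nat alpha * L j)"
      by (simp add: dirichlet_term_def of_nat_powr_eq_exp[OF j] zeta_arg_def L_def exp_add[symmetric] algebra_simps)
  qed simp
  thus ?thesis unfolding 1 2 by (simp add: prod.distrib)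
qed

text \<open>
  The product of the zeta values expands to an absolutely convergent sum over all tuples \<open>d\<close>. Grouping
  it by the index gives the Dirichlet series.
\<close>

lemma zeta_product:
  assumes cnt: "\<And>n. 1 \<le> n \<Longrightarrow> cnt n = (\<Sum>d\<in>diagonals_of_index n. \<Prod>j<g. d j ^ (j + g * (alpha - 1)))"
    and s: "\<And>j. j < g \<Longrightarrow> 1 < Re (zeta_arg s j)"
  shows "dirichlet_converges cnt s" "dirichlet_series cnt s = (\<Prod>j<g. riemann_zeta (zeta_arg s j))"
proof -
  have z: "dirichlet_term (\<lambda>_. 1) (zeta_arg s j) abs_summable_on {1..}" if "j \<in> {..<g}" for j
    using dirichlet_converges_zeta[OF s] that by (simp add: dirichlet_converges_def)
  have G: "zeta_term s abs_summable_on diagonals"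
    unfolding zeta_term_def diagonals_def by (rule abs_summable_prod_PiE[OF _ z]) auto
  have GP: "infsum (zeta_term s) diagonals = (\<Prod>j<g. riemann_zeta (zeta_arg s j))"
    unfolding zeta_term_def diagonals_def riemann_zeta_def dirichlet_series_def
    by (rule infsum_prod_PiE_abs[OF _ z]) auto
  have bij: "bij_betw snd (Sigma {1..} diagonals_of_index) diagonals"
  proof (rule bij_betw_imageI)
    show "inj_on snd (Sigma {1..} diagonals_of_index)" by (auto simp: inj_on_def diagonals_of_index_def)
    show "snd ` Sigma {1..} diagonals_of_index = diagonals"
    proof (rule subset_antisym; rule subsetI)
      fix d assume d: "d \<in> diagonals"
      have "0 < (\<Prod>j<g. d j) ^ alpha" using diagonals_pos[OF d] by (simp add: prod_pos)
      hence "((\<Prod>j<g. d j) ^ alpha, d) \<in> Sigma {1..} diagonals_of_index" using d by (auto simp: diagonals_of_index_def Suc_le_eq)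
      thus "d \<in> snd ` Sigma {1..} diagonals_of_index" by force
    qed (auto simp: diagonals_of_index_def)
  qed
  have S: "(\<lambda>x. zeta_term s (snd x)) abs_summable_on Sigma {1..} diagonals_of_index"
    using summable_on_reindex_bij_betw[OF bij, of "\<lambda>d. norm (zeta_term s d)"] G by simp
  have dterm: "dirichlet_term cnt s n = (\<Sum>d\<in>diagonals_of_index n. zeta_term s d)" if "1 \<le> n" for n
  proof -
    have "dirichlet_term cnt s n = (\<Sum>d\<in>diagonals_of_index n. of_nat (\<Prod>j<g. d j ^ (j + g * (alpha - 1))) * of_nat n powr (- s))"
      unfolding dirichlet_term_def cnt[OF that] by (simp add: sum_distrib_right)
    also have "\<dots> = (\<Sum>d\<in>diagonals_of_index n. zeta_term s d)" by (rule sum.cong) (use zeta_term_eq in auto)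
    finally show ?thesis .
  qed
  have inner: "infsum (\<lambda>d. zeta_term s (snd (n, d))) (diagonals_of_index n) = dirichlet_term cnt s n" if "n \<in> {1..}" for n
    using dterm[of n] that finite_diagonals_of_index[of n] by simp
  have "(\<lambda>n. infsum (\<lambda>d. norm (zeta_term s (snd (n, d)))) (diagonals_of_index n)) abs_summable_on {1..}"
    using S unfolding abs_summable_on_Sigma_iff by blast
  thus "dirichlet_converges cnt s"
    unfolding dirichlet_converges_def
  proof (rule abs_summable_on_comparison_test)
    fix n :: nat assume n: "n \<in> {1..}"
    have "norm (dirichlet_term cnt s n) \<le> (\<Sum>d\<in>diagonals_of_index n. norm (zeta_term s d))"
      using dterm[of n] n by (simp add: norm_sum)
    also have "\<dots> = infsum (\<lambda>d. norm (zeta_term s (snd (n, d)))) (diagonals_of_index n)"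
      using finite_diagonals_of_index[of n] n by simp
    finally show "norm (dirichlet_term cnt s n) \<le> norm (infsum (\<lambda>d. norm (zeta_term s (snd (n, d)))) (diagonals_of_index n))" by simp
  qed
  have "dirichlet_series cnt s = (\<Sum>\<^sub>\<infinity>n\<in>{1..}. infsum (\<lambda>d. zeta_term s (snd (n, d))) (diagonals_of_index n))"
    unfolding dirichlet_series_def by (rule infsum_cong) (use inner in simp)
  also have "\<dots> = infsum (\<lambda>x. zeta_term s (snd x)) (Sigma {1..} diagonals_of_index)"
    by (rule infsum_Sigma_banach[OF abs_summable_summable[OF S]])
  also have "\<dots> = infsum (zeta_term s) diagonals" by (rule infsum_reindex_bij_betw[OF bij])
  finally show "dirichlet_series cnt s = (\<Prod>j<g. riemann_zeta (zeta_arg s j))" using GP by simp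
qed

text \<open>
  Both sides count the letters of the words in the Lyndon basis: by length on the left, and letter by letter on
  the right.
\<close>

lemma sum_rank:
  "(\<Sum>i = 1..c. i * card {w \<in> W. length w = i}) = g * alpha"
  "(\<Sum>i = 2..c. i * card {w \<in> W. length w = i}) = g * (alpha - 1)"
proof -
  have len: "length w = (\<Sum>j<g. count_list w j)" if "w \<in> W" for w
    using sum_count_set[OF W_D(2)[OF that]] by simp
  have "(\<Sum>i = 1..c. i * card {w \<in> W. length w = i}) = (\<Sum>i = 1..c. \<Sum>w\<in>{w \<in> W. length w = i}. length w)"
    by (rule sum.cong) auto
  also have "\<dots> = (\<Sum>w\<in>W. length w)"
    by (rule sum.group[OF finite_W]) (use W_D in \<open>auto simp: Suc_le_eq\<close>)
  also have "\<dots> = (\<Sum>w\<in>W. \<Sum>j<g. count_list w j)" by (rule sum.cong) (use len in auto)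
  also have "\<dots> = (\<Sum>j<g. letter_count j)" unfolding letter_count_def by (rule sum.swap)
  also have "\<dots> = g * alpha" using letter_count_alpha by simp
  finally show "(\<Sum>i = 1..c. i * card {w \<in> W. length w = i}) = g * alpha" .
  have "(\<Sum>i = 2..c. i * card {w \<in> W. length w = i}) = (\<Sum>i = 2..c. \<Sum>w\<in>{w \<in> W_long. length w = i}. length w)"
  proof (rule sum.cong)
    fix i assume "i \<in> {2..c}"
    hence "{w \<in> W. length w = i} = {w \<in> W_long. length w = i}" by (auto simp: W_long_def)
    thus "i * card {w \<in> W. length w = i} = (\<Sum>w\<in>{w \<in> W_long. length w = i}. length w)" by simp
  qed simp
  also have "\<dots> = (\<Sum>w\<in>W_long. length w)"
    by (rule sum.group[OF W_split(3)]) (use W_D in \<open>auto simp: W_long_def\<close>)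
  also have "\<dots> = (\<Sum>w\<in>W_long. \<Sum>j<g. count_list w j)" by (rule sum.cong) (use len in \<open>auto simp: W_long_def\<close>)
  also have "\<dots> = (\<Sum>j<g. \<Sum>w\<in>W_long. count_list w j)" by (rule sum.swap)
  also have "\<dots> = g * (alpha - 1)" using letter_count_long by simp
  finally show "(\<Sum>i = 2..c. i * card {w \<in> W. length w = i}) = g * (alpha - 1)" .
qed

end

theorem proposition7p4:
  fixes c g :: nat and F :: "(int, (free_magma \<Rightarrow> int) set set) module"
    and m :: "nat \<Rightarrow> nat" and \<alpha> \<beta> :: real and s :: complex
  assumes "c \<ge> 2" and "g \<ge> 1"
    and "F = free_nilpotent c g"
    and "\<And>i. 1 \<le> i \<Longrightarrow> i \<le> c \<Longrightarrow> m i = ab_rank (lower_central_factor F i)"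
    and "\<alpha> = 1 / real g * (\<Sum>i = 1..c. real i * real (m i))"
    and "\<beta> = (\<Sum>i = 2..c. real i * real (m i))"
    and "\<And>j. j < g \<Longrightarrow> Re (of_real \<alpha> * s - of_real \<beta> - of_nat j) > 1"
  shows "dirichlet_converges (iso_count F) s
    \<and> dirichlet_converges (proiso_count F) s
    \<and> iso_zeta F s = proiso_zeta F s
    \<and> proiso_zeta F s = (\<Prod>j<g. riemann_zeta (of_real \<alpha> * s - of_real \<beta> - of_nat j))"
proof -
  interpret free_nilp c g using assms(1,2) by unfold_locales auto
  have m: "m i = card {w \<in> W. length w = i}" if "1 \<le> i" "i \<le> c" for i
    using assms(4)[OF that] rank_lower_central_factor[OF that] assms(3) by simp
  have "(\<Sum>i = 1..c. real i * real (m i)) = real (\<Sum>i = 1..c. i * card {w \<in> W. length w = i})"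
    unfolding of_nat_sum of_nat_mult by (rule sum.cong) (use m in auto)
  also have "\<dots> = real (g * alpha)" by (simp only: sum_rank(1))
  finally have \<alpha>: "\<alpha> = real alpha" unfolding assms(5) using assms(2) by simp
  have "(\<Sum>i = 2..c. real i * real (m i)) = real (\<Sum>i = 2..c. i * card {w \<in> W. length w = i})"
    unfolding of_nat_sum of_nat_mult by (rule sum.cong) (use m in auto)
  also have "\<dots> = real (g * (alpha - 1))" by (simp only: sum_rank(2))
  finally have \<beta>: "\<beta> = real (g * (alpha - 1))" unfolding assms(6) .
  have arg: "of_real \<alpha> * s - of_real \<beta> - of_nat j = zeta_arg s j" for j
    unfolding zeta_arg_def \<alpha> \<beta> of_real_of_nat_eq ..
  have s: "1 < Re (zeta_arg s j)" if "j < g" for j using assms(7)[OF that] unfolding arg .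
  have F: "nonassoc_algebra \<Z> F" unfolding assms(3) by (rule lie_algebra.axioms(1)[OF lie_algebra_free_nilpotent])
  have iso: "alg_iso \<Z> F Palg" unfolding assms(3) by (rule free_nilpotent_iso)
  have ic: "iso_count F n = (\<Sum>d\<in>diagonals_of_index n. \<Prod>j<g. d j ^ (j + g * (alpha - 1)))" if "1 \<le> n" for n
    using count_formula(1)[OF that] iso_count_transfer[OF F nonassoc_algebra_Palg iso] by simp
  have jc: "proiso_count F n = (\<Sum>d\<in>diagonals_of_index n. \<Prod>j<g. d j ^ (j + g * (alpha - 1)))" if "1 \<le> n" for n
    using count_formula(2)[OF that] proiso_count_transfer[OF F nonassoc_algebra_Palg iso closed_ring_profinite] by simp
  show ?thesis
    unfolding arg iso_zeta_def proiso_zeta_def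
    using zeta_product[OF ic s] zeta_product[OF jc s] by simp
qed

end
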